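(* Let $H$ be a cocommutative Hopf algebra over $\mathbf k$ with $\dim\mathrm F^nH<\infty$ for all $n$, and let $X=H^*$. Let $L$ be a finite Lie $H$-pseudoalgebra that is a free $H$-module, $\mathcal A(L)=X\otimes_HL$ its annihilation Lie algebra, and $\widehat L=\mathcal C(\mathcal A(L))=\mathrm{Hom}_H^{\mathrm{cont}}(X,X\otimes_HL)$. Then the map $$\Phi:L\to\widehat L,\qquad \Phi(a)(x)=x\otimes_Ha\quad(a\in L,\ x\in X),$$ is an isomorphism of Lie $H$-pseudoalgebras.
   Context: $\mathbf k$ is an algebraically closed field of characteristic $0$; unadorned $\otimes$ is over $\mathbf k$. $\Delta,\varepsilon,S$ denote the structure maps of $H$; $H^{\otimes n}$ is a right $H$-module via the iterated coproduct. By Kostant's theorem $H$ is the smash product of $U(P)$ ($P$ the Lie algebra of primitive elements) and $\mathbf k[G]$ ($G$ the group of group-like elements); $\mathrm F^nH$ is the product of the $n$th term of the canonical filtration of $U(P)$ with $\mathbf k[G]$. A Lie $H$-pseudoalgebra is a left $H$-module $L$ with a linear map $L\otimes L\to(H\otimes H)\otimes_HL$, $a\otimes b\mapsto[a*b]$, such that $[fa*gb]=((f\otimes g)\otimes_H1)[a*b]$; $[b*a]=-(\sigma\otimes_H\mathrm{id})[a*b]$ ($\sigma$ the flip); and $[a*[b*c]]-((\sigma\otimes\mathrm{id})\otimes_H\mathrm{id})[b*[a*c]]=[[a*b]*c]$ in $H^{\otimes3}\otimes_HL$. Here, if $[a*b]=\sum_i g_i\otimes_He_i$ and $[e_i*c]=\sum_j(f_{ij}\otimes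 g_{ij})\otimes_He_{ij}$, then $[[a*b]*c]=\sum(g_i\otimes1)(\Delta(f_{ij})\otimes g_{ij})\otimes_He_{ij}$; if $[b*c]=\sum_i h_i\otimes_Hd_i$ and $[a*d_i]=\sum_j(h_{ij}\otimes l_{ij})\otimes_Hd_{ij}$, then $[a*[b*c]]=\sum(1\otimes h_i)(h_{ij}\otimes\Delta(l_{ij}))\otimes_Hd_{ij}$. Finite means finitely generated over $H$. $X=H^*$ is a commutative algebra (product dual to $\Delta$), with $\langle hx,f\rangle=\langle x,S(h)f\rangle$, $\langle xh,f\rangle=\langle x,fS(h)\rangle$, $\langle S(x),h\rangle=\langle x,S(h)\rangle$, topologized by $\mathrm F_nX=(\mathrm F^nH)^\perp$. $\mathcal A(L)=X\otimes_HL$ is a Lie algebra with $[x\otimes_Ha,y\otimes_Hb]=\sum_i(xf_i)(yg_i)\otimes_He_i$ if $[a*b]=\sum_i(f_i\otimes g_i)\otimes_He_i$, with left $H$-action $h(x\otimes_Ha)=hx\otimes_Ha$, topologized by the subspaces $\mathrm F_nX\otimes_HL_0$, where $L_0$ is a finite-dimensional subspace generating $L$ over $H$. For a topological Lie algebra $\mathcal L$ with compatible continuous $H$-action, $\mathcal C(\mathcal L)=\mathrm{Hom}_H^{\mathrm{cont}}(X,\mathcal L)$ (continuous $H$-linear maps) is an $H$-module by $(h\alpha)(x)=\alpha(xh)$, with $x$-brackets ($x\in X$) $[\alpha_x\beta](y)=\sum_i[\alpha(x_i),\beta(y(h_iS(x)))]$, $\{h_i\}$, $\{x_i\}$ being dual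 bases of $H$ and $X$. When only finitely many $[\alpha_{x_i}\beta]$ are nonzero for each $\alpha,\beta$, these correspond to the Lie pseudobracket $[\alpha*\beta]=\sum_i(S(h_i)\otimes1)\otimes_H[\alpha_{x_i}\beta]$; the claim includes that this is the case for $\widehat L$. *)

theory Defs
  imports "HOL-Analysis.Analysis" "HOL-Algebra.Module" "HOL-Library.Poly_Mapping"
begin

text \<open>
  Conventions. The ground field and the Hopf algebra are types ('k and 'h). Modules, which also
  occur as tensor products and as spaces of maps, are HOL-Algebra records of type
  \<^typ>\<open>('r, 'm) module\<close>; their action \<open>\<odot>\<close> is a left action of the possibly
  noncommutative ring 'r, and only the additive part of the ring record underneath is meaningful
  unless stated otherwise.
\<close>

section \<open>Presented abelian groups\<close>

text \<open>
  The free abelian group on \<open>B\<close> modulo the subgroup generated by \<open>R\<close>. Its elements are cosets of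
  finite formal sums; \<open>frag_cmul\<close>-span means subgroup generated.
\<close>

definition frag_class :: "('b \<Rightarrow>\<^sub>0 int) set \<Rightarrow> ('b \<Rightarrow>\<^sub>0 int) \<Rightarrow> ('b \<Rightarrow>\<^sub>0 int) set" where
  "frag_class R u = {v. v - u \<in> Modules.module.span frag_cmul R}"

definition presented_group :: "'b set \<Rightarrow> ('b \<Rightarrow>\<^sub>0 int) set \<Rightarrow> ('b \<Rightarrow>\<^sub>0 int) set ring" where
  "presented_group B R =
    \<lparr>carrier = {frag_class R u |u. Poly_Mapping.keys u \<subseteq> B},
     mult = undefined, one = undefined,
     zero = frag_class R 0,
     add = (\<lambda>U V. {u + v |u v. u \<in> U \<and> v \<in> V})\<rparr>"

text \<open>
  The homomorphism from a presented group to \<open>G\<close> that sends each generator \<open>b\<close> to \<open>\<phi> b\<close>, evaluated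
  at the coset \<open>U\<close>; it is meaningful when the additive extension of \<open>\<phi>\<close> kills the relators, so that
  it is constant on \<open>U\<close>.
\<close>

definition frag_lift :: "('g, 'x) ring_scheme \<Rightarrow> ('b \<Rightarrow> 'g) \<Rightarrow> ('b \<Rightarrow>\<^sub>0 int) set \<Rightarrow> 'g" where
  "frag_lift G \<phi> U =
    the_elem ((\<lambda>u. \<Oplus>\<^bsub>G\<^esub>b\<in>Poly_Mapping.keys u. [Poly_Mapping.lookup u b] \<cdot>\<^bsub>G\<^esub> \<phi> b) ` U)"

definition type_ring :: "'a::ring_1 ring" where
  "type_ring = \<lparr>carrier = UNIV, mult = (*), one = 1, zero = 0, add = (+)\<rparr>"


section \<open>Tensor powers over the field\<close>

type_synonym 'h tensor = "('h list \<Rightarrow>\<^sub>0 int) set"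

record ('k, 'h) hopf =
  scal :: "'k \<Rightarrow> 'h \<Rightarrow> 'h"
  comult :: "'h \<Rightarrow> 'h tensor"
  counit :: "'h \<Rightarrow> 'k"
  antipode :: "'h \<Rightarrow> 'h"

text \<open>
  The pure tensor \<open>h\<^sub>1 \<otimes> \<dots> \<otimes> h\<^sub>n\<close> is the class of the list \<open>[h\<^sub>1, \<dots>, h\<^sub>n]\<close>. The relators make it
  additive in each entry and let scalars move from one entry to another; only \<open>n \<ge> 1\<close> is used.
\<close>

definition tpow_rels :: "('k, 'h::ring_1) hopf \<Rightarrow> nat \<Rightarrow> ('h list \<Rightarrow>\<^sub>0 int) set" where
  "tpow_rels H n =
    {frag_of (xs[i := u + v]) - frag_of (xs[i := u]) - frag_of (xs[i := v]) |xs i u v.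
       length xs = n \<and> i < n} \<union>
    {frag_of (xs[i := scal H c (xs ! i)]) - frag_of (xs[j := scal H c (xs ! j)]) |xs i j c.
       length xs = n \<and> i < n \<and> j < n}"

definition tpow_group :: "('k, 'h::ring_1) hopf \<Rightarrow> nat \<Rightarrow> 'h tensor ring" where
  "tpow_group H n = presented_group {xs. length xs = n} (tpow_rels H n)"

definition pure :: "('k, 'h::ring_1) hopf \<Rightarrow> 'h list \<Rightarrow> 'h tensor" where
  "pure H xs = frag_class (tpow_rels H (length xs)) (frag_of xs)"

text \<open>The \<open>n\<close>-th tensor power of \<open>H\<close>, as a ring (factorwise product) and a vector space.\<close>

definition tpow :: "('k, 'h::ring_1) hopf \<Rightarrow> nat \<Rightarrow> ('k, 'h tensor) module" where
  "tpow H n =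
    \<lparr>carrier = carrier (tpow_group H n),
     mult = (\<lambda>s t. frag_lift (tpow_group H n)
       (\<lambda>xs. frag_lift (tpow_group H n) (\<lambda>ys. pure H (map2 (*) xs ys)) t) s),
     one = pure H (replicate n 1),
     zero = zero (tpow_group H n),
     add = add (tpow_group H n),
     smult = (\<lambda>c. frag_lift (tpow_group H n) (\<lambda>xs. pure H (xs[0 := scal H c (xs ! 0)])))\<rparr>"

text \<open>Juxtaposition of an \<open>m\<close>-fold and an \<open>n\<close>-fold tensor.\<close>

definition tcat :: "('k, 'h::ring_1) hopf \<Rightarrow> nat \<Rightarrow> nat \<Rightarrow> 'h tensor \<Rightarrow> 'h tensor \<Rightarrow> 'h tensor" where
  "tcat H m n s t =
    frag_lift (tpow H (m + n)) (\<lambda>xs. frag_lift (tpow H (m + n)) (\<lambda>ys. pure H (xs @ ys)) t) s"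

text \<open>Exchange of the first two factors: \<open>\<sigma>\<close> for \<open>n = 2\<close> and \<open>\<sigma> \<otimes> id\<close> for \<open>n = 3\<close>.\<close>

definition tflip :: "('k, 'h::ring_1) hopf \<Rightarrow> nat \<Rightarrow> 'h tensor \<Rightarrow> 'h tensor" where
  "tflip H n = frag_lift (tpow H n) (\<lambda>xs. pure H (xs ! 1 # xs ! 0 # drop 2 xs))"

definition comult_id :: "('k, 'h::ring_1) hopf \<Rightarrow> 'h tensor \<Rightarrow> 'h tensor" where
  "comult_id H = frag_lift (tpow H 3) (\<lambda>xs. tcat H 2 1 (comult H (xs ! 0)) (pure H [xs ! 1]))"

definition id_comult :: "('k, 'h::ring_1) hopf \<Rightarrow> 'h tensor \<Rightarrow> 'h tensor" where
  "id_comult H = frag_lift (tpow H 3) (\<lambda>xs. tcat H 1 2 (pure H [xs ! 0]) (comult H (xs ! 1)))"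


section \<open>Cocommutative Hopf algebras\<close>

locale hopf_algebra =
  fixes H :: "('k::field, 'h::ring_1) hopf"
  assumes scal_vector_space: "vector_space (scal H)"
    and scal_mult_left: "scal H c (f * g) = scal H c f * g"
    and scal_mult_right: "scal H c (f * g) = f * scal H c g"
    and comult_closed: "comult H f \<in> carrier (tpow H 2)"
    and comult_add: "comult H (f + g) = comult H f \<oplus>\<^bsub>tpow H 2\<^esub> comult H g"
    and comult_scal: "comult H (scal H c f) = c \<odot>\<^bsub>tpow H 2\<^esub> comult H f"
    and comult_mult: "comult H (f * g) = comult H f \<otimes>\<^bsub>tpow H 2\<^esub> comult H g"
    and comult_one: "comult H 1 = \<one>\<^bsub>tpow H 2\<^esub>"
    and counit_linear: "Vector_Spaces.linear (scal H) (*) (counit H)"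
    and counit_mult: "counit H (f * g) = counit H f * counit H g"
    and counit_one: "counit H 1 = 1"
    and coassoc: "comult_id H (comult H f) = id_comult H (comult H f)"
    and counit_left:
      "frag_lift type_ring (\<lambda>xs. scal H (counit H (xs ! 0)) (xs ! 1)) (comult H f) = f"
    and counit_right:
      "frag_lift type_ring (\<lambda>xs. scal H (counit H (xs ! 1)) (xs ! 0)) (comult H f) = f"
    and antipode_linear: "Vector_Spaces.linear (scal H) (scal H) (antipode H)"
    and antipode_left:
      "frag_lift type_ring (\<lambda>xs. antipode H (xs ! 0) * xs ! 1) (comult H f) = scal H (counit H f) 1"
    and antipode_right:
      "frag_lift type_ring (\<lambda>xs. xs ! 0 * antipode H (xs ! 1)) (comult H f) = scal H (counit H f) 1"

definition cocommutative :: "('k, 'h::ring_1) hopf \<Rightarrow> bool" where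
  "cocommutative H \<longleftrightarrow> (\<forall>f. tflip H 2 (comult H f) = comult H f)"

abbreviation hspan :: "('k::field, 'h::ring_1) hopf \<Rightarrow> 'h set \<Rightarrow> 'h set" where
  "hspan H \<equiv> Modules.module.span (scal H)"

definition primitives :: "('k, 'h::ring_1) hopf \<Rightarrow> 'h set" where
  "primitives H = {p. comult H p = pure H [p, 1] \<oplus>\<^bsub>tpow H 2\<^esub> pure H [1, p]}"

definition grouplikes :: "('k, 'h::ring_1) hopf \<Rightarrow> 'h set" where
  "grouplikes H = {g. g \<noteq> 0 \<and> comult H g = pure H [g, g]}"

text \<open>
  \<open>U(P)\<close> is identified with the subalgebra of \<open>H\<close> generated by the primitive elements. The \<open>n\<close>-th
  term of its canonical filtration is spanned by products of at most \<open>n\<close> primitives.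
\<close>

definition U_filt :: "('k::field, 'h::ring_1) hopf \<Rightarrow> nat \<Rightarrow> 'h set" where
  "U_filt H n = hspan H {prod_list ps |ps. set ps \<subseteq> primitives H \<and> length ps \<le> n}"

definition H_filt :: "('k::field, 'h::ring_1) hopf \<Rightarrow> nat \<Rightarrow> 'h set" where
  "H_filt H n = hspan H {u * g |u g. u \<in> U_filt H n \<and> g \<in> hspan H (grouplikes H)}"

definition is_basis :: "('k::field, 'h::ring_1) hopf \<Rightarrow> 'h set \<Rightarrow> bool" where
  "is_basis H B \<longleftrightarrow> \<not> Modules.module.dependent (scal H) B \<and> hspan H B = UNIV"


section \<open>The dual algebra\<close>

definition dual :: "('k::field, 'h::ring_1) hopf \<Rightarrow> ('h \<Rightarrow> 'k) ring" where
  "dual H =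
    \<lparr>carrier = {x. Vector_Spaces.linear (scal H) (*) x},
     mult = (\<lambda>x y h. frag_lift type_ring (\<lambda>xs. x (xs ! 0) * y (xs ! 1)) (comult H h)),
     one = counit H,
     zero = (\<lambda>h. 0),
     add = (\<lambda>x y h. x h + y h)\<rparr>"

definition dual_lact :: "('k, 'h::ring_1) hopf \<Rightarrow> 'h \<Rightarrow> ('h \<Rightarrow> 'k) \<Rightarrow> 'h \<Rightarrow> 'k" where
  "dual_lact H h x = (\<lambda>f. x (antipode H h * f))"

definition dual_ract :: "('k, 'h::ring_1) hopf \<Rightarrow> ('h \<Rightarrow> 'k) \<Rightarrow> 'h \<Rightarrow> 'h \<Rightarrow> 'k" where
  "dual_ract H x h = (\<lambda>f. x (f * antipode H h))"

definition dual_antipode :: "('k, 'h::ring_1) hopf \<Rightarrow> ('h \<Rightarrow> 'k) \<Rightarrow> 'h \<Rightarrow> 'k" where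
  "dual_antipode H x = (\<lambda>h. x (antipode H h))"

definition dual_filt :: "('k::field, 'h::ring_1) hopf \<Rightarrow> nat \<Rightarrow> ('h \<Rightarrow> 'k) set" where
  "dual_filt H n = {x \<in> carrier (dual H). \<forall>f\<in>H_filt H n. x f = 0}"

text \<open>The element of \<open>X\<close> dual to the member \<open>b\<close> of the basis \<open>B\<close>: the \<open>b\<close>-coordinate function.\<close>

definition dual_vec :: "('k::field, 'h::ring_1) hopf \<Rightarrow> 'h set \<Rightarrow> 'h \<Rightarrow> 'h \<Rightarrow> 'k" where
  "dual_vec H B b = (\<lambda>h. Modules.module.representation (scal H) B h b)"

text \<open>The group topology in which the subgroups \<open>N n\<close> are a neighbourhood basis of zero.\<close>

definition filt_topology :: "('g, 'x) ring_scheme \<Rightarrow> (nat \<Rightarrow> 'g set) \<Rightarrow> 'g topology" where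
  "filt_topology G N = topology_generated_by {(\<lambda>v. u \<oplus>\<^bsub>G\<^esub> v) ` N n |u n. u \<in> carrier G}"

abbreviation dual_topology :: "('k::field, 'h::ring_1) hopf \<Rightarrow> ('h \<Rightarrow> 'k) topology" where
  "dual_topology H \<equiv> filt_topology (dual H) (dual_filt H)"


section \<open>Left modules and tensor products over \<open>H\<close>\<close>

definition left_module :: "('r::ring_1, 'm, 'x) module_scheme \<Rightarrow> bool" where
  "left_module M \<longleftrightarrow> abelian_group M \<and>
    (\<forall>r. \<forall>a\<in>carrier M. r \<odot>\<^bsub>M\<^esub> a \<in> carrier M) \<and>
    (\<forall>r. \<forall>a\<in>carrier M. \<forall>b\<in>carrier M. r \<odot>\<^bsub>M\<^esub> (a \<oplus>\<^bsub>M\<^esub> b) = r \<odot>\<^bsub>M\<^esub> a \<oplus>\<^bsub>M\<^esub> r \<odot>\<^bsub>M\<^esub> b) \<and>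
    (\<forall>r s. \<forall>a\<in>carrier M. (r + s) \<odot>\<^bsub>M\<^esub> a = r \<odot>\<^bsub>M\<^esub> a \<oplus>\<^bsub>M\<^esub> s \<odot>\<^bsub>M\<^esub> a) \<and>
    (\<forall>r s. \<forall>a\<in>carrier M. (r * s) \<odot>\<^bsub>M\<^esub> a = r \<odot>\<^bsub>M\<^esub> (s \<odot>\<^bsub>M\<^esub> a)) \<and>
    (\<forall>a\<in>carrier M. 1 \<odot>\<^bsub>M\<^esub> a = a)"

definition span_over :: "('r, 'm, 'x) module_scheme \<Rightarrow> 'r set \<Rightarrow> 'm set \<Rightarrow> 'm set" where
  "span_over M R A =
    {\<Oplus>\<^bsub>M\<^esub>a\<in>F. r a \<odot>\<^bsub>M\<^esub> a |F r. finite F \<and> F \<subseteq> A \<and> r ` F \<subseteq> R}"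

definition scalars :: "('k, 'h::ring_1) hopf \<Rightarrow> 'h set" where
  "scalars H = range (\<lambda>c. scal H c 1)"

definition finitely_generated :: "('r, 'm, 'x) module_scheme \<Rightarrow> bool" where
  "finitely_generated M \<longleftrightarrow> (\<exists>E. finite E \<and> E \<subseteq> carrier M \<and> span_over M UNIV E = carrier M)"

definition free_module :: "('r::ring_1, 'm, 'x) module_scheme \<Rightarrow> bool" where
  "free_module M \<longleftrightarrow> (\<exists>E. E \<subseteq> carrier M \<and> span_over M UNIV E = carrier M \<and>
    (\<forall>F r. finite F \<longrightarrow> F \<subseteq> E \<longrightarrow> (\<Oplus>\<^bsub>M\<^esub>e\<in>F. r e \<odot>\<^bsub>M\<^esub> e) = \<zero>\<^bsub>M\<^esub> \<longrightarrow> (\<forall>e\<in>F. r e = 0)))"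

text \<open>A finite-dimensional subspace of \<open>M\<close> (over the field) that generates \<open>M\<close> over \<open>H\<close>.\<close>

definition generating_subspace ::
  "('k, 'h::ring_1) hopf \<Rightarrow> ('h, 'm, 'x) module_scheme \<Rightarrow> 'm set \<Rightarrow> bool" where
  "generating_subspace H M L0 \<longleftrightarrow>
    (\<exists>E. finite E \<and> E \<subseteq> carrier M \<and> L0 = span_over M (scalars H) E) \<and>
    span_over M UNIV L0 = carrier M"

text \<open>
  The tensor product \<open>A \<otimes> M\<close> over 'r of a right module \<open>A\<close>, with right action \<open>ra\<close>, and a left
  module \<open>M\<close>. It carries the left action \<open>s (a \<otimes> m) = (la s a) \<otimes> m\<close> coming from a left action \<open>la\<close>
  on \<open>A\<close> that commutes with \<open>ra\<close>.
\<close>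

definition tprod_rels ::
  "('a, 'x) ring_scheme \<Rightarrow> ('a \<Rightarrow> 'r \<Rightarrow> 'a) \<Rightarrow> ('r, 'm, 'y) module_scheme \<Rightarrow> ('a \<times> 'm \<Rightarrow>\<^sub>0 int) set" where
  "tprod_rels A ra M =
    {frag_of (a \<oplus>\<^bsub>A\<^esub> a', m) - frag_of (a, m) - frag_of (a', m) |a a' m.
       a \<in> carrier A \<and> a' \<in> carrier A \<and> m \<in> carrier M} \<union>
    {frag_of (a, m \<oplus>\<^bsub>M\<^esub> m') - frag_of (a, m) - frag_of (a, m') |a m m'.
       a \<in> carrier A \<and> m \<in> carrier M \<and> m' \<in> carrier M} \<union>
    {frag_of (ra a r, m) - frag_of (a, r \<odot>\<^bsub>M\<^esub> m) |a r m. a \<in> carrier A \<and> m \<in> carrier M}"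

definition tprod_group ::
  "('a, 'x) ring_scheme \<Rightarrow> ('a \<Rightarrow> 'r \<Rightarrow> 'a) \<Rightarrow> ('r, 'm, 'y) module_scheme \<Rightarrow>
   ('a \<times> 'm \<Rightarrow>\<^sub>0 int) set ring" where
  "tprod_group A ra M = presented_group (carrier A \<times> carrier M) (tprod_rels A ra M)"

definition tprod_pure ::
  "('a, 'x) ring_scheme \<Rightarrow> ('a \<Rightarrow> 'r \<Rightarrow> 'a) \<Rightarrow> ('r, 'm, 'y) module_scheme \<Rightarrow> 'a \<Rightarrow> 'm \<Rightarrow>
   ('a \<times> 'm \<Rightarrow>\<^sub>0 int) set" where
  "tprod_pure A ra M a m = frag_class (tprod_rels A ra M) (frag_of (a, m))"

definition tprod ::
  "('a, 'x) ring_scheme \<Rightarrow> ('a \<Rightarrow> 'r \<Rightarrow> 'a) \<Rightarrow> ('s \<Rightarrow> 'a \<Rightarrow> 'a) \<Rightarrow> ('r, 'm, 'y) module_scheme \<Rightarrow>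
   ('s, ('a \<times> 'm \<Rightarrow>\<^sub>0 int) set) module" where
  "tprod A ra la M =
    \<lparr>carrier = carrier (tprod_group A ra M),
     mult = undefined, one = undefined,
     zero = zero (tprod_group A ra M),
     add = add (tprod_group A ra M),
     smult = (\<lambda>s. frag_lift (tprod_group A ra M) (\<lambda>(a, m). tprod_pure A ra M (la s a) m))\<rparr>"


section \<open>Lie pseudoalgebras\<close>

text \<open>\<open>comult_iter H n\<close> is the iterated coproduct from \<open>H\<close> to the \<open>(n + 1)\<close>-fold tensor power.\<close>

primrec comult_iter :: "('k, 'h::ring_1) hopf \<Rightarrow> nat \<Rightarrow> 'h \<Rightarrow> 'h tensor" where
  "comult_iter H 0 h = pure H [h]"
| "comult_iter H (Suc n) h =
    frag_lift (tpow H (n + 2))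
      (\<lambda>xs. frag_lift (tpow H (n + 2)) (\<lambda>ys. pure H (ys @ tl xs)) (comult H (hd xs)))
      (comult_iter H n h)"

definition tpow_ract :: "('k, 'h::ring_1) hopf \<Rightarrow> nat \<Rightarrow> 'h tensor \<Rightarrow> 'h \<Rightarrow> 'h tensor" where
  "tpow_ract H n t h = t \<otimes>\<^bsub>tpow H n\<^esub> comult_iter H (n - 1) h"

type_synonym ('h, 'm) htensor = "('h tensor \<times> 'm \<Rightarrow>\<^sub>0 int) set"

text \<open>
  The \<open>n\<close>-th tensor power of \<open>H\<close> tensored over \<open>H\<close> with \<open>M\<close>. Its action \<open>t \<odot> _\<close> is left
  multiplication by \<open>t \<otimes>\<^sub>H 1\<close> for \<open>t\<close> in the tensor power.
\<close>

definition htens ::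
  "('k, 'h::ring_1) hopf \<Rightarrow> nat \<Rightarrow> ('h, 'm, 'x) module_scheme \<Rightarrow> ('h tensor, ('h, 'm) htensor) module" where
  "htens H n M = tprod (tpow H n) (tpow_ract H n) (mult (tpow H n)) M"

definition hpure ::
  "('k, 'h::ring_1) hopf \<Rightarrow> nat \<Rightarrow> ('h, 'm, 'x) module_scheme \<Rightarrow> 'h tensor \<Rightarrow> 'm \<Rightarrow> ('h, 'm) htensor" where
  "hpure H n M = tprod_pure (tpow H n) (tpow_ract H n) M"

definition hflip ::
  "('k, 'h::ring_1) hopf \<Rightarrow> nat \<Rightarrow> ('h, 'm, 'x) module_scheme \<Rightarrow> ('h, 'm) htensor \<Rightarrow> ('h, 'm) htensor" where
  "hflip H n M = frag_lift (htens H n M) (\<lambda>(t, m). hpure H n M (tflip H n t) m)"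

record ('h, 'm) pseudoalgebra = "('h, 'm) module" +
  pbracket :: "'m \<Rightarrow> 'm \<Rightarrow> ('h, 'm) htensor"

definition pbracket_left ::
  "('k, 'h::ring_1) hopf \<Rightarrow> ('h, 'm, 'x) pseudoalgebra_scheme \<Rightarrow> 'm \<Rightarrow> 'm \<Rightarrow> 'm \<Rightarrow> ('h, 'm) htensor" where
  \<comment> \<open>\<open>[[a*b]*c]\<close>\<close>
  "pbracket_left H L a b c =
    frag_lift (htens H 3 L)
      (\<lambda>(g, e). frag_lift (htens H 3 L)
         (\<lambda>(t, e'). hpure H 3 L (tcat H 2 1 g (pure H [1]) \<otimes>\<^bsub>tpow H 3\<^esub> comult_id H t) e')
         (pbracket L e c))
      (pbracket L a b)"

definition pbracket_right ::
  "('k, 'h::ring_1) hopf \<Rightarrow> ('h, 'm, 'x) pseudoalgebra_scheme \<Rightarrow> 'm \<Rightarrow> 'm \<Rightarrow> 'm \<Rightarrow> ('h, 'm) htensor" where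
  \<comment> \<open>\<open>[a*[b*c]]\<close>\<close>
  "pbracket_right H L a b c =
    frag_lift (htens H 3 L)
      (\<lambda>(h, d). frag_lift (htens H 3 L)
         (\<lambda>(t, d'). hpure H 3 L (tcat H 1 2 (pure H [1]) h \<otimes>\<^bsub>tpow H 3\<^esub> id_comult H t) d')
         (pbracket L a d))
      (pbracket L b c)"

text \<open>
  Linearity of the pseudobracket over the field is additivity together with sesquilinearity for
  \<open>f\<close>, \<open>g\<close> multiples of \<open>1\<close>.
\<close>

definition lie_pseudoalgebra ::
  "('k, 'h::ring_1) hopf \<Rightarrow> ('h, 'm, 'x) pseudoalgebra_scheme \<Rightarrow> bool" where
  "lie_pseudoalgebra H L \<longleftrightarrow> left_module L \<and>
    (\<forall>a\<in>carrier L. \<forall>b\<in>carrier L. pbracket L a b \<in> carrier (htens H 2 L)) \<and>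
    (\<forall>a\<in>carrier L. \<forall>a'\<in>carrier L. \<forall>b\<in>carrier L.
       pbracket L (a \<oplus>\<^bsub>L\<^esub> a') b = pbracket L a b \<oplus>\<^bsub>htens H 2 L\<^esub> pbracket L a' b) \<and>
    (\<forall>a\<in>carrier L. \<forall>b\<in>carrier L. \<forall>b'\<in>carrier L.
       pbracket L a (b \<oplus>\<^bsub>L\<^esub> b') = pbracket L a b \<oplus>\<^bsub>htens H 2 L\<^esub> pbracket L a b') \<and>
    (\<forall>f g. \<forall>a\<in>carrier L. \<forall>b\<in>carrier L.
       pbracket L (f \<odot>\<^bsub>L\<^esub> a) (g \<odot>\<^bsub>L\<^esub> b) = pure H [f, g] \<odot>\<^bsub>htens H 2 L\<^esub> pbracket L a b) \<and>
    (\<forall>a\<in>carrier L. \<forall>b\<in>carrier L.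
       pbracket L b a = \<ominus>\<^bsub>htens H 2 L\<^esub> hflip H 2 L (pbracket L a b)) \<and>
    (\<forall>a\<in>carrier L. \<forall>b\<in>carrier L. \<forall>c\<in>carrier L.
       pbracket_right H L a b c \<ominus>\<^bsub>htens H 3 L\<^esub> hflip H 3 L (pbracket_right H L b a c)
       = pbracket_left H L a b c)"

text \<open>The map \<open>id \<otimes>\<^sub>H \<Phi>\<close> on the codomain of the pseudobracket of \<open>L\<close>.\<close>

definition hmap ::
  "('k, 'h::ring_1) hopf \<Rightarrow> ('h, 'n, 'y) module_scheme \<Rightarrow> ('m \<Rightarrow> 'n) \<Rightarrow> ('h, 'm) htensor \<Rightarrow> ('h, 'n) htensor" where
  "hmap H M' \<Phi> = frag_lift (htens H 2 M') (\<lambda>(t, m). hpure H 2 M' t (\<Phi> m))"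

definition lie_pseudoalgebra_iso ::
  "('k, 'h::ring_1) hopf \<Rightarrow> ('h, 'm, 'x) pseudoalgebra_scheme \<Rightarrow> ('h, 'n, 'y) pseudoalgebra_scheme \<Rightarrow>
   ('m \<Rightarrow> 'n) \<Rightarrow> bool" where
  "lie_pseudoalgebra_iso H L L' \<Phi> \<longleftrightarrow>
    lie_pseudoalgebra H L \<and> lie_pseudoalgebra H L' \<and>
    bij_betw \<Phi> (carrier L) (carrier L') \<and>
    (\<forall>a\<in>carrier L. \<forall>b\<in>carrier L. \<Phi> (a \<oplus>\<^bsub>L\<^esub> b) = \<Phi> a \<oplus>\<^bsub>L'\<^esub> \<Phi> b) \<and>
    (\<forall>h. \<forall>a\<in>carrier L. \<Phi> (h \<odot>\<^bsub>L\<^esub> a) = h \<odot>\<^bsub>L'\<^esub> \<Phi> a) \<and>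
    (\<forall>a\<in>carrier L. \<forall>b\<in>carrier L. hmap H L' \<Phi> (pbracket L a b) = pbracket L' (\<Phi> a) (\<Phi> b))"


section \<open>The annihilation algebra\<close>

record ('h, 'g) top_lie_algebra = "('h, 'g) module" +
  lie_bracket :: "'g \<Rightarrow> 'g \<Rightarrow> 'g"
  lie_topology :: "'g topology"

type_synonym ('k, 'h, 'm) annih_elem = "(('h \<Rightarrow> 'k) \<times> 'm \<Rightarrow>\<^sub>0 int) set"

definition annih_module ::
  "('k::field, 'h::ring_1) hopf \<Rightarrow> ('h, 'm, 'x) module_scheme \<Rightarrow> ('h, ('k, 'h, 'm) annih_elem) module" where
  "annih_module H L = tprod (dual H) (dual_ract H) (dual_lact H) L"

definition annih_pure ::
  "('k::field, 'h::ring_1) hopf \<Rightarrow> ('h, 'm, 'x) module_scheme \<Rightarrow> ('h \<Rightarrow> 'k) \<Rightarrow> 'm \<Rightarrow> ('k, 'h, 'm) annih_elem" where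
  "annih_pure H L = tprod_pure (dual H) (dual_ract H) L"

definition annih_bracket ::
  "('k::field, 'h::ring_1) hopf \<Rightarrow> ('h, 'm, 'x) pseudoalgebra_scheme \<Rightarrow>
   ('k, 'h, 'm) annih_elem \<Rightarrow> ('k, 'h, 'm) annih_elem \<Rightarrow> ('k, 'h, 'm) annih_elem" where
  "annih_bracket H L U V =
    frag_lift (annih_module H L)
      (\<lambda>(x, a). frag_lift (annih_module H L)
         (\<lambda>(y, b). frag_lift (annih_module H L)
            (\<lambda>(t, e). frag_lift (annih_module H L)
               (\<lambda>fs. annih_pure H L (dual_ract H x (fs ! 0) \<otimes>\<^bsub>dual H\<^esub> dual_ract H y (fs ! 1)) e) t)
            (pbracket L a b))
         V)
      U"

text \<open>The image of \<open>F\<^sub>n X \<otimes> L0\<close> in \<open>X \<otimes>\<^sub>H L\<close>: all finite sums of its pure tensors.\<close>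

definition annih_filt ::
  "('k::field, 'h::ring_1) hopf \<Rightarrow> ('h, 'm, 'x) module_scheme \<Rightarrow> 'm set \<Rightarrow> nat \<Rightarrow> ('k, 'h, 'm) annih_elem set" where
  "annih_filt H L L0 n =
    {frag_class (tprod_rels (dual H) (dual_ract H) L) u |u. Poly_Mapping.keys u \<subseteq> dual_filt H n \<times> L0}"

definition annih ::
  "('k::field, 'h::ring_1) hopf \<Rightarrow> ('h, 'm, 'x) pseudoalgebra_scheme \<Rightarrow> 'm set \<Rightarrow>
   ('h, ('k, 'h, 'm) annih_elem) top_lie_algebra" where
  "annih H L L0 = module.extend (annih_module H L)
    (top_lie_algebra.fields (annih_bracket H L) (filt_topology (annih_module H L) (annih_filt H L L0)))"


section \<open>Reconstruction of a pseudoalgebra\<close>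

text \<open>
  Continuous \<open>H\<close>-linear maps from \<open>X\<close> to \<open>LL\<close>; functions are taken to be \<open>undefined\<close> outside
  \<open>X\<close>, so that equality of functions is equality on \<open>X\<close>.
\<close>

definition cont_hom ::
  "('k::field, 'h::ring_1) hopf \<Rightarrow> ('h, 'g, 'x) top_lie_algebra_scheme \<Rightarrow> ('h, ('h \<Rightarrow> 'k) \<Rightarrow> 'g) module" where
  "cont_hom H LL =
    \<lparr>carrier = {\<alpha> \<in> carrier (dual H) \<rightarrow>\<^sub>E carrier LL.
       (\<forall>x\<in>carrier (dual H). \<forall>y\<in>carrier (dual H). \<alpha> (x \<oplus>\<^bsub>dual H\<^esub> y) = \<alpha> x \<oplus>\<^bsub>LL\<^esub> \<alpha> y) \<and>
       (\<forall>h. \<forall>x\<in>carrier (dual H). \<alpha> (dual_lact H h x) = h \<odot>\<^bsub>LL\<^esub> \<alpha> x) \<and>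
       continuous_map (dual_topology H) (lie_topology LL) \<alpha>},
     mult = undefined, one = undefined,
     zero = (\<lambda>x\<in>carrier (dual H). \<zero>\<^bsub>LL\<^esub>),
     add = (\<lambda>\<alpha> \<beta>. \<lambda>x\<in>carrier (dual H). \<alpha> x \<oplus>\<^bsub>LL\<^esub> \<beta> x),
     smult = (\<lambda>h \<alpha>. \<lambda>x\<in>carrier (dual H). \<alpha> (dual_ract H x h))\<rparr>"

text \<open>
  The \<open>x\<close>-bracket, for the basis \<open>B\<close> of \<open>H\<close> and the dual basis of \<open>X\<close>. When \<open>H\<close> is
  infinite-dimensional the sum over \<open>B\<close> is infinite; it is understood as the limit of the finite
  partial sums in the topology of \<open>LL\<close>.
\<close>

definition xbracket_sums ::
  "('k::field, 'h::ring_1) hopf \<Rightarrow> 'h set \<Rightarrow> ('h, 'g, 'x) top_lie_algebra_scheme \<Rightarrow>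
   (('h \<Rightarrow> 'k) \<Rightarrow> 'g) \<Rightarrow> ('h \<Rightarrow> 'k) \<Rightarrow> (('h \<Rightarrow> 'k) \<Rightarrow> 'g) \<Rightarrow> ('h \<Rightarrow> 'k) \<Rightarrow> 'g \<Rightarrow> bool" where
  "xbracket_sums H B LL \<alpha> x \<beta> y s \<longleftrightarrow>
    limitin (lie_topology LL)
      (\<lambda>F. \<Oplus>\<^bsub>LL\<^esub>h\<in>F. lie_bracket LL (\<alpha> (dual_vec H B h))
                              (\<beta> (y \<otimes>\<^bsub>dual H\<^esub> dual_lact H h (dual_antipode H x))))
      s (finite_subsets_at_top B)"

definition xbracket ::
  "('k::field, 'h::ring_1) hopf \<Rightarrow> 'h set \<Rightarrow> ('h, 'g, 'x) top_lie_algebra_scheme \<Rightarrow>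
   (('h \<Rightarrow> 'k) \<Rightarrow> 'g) \<Rightarrow> ('h \<Rightarrow> 'k) \<Rightarrow> (('h \<Rightarrow> 'k) \<Rightarrow> 'g) \<Rightarrow> ('h \<Rightarrow> 'k) \<Rightarrow> 'g" where
  "xbracket H B LL \<alpha> x \<beta> = (\<lambda>y\<in>carrier (dual H). THE s. xbracket_sums H B LL \<alpha> x \<beta> y s)"

definition xbracket_support ::
  "('k::field, 'h::ring_1) hopf \<Rightarrow> 'h set \<Rightarrow> ('h, 'g, 'x) top_lie_algebra_scheme \<Rightarrow>
   (('h \<Rightarrow> 'k) \<Rightarrow> 'g) \<Rightarrow> (('h \<Rightarrow> 'k) \<Rightarrow> 'g) \<Rightarrow> 'h set" where
  "xbracket_support H B LL \<alpha> \<beta> =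
    {h \<in> B. xbracket H B LL \<alpha> (dual_vec H B h) \<beta> \<noteq> \<zero>\<^bsub>cont_hom H LL\<^esub>}"

text \<open>
  The pseudobracket below is meaningful under \<open>xbrackets_ok\<close>, by which the \<open>x\<close>-brackets exist and,
  for all \<open>\<alpha>\<close> and \<open>\<beta>\<close>, only finitely many of those at dual basis vectors are nonzero.
\<close>

definition xbrackets_ok ::
  "('k::field, 'h::ring_1) hopf \<Rightarrow> 'h set \<Rightarrow> ('h, 'g, 'x) top_lie_algebra_scheme \<Rightarrow> bool" where
  "xbrackets_ok H B LL \<longleftrightarrow>
    (\<forall>\<alpha>\<in>carrier (cont_hom H LL). \<forall>\<beta>\<in>carrier (cont_hom H LL).
      (\<forall>x\<in>carrier (dual H).
        (\<forall>y\<in>carrier (dual H). \<exists>!s. xbracket_sums H B LL \<alpha> x \<beta> y s) \<and>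
        xbracket H B LL \<alpha> x \<beta> \<in> carrier (cont_hom H LL)) \<and>
      finite (xbracket_support H B LL \<alpha> \<beta>))"

definition reconstruction ::
  "('k::field, 'h::ring_1) hopf \<Rightarrow> 'h set \<Rightarrow> ('h, 'g, 'x) top_lie_algebra_scheme \<Rightarrow>
   ('h, ('h \<Rightarrow> 'k) \<Rightarrow> 'g) pseudoalgebra" where
  "reconstruction H B LL = module.extend (cont_hom H LL) (pseudoalgebra.fields
    (\<lambda>\<alpha> \<beta>. \<Oplus>\<^bsub>htens H 2 (cont_hom H LL)\<^esub>h\<in>xbracket_support H B LL \<alpha> \<beta>.
       hpure H 2 (cont_hom H LL) (pure H [antipode H h, 1]) (xbracket H B LL \<alpha> (dual_vec H B h) \<beta>)))"

definition canonical_map ::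
  "('k::field, 'h::ring_1) hopf \<Rightarrow> ('h, 'm, 'x) module_scheme \<Rightarrow> 'm \<Rightarrow> ('h \<Rightarrow> 'k) \<Rightarrow> ('k, 'h, 'm) annih_elem" where
  "canonical_map H L a = (\<lambda>x\<in>carrier (dual H). annih_pure H L x a)"

end

theory Submission
  imports Defs
begin

text \<open>
  Write \<open>\<Phi>\<close> for the canonical map and \<open>S\<close> for the antipode, and let \<open>L\<close> be free over \<open>H\<close> with
  basis \<open>e\<^sub>1, \<dots>, e\<^sub>r\<close>, which is finite because \<open>L\<close> is finitely generated. Then \<open>X \<otimes>\<^sub>H L\<close> is \<open>X\<^sup>r\<close>, so
  an \<open>H\<close>-linear map \<open>\<alpha>\<close> from \<open>X\<close> to it has \<open>r\<close> coordinates, \<open>H\<close>-linear endomorphisms of \<open>X\<close>, and each of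
  these is determined by the functional that evaluates its values at \<open>1\<close>. When \<open>\<alpha>\<close> is continuous,
  this functional vanishes on some \<open>F\<^sub>n X\<close>; it therefore factors through the dual of the
  finite-dimensional space \<open>F\<^sup>n H\<close> and is the evaluation at an element of \<open>H\<close>. Unwinding, \<open>\<alpha>\<close> is \<open>\<Phi>(a)\<close>
  for exactly one \<open>a\<close> (\<open>continuous_functional\<close>, \<open>can_inj\<close>, \<open>can_surj\<close>).

  For the brackets, every value \<open>[a * b]\<close> can be written as \<open>\<Sum>(f \<otimes> 1) \<otimes>\<^sub>H l\<^sub>f\<close> (\<open>normal_form\<close>). In this form
  the series for \<open>[\<Phi>(a)\<^sub>x \<Phi>(b)](y)\<close> can be summed: at each \<open>u \<in> H\<close> it is a finite sum, equal to
  \<open>y(u\<^sub>2) x(S(u\<^sub>3) u\<^sub>1 S(f))\<close> in Sweedler notation, and cocommutativity cancels \<open>S(u\<^sub>3)\<close> against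
  \<open>u\<^sub>1\<close> (\<open>partial_apply\<close>). The limit is \<open>\<Phi>(\<Sum>x(S f) l\<^sub>f)\<close> at \<open>y\<close>, and it is unique because the topology
  is separated (\<open>xbracket_can\<close>). For \<open>x = x\<^sub>h\<close> in the dual basis this vanishes unless \<open>h\<close> occurs in the
  expansion of some \<open>S f\<close>, so the support is finite; and \<open>\<Sum>x\<^sub>h(S f) S(h) = f\<close> turns the pseudobracket of
  \<open>\<Phi>(a)\<close> and \<open>\<Phi>(b)\<close> back into the image of \<open>[a * b]\<close> under \<open>id \<otimes>\<^sub>H \<Phi>\<close> (\<open>pbracket_can\<close>). The axioms of a Lie
  pseudoalgebra then pass from \<open>L\<close> along the bijection \<open>\<Phi>\<close> (\<open>transport_lie_pseudoalgebra\<close>).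

  All statements about the topology use that the subspaces \<open>F\<^sup>n H\<close> exhaust \<open>H\<close> (\<open>H_filt_exhausts\<close>), which is
  the part of the theorem of Cartier and Kostant that concerns generation. Its proof regards \<open>H\<close> as
  a module over the commutative algebra \<open>X\<close>, acting by \<open>x h = x(h\<^sub>2) h\<^sub>1\<close>. Finite-dimensional
  submodules decompose into pieces on which the ideal of the functionals vanishing at one group-like
  element \<open>g\<close> is nilpotent; translation by \<open>g\<close> reduces to \<open>g = 1\<close>, and there an Euler operator shows, by
  induction on the order of nilpotency and in characteristic \<open>0\<close>, that primitive elements generate.

  Tensor products are groups given by generators and relators. Maps out of them come from universal
  properties and are compared on pure tensors; a tensor of order two is also determined by its
  contractions with functionals, and the axioms of \<open>H\<close> become identities between the sums
  \<open>sw \<phi> h = \<Sum>\<phi>(h\<^sub>1)(h\<^sub>2)\<close>.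
\<close>

section \<open>Presented abelian groups\<close>

text \<open>The additive extension of \<open>\<phi>\<close> to formal sums; \<open>frag_lift\<close> is its value on a coset on which it is constant.\<close>

definition formal_sum :: "('g, 'x) ring_scheme \<Rightarrow> ('b \<Rightarrow> 'g) \<Rightarrow> ('b \<Rightarrow>\<^sub>0 int) \<Rightarrow> 'g" where
  "formal_sum G \<phi> u = (\<Oplus>\<^bsub>G\<^esub>b\<in>Poly_Mapping.keys u. [Poly_Mapping.lookup u b] \<cdot>\<^bsub>G\<^esub> \<phi> b)"

lemma frag_lift_formal_sum: "frag_lift G \<phi> U = the_elem (formal_sum G \<phi> ` U)"
  by (simp add: frag_lift_def formal_sum_def[abs_def])

definition additive_map :: "('g, 'x) ring_scheme \<Rightarrow> ('g', 'y) ring_scheme \<Rightarrow> ('g \<Rightarrow> 'g') \<Rightarrow> bool" where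
  "additive_map M G f \<longleftrightarrow> f \<in> carrier M \<rightarrow> carrier G \<and>
     (\<forall>a\<in>carrier M. \<forall>b\<in>carrier M. f (a \<oplus>\<^bsub>M\<^esub> b) = f a \<oplus>\<^bsub>G\<^esub> f b)"

lemma additiveI:
  "(\<And>a. a \<in> carrier M \<Longrightarrow> f a \<in> carrier G) \<Longrightarrow>
   (\<And>a b. a \<in> carrier M \<Longrightarrow> b \<in> carrier M \<Longrightarrow> f (a \<oplus>\<^bsub>M\<^esub> b) = f a \<oplus>\<^bsub>G\<^esub> f b) \<Longrightarrow> additive_map M G f"
  by (auto simp: additive_map_def)

lemma additive_closed: "additive_map M G f \<Longrightarrow> a \<in> carrier M \<Longrightarrow> f a \<in> carrier G"
  by (auto simp: additive_map_def)

lemma additive_add: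
  "additive_map M G f \<Longrightarrow> a \<in> carrier M \<Longrightarrow> b \<in> carrier M \<Longrightarrow> f (a \<oplus>\<^bsub>M\<^esub> b) = f a \<oplus>\<^bsub>G\<^esub> f b"
  by (auto simp: additive_map_def)

lemma additive_zero:
  assumes "abelian_group M" "abelian_group G" "additive_map M G f"
  shows "f \<zero>\<^bsub>M\<^esub> = \<zero>\<^bsub>G\<^esub>"
proof -
  interpret M: abelian_group M by fact
  interpret G: abelian_group G by fact
  have "f \<zero>\<^bsub>M\<^esub> \<oplus>\<^bsub>G\<^esub> f \<zero>\<^bsub>M\<^esub> = f \<zero>\<^bsub>M\<^esub>"
    using additive_add[OF assms(3), of "\<zero>\<^bsub>M\<^esub>" "\<zero>\<^bsub>M\<^esub>"] by simp
  then show ?thesis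
    using additive_closed[OF assms(3), of "\<zero>\<^bsub>M\<^esub>"] by simp
qed

lemma additive_uminus:
  assumes "abelian_group M" "abelian_group G" "additive_map M G f" "a \<in> carrier M"
  shows "f (\<ominus>\<^bsub>M\<^esub> a) = \<ominus>\<^bsub>G\<^esub> f a"
proof -
  interpret M: abelian_group M by fact
  interpret G: abelian_group G by fact
  have "f (\<ominus>\<^bsub>M\<^esub> a) \<oplus>\<^bsub>G\<^esub> f a = \<zero>\<^bsub>G\<^esub>"
    using additive_add[OF assms(3), of "\<ominus>\<^bsub>M\<^esub> a" a] assms additive_zero[OF assms(1-3)]
    by (simp add: M.l_neg)
  then show ?thesis
    using additive_closed[OF assms(3)] assms(4) by (metis G.minus_equality M.a_inv_closed)
qed

lemma additive_minus:
  assumes "abelian_group M" "abelian_group G" "additive_map M G f" "a \<in> carrier M" "b \<in> carrier M"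
  shows "f (a \<ominus>\<^bsub>M\<^esub> b) = f a \<ominus>\<^bsub>G\<^esub> f b"
proof -
  interpret M: abelian_group M by fact
  show ?thesis using assms
    by (simp add: a_minus_def additive_add[OF assms(3)] additive_uminus)
qed

lemma additive_finsum:
  assumes "abelian_group M" "abelian_group G" "additive_map M G f" "\<And>i. i \<in> A \<Longrightarrow> s i \<in> carrier M"
  shows "f (\<Oplus>\<^bsub>M\<^esub>i\<in>A. s i) = (\<Oplus>\<^bsub>G\<^esub>i\<in>A. f (s i))"
proof -
  interpret M: abelian_group M by fact
  interpret G: abelian_group G by fact
  show ?thesis
    using assms(4)
  proof (induction A rule: infinite_finite_induct)
    case (insert x F)
    then have s: "s \<in> F \<rightarrow> carrier M" "s x \<in> carrier M" by auto
    have fs: "(\<lambda>i. f (s i)) \<in> F \<rightarrow> carrier G" "f (s x) \<in> carrier G"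
      using s additive_closed[OF assms(3)] by auto
    show ?case
      using insert s fs
      by (simp add: M.finsum_insert G.finsum_insert additive_add[OF assms(3)] M.finsum_closed)
  qed (auto simp: additive_zero[OF assms(1-3)])
qed

lemma additive_comp: "additive_map M G f \<Longrightarrow> additive_map G K g \<Longrightarrow> additive_map M K (\<lambda>a. g (f a))"
  by (auto simp: additive_map_def Pi_iff)

lemma additive_sum2:
  assumes "abelian_group G" "additive_map M G f" "additive_map M G g"
  shows "additive_map M G (\<lambda>a. f a \<oplus>\<^bsub>G\<^esub> g a)"
proof -
  interpret G: abelian_group G by fact
  show ?thesis
    using assms(2,3) by (intro additiveI)
      (auto simp: additive_closed additive_add[OF assms(2)] additive_add[OF assms(3)] G.a_ac)
qed

text \<open>
  The group structure of a record is determined by its carrier, zero and addition; the tensor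
  powers and the module tensor products differ from the presented groups only in their
  multiplications.
\<close>

lemma add_monoid_cong:
  fixes M :: "('g, 'x) ring_scheme" and N :: "('g, 'y) ring_scheme" 
  assumes "carrier M = carrier N" "zero M = zero N" "add M = add N"
  shows "formal_sum M = formal_sum N" "frag_lift M = frag_lift N" "finsum M = finsum N"
    "a_inv M = a_inv N" "a_minus M = a_minus N" "additive_map M G f = additive_map N G f"
    "additive_map G M f' = additive_map G N f'"
proof -
  have 2: "finsum M = finsum N"
    using assms by (intro ext) (simp add: finsum_def finprod_def)
  have 3: "add_pow M = (add_pow N :: int \<Rightarrow> 'g \<Rightarrow> 'g)"
    using assms by (intro ext) (simp add: add_pow_def int_pow_def nat_pow_def m_inv_def Let_def)
  show f: "formal_sum M = formal_sum N"
    by (intro ext) (simp add: formal_sum_def 2 3)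
  show "frag_lift M = frag_lift N"
    by (intro ext) (simp add: frag_lift_formal_sum f)
  show "finsum M = finsum N" by fact
  show i: "a_inv M = a_inv N"
    using assms by (intro ext) (simp add: a_inv_def m_inv_def)
  show "a_minus M = a_minus N"
    using assms by (intro ext) (simp add: a_minus_def i)
  show "additive_map M G f = additive_map N G f" "additive_map G M f' = additive_map G N f'"
    using assms by (auto simp: additive_map_def)
qed

lemma funcset_mono: "f \<in> A \<rightarrow> C \<Longrightarrow> A' \<subseteq> A \<Longrightarrow> f \<in> A' \<rightarrow> C"
  by auto

context abelian_group
begin

lemma add_pow_zero_int: "[(0::int)] \<cdot> a = \<zero>"
  by (simp add: add_pow_def)

lemma formal_sum_superset:
  assumes "finite A" "Poly_Mapping.keys u \<subseteq> A" "\<phi> \<in> A \<rightarrow> carrier G"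
  shows "formal_sum G \<phi> u = (\<Oplus>b\<in>A. [Poly_Mapping.lookup u b] \<cdot> \<phi> b)"
  unfolding formal_sum_def
  by (rule add.finprod_mono_neutral_cong_left[OF assms(1,2)])
    (use assms in \<open>auto simp: in_keys_iff add_pow_zero_int Pi_iff intro!: add.int_pow_closed\<close>)

lemma formal_sum_closed:
  "\<phi> \<in> Poly_Mapping.keys u \<rightarrow> carrier G \<Longrightarrow> formal_sum G \<phi> u \<in> carrier G"
  unfolding formal_sum_def by (auto simp: Pi_iff intro!: finsum_closed add.int_pow_closed)

lemma formal_sum_zero [simp]: "formal_sum G \<phi> 0 = \<zero>"
  by (simp add: formal_sum_def)

lemma formal_sum_of [simp]: "\<phi> b \<in> carrier G \<Longrightarrow> formal_sum G \<phi> (frag_of b) = \<phi> b"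
  by (simp add: formal_sum_def add.int_pow_1)

lemma formal_sum_add:
  assumes "\<phi> \<in> Poly_Mapping.keys u \<union> Poly_Mapping.keys v \<rightarrow> carrier G"
  shows "formal_sum G \<phi> (u + v) = formal_sum G \<phi> u \<oplus> formal_sum G \<phi> v"
proof -
  let ?A = "Poly_Mapping.keys u \<union> Poly_Mapping.keys v"
  have "formal_sum G \<phi> (u + v) = (\<Oplus>b\<in>?A. [Poly_Mapping.lookup (u + v) b] \<cdot> \<phi> b)"
    using assms keys_add[of u v] by (intro formal_sum_superset) auto
  also have "\<dots> = (\<Oplus>b\<in>?A. [Poly_Mapping.lookup u b] \<cdot> \<phi> b \<oplus> [Poly_Mapping.lookup v b] \<cdot> \<phi> b)"
    using assms by (intro finsum_cong') (auto simp: lookup_add add.int_pow_mult Pi_iff)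
  also have "\<dots> = formal_sum G \<phi> u \<oplus> formal_sum G \<phi> v"
    using assms by (subst finsum_addf) (auto simp: formal_sum_superset[of ?A] Pi_iff)
  finally show ?thesis .
qed

lemma formal_sum_diff:
  assumes "\<phi> \<in> Poly_Mapping.keys u \<union> Poly_Mapping.keys v \<rightarrow> carrier G"
  shows "formal_sum G \<phi> (u - v) = formal_sum G \<phi> u \<ominus> formal_sum G \<phi> v"
proof -
  have "formal_sum G \<phi> u = formal_sum G \<phi> (u - v) \<oplus> formal_sum G \<phi> v"
    using formal_sum_add[of \<phi> "u - v" v] assms keys_diff[of u v] by auto
  moreover have "formal_sum G \<phi> (u - v) \<in> carrier G" "formal_sum G \<phi> v \<in> carrier G"
    using assms keys_diff[of u v] by (auto intro!: formal_sum_closed)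
  ultimately show ?thesis
    by (simp add: a_minus_def a_assoc r_neg)
qed

lemma finsum_swap:
  assumes "finite A" "\<And>i j. i \<in> A \<Longrightarrow> j \<in> B \<Longrightarrow> s i j \<in> carrier G"
  shows "(\<Oplus>i\<in>A. \<Oplus>j\<in>B. s i j) = (\<Oplus>j\<in>B. \<Oplus>i\<in>A. s i j)"
  using assms
proof (induction A rule: finite_induct)
  case (insert a A)
  have "(\<Oplus>i\<in>insert a A. \<Oplus>j\<in>B. s i j) = (\<Oplus>j\<in>B. s a j) \<oplus> (\<Oplus>i\<in>A. \<Oplus>j\<in>B. s i j)"
    using insert by (intro finsum_insert) (auto intro!: finsum_closed)
  also have "\<dots> = (\<Oplus>j\<in>B. s a j \<oplus> (\<Oplus>i\<in>A. s i j))"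
    using insert by (simp add: finsum_addf Pi_iff finsum_closed)
  also have "\<dots> = (\<Oplus>j\<in>B. \<Oplus>i\<in>insert a A. s i j)"
    using insert by (intro finsum_cong' refl) (auto intro!: finsum_closed simp: Pi_iff)
  finally show ?case .
qed (simp add: finsum_zero)

end

lemma frag_span_keys:
  assumes "v \<in> Modules.module.span frag_cmul R" "\<And>r. r \<in> R \<Longrightarrow> Poly_Mapping.keys r \<subseteq> B"
  shows "Poly_Mapping.keys v \<subseteq> B"
proof -
  interpret Modules.module frag_cmul
    by unfold_locales (auto simp: frag_cmul_distrib frag_cmul_distrib2)
  show ?thesis
    using assms(1)
  proof (induction rule: span_induct_alt)
    case (step c x y)
    then show ?case
      using keys_add[of "frag_cmul c x" y] keys_cmul[of c x] assms(2)[of x] by blast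
  qed auto
qed

interpretation frag: Modules.module frag_cmul
  by unfold_locales (auto simp: frag_cmul_distrib frag_cmul_distrib2)

text \<open>
  The formal sums over \<open>B\<close> with value zero are closed under differences, hence under multiples by integers,
  so they contain the subgroup generated by the relators.
\<close>

lemma (in abelian_group) formal_sum_span_zero:
  assumes "v \<in> frag.span R" "\<And>r. r \<in> R \<Longrightarrow> Poly_Mapping.keys r \<subseteq> B"
    and "\<phi> \<in> B \<rightarrow> carrier G" "\<And>r. r \<in> R \<Longrightarrow> formal_sum G \<phi> r = \<zero>"
  shows "formal_sum G \<phi> v = \<zero>"
proof -
  define S where "S = {v. Poly_Mapping.keys v \<subseteq> B \<and> formal_sum G \<phi> v = \<zero>}"
  have diff: "u - v \<in> S" if "u \<in> S" "v \<in> S" for u v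
  proof -
    have k: "Poly_Mapping.keys u \<subseteq> B" "Poly_Mapping.keys v \<subseteq> B"
      and s: "formal_sum G \<phi> u = \<zero>" "formal_sum G \<phi> v = \<zero>"
      using that by (simp_all add: S_def)
    have "formal_sum G \<phi> (u - v) = \<zero> \<ominus> \<zero>"
      using formal_sum_diff[of \<phi> u v, OF funcset_mono[OF assms(3) Un_least[OF k]]] by (simp only: s)
    then show ?thesis
      using k keys_diff[of u v] by (simp add: S_def a_minus_def) blast
  qed
  have z: "0 \<in> S" by (simp add: S_def)
  have neg: "- u \<in> S" if "u \<in> S" for u
    using diff[OF z that] by (simp only: diff_0)
  have add: "u + v \<in> S" if "u \<in> S" "v \<in> S" for u v
    using diff[OF that(1) neg[OF that(2)]] by (simp only: diff_minus_eq_add)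
  have cm: "frag_cmul (int n) u \<in> S" if "u \<in> S" for n u
  proof (induction n)
    case (Suc n)
    show ?case
      using add[OF that Suc] by (simp add: frag_cmul_distrib)
  qed (use z in simp)
  have cm': "frag_cmul c u \<in> S" if "u \<in> S" for c u
  proof (cases c rule: int_cases2)
    case (nonneg n)
    show ?thesis unfolding nonneg by (rule cm[OF that])
  next
    case (nonpos n)
    have "- frag_cmul (int n) u \<in> S" by (rule neg[OF cm[OF that]])
    then show ?thesis unfolding nonpos minus_frag_cmul .
  qed
  have "R \<subseteq> S"
    using assms(2,4) by (simp add: S_def subset_iff)
  moreover have "frag.subspace S"
    using z add cm' by (rule frag.subspaceI)
  ultimately have "frag.span R \<subseteq> S" by (rule frag.span_minimal)
  then have "v \<in> S" using assms(1) by (rule subsetD)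
  then show ?thesis by (simp add: S_def)
qed

text \<open>
  A record is presented by generators \<open>B\<close> and relators \<open>R\<close> if its additive part is the presented
  group. The condition on the relators keeps the cosets inside the formal sums over \<open>B\<close>, so that
  additive extensions of maps defined on \<open>B\<close> can be evaluated on every member of a coset.
\<close>

definition presented ::
  "(('b \<Rightarrow>\<^sub>0 int) set, 'x) ring_scheme \<Rightarrow> 'b set \<Rightarrow> ('b \<Rightarrow>\<^sub>0 int) set \<Rightarrow> bool" where
  "presented M B R \<longleftrightarrow> carrier M = {frag_class R u |u. Poly_Mapping.keys u \<subseteq> B} \<and>
     zero M = frag_class R 0 \<and> add M = (\<lambda>U V. {u + v |u v. u \<in> U \<and> v \<in> V}) \<and>
     (\<forall>r\<in>R. Poly_Mapping.keys r \<subseteq> B)"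

lemma frag_class_eq_iff: "frag_class R u = frag_class R v \<longleftrightarrow> u - v \<in> frag.span R"
proof
  assume "frag_class R u = frag_class R v"
  moreover have "u \<in> frag_class R u" by (simp add: frag_class_def frag.span_zero)
  ultimately show "u - v \<in> frag.span R" by (auto simp: frag_class_def)
next
  assume *: "u - v \<in> frag.span R"
  have "w - u \<in> frag.span R \<longleftrightarrow> w - v \<in> frag.span R" for w
    using frag.span_add_eq2[OF *, of "w - u"] by simp
  then show "frag_class R u = frag_class R v"
    by (auto simp: frag_class_def)
qed

lemma frag_class_add:
  "{a + b |a b. a \<in> frag_class R u \<and> b \<in> frag_class R v} = frag_class R (u + v)"
proof (intro equalityI subsetI)
  fix w assume "w \<in> {a + b |a b. a \<in> frag_class R u \<and> b \<in> frag_class R v}"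
  then obtain a b where "w = a + b" "a - u \<in> frag.span R" "b - v \<in> frag.span R"
    by (auto simp: frag_class_def)
  then show "w \<in> frag_class R (u + v)"
    using frag.span_add[of "a - u" R "b - v"] by (simp add: frag_class_def algebra_simps)
next
  fix w assume "w \<in> frag_class R (u + v)"
  then have "w = u + (w - u) \<and> u \<in> frag_class R u \<and> w - u \<in> frag_class R v"
    by (simp add: frag_class_def frag.span_zero algebra_simps)
  then show "w \<in> {a + b |a b. a \<in> frag_class R u \<and> b \<in> frag_class R v}"
    by (intro CollectI exI[of _ u] exI[of _ "w - u"])
qed

context
  fixes M :: "(('b \<Rightarrow>\<^sub>0 int) set, 'x) ring_scheme" and B R
  assumes M: "presented M B R"
begin

lemma presented_elim:
  assumes "U \<in> carrier M" obtains u where "Poly_Mapping.keys u \<subseteq> B" "U = frag_class R u"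
  using assms M by (auto simp: presented_def)

lemma presented_class: "Poly_Mapping.keys u \<subseteq> B \<Longrightarrow> frag_class R u \<in> carrier M"
  using M by (auto simp: presented_def)

lemma presented_add: "frag_class R u \<oplus>\<^bsub>M\<^esub> frag_class R v = frag_class R (u + v)"
  using M by (simp add: presented_def frag_class_add)

lemma presented_zero: "\<zero>\<^bsub>M\<^esub> = frag_class R 0"
  using M by (simp add: presented_def)

lemma presented_abelian_group: "abelian_group M"
proof (rule abelian_groupI)
  fix U V W assume U: "U \<in> carrier M" and V: "V \<in> carrier M"
  obtain u v where u: "Poly_Mapping.keys u \<subseteq> B" "U = frag_class R u"
    and v: "Poly_Mapping.keys v \<subseteq> B" "V = frag_class R v"
    using presented_elim U V by metis
  show "U \<oplus>\<^bsub>M\<^esub> V \<in> carrier M"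
    unfolding u v presented_add using u v keys_add[of u v] by (intro presented_class) auto
  show "U \<oplus>\<^bsub>M\<^esub> V = V \<oplus>\<^bsub>M\<^esub> U"
    unfolding u v presented_add by (simp add: add.commute)
  assume "W \<in> carrier M"
  then obtain w where w: "W = frag_class R w" using presented_elim by metis
  show "U \<oplus>\<^bsub>M\<^esub> V \<oplus>\<^bsub>M\<^esub> W = U \<oplus>\<^bsub>M\<^esub> (V \<oplus>\<^bsub>M\<^esub> W)"
    unfolding u v w presented_add by (simp add: add.assoc)
next
  show "\<zero>\<^bsub>M\<^esub> \<in> carrier M" unfolding presented_zero by (rule presented_class) simp
  fix U assume "U \<in> carrier M"
  then obtain u where u: "Poly_Mapping.keys u \<subseteq> B" "U = frag_class R u" using presented_elim by metis
  show "\<zero>\<^bsub>M\<^esub> \<oplus>\<^bsub>M\<^esub> U = U" unfolding presented_zero u presented_add by simp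
  have "frag_class R (- u) \<oplus>\<^bsub>M\<^esub> U = \<zero>\<^bsub>M\<^esub>"
    unfolding presented_zero u presented_add by simp
  then show "\<exists>V\<in>carrier M. V \<oplus>\<^bsub>M\<^esub> U = \<zero>\<^bsub>M\<^esub>"
    using presented_class[of "- u"] u by auto
qed

interpretation M: abelian_group M by (rule presented_abelian_group)

lemma presented_uminus: "Poly_Mapping.keys u \<subseteq> B \<Longrightarrow> \<ominus>\<^bsub>M\<^esub> frag_class R u = frag_class R (- u)"
  by (rule M.minus_equality)
    (auto simp: presented_add presented_zero intro!: presented_class)

lemma presented_minus:
  "Poly_Mapping.keys u \<subseteq> B \<Longrightarrow> Poly_Mapping.keys v \<subseteq> B \<Longrightarrow>
   frag_class R u \<ominus>\<^bsub>M\<^esub> frag_class R v = frag_class R (u - v)"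
  by (simp add: a_minus_def presented_uminus presented_add)

lemma presented_induct [consumes 1, case_names zero gen diff]:
  assumes "U \<in> carrier M" "P \<zero>\<^bsub>M\<^esub>" "\<And>b. b \<in> B \<Longrightarrow> P (frag_class R (frag_of b))"
    and "\<And>U V. U \<in> carrier M \<Longrightarrow> V \<in> carrier M \<Longrightarrow> P U \<Longrightarrow> P V \<Longrightarrow> P (U \<ominus>\<^bsub>M\<^esub> V)"
  shows "P U"
proof -
  obtain u where u: "Poly_Mapping.keys u \<subseteq> B" "U = frag_class R u" using presented_elim assms(1) by metis
  have "Poly_Mapping.keys u \<subseteq> B \<and> P (frag_class R u)"
    using u(1)
  proof (induction u rule: frag_induction)
    case (diff a b)
    then show ?case
      using assms(4)[of "frag_class R a" "frag_class R b"] keys_diff[of a b]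
      by (auto simp: presented_minus intro!: presented_class)
  qed (use assms presented_zero in auto)
  then show ?thesis by (simp add: u)
qed

lemma additive_eq_on_generators:
  assumes "abelian_group G" "additive_map M G f" "additive_map M G g"
    and "\<And>b. b \<in> B \<Longrightarrow> f (frag_class R (frag_of b)) = g (frag_class R (frag_of b))"
    and "U \<in> carrier M"
  shows "f U = g U"
  using assms(5)
proof (induction U rule: presented_induct)
  case zero
  then show ?case using assms by (simp add: additive_zero M.abelian_group_axioms)
next
  case (diff U V)
  then show ?case using assms by (simp add: additive_minus M.abelian_group_axioms)
qed (use assms in auto)

text \<open>The value is the same on the whole coset, since its members differ by elements of the span of the relators.\<close>

lemma frag_lift_class:
  assumes "\<And>r. r \<in> R \<Longrightarrow> formal_sum G \<phi> r = \<zero>\<^bsub>G\<^esub>" "\<phi> \<in> B \<rightarrow> carrier G" "abelian_group G"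
    and "Poly_Mapping.keys u \<subseteq> B"
  shows "frag_lift G \<phi> (frag_class R u) = formal_sum G \<phi> u"
proof -
  interpret G: abelian_group G by fact
  have "formal_sum G \<phi> v = formal_sum G \<phi> u" if "v \<in> frag_class R u" for v
  proof -
    have sp: "v - u \<in> frag.span R" using that by (simp add: frag_class_def)
    have R: "\<And>r. r \<in> R \<Longrightarrow> Poly_Mapping.keys r \<subseteq> B" using M by (simp add: presented_def)
    have 0: "formal_sum G \<phi> (v - u) = \<zero>\<^bsub>G\<^esub>"
      by (rule G.formal_sum_span_zero[OF sp R assms(2,1)])
    have k: "Poly_Mapping.keys (v - u) \<subseteq> B" by (rule frag_span_keys[OF sp R])
    have "formal_sum G \<phi> (u + (v - u)) = formal_sum G \<phi> u \<oplus>\<^bsub>G\<^esub> formal_sum G \<phi> (v - u)"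
      by (rule G.formal_sum_add) (rule funcset_mono[OF assms(2) Un_least[OF assms(4) k]])
    moreover have "formal_sum G \<phi> u \<in> carrier G"
      by (rule G.formal_sum_closed) (rule funcset_mono[OF assms(2,4)])
    ultimately show ?thesis
      unfolding 0 by (simp only: add_diff_cancel_left' add_diff_eq G.r_zero)
  qed
  then have "formal_sum G \<phi> ` frag_class R u \<subseteq> {formal_sum G \<phi> u}"
    by (intro image_subsetI) (simp only: singleton_iff)
  moreover have "formal_sum G \<phi> u \<in> formal_sum G \<phi> ` frag_class R u"
    by (rule imageI) (simp add: frag_class_def frag.span_zero)
  ultimately have *: "formal_sum G \<phi> ` frag_class R u = {formal_sum G \<phi> u}"
    by (intro equalityI) auto
  show ?thesis unfolding frag_lift_formal_sum * by (rule the_elem_eq)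
qed

text \<open>The universal property of a presented group.\<close>

lemma
  assumes "abelian_group G" "\<And>b. b \<in> B \<Longrightarrow> \<phi> b \<in> carrier G"
    and "\<And>r. r \<in> R \<Longrightarrow> formal_sum G \<phi> r = \<zero>\<^bsub>G\<^esub>"
  shows frag_lift_additive: "additive_map M G (frag_lift G \<phi>)"
    and frag_lift_gen: "b \<in> B \<Longrightarrow> frag_lift G \<phi> (frag_class R (frag_of b)) = \<phi> b"
proof -
  interpret G: abelian_group G by fact
  have \<phi>: "\<phi> \<in> B \<rightarrow> carrier G" using assms(2) by (simp add: Pi_iff)
  have eq: "frag_lift G \<phi> (frag_class R u) = formal_sum G \<phi> u" if "Poly_Mapping.keys u \<subseteq> B" for u
    using assms(3) \<phi> assms(1) that by (rule frag_lift_class)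
  show "additive_map M G (frag_lift G \<phi>)"
  proof (rule additiveI)
    fix U V assume UV: "U \<in> carrier M" "V \<in> carrier M"
    obtain u where u: "Poly_Mapping.keys u \<subseteq> B" "U = frag_class R u"
      using presented_elim[OF UV(1)] .
    obtain v where v: "Poly_Mapping.keys v \<subseteq> B" "V = frag_class R v"
      using presented_elim[OF UV(2)] .
    have uv: "Poly_Mapping.keys (u + v) \<subseteq> B" using u(1) v(1) keys_add[of u v] by blast
    show "frag_lift G \<phi> U \<in> carrier G"
      unfolding u(2) eq[OF u(1)] by (rule G.formal_sum_closed) (rule funcset_mono[OF \<phi> u(1)])
    show "frag_lift G \<phi> (U \<oplus>\<^bsub>M\<^esub> V) = frag_lift G \<phi> U \<oplus>\<^bsub>G\<^esub> frag_lift G \<phi> V"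
      unfolding u(2) v(2) presented_add eq[OF u(1)] eq[OF v(1)] eq[OF uv]
      by (rule G.formal_sum_add) (rule funcset_mono[OF \<phi> Un_least[OF u(1) v(1)]])
  qed
  assume b: "b \<in> B"
  have k: "Poly_Mapping.keys (frag_of b) \<subseteq> B" using b by simp
  have "\<phi> b \<in> carrier G" using b by (rule assms(2))
  then have *: "formal_sum G \<phi> (frag_of b) = \<phi> b" by (rule G.formal_sum_of[of \<phi> b])
  show "frag_lift G \<phi> (frag_class R (frag_of b)) = \<phi> b"
    by (rule trans[OF eq[OF k] *])
qed

end

lemma frag_lift_cong:
  assumes "presented M B R" "abelian_group G" "\<And>b. b \<in> B \<Longrightarrow> \<phi> b = \<psi> b" "U \<in> carrier M"
    and "\<And>b. b \<in> B \<Longrightarrow> \<phi> b \<in> carrier G"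
  shows "frag_lift G \<phi> U = frag_lift G \<psi> U"
proof -
  interpret G: abelian_group G by fact
  obtain u where u: "Poly_Mapping.keys u \<subseteq> B" "U = frag_class R u"
    using presented_elim[OF assms(1,4)] .
  have "formal_sum G \<phi> v = formal_sum G \<psi> v" if "v \<in> U" for v
  proof -
    have "v - u \<in> frag.span R" using that u by (simp add: frag_class_def)
    then have "Poly_Mapping.keys (v - u) \<subseteq> B"
      using assms(1) frag_span_keys[of "v - u" R B] by (auto simp: presented_def)
    then have "Poly_Mapping.keys v \<subseteq> B"
      using u(1) keys_add[of u "v - u"] by auto
    then show ?thesis
      unfolding formal_sum_def using assms by (intro G.finsum_cong') auto
  qed
  then show ?thesis by (simp add: frag_lift_formal_sum)
qed

lemma presented_group_presented:
  assumes "\<And>r. r \<in> R \<Longrightarrow> Poly_Mapping.keys r \<subseteq> B"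
    and "carrier M = carrier (presented_group B R)" "zero M = zero (presented_group B R)"
      "add M = add (presented_group B R)"
  shows "presented M B R"
  using assms by (simp add: presented_def presented_group_def)

lemma (in abelian_group) formal_sum_diff_of:
  assumes "\<phi> a \<in> carrier G" "\<phi> b \<in> carrier G" "\<phi> a = \<phi> b"
  shows "formal_sum G \<phi> (frag_of a - frag_of b) = \<zero>"
proof -
  have "formal_sum G \<phi> (frag_of a - frag_of b) = \<phi> a \<ominus> \<phi> b"
    using assms(1,2) by (simp add: formal_sum_diff)
  also have "\<dots> = \<zero>" using assms(2) unfolding assms(3) by (simp add: a_minus_def r_neg)
  finally show ?thesis .
qed

lemma (in abelian_group) formal_sum_diff_of2:
  assumes "\<phi> a \<in> carrier G" "\<phi> b \<in> carrier G" "\<phi> c \<in> carrier G" "\<phi> a = \<phi> b \<oplus> \<phi> c"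
  shows "formal_sum G \<phi> (frag_of a - frag_of b - frag_of c) = \<zero>"
proof -
  have "\<phi> \<in> Poly_Mapping.keys (frag_of a - frag_of b) \<rightarrow> carrier G"
    using assms keys_diff[of "frag_of a" "frag_of b"] by auto
  then have "formal_sum G \<phi> (frag_of a - frag_of b - frag_of c) = \<phi> a \<ominus> \<phi> b \<ominus> \<phi> c"
    using assms(1-3) by (simp add: formal_sum_diff)
  also have "\<dots> = \<phi> a \<oplus> \<ominus> (\<phi> b \<oplus> \<phi> c)"
    using assms(1-3) by (simp add: a_minus_def minus_add a_assoc)
  also have "\<dots> = \<zero>" using assms(1) unfolding assms(4)[symmetric] by (simp add: r_neg)
  finally show ?thesis .
qed

lemma abelian_group_type_ring: "abelian_group (type_ring :: 'a::ring_1 ring)"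
proof (rule abelian_groupI)
  show "\<exists>y\<in>carrier type_ring. y \<oplus>\<^bsub>type_ring\<^esub> x = \<zero>\<^bsub>type_ring\<^esub>" for x :: 'a
    by (rule bexI[of _ "- x"]) (auto simp: type_ring_def)
qed (auto simp: type_ring_def ac_simps)

lemma type_ring_simps [simp]:
  "carrier (type_ring :: 'a::ring_1 ring) = UNIV" "\<zero>\<^bsub>type_ring\<^esub> = (0::'a)"
  "a \<oplus>\<^bsub>type_ring\<^esub> b = a + (b::'a)"
  by (auto simp: type_ring_def)

lemma finsum_type_ring: "finite A \<Longrightarrow> (\<Oplus>\<^bsub>type_ring\<^esub>i\<in>A. f i) = (\<Sum>i\<in>A. f i :: 'a::ring_1)"
proof (induction A rule: finite_induct)
  case empty
  interpret abelian_group "type_ring :: 'a ring" by (rule abelian_group_type_ring)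
  show ?case using finsum_empty[of f] by (simp only: type_ring_simps sum.empty)
next
  case (insert x F)
  interpret abelian_group "type_ring :: 'a ring" by (rule abelian_group_type_ring)
  have "finsum type_ring f (insert x F) = f x \<oplus>\<^bsub>type_ring\<^esub> finsum type_ring f F"
    using insert by (intro finsum_insert) auto
  then show ?case by (simp only: type_ring_simps insert sum.insert[OF insert(1,2)])
qed

section \<open>Biadditive maps\<close>

definition biadditive ::
  "('a, 'x) ring_scheme \<Rightarrow> ('b, 'y) ring_scheme \<Rightarrow> ('c, 'z) ring_scheme \<Rightarrow> ('a \<Rightarrow> 'b \<Rightarrow> 'c) \<Rightarrow> bool" where
  "biadditive M N G f \<longleftrightarrow>
     (\<forall>a\<in>carrier M. additive_map N G (f a)) \<and> (\<forall>b\<in>carrier N. additive_map M G (\<lambda>a. f a b))"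

lemma biadditiveI:
  "(\<And>a. a \<in> carrier M \<Longrightarrow> additive_map N G (f a)) \<Longrightarrow>
   (\<And>b. b \<in> carrier N \<Longrightarrow> additive_map M G (\<lambda>a. f a b)) \<Longrightarrow> biadditive M N G f"
  by (simp add: biadditive_def)

lemma biadditiveD:
  assumes "biadditive M N G f"
  shows "a \<in> carrier M \<Longrightarrow> additive_map N G (f a)" "b \<in> carrier N \<Longrightarrow> additive_map M G (\<lambda>a. f a b)"
    "a \<in> carrier M \<Longrightarrow> b \<in> carrier N \<Longrightarrow> f a b \<in> carrier G"
  using assms by (auto simp: biadditive_def additive_map_def Pi_iff)

text \<open>
  A map of two variables, additive in the second and compatible with the relators in the first,
  lifts in the first variable to a biadditive map. Every product below (of tensors, juxtaposition,
  brackets) arises by applying this twice.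
\<close>

lemma lift_biadditive:
  assumes M: "presented M B R" and "abelian_group N" "abelian_group G"
    and "\<And>b. b \<in> B \<Longrightarrow> additive_map N G (\<phi> b)"
    and "\<And>r t. r \<in> R \<Longrightarrow> t \<in> carrier N \<Longrightarrow> formal_sum G (\<lambda>b. \<phi> b t) r = \<zero>\<^bsub>G\<^esub>"
  shows "biadditive M N G (\<lambda>s t. frag_lift G (\<lambda>b. \<phi> b t) s)"
proof -
  interpret M: abelian_group M by (rule presented_abelian_group[OF M])
  interpret N: abelian_group N by fact
  interpret G: abelian_group G by fact
  have cl: "\<phi> b t \<in> carrier G" if "b \<in> B" "t \<in> carrier N" for b t
    by (rule additive_closed[OF assms(4)[OF that(1)] that(2)])
  have add1: "additive_map M G (frag_lift G (\<lambda>b. \<phi> b t))" if "t \<in> carrier N" for t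
    by (rule frag_lift_additive[OF M assms(3)]) (simp_all add: cl that assms(5))
  have gen: "frag_lift G (\<lambda>b. \<phi> b t) (frag_class R (frag_of b)) = \<phi> b t"
    if "t \<in> carrier N" "b \<in> B" for t b
    by (rule frag_lift_gen[OF M assms(3)]) (simp_all add: cl that assms(5))
  have "frag_lift G (\<lambda>b. \<phi> b (t \<oplus>\<^bsub>N\<^esub> t')) s = frag_lift G (\<lambda>b. \<phi> b t) s \<oplus>\<^bsub>G\<^esub> frag_lift G (\<lambda>b. \<phi> b t') s"
    if t: "t \<in> carrier N" "t' \<in> carrier N" and s: "s \<in> carrier M" for t t' s
    by (rule additive_eq_on_generators[OF M assms(3) add1 additive_sum2[OF assms(3) add1 add1] _ s])
      (use t in \<open>simp_all add: gen additive_add[OF assms(4)]\<close>)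
  then show ?thesis
    by (intro biadditiveI additiveI add1) (simp_all add: additive_closed[OF add1])
qed

section \<open>Tensor powers\<close>

definition multilinear ::
  "('k, 'h::ring_1) hopf \<Rightarrow> nat \<Rightarrow> ('g, 'x) ring_scheme \<Rightarrow> ('h list \<Rightarrow> 'g) \<Rightarrow> bool" where
  "multilinear H n G \<tau> \<longleftrightarrow>
     (\<forall>xs. length xs = n \<longrightarrow> \<tau> xs \<in> carrier G) \<and>
     (\<forall>xs i u v. length xs = n \<longrightarrow> i < n \<longrightarrow> \<tau> (xs[i := u + v]) = \<tau> (xs[i := u]) \<oplus>\<^bsub>G\<^esub> \<tau> (xs[i := v])) \<and>
     (\<forall>xs i j c. length xs = n \<longrightarrow> i < n \<longrightarrow> j < n \<longrightarrow>
        \<tau> (xs[i := scal H c (xs ! i)]) = \<tau> (xs[j := scal H c (xs ! j)]))"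

lemma multilinearI:
  assumes "\<And>xs. length xs = n \<Longrightarrow> \<tau> xs \<in> carrier G"
    and "\<And>xs i u v. length xs = n \<Longrightarrow> i < n \<Longrightarrow> \<tau> (xs[i := u + v]) = \<tau> (xs[i := u]) \<oplus>\<^bsub>G\<^esub> \<tau> (xs[i := v])"
    and "\<And>xs i j c. length xs = n \<Longrightarrow> i < n \<Longrightarrow> j < n \<Longrightarrow>
        \<tau> (xs[i := scal H c (xs ! i)]) = \<tau> (xs[j := scal H c (xs ! j)])"
  shows "multilinear H n G \<tau>"
  unfolding multilinear_def by (intro conjI allI impI) (fact assms)+

lemma multilinearD:
  assumes "multilinear H n G \<tau>"
  shows "length xs = n \<Longrightarrow> \<tau> xs \<in> carrier G"
    and "length xs = n \<Longrightarrow> i < n \<Longrightarrow> \<tau> (xs[i := u + v]) = \<tau> (xs[i := u]) \<oplus>\<^bsub>G\<^esub> \<tau> (xs[i := v])"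
    and "length xs = n \<Longrightarrow> i < n \<Longrightarrow> j < n \<Longrightarrow>
        \<tau> (xs[i := scal H c (xs ! i)]) = \<tau> (xs[j := scal H c (xs ! j)])"
proof -
  note m = assms[unfolded multilinear_def]
  show "length xs = n \<Longrightarrow> \<tau> xs \<in> carrier G"
    by (rule m[THEN conjunct1, rule_format])
  show "length xs = n \<Longrightarrow> i < n \<Longrightarrow> \<tau> (xs[i := u + v]) = \<tau> (xs[i := u]) \<oplus>\<^bsub>G\<^esub> \<tau> (xs[i := v])"
    by (rule m[THEN conjunct2, THEN conjunct1, rule_format])
  show "length xs = n \<Longrightarrow> i < n \<Longrightarrow> j < n \<Longrightarrow>
      \<tau> (xs[i := scal H c (xs ! i)]) = \<tau> (xs[j := scal H c (xs ! j)])"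
    by (rule m[THEN conjunct2, THEN conjunct2, rule_format])
qed

lemma keys_diff2:
  "a \<in> B \<Longrightarrow> b \<in> B \<Longrightarrow> Poly_Mapping.keys (frag_of a - frag_of b) \<subseteq> B"
  "a \<in> B \<Longrightarrow> b \<in> B \<Longrightarrow> c \<in> B \<Longrightarrow> Poly_Mapping.keys (frag_of a - frag_of b - frag_of c) \<subseteq> B"
  using keys_diff[of "frag_of a" "frag_of b"] keys_diff[of "frag_of a - frag_of b" "frag_of c"] by auto

lemma tpow_presented: "presented (tpow H n) {xs. length xs = n} (tpow_rels H n)"
proof (rule presented_group_presented)
  fix r assume "r \<in> tpow_rels H n"
  then show "Poly_Mapping.keys r \<subseteq> {xs. length xs = n}"
    unfolding tpow_rels_def by (elim UnE CollectE exE) (simp_all add: keys_diff2)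
qed (simp_all add: tpow_def tpow_group_def)

lemmas tpow_abelian_group = presented_abelian_group[OF tpow_presented]

lemma pure_eq_class: "length xs = n \<Longrightarrow> pure H xs = frag_class (tpow_rels H n) (frag_of xs)"
  by (auto simp: pure_def)

lemma tpow_group_simps:
  "carrier (tpow_group H n) = carrier (tpow H n)" "zero (tpow_group H n) = zero (tpow H n)"
  "add (tpow_group H n) = add (tpow H n)"
  by (simp_all add: tpow_def)

lemmas frag_lift_tpow_group = add_monoid_cong(2)[OF tpow_group_simps]

lemma tensor_lift_relator:
  assumes "abelian_group G" "multilinear H n G \<tau>" "r \<in> tpow_rels H n"
  shows "formal_sum G \<tau> r = \<zero>\<^bsub>G\<^esub>"
proof -
  interpret G: abelian_group G by fact
  note \<tau> = multilinearD[OF assms(2)]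
  from assms(3) consider
    xs i u v where "length xs = n" "i < n" "r = frag_of (xs[i := u + v]) - frag_of (xs[i := u]) - frag_of (xs[i := v])"
  | xs i j c where "length xs = n" "i < n" "j < n" "r = frag_of (xs[i := scal H c (xs ! i)]) - frag_of (xs[j := scal H c (xs ! j)])"
    unfolding tpow_rels_def by blast
  then show ?thesis
  proof cases
    case 1
    have l: "length (xs[i := w]) = n" for w using 1(1) by simp
    show ?thesis unfolding 1(3)
      by (rule G.formal_sum_diff_of2[of \<tau>]) (rule \<tau>(1)[OF l] \<tau>(2)[OF 1(1,2)])+
  next
    case 2
    have l: "length (xs[i := w]) = n" for w i using 2(1) by simp
    show ?thesis unfolding 2(4)
      by (rule G.formal_sum_diff_of[of \<tau>]) (rule \<tau>(1)[OF l] \<tau>(3)[OF 2(1-3)])+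
  qed
qed

lemma
  assumes "abelian_group G" "multilinear H n G \<tau>"
  shows tensor_lift_additive: "additive_map (tpow H n) G (frag_lift G \<tau>)"
    and tensor_lift_pure: "length xs = n \<Longrightarrow> frag_lift G \<tau> (pure H xs) = \<tau> xs"
proof -
  have 1: "\<tau> xs \<in> carrier G" if "xs \<in> {xs. length xs = n}" for xs
    using that by (intro multilinearD(1)[OF assms(2)]) simp
  note 2 = tensor_lift_relator[OF assms]
  show "additive_map (tpow H n) G (frag_lift G \<tau>)"
    using tpow_presented assms(1) 1 2 by (rule frag_lift_additive)
  assume xs: "length xs = n"
  then have m: "xs \<in> {xs. length xs = n}" by (rule CollectI)
  have "frag_lift G \<tau> (frag_class (tpow_rels H n) (frag_of xs)) = \<tau> xs"
  proof (rule frag_lift_gen[of "tpow H n" "{xs. length xs = n}" "tpow_rels H n" G \<tau> xs])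
    show "\<tau> xs \<in> carrier G" if "xs \<in> {xs. length xs = n}" for xs by (rule 1[OF that])
    show "formal_sum G \<tau> r = \<zero>\<^bsub>G\<^esub>" if "r \<in> tpow_rels H n" for r by (rule 2[OF that])
  qed (rule tpow_presented assms(1) m)+
  then show "frag_lift G \<tau> (pure H xs) = \<tau> xs"
    by (simp only: pure_eq_class[OF xs])
qed

lemma pure_closed: "length xs = n \<Longrightarrow> pure H xs \<in> carrier (tpow H n)"
  by (simp add: pure_eq_class presented_class[OF tpow_presented])

lemma pure_multilinear:
  fixes H :: "('k, 'h::ring_1) hopf"
  shows "multilinear H n (tpow H n) (pure H)"
proof (rule multilinearI)
  fix xs :: "'h list" and i u v assume *: "length xs = n" "i < n"
  let ?a = "frag_of (xs[i := u + v])" and ?b = "frag_of (xs[i := u])" and ?c = "frag_of (xs[i := v])"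
  have "?a - ?b - ?c \<in> tpow_rels H n"
    using * unfolding tpow_rels_def by blast
  then have "?a - (?b + ?c) \<in> frag.span (tpow_rels H n)"
    by (simp only: diff_diff_add frag.span_base)
  then have "frag_class (tpow_rels H n) ?a = frag_class (tpow_rels H n) (?b + ?c)"
    by (simp only: frag_class_eq_iff)
  also have "\<dots> = frag_class (tpow_rels H n) ?b \<oplus>\<^bsub>tpow H n\<^esub> frag_class (tpow_rels H n) ?c"
    by (rule presented_add[OF tpow_presented, symmetric])
  finally show "pure H (xs[i := u + v]) = pure H (xs[i := u]) \<oplus>\<^bsub>tpow H n\<^esub> pure H (xs[i := v])"
    using * by (simp add: pure_eq_class[where n = n])
next
  fix xs :: "'h list" and i j c assume *: "length xs = n" "i < n" "j < n"
  let ?a = "frag_of (xs[i := scal H c (xs ! i)])" and ?b = "frag_of (xs[j := scal H c (xs ! j)])"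
  have "?a - ?b \<in> tpow_rels H n"
    using * unfolding tpow_rels_def by blast
  then have "frag_class (tpow_rels H n) ?a = frag_class (tpow_rels H n) ?b"
    by (simp only: frag_class_eq_iff frag.span_base)
  then show "pure H (xs[i := scal H c (xs ! i)]) = pure H (xs[j := scal H c (xs ! j)])"
    using * by (simp add: pure_eq_class[where n = n])
qed (rule pure_closed)

lemma tensor_eq_on_pure:
  fixes H :: "('k, 'h::ring_1) hopf"
  assumes "abelian_group G" "additive_map (tpow H n) G f" "additive_map (tpow H n) G g"
    and "\<And>xs. length xs = n \<Longrightarrow> f (pure H xs) = g (pure H xs)" "t \<in> carrier (tpow H n)"
  shows "f t = g t"
proof (rule additive_eq_on_generators[OF tpow_presented assms(1-3) _ assms(5)])
  fix xs :: "'h list" assume "xs \<in> {xs. length xs = n}"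
  then have xs: "length xs = n" by (rule CollectD)
  show "f (frag_class (tpow_rels H n) (frag_of xs)) = g (frag_class (tpow_rels H n) (frag_of xs))"
    using assms(4)[OF xs] by (simp only: pure_eq_class[OF xs])
qed

lemma tensor_induct [consumes 1, case_names zero pure diff]:
  fixes H :: "('k, 'h::ring_1) hopf"
  assumes "t \<in> carrier (tpow H n)" "P \<zero>\<^bsub>tpow H n\<^esub>" "\<And>xs. length xs = n \<Longrightarrow> P (pure H xs)"
    and "\<And>s t. s \<in> carrier (tpow H n) \<Longrightarrow> t \<in> carrier (tpow H n) \<Longrightarrow> P s \<Longrightarrow> P t \<Longrightarrow> P (s \<ominus>\<^bsub>tpow H n\<^esub> t)"
  shows "P t"
proof (rule presented_induct[where P = P, OF tpow_presented assms(1,2)])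
  fix xs :: "'h list" assume "xs \<in> {xs. length xs = n}"
  then have xs: "length xs = n" by (rule CollectD)
  show "P (frag_class (tpow_rels H n) (frag_of xs))"
    using assms(3)[OF xs] by (simp only: pure_eq_class[OF xs])
qed (rule assms(4))

text \<open>
  The case of two tensor powers, in which the compatibility with the relators of either factor is
  multilinearity.
\<close>

lemma
  fixes H :: "('k, 'h::ring_1) hopf"
  assumes G: "abelian_group G"
    and 1: "\<And>ys. length ys = m \<Longrightarrow> multilinear H n G (\<lambda>xs. \<tau> xs ys)"
    and 2: "\<And>xs. length xs = n \<Longrightarrow> multilinear H m G (\<tau> xs)"
  shows tensor_lift2_biadditive:
      "biadditive (tpow H n) (tpow H m) G (\<lambda>s t. frag_lift G (\<lambda>xs. frag_lift G (\<tau> xs) t) s)"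
    and tensor_lift2_multilinear:
      "t \<in> carrier (tpow H m) \<Longrightarrow> multilinear H n G (\<lambda>xs. frag_lift G (\<tau> xs) t)"
    and tensor_lift2_pure: "length xs = n \<Longrightarrow> length ys = m \<Longrightarrow>
      frag_lift G (\<lambda>xs. frag_lift G (\<tau> xs) (pure H ys)) (pure H xs) = \<tau> xs ys"
proof -
  interpret G: abelian_group G by fact
  note add = tensor_lift_additive[OF G 2] and pure = tensor_lift_pure[OF G 2]
  show *: "multilinear H n G (\<lambda>xs. frag_lift G (\<tau> xs) t)" if t: "t \<in> carrier (tpow H m)" for t
  proof (rule multilinearI)
    fix xs :: "'h list" assume xs: "length xs = n"
    show "frag_lift G (\<tau> xs) t \<in> carrier G" by (rule additive_closed[OF add[OF xs] t])
    fix i u v assume i: "i < n"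
    have *: "length (xs[i := a]) = n" for a using xs by simp
    show "frag_lift G (\<tau> (xs[i := u + v])) t = frag_lift G (\<tau> (xs[i := u])) t \<oplus>\<^bsub>G\<^esub> frag_lift G (\<tau> (xs[i := v])) t"
      by (rule tensor_eq_on_pure[OF G add[OF *] additive_sum2[OF G add[OF *] add[OF *]] _ t])
        (simp add: pure[OF *] multilinearD(2)[OF 1 xs i])
  next
    fix xs :: "'h list" and i j c assume xs: "length xs = n" and i: "i < n" "j < n"
    have *: "length (xs[i := a]) = n" for a i using xs by simp
    show "frag_lift G (\<tau> (xs[i := scal H c (xs ! i)])) t = frag_lift G (\<tau> (xs[j := scal H c (xs ! j)])) t"
      by (rule tensor_eq_on_pure[OF G add[OF *] add[OF *] _ t])
        (simp only: pure[OF *] multilinearD(3)[OF 1 xs i])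
  qed
  show "biadditive (tpow H n) (tpow H m) G (\<lambda>s t. frag_lift G (\<lambda>xs. frag_lift G (\<tau> xs) t) s)"
  proof (rule lift_biadditive[where \<phi> = "\<lambda>xs. frag_lift G (\<tau> xs)",
        OF tpow_presented[of H n] tpow_abelian_group[of H m] G])
    show "additive_map (tpow H m) G (frag_lift G (\<tau> xs))" if "xs \<in> {xs. length xs = n}" for xs
      by (rule add) (rule CollectD[OF that])
    show "formal_sum G (\<lambda>xs. frag_lift G (\<tau> xs) t) r = \<zero>\<^bsub>G\<^esub>"
      if "r \<in> tpow_rels H n" "t \<in> carrier (tpow H m)" for r t
      by (rule tensor_lift_relator[OF G *[OF that(2)] that(1)])
  qed
  show "frag_lift G (\<lambda>xs. frag_lift G (\<tau> xs) (pure H ys)) (pure H xs) = \<tau> xs ys"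
    if "length xs = n" "length ys = m"
    unfolding tensor_lift_pure[OF G *[OF pure_closed[OF that(2)]] that(1)] by (rule pure[OF that])
qed

text \<open>Precomposition with linear maps in the entries, as needed for products and scalar multiples.\<close>

lemma multilinear_entrywise:
  fixes H :: "('k, 'h::ring_1) hopf"
  assumes \<tau>: "multilinear H n G \<tau>"
    and f: "\<And>i u v. i < n \<Longrightarrow> f i (u + v) = f i u + f i v"
      "\<And>i c u. i < n \<Longrightarrow> f i (scal H c u) = scal H c (f i u)"
    and \<tau>': "\<And>xs. length xs = n \<Longrightarrow> \<tau>' xs = \<tau> (map (\<lambda>i. f i (xs ! i)) [0..<n])"
  shows "multilinear H n G \<tau>'"
proof (rule multilinearI)
  fix xs :: "'h list" assume xs: "length xs = n"
  let ?F = "\<lambda>xs. map (\<lambda>i. f i (xs ! i)) [0..<n]"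
  have l: "length (?F xs) = n" by simp
  have upd: "\<tau>' (xs[i := u]) = \<tau> ((?F xs)[i := f i u])" if "i < n" for i u
  proof -
    have "?F (xs[i := u]) = (?F xs)[i := f i u]"
      using that xs by (auto intro!: nth_equalityI simp: nth_list_update)
    then show ?thesis using \<tau>'[of "xs[i := u]"] xs by simp
  qed
  show "\<tau>' xs \<in> carrier G"
    unfolding \<tau>'[OF xs] by (rule multilinearD(1)[OF \<tau> l])
  fix i assume i: "i < n"
  show "\<tau>' (xs[i := u + v]) = \<tau>' (xs[i := u]) \<oplus>\<^bsub>G\<^esub> \<tau>' (xs[i := v])" for u v
    unfolding upd[OF i] f(1)[OF i] by (rule multilinearD(2)[OF \<tau> l i])
  have F: "f i (scal H c (xs ! i)) = scal H c (?F xs ! i)" if "i < n" for c i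
    using that by (simp add: f(2))
  show "\<tau>' (xs[i := scal H c (xs ! i)]) = \<tau>' (xs[j := scal H c (xs ! j)])" if j: "j < n" for j c
    unfolding upd[OF i] upd[OF j] F[OF i] F[OF j] by (rule multilinearD(3)[OF \<tau> l i j])
qed

context hopf_algebra
begin

sublocale V: vector_space "scal H" by (rule scal_vector_space)

lemma multilinear_map2:
  assumes "length ys = n"
  shows "multilinear H n (tpow H n) (\<lambda>xs. pure H (map2 (*) xs ys))"
    and "multilinear H n (tpow H n) (\<lambda>xs. pure H (map2 (*) ys xs))"
proof -
  have eq: "map2 (*) xs ys = map (\<lambda>i. xs ! i * ys ! i) [0..<n]"
    "map2 (*) ys xs = map (\<lambda>i. ys ! i * xs ! i) [0..<n]" if "length xs = n" for xs :: "'h list"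
    using that assms by (auto intro!: nth_equalityI)
  show "multilinear H n (tpow H n) (\<lambda>xs. pure H (map2 (*) xs ys))"
    by (rule multilinear_entrywise[OF pure_multilinear, where f = "\<lambda>i u. u * ys ! i"])
      (simp_all only: eq(1) distrib_right scal_mult_left)
  show "multilinear H n (tpow H n) (\<lambda>xs. pure H (map2 (*) ys xs))"
    by (rule multilinear_entrywise[OF pure_multilinear, where f = "\<lambda>i u. ys ! i * u"])
      (simp_all only: eq(2) distrib_left scal_mult_right)
qed

lemma tmult_eq: "mult (tpow H n) = (\<lambda>s t. frag_lift (tpow H n)
       (\<lambda>xs. frag_lift (tpow H n) (\<lambda>ys. pure H (map2 (*) xs ys)) t) s)"
  unfolding frag_lift_tpow_group[symmetric] by (simp add: tpow_def)

lemma tmult_biadditive: "biadditive (tpow H n) (tpow H n) (tpow H n) (mult (tpow H n))"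
  unfolding tmult_eq by (rule tensor_lift2_biadditive[OF tpow_abelian_group]) (simp_all only: multilinear_map2)

lemma tmult_pure:
  "length xs = n \<Longrightarrow> length ys = n \<Longrightarrow> pure H xs \<otimes>\<^bsub>tpow H n\<^esub> pure H ys = pure H (map2 (*) xs ys)"
  unfolding tmult_eq
  by (rule tensor_lift2_pure[where \<tau> = "\<lambda>xs ys. pure H (map2 (*) xs ys)", OF tpow_abelian_group])
    (simp_all only: multilinear_map2)

lemmas tmult_closed = biadditiveD(3)[OF tmult_biadditive]

lemma tmult_assoc:
  assumes "s \<in> carrier (tpow H n)" "t \<in> carrier (tpow H n)" "u \<in> carrier (tpow H n)"
  shows "(s \<otimes>\<^bsub>tpow H n\<^esub> t) \<otimes>\<^bsub>tpow H n\<^esub> u = s \<otimes>\<^bsub>tpow H n\<^esub> (t \<otimes>\<^bsub>tpow H n\<^esub> u)"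
proof -
  let ?T = "tpow H n"
  note ag = tpow_abelian_group[of H n]
  note L = biadditiveD(1)[OF tmult_biadditive] and R = biadditiveD(2)[OF tmult_biadditive]
  have m: "map2 (*) (map2 (*) xs ys) zs = map2 (*) xs (map2 (*) ys zs)"
    if "length xs = n" "length ys = n" "length zs = n" for xs ys zs :: "'h list"
    using that by (auto intro!: nth_equalityI simp: mult.assoc)
  have 1: "(pure H xs \<otimes>\<^bsub>?T\<^esub> pure H ys) \<otimes>\<^bsub>?T\<^esub> u = pure H xs \<otimes>\<^bsub>?T\<^esub> (pure H ys \<otimes>\<^bsub>?T\<^esub> u)"
    if "length xs = n" "length ys = n" for xs ys
    by (rule tensor_eq_on_pure[OF ag L additive_comp[OF L L] _ assms(3)])
      (use that in \<open>auto simp: tmult_pure pure_closed m\<close>)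
  have 2: "(pure H xs \<otimes>\<^bsub>?T\<^esub> t) \<otimes>\<^bsub>?T\<^esub> u = pure H xs \<otimes>\<^bsub>?T\<^esub> (t \<otimes>\<^bsub>?T\<^esub> u)"
    if "length xs = n" for xs
    by (rule tensor_eq_on_pure[OF ag additive_comp[OF L R] additive_comp[OF R L] _ assms(2)])
      (use that assms in \<open>auto simp: pure_closed 1\<close>)
  show ?thesis
    by (rule tensor_eq_on_pure[OF ag additive_comp[OF R R] R _ assms(1)])
      (use assms in \<open>auto simp: 2 tmult_closed\<close>)
qed

lemma tsmult_pure_multilinear:
  assumes "n \<ge> 1" shows "multilinear H n (tpow H n) (\<lambda>xs. pure H (xs[0 := scal H c (xs ! 0)]))"
proof (rule multilinearI)
  note p = multilinearD(2,3)[OF pure_multilinear[of H n]]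
  fix xs :: "'h list" and i u v assume xs: "length xs = n" and i: "i < n"
  have *: "pure H ((xs[i := w])[0 := scal H c (xs[i := w] ! 0)]) = pure H (xs[i := scal H c w])" for w
    using p(2)[of "xs[i := w]" 0 i c] xs i by simp
  show "pure H ((xs[i := u + v])[0 := scal H c (xs[i := u + v] ! 0)]) =
    pure H ((xs[i := u])[0 := scal H c (xs[i := u] ! 0)]) \<oplus>\<^bsub>tpow H n\<^esub> pure H ((xs[i := v])[0 := scal H c (xs[i := v] ! 0)])"
    unfolding * V.scale_right_distrib by (rule p(1)[OF xs i])
next
  note p = multilinearD(2,3)[OF pure_multilinear[of H n]]
  fix xs :: "'h list" and i j d assume xs: "length xs = n" and i: "i < n" "j < n"
  have *: "pure H ((xs[i := w])[0 := scal H c (xs[i := w] ! 0)]) = pure H (xs[i := scal H c w])" if "i < n" for w i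
    using p(2)[of "xs[i := w]" 0 i c] xs that by simp
  show "pure H ((xs[i := scal H d (xs ! i)])[0 := scal H c (xs[i := scal H d (xs ! i)] ! 0)]) =
    pure H ((xs[j := scal H d (xs ! j)])[0 := scal H c (xs[j := scal H d (xs ! j)] ! 0)])"
    unfolding *[OF i(1)] *[OF i(2)] V.scale_scale by (rule p(2)[OF xs i])
qed (use assms in \<open>simp add: pure_closed\<close>)

lemma tsmult_eq: "smult (tpow H n) c = frag_lift (tpow H n) (\<lambda>xs. pure H (xs[0 := scal H c (xs ! 0)]))"
  unfolding frag_lift_tpow_group[symmetric] by (simp add: tpow_def)

end

lemma additive_map_finsum:
  assumes "abelian_group G" "\<And>b. b \<in> F \<Longrightarrow> additive_map M G (f b)"
  shows "additive_map M G (\<lambda>a. \<Oplus>\<^bsub>G\<^esub>b\<in>F. f b a)"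
proof -
  interpret G: abelian_group G by fact
  show ?thesis
  proof (rule additiveI)
    fix a assume a: "a \<in> carrier M"
    have fa: "(\<lambda>b. f b a) \<in> F \<rightarrow> carrier G" if "a \<in> carrier M" for a
      by (rule funcsetI) (rule additive_closed[OF assms(2) that])
    show "(\<Oplus>\<^bsub>G\<^esub>b\<in>F. f b a) \<in> carrier G"
      by (rule G.finsum_closed[OF fa[OF a]])
    fix c assume c: "c \<in> carrier M"
    have "(\<Oplus>\<^bsub>G\<^esub>b\<in>F. f b (a \<oplus>\<^bsub>M\<^esub> c)) = (\<Oplus>\<^bsub>G\<^esub>b\<in>F. f b a \<oplus>\<^bsub>G\<^esub> f b c)"
    proof (rule G.finsum_cong'[OF refl])
      show "(\<lambda>b. f b a \<oplus>\<^bsub>G\<^esub> f b c) \<in> F \<rightarrow> carrier G"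
        using fa[OF a] fa[OF c] by (simp add: Pi_iff)
      show "f b (a \<oplus>\<^bsub>M\<^esub> c) = f b a \<oplus>\<^bsub>G\<^esub> f b c" if "b \<in> F" for b
        by (rule additive_add[OF assms(2)[OF that] a c])
    qed
    also have "\<dots> = (\<Oplus>\<^bsub>G\<^esub>b\<in>F. f b a) \<oplus>\<^bsub>G\<^esub> (\<Oplus>\<^bsub>G\<^esub>b\<in>F. f b c)"
      by (rule G.finsum_addf[OF fa[OF a] fa[OF c]])
    finally show "(\<Oplus>\<^bsub>G\<^esub>b\<in>F. f b (a \<oplus>\<^bsub>M\<^esub> c)) = (\<Oplus>\<^bsub>G\<^esub>b\<in>F. f b a) \<oplus>\<^bsub>G\<^esub> (\<Oplus>\<^bsub>G\<^esub>b\<in>F. f b c)" .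
  qed
qed

section \<open>Sweedler calculus\<close>

context hopf_algebra
begin

lemma multilinear_2I:
  assumes "\<And>a b. \<phi> a b \<in> carrier G"
    and "\<And>u v b. \<phi> (u + v) b = \<phi> u b \<oplus>\<^bsub>G\<^esub> \<phi> v b"
    and "\<And>a u v. \<phi> a (u + v) = \<phi> a u \<oplus>\<^bsub>G\<^esub> \<phi> a v"
    and "\<And>a b c. \<phi> (scal H c a) b = \<phi> a (scal H c b)"
  shows "multilinear H 2 G (\<lambda>xs. \<phi> (xs ! 0) (xs ! 1))"
proof (rule multilinearI)
  fix xs :: "'h list" and i assume xs: "length xs = 2" and i: "i < (2::nat)"
  then have i01: "i = 0 \<or> i = 1" by auto
  show "\<phi> (xs[i := u + v] ! 0) (xs[i := u + v] ! 1) =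
      \<phi> (xs[i := u] ! 0) (xs[i := u] ! 1) \<oplus>\<^bsub>G\<^esub> \<phi> (xs[i := v] ! 0) (xs[i := v] ! 1)" for u v
    using i01 xs by (elim disjE) (simp_all add: assms(2,3))
  fix j c assume j: "j < (2::nat)"
  then have j01: "j = 0 \<or> j = 1" by auto
  show "\<phi> (xs[i := scal H c (xs ! i)] ! 0) (xs[i := scal H c (xs ! i)] ! 1) =
      \<phi> (xs[j := scal H c (xs ! j)] ! 0) (xs[j := scal H c (xs ! j)] ! 1)"
    using i01 j01 xs assms(4)[of c "xs ! 0" "xs ! 1"] by (elim disjE) simp_all
qed (rule assms(1))

lemma pure_pair_additive:
  "additive_map type_ring (tpow H 2) (\<lambda>a. pure H [a, b])"
  "additive_map type_ring (tpow H 2) (\<lambda>b. pure H [a, b])"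
  using multilinearD(2)[OF pure_multilinear[of H 2], of "[a, b]" 0]
    multilinearD(2)[OF pure_multilinear[of H 2], of "[a, b]" 1]
  by (auto intro!: additiveI pure_closed)

lemma pair_closed: "pure H [a, b] \<in> carrier (tpow H 2)"
  by (simp add: pure_closed)

lemma pure_pair_scal: "pure H [scal H c a, b] = pure H [a, scal H c b]"
  using multilinearD(3)[OF pure_multilinear[of H 2], of "[a, b]" 0 1 c] by simp

text \<open>
  The scalar multiplication \<open>s\<close> of the target is a parameter, so that the same rules serve
  functionals on \<open>H\<close> and linear maps to \<open>H\<close>.
\<close>

definition lin :: "('k \<Rightarrow> 'v \<Rightarrow> 'v) \<Rightarrow> ('h \<Rightarrow> 'v::plus) \<Rightarrow> bool" where
  "lin s F \<longleftrightarrow> (\<forall>a b. F (a + b) = F a + F b) \<and> (\<forall>c a. F (scal H c a) = s c (F a))"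

lemma lin_add: "lin s F \<Longrightarrow> F (a + b) = F a + F b"
  by (simp add: lin_def)

lemma lin_scal: "lin s F \<Longrightarrow> F (scal H c a) = s c (F a)"
  by (simp add: lin_def)

lemma lin_zero: "lin s F \<Longrightarrow> F 0 = (0::'v::ab_group_add)"
  using lin_add[of s F 0 0] by simp

lemma lin_uminus: "lin s F \<Longrightarrow> F (- a) = - (F a :: 'v::ab_group_add)"
  using lin_add[of s F "- a" a] lin_zero[of s F] by (simp add: eq_neg_iff_add_eq_0)

lemma lin_diff: "lin s F \<Longrightarrow> F (a - b) = F a - (F b :: 'v::ab_group_add)"
  using lin_add[of s F a "- b"] by (simp add: lin_uminus)

lemma lin_sum: "lin s F \<Longrightarrow> F (sum f A) = (\<Sum>i\<in>A. F (f i) :: 'v::ab_group_add)"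
  by (induction A rule: infinite_finite_induct) (simp_all add: lin_zero lin_add)

lemma lin_dual: "x \<in> carrier (dual H) \<longleftrightarrow> lin (*) x"
proof -
  have 1: "vector_space ((*) :: 'k \<Rightarrow> 'k \<Rightarrow> 'k)" by unfold_locales (auto simp: algebra_simps)
  show ?thesis
    by (simp add: dual_def lin_def Vector_Spaces.linear_iff scal_vector_space 1)
qed

lemma lin_counit: "lin (*) (counit H)"
  using counit_linear lin_dual by (simp add: dual_def)

lemma lin_antipode: "lin (scal H) (antipode H)"
  using antipode_linear by (simp add: lin_def Vector_Spaces.linear_iff)

definition bilin :: "('k \<Rightarrow> 'v \<Rightarrow> 'v) \<Rightarrow> ('h \<Rightarrow> 'h \<Rightarrow> 'v::plus) \<Rightarrow> bool" where
  "bilin s \<phi> \<longleftrightarrow> (\<forall>b. lin s (\<lambda>a. \<phi> a b)) \<and> (\<forall>a. lin s (\<lambda>b. \<phi> a b))"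

lemma bilinI: "(\<And>b. lin s (\<lambda>a. \<phi> a b)) \<Longrightarrow> (\<And>a. lin s (\<lambda>b. \<phi> a b)) \<Longrightarrow> bilin s \<phi>"
  by (simp add: bilin_def)

lemma bilin_multilinear:
  fixes \<phi> :: "'h \<Rightarrow> 'h \<Rightarrow> 'v::ring_1"
  assumes "bilin s \<phi>"
  shows "multilinear H 2 type_ring (\<lambda>xs. \<phi> (xs ! 0) (xs ! 1))"
proof (rule multilinear_2I)
  have 1: "lin s (\<lambda>a. \<phi> a b)" "lin s (\<lambda>b. \<phi> a b)" for a b
    using assms by (simp_all add: bilin_def)
  show "\<phi> (u + v) b = \<phi> u b \<oplus>\<^bsub>type_ring\<^esub> \<phi> v b" for u v b
    using lin_add[OF 1(1)] by simp
  show "\<phi> a (u + v) = \<phi> a u \<oplus>\<^bsub>type_ring\<^esub> \<phi> a v" for u v a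
    using lin_add[OF 1(2)] by simp
  show "\<phi> (scal H c a) b = \<phi> a (scal H c b)" for a b c
    using lin_scal[OF 1(1)] lin_scal[OF 1(2)] by simp
qed simp

subsection \<open>Expansion of tensors in a basis of the second factor\<close>

lemma basis_facts:
  assumes "is_basis H B"
  shows "V.independent B" "V.span B = UNIV"
  using assms by (simp_all add: is_basis_def)

lemma dual_vec_lin: assumes "is_basis H B" shows "lin (*) (dual_vec H B b)"
  using basis_facts[OF assms] by (simp add: lin_def dual_vec_def V.representation_add V.representation_scale)

lemma finite_dual_vec: "finite {b. dual_vec H B b h \<noteq> 0}"
  by (simp add: dual_vec_def V.finite_representation)

lemma dual_vec_nonzero: "dual_vec H B b h \<noteq> 0 \<Longrightarrow> b \<in> B"
  by (simp add: dual_vec_def V.representation_ne_zero)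

lemma basis_expansion:
  assumes "is_basis H B" "finite F" "{b. dual_vec H B b h \<noteq> 0} \<subseteq> F"
  shows "(\<Sum>b\<in>F. scal H (dual_vec H B b h) b) = h"
proof -
  have "(\<Sum>b\<in>F. scal H (dual_vec H B b h) b) = (\<Sum>b | dual_vec H B b h \<noteq> 0. scal H (dual_vec H B b h) b)"
    using assms by (intro sum.mono_neutral_right) auto
  then show ?thesis
    using V.sum_nonzero_representation_eq[of B h] basis_facts[OF assms(1)] by (simp add: dual_vec_def)
qed

text \<open>The map \<open>id \<otimes> x\<close> from \<open>H \<otimes> H\<close> to \<open>H\<close>.\<close>

definition contract :: "('h \<Rightarrow> 'k) \<Rightarrow> 'h tensor \<Rightarrow> 'h" where
  "contract x = frag_lift type_ring (\<lambda>xs. scal H (x (xs ! 1)) (xs ! 0))"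

lemma bilin_contract: "lin (*) x \<Longrightarrow> bilin (scal H) (\<lambda>a b. scal H (x b) a)"
  by (auto intro!: bilinI simp: lin_def V.scale_left_distrib V.scale_right_distrib mult.commute)

lemma contract_additive: "lin (*) x \<Longrightarrow> additive_map (tpow H 2) type_ring (contract x)"
  unfolding contract_def
  by (rule tensor_lift_additive[OF abelian_group_type_ring bilin_multilinear[OF bilin_contract]])

lemma contract_pure: "lin (*) x \<Longrightarrow> contract x (pure H [a, b]) = scal H (x b) a"
  using tensor_lift_pure[OF abelian_group_type_ring bilin_multilinear[OF bilin_contract, of x], of "[a, b]"]
  by (simp add: contract_def)

lemma pure_zero_left: "pure H [0, b] = \<zero>\<^bsub>tpow H 2\<^esub>"
  using additive_zero[OF abelian_group_type_ring tpow_abelian_group pure_pair_additive(1)[of b]] by simp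

lemma length2: "length xs = 2 \<Longrightarrow> xs = [xs ! 0, xs ! 1]"
  by (cases xs; cases "tl xs") auto

text \<open>
  The expansion holds for all large finite sets of basis elements. This uniformity makes it stable
  under differences, so that the pure tensors suffice.
\<close>

lemma tensor_expansion:
  assumes B: "is_basis H B" and t: "t \<in> carrier (tpow H 2)"
  shows "\<exists>F0. finite F0 \<and> F0 \<subseteq> B \<and> (\<forall>F. finite F \<longrightarrow> F0 \<subseteq> F \<longrightarrow> F \<subseteq> B \<longrightarrow>
    t = (\<Oplus>\<^bsub>tpow H 2\<^esub>b\<in>F. pure H [contract (dual_vec H B b) t, b]))"
proof -
  interpret T: abelian_group "tpow H 2" by (rule tpow_abelian_group)
  define E where "E F t = (\<Oplus>\<^bsub>tpow H 2\<^esub>b\<in>F. pure H [contract (dual_vec H B b) t, b])" for F t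
  have addE: "additive_map (tpow H 2) (tpow H 2) (E F)" for F
    unfolding E_def
    by (rule additive_map_finsum[OF tpow_abelian_group])
      (rule additive_comp[OF contract_additive[OF dual_vec_lin[OF B]] pure_pair_additive(1)])
  have "\<exists>F0. finite F0 \<and> F0 \<subseteq> B \<and> (\<forall>F. finite F \<longrightarrow> F0 \<subseteq> F \<longrightarrow> F \<subseteq> B \<longrightarrow> t = E F t)"
    using t
  proof (induction t rule: tensor_induct)
    case zero
    show ?case
      using additive_zero[OF tpow_abelian_group tpow_abelian_group addE] by (intro exI[of _ "{}"]) auto
  next
    case (pure xs)
    define a h where "a = xs ! 0" and "h = xs ! 1"
    have xs: "xs = [a, h]" using length2[OF pure] by (simp add: a_def h_def)
    show ?case
    proof (intro exI conjI allI impI)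
      show "finite {b. dual_vec H B b h \<noteq> 0}" by (rule finite_dual_vec)
      show "{b. dual_vec H B b h \<noteq> 0} \<subseteq> B" using dual_vec_nonzero by auto
      fix F assume F: "finite F" "{b. dual_vec H B b h \<noteq> 0} \<subseteq> F"
      have "pure H [a, h] = pure H [a, \<Oplus>\<^bsub>type_ring\<^esub>b\<in>F. scal H (dual_vec H B b h) b]"
        using basis_expansion[OF B F] F(1) by (simp add: finsum_type_ring)
      also have "\<dots> = (\<Oplus>\<^bsub>tpow H 2\<^esub>b\<in>F. pure H [a, scal H (dual_vec H B b h) b])"
        by (rule additive_finsum[OF abelian_group_type_ring tpow_abelian_group pure_pair_additive(2)]) simp
      also have "\<dots> = E F (pure H [a, h])"
        by (simp add: E_def contract_pure[OF dual_vec_lin[OF B]] pure_pair_scal)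
      finally show "pure H xs = E F (pure H xs)" by (simp add: xs)
    qed
  next
    case (diff s t)
    obtain F1 where F1: "finite F1" "F1 \<subseteq> B" "\<forall>F. finite F \<longrightarrow> F1 \<subseteq> F \<longrightarrow> F \<subseteq> B \<longrightarrow> s = E F s"
      using diff(3) by (elim exE conjE)
    obtain F2 where F2: "finite F2" "F2 \<subseteq> B" "\<forall>F. finite F \<longrightarrow> F2 \<subseteq> F \<longrightarrow> F \<subseteq> B \<longrightarrow> t = E F t"
      using diff(4) by (elim exE conjE)
    show ?case
    proof (intro exI conjI allI impI)
      fix F assume F': "finite F" "F1 \<union> F2 \<subseteq> F" "F \<subseteq> B"
      have "E F (s \<ominus>\<^bsub>tpow H 2\<^esub> t) = E F s \<ominus>\<^bsub>tpow H 2\<^esub> E F t"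
        by (rule additive_minus[OF tpow_abelian_group tpow_abelian_group addE diff(1,2)])
      moreover have "s = E F s" using F1(3) F' by blast
      moreover have "t = E F t" using F2(3) F' by blast
      ultimately show "s \<ominus>\<^bsub>tpow H 2\<^esub> t = E F (s \<ominus>\<^bsub>tpow H 2\<^esub> t)" by simp
    qed (use F1 F2 in auto)
  qed
  then show ?thesis by (simp add: E_def)
qed

lemma finite_expansion:
  assumes B: "is_basis H B" and t: "t \<in> carrier (tpow H 2)"
  obtains F where "finite F" "t = (\<Oplus>\<^bsub>tpow H 2\<^esub>b\<in>F. pure H [contract (dual_vec H B b) t, b])"
proof -
  obtain F where F: "finite F" "F \<subseteq> B" "\<forall>F'. finite F' \<longrightarrow> F \<subseteq> F' \<longrightarrow> F' \<subseteq> B \<longrightarrow>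
    t = (\<Oplus>\<^bsub>tpow H 2\<^esub>b\<in>F'. pure H [contract (dual_vec H B b) t, b])"
    using tensor_expansion[OF assms] by (elim exE conjE)
  show ?thesis
    by (rule that[OF F(1)]) (rule F(3)[rule_format, OF F(1) subset_refl F(2)])
qed

definition hbasis :: "'h set" where "hbasis = V.extend_basis {}"

lemma is_basis_hbasis: "is_basis H hbasis"
  unfolding is_basis_def hbasis_def
  using V.independent_extend_basis[OF V.independent_empty] V.span_extend_basis[OF V.independent_empty] by blast

text \<open>The coefficients of the expansion are contractions, hence contractions determine a tensor.\<close>

lemma tensor_zeroI:
  assumes "t \<in> carrier (tpow H 2)" "\<And>x. lin (*) x \<Longrightarrow> contract x t = 0"
  shows "t = \<zero>\<^bsub>tpow H 2\<^esub>"
proof -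
  interpret T: abelian_group "tpow H 2" by (rule tpow_abelian_group)
  obtain F where F: "t = (\<Oplus>\<^bsub>tpow H 2\<^esub>b\<in>F. pure H [contract (dual_vec H hbasis b) t, b])"
    by (rule finite_expansion[OF is_basis_hbasis assms(1)])
  have "(\<Oplus>\<^bsub>tpow H 2\<^esub>b\<in>F. pure H [contract (dual_vec H hbasis b) t, b]) = \<zero>\<^bsub>tpow H 2\<^esub>"
    by (simp only: assms(2)[OF dual_vec_lin[OF is_basis_hbasis]] pure_zero_left T.finsum_zero)
  with F show ?thesis by (rule trans)
qed

lemma tensor_eqI:
  assumes "s \<in> carrier (tpow H 2)" "t \<in> carrier (tpow H 2)" "\<And>x. lin (*) x \<Longrightarrow> contract x s = contract x t"
  shows "s = t"
proof -
  interpret T: abelian_group "tpow H 2" by (rule tpow_abelian_group)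
  interpret Z: abelian_group "type_ring :: 'h ring" by (rule abelian_group_type_ring)
  have "s \<ominus>\<^bsub>tpow H 2\<^esub> t = \<zero>\<^bsub>tpow H 2\<^esub>"
  proof (rule tensor_zeroI)
    fix x :: "'h \<Rightarrow> 'k" assume x: "lin (*) x"
    have "contract x (s \<ominus>\<^bsub>tpow H 2\<^esub> t) = contract x s \<ominus>\<^bsub>type_ring\<^esub> contract x t"
      by (rule additive_minus[OF tpow_abelian_group abelian_group_type_ring contract_additive[OF x] assms(1,2)])
    also have "\<dots> = \<zero>\<^bsub>type_ring\<^esub>"
      unfolding assms(3)[OF x] by (simp only: a_minus_def) (rule Z.r_neg, simp)
    finally show "contract x (s \<ominus>\<^bsub>tpow H 2\<^esub> t) = 0" by simp
  qed (rule T.minus_closed[OF assms(1,2)])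
  then have "s \<oplus>\<^bsub>tpow H 2\<^esub> \<ominus>\<^bsub>tpow H 2\<^esub> t = \<zero>\<^bsub>tpow H 2\<^esub>" by (simp only: a_minus_def)
  then have "\<ominus>\<^bsub>tpow H 2\<^esub> (\<ominus>\<^bsub>tpow H 2\<^esub> t) = s"
    using T.a_inv_closed[OF assms(2)] assms(1) by (rule T.minus_equality)
  then show ?thesis unfolding T.minus_minus[OF assms(2)] by (rule sym)
qed

subsection \<open>Sums over the coproduct\<close>

text \<open>
  A fixed expansion \<open>\<Delta>(h) = \<Sum>c\<^sub>b \<otimes> b\<close> over finitely many \<open>b\<close>, with \<open>c\<^sub>b\<close> the value of \<open>colegs h\<close> at \<open>b\<close>. The sum
  \<open>sw \<phi> h\<close> formed from it is \<open>\<Sum>\<phi>(h\<^sub>1)(h\<^sub>2)\<close> in Sweedler notation; for bilinear \<open>\<phi>\<close> it depends on the coproduct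
  only, by \<open>sw_lift\<close>.
\<close>

definition cosupp :: "'h \<Rightarrow> 'h set" where
  "cosupp h = (SOME F. finite F \<and>
     comult H h = (\<Oplus>\<^bsub>tpow H 2\<^esub>b\<in>F. pure H [contract (dual_vec H hbasis b) (comult H h), b]))"

definition colegs :: "'h \<Rightarrow> 'h \<Rightarrow> 'h" where
  "colegs h b = contract (dual_vec H hbasis b) (comult H h)"

definition sw :: "('h \<Rightarrow> 'h \<Rightarrow> 'v::comm_monoid_add) \<Rightarrow> 'h \<Rightarrow> 'v" where
  "sw \<phi> h = (\<Sum>b\<in>cosupp h. \<phi> (colegs h b) b)"

lemma cosupp: "finite (cosupp h)" "comult H h = (\<Oplus>\<^bsub>tpow H 2\<^esub>b\<in>cosupp h. pure H [colegs h b, b])"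
proof -
  obtain F where "finite F"
    "comult H h = (\<Oplus>\<^bsub>tpow H 2\<^esub>b\<in>F. pure H [contract (dual_vec H hbasis b) (comult H h), b])"
    by (rule finite_expansion[OF is_basis_hbasis comult_closed])
  then have ex: "\<exists>F. finite F \<and> comult H h =
      (\<Oplus>\<^bsub>tpow H 2\<^esub>b\<in>F. pure H [contract (dual_vec H hbasis b) (comult H h), b])"
    by (intro exI conjI)
  have *: "finite (cosupp h) \<and> comult H h =
      (\<Oplus>\<^bsub>tpow H 2\<^esub>b\<in>cosupp h. pure H [contract (dual_vec H hbasis b) (comult H h), b])"
    unfolding cosupp_def using ex by (rule someI_ex)
  show "finite (cosupp h)" by (rule conjunct1[OF *])
  show "comult H h = (\<Oplus>\<^bsub>tpow H 2\<^esub>b\<in>cosupp h. pure H [colegs h b, b])"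
    unfolding colegs_def by (rule conjunct2[OF *])
qed

lemma additive_comult_expand:
  assumes "abelian_group G" "additive_map (tpow H 2) G f"
  shows "f (comult H h) = (\<Oplus>\<^bsub>G\<^esub>b\<in>cosupp h. f (pure H [colegs h b, b]))"
  by (subst cosupp(2)) (rule additive_finsum[OF tpow_abelian_group assms], simp add: pure_closed)

lemma sw_additive:
  fixes f :: "'h tensor \<Rightarrow> 'v::ring_1"
  assumes "additive_map (tpow H 2) type_ring f"
  shows "f (comult H h) = sw (\<lambda>a b. f (pure H [a, b])) h"
  using additive_comult_expand[OF abelian_group_type_ring assms, of h]
  by (simp add: finsum_type_ring[OF cosupp(1)] sw_def)

lemma sw_lift:
  fixes \<phi> :: "'h \<Rightarrow> 'h \<Rightarrow> 'v::ring_1"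
  assumes "bilin s \<phi>"
  shows "frag_lift type_ring (\<lambda>xs. \<phi> (xs ! 0) (xs ! 1)) (comult H h) = sw \<phi> h"
proof -
  note m = bilin_multilinear[OF assms]
  have 1: "frag_lift type_ring (\<lambda>xs. \<phi> (xs ! 0) (xs ! 1)) (pure H [a, b]) = \<phi> a b" for a b
    using tensor_lift_pure[OF abelian_group_type_ring m, of "[a, b]"] by simp
  show ?thesis
    by (simp only: sw_additive[OF tensor_lift_additive[OF abelian_group_type_ring m], of h] 1)
qed

lemma sw_comp: "F 0 = 0 \<Longrightarrow> (\<And>a b. F (a + b) = F a + F b) \<Longrightarrow> F (sw \<phi> h) = sw (\<lambda>a b. F (\<phi> a b)) h"
  using sum_comp_morphism[of F "\<lambda>b. \<phi> (colegs h b) b" "cosupp h"] by (simp add: sw_def o_def)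

abbreviation anti :: "'h \<Rightarrow> 'h" where "anti \<equiv> antipode H"
abbreviation eps :: "'h \<Rightarrow> 'k" where "eps \<equiv> counit H"

lemma sw_cong: "(\<And>a b. \<phi> a b = \<psi> a b) \<Longrightarrow> sw \<phi> h = sw \<psi> h"
  by (simp add: sw_def)

lemma sw_swap: "sw (\<lambda>a b. sw (\<lambda>c d. \<psi> a b c d) g) h = sw (\<lambda>c d. sw (\<lambda>a b. \<psi> a b c d) h) g"
  unfolding sw_def by (rule sum.swap)

lemma sw_plus: "sw (\<lambda>a b. \<phi> a b + \<psi> a b) h = sw \<phi> h + sw \<psi> h"
  by (simp add: sw_def sum.distrib)

lemma sw_sum: "sw (\<lambda>a b. \<Sum>i\<in>A. \<phi> i a b) h = (\<Sum>i\<in>A. sw (\<phi> i) h)"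
  unfolding sw_def by (rule sum.swap)

definition distributes :: "('k \<Rightarrow> 'v \<Rightarrow> 'v::ab_group_add) \<Rightarrow> bool" where
  "distributes s \<longleftrightarrow> (\<forall>c u v. s c (u + v) = s c u + s c v)"

lemma distributes_scal: "distributes (scal H)" and distributes_times: "distributes ((*) :: 'k \<Rightarrow> 'k \<Rightarrow> 'k)"
  by (simp_all add: distributes_def V.scale_right_distrib distrib_left)

lemma distributes_zero: "distributes s \<Longrightarrow> s c 0 = 0"
  unfolding distributes_def by (metis add_cancel_right_left)

lemma sw_scale_out: "distributes s \<Longrightarrow> sw (\<lambda>a b. s c (\<phi> a b)) h = s c (sw \<phi> h)"
  by (rule sw_comp[symmetric]) (simp_all add: distributes_zero distributes_def)

definition tlift :: "('h \<Rightarrow> 'h \<Rightarrow> 'v::ring_1) \<Rightarrow> 'h tensor \<Rightarrow> 'v" where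
  "tlift \<phi> = frag_lift type_ring (\<lambda>xs. \<phi> (xs ! 0) (xs ! 1))"

lemma tlift_additive: "bilin s \<phi> \<Longrightarrow> additive_map (tpow H 2) type_ring (tlift \<phi>)"
  unfolding tlift_def by (rule tensor_lift_additive[OF abelian_group_type_ring bilin_multilinear])

lemma tlift_pure: "bilin s \<phi> \<Longrightarrow> tlift \<phi> (pure H [a, b]) = \<phi> a b"
  using tensor_lift_pure[OF abelian_group_type_ring bilin_multilinear, of s \<phi> "[a, b]"]
  by (simp add: tlift_def)

lemma tlift_comult: "bilin s \<phi> \<Longrightarrow> tlift \<phi> (comult H h) = sw \<phi> h"
  unfolding tlift_def by (rule sw_lift)

lemma sw_add: "bilin s \<phi> \<Longrightarrow> sw \<phi> (f + g) = sw \<phi> f + sw (\<phi> :: 'h \<Rightarrow> 'h \<Rightarrow> 'v::ring_1) g"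
  using additive_add[OF tlift_additive[of s \<phi>] comult_closed comult_closed, of f g]
  by (simp add: tlift_comult flip: comult_add)

lemma tsmult_additive: "n \<ge> 1 \<Longrightarrow> additive_map (tpow H n) (tpow H n) (smult (tpow H n) c)"
  unfolding tsmult_eq by (rule tensor_lift_additive[OF tpow_abelian_group tsmult_pure_multilinear])

lemma tsmult_pure:
  "n \<ge> 1 \<Longrightarrow> length xs = n \<Longrightarrow> c \<odot>\<^bsub>tpow H n\<^esub> pure H xs = pure H (xs[0 := scal H c (xs ! 0)])"
  unfolding tsmult_eq
  by (rule tensor_lift_pure[where \<tau> = "\<lambda>xs. pure H (xs[0 := scal H c (xs ! 0)])",
        OF tpow_abelian_group tsmult_pure_multilinear])

lemma sw_scal:
  fixes \<phi> :: "'h \<Rightarrow> 'h \<Rightarrow> 'v::ring_1"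
  assumes "bilin s \<phi>" "distributes s" shows "sw \<phi> (scal H c h) = s c (sw \<phi> h)"
proof -
  have add: "additive_map (tpow H 2) type_ring (\<lambda>t. tlift \<phi> (c \<odot>\<^bsub>tpow H 2\<^esub> t))"
    by (rule additive_comp[OF tsmult_additive tlift_additive[OF assms(1)]]) simp
  have val: "tlift \<phi> (c \<odot>\<^bsub>tpow H 2\<^esub> pure H [a, b]) = s c (\<phi> a b)" for a b
    using assms(1) by (simp add: tsmult_pure tlift_pure[OF assms(1)] bilin_def lin_def)
  have "sw \<phi> (scal H c h) = tlift \<phi> (c \<odot>\<^bsub>tpow H 2\<^esub> comult H h)"
    by (simp only: comult_scal flip: tlift_comult[OF assms(1)])
  also have "\<dots> = sw (\<lambda>a b. s c (\<phi> a b)) h"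
    unfolding sw_additive[OF add] val ..
  finally show ?thesis by (simp add: sw_scale_out[OF assms(2)])
qed

text \<open>Rules that recognise a linear dependence on one variable of an expression.\<close>

lemma lin_id: "lin (scal H) (\<lambda>a. a)"
  by (simp add: lin_def)

lemma lin_mult_right: "lin (scal H) F \<Longrightarrow> lin (scal H) (\<lambda>a. F a * c)"
  by (simp add: lin_def distrib_right scal_mult_left)

lemma lin_mult_left: "lin (scal H) F \<Longrightarrow> lin (scal H) (\<lambda>a. c * F a)"
  by (simp add: lin_def distrib_left scal_mult_right)

lemma lin_comp: "lin s x \<Longrightarrow> lin (scal H) F \<Longrightarrow> lin s (\<lambda>a. x (F a))"
  by (simp add: lin_def)

lemmas lin_anti = lin_comp[OF lin_antipode]
lemmas lin_eps = lin_comp[OF lin_counit]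

lemma lin_scal_left: "lin (*) F \<Longrightarrow> lin (scal H) (\<lambda>a. scal H (F a) c)"
  by (simp add: lin_def V.scale_left_distrib)

lemma lin_scal_right: "lin (scal H) F \<Longrightarrow> lin (scal H) (\<lambda>a. scal H c (F a))"
  by (simp add: lin_def V.scale_right_distrib mult.commute)

lemma lin_times_left: "lin (*) F \<Longrightarrow> lin (*) (\<lambda>a. c * (F a :: 'k))"
  by (simp add: lin_def algebra_simps)

lemma lin_times_right: "lin (*) F \<Longrightarrow> lin (*) (\<lambda>a. (F a :: 'k) * c)"
  by (simp add: lin_def algebra_simps)

lemma lin_sw_inside:
  assumes "distributes s" "\<And>p q. lin s (\<lambda>a. \<phi> a p q)" shows "lin s (\<lambda>a. sw (\<phi> a) h)"
proof -
  have "sw (\<phi> (a + b)) h = sw (\<phi> a) h + sw (\<phi> b) h" for a b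
    using lin_add[OF assms(2)] by (simp add: sw_def sum.distrib)
  moreover have "sw (\<phi> (scal H c a)) h = s c (sw (\<phi> a) h)" for c a
    using lin_scal[OF assms(2)] by (simp add: sw_scale_out[OF assms(1), symmetric]) (simp add: sw_def)
  ultimately show ?thesis by (simp add: lin_def)
qed

lemma lin_sw_outside:
  fixes \<phi> :: "'h \<Rightarrow> 'h \<Rightarrow> 'v::ring_1"
  assumes "distributes s" "\<And>b. lin s (\<lambda>a. \<phi> a b)" "\<And>a. lin s (\<lambda>b. \<phi> a b)" "lin (scal H) F"
  shows "lin s (\<lambda>a. sw \<phi> (F a))"
proof -
  have "bilin s \<phi>" using assms by (intro bilinI)
  then show ?thesis
    using assms(4) by (simp add: lin_def sw_add sw_scal[OF _ assms(1)])
qed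

lemmas lin_sw_rules =
  lin_sw_inside[OF distributes_scal] lin_sw_inside[OF distributes_times]
  lin_sw_outside[OF distributes_scal] lin_sw_outside[OF distributes_times]

lemmas lin_intros = lin_id lin_mult_right lin_mult_left lin_anti lin_eps lin_scal_left lin_scal_right
  lin_times_left lin_times_right lin_sw_rules

lemma lin_comp_sw: "lin s F \<Longrightarrow> F (sw \<phi> h) = sw (\<lambda>a b. F (\<phi> a b) :: 'v::ab_group_add) h"
  by (rule sw_comp) (simp_all add: lin_zero lin_add)

subsection \<open>The axioms in Sweedler form\<close>

text \<open>Multiplicativity of the coproduct.\<close>

lemma sw_mult:
  fixes \<phi> :: "'h \<Rightarrow> 'h \<Rightarrow> 'v::ring_1"
  assumes "bilin s \<phi>"
  shows "sw \<phi> (f * g) = sw (\<lambda>a b. sw (\<lambda>c d. \<phi> (a * c) (b * d)) g) f"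
proof -
  let ?m = "mult (tpow H 2)"
  note L = tlift_additive[OF assms]
  have 1: "additive_map (tpow H 2) type_ring (\<lambda>t. tlift \<phi> (?m t (comult H g)))"
    by (rule additive_comp[OF biadditiveD(2)[OF tmult_biadditive comult_closed] L])
  have 2: "additive_map (tpow H 2) type_ring (\<lambda>t. tlift \<phi> (?m (pure H [a, b]) t))" for a b
    by (rule additive_comp[OF biadditiveD(1)[OF tmult_biadditive] L]) (simp add: pure_closed)
  have "sw \<phi> (f * g) = tlift \<phi> (?m (comult H f) (comult H g))"
    by (simp only: comult_mult flip: tlift_comult[OF assms])
  also have "\<dots> = sw (\<lambda>a b. tlift \<phi> (?m (pure H [a, b]) (comult H g))) f"
    by (rule sw_additive[OF 1])
  also have "\<dots> = sw (\<lambda>a b. sw (\<lambda>c d. tlift \<phi> (?m (pure H [a, b]) (pure H [c, d]))) g) f"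
    by (intro sw_cong sw_additive 2)
  also have "\<dots> = sw (\<lambda>a b. sw (\<lambda>c d. \<phi> (a * c) (b * d)) g) f"
    by (simp add: tmult_pure tlift_pure[OF assms])
  finally show ?thesis .
qed

lemma comult_one_pure: "comult H 1 = pure H [1, 1]"
  by (simp add: comult_one tpow_def numeral_2_eq_2)

lemma sw_one: "bilin s \<phi> \<Longrightarrow> sw \<phi> 1 = (\<phi> 1 1 :: 'v::ring_1)"
  using tlift_comult[of s \<phi> 1] by (simp add: comult_one_pure tlift_pure)

lemma multilinear_append:
  shows "length ys = m \<Longrightarrow> multilinear H n (tpow H (n + m)) (\<lambda>xs. pure H (xs @ ys))"
    and "length xs = n \<Longrightarrow> multilinear H m (tpow H (n + m)) (\<lambda>ys. pure H (xs @ ys))"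
proof -
  note p = multilinearD[OF pure_multilinear[of H "n + m"]]
  show "multilinear H n (tpow H (n + m)) (\<lambda>xs. pure H (xs @ ys))" if ys: "length ys = m" for ys
  proof (rule multilinearI)
    fix xs :: "'h list" assume xs: "length xs = n"
    have l: "length (xs @ ys) = n + m" using xs ys by simp
    have u: "xs[i := u] @ ys = (xs @ ys)[i := u]" if "i < n" for i u
      using that xs by (simp add: list_update_append)
    have g: "xs ! i = (xs @ ys) ! i" if "i < n" for i
      using that xs by (simp add: nth_append)
    show "pure H (xs @ ys) \<in> carrier (tpow H (n + m))" by (rule p(1)[OF l])
    fix i assume i: "i < n"
    show "pure H (xs[i := a + b] @ ys) = pure H (xs[i := a] @ ys) \<oplus>\<^bsub>tpow H (n + m)\<^esub> pure H (xs[i := b] @ ys)" for a b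
      unfolding u[OF i] by (rule p(2)[OF l]) (use i in simp)
    show "pure H (xs[i := scal H c (xs ! i)] @ ys) = pure H (xs[j := scal H c (xs ! j)] @ ys)" if j: "j < n" for c j
      unfolding u[OF i] u[OF j] g[OF i] g[OF j] by (rule p(3)[OF l]) (use i j in simp_all)
  qed
  show "multilinear H m (tpow H (n + m)) (\<lambda>ys. pure H (xs @ ys))" if xs: "length xs = n" for xs
  proof (rule multilinearI)
    fix ys :: "'h list" assume ys: "length ys = m"
    have l: "length (xs @ ys) = n + m" using xs ys by simp
    have u: "xs @ ys[i := u] = (xs @ ys)[n + i := u]" if "i < m" for i u
      using that xs by (simp add: list_update_append)
    have g: "ys ! i = (xs @ ys) ! (n + i)" if "i < m" for i
      using that xs by (simp add: nth_append)
    show "pure H (xs @ ys) \<in> carrier (tpow H (n + m))" by (rule p(1)[OF l])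
    fix i assume i: "i < m"
    show "pure H (xs @ ys[i := a + b]) = pure H (xs @ ys[i := a]) \<oplus>\<^bsub>tpow H (n + m)\<^esub> pure H (xs @ ys[i := b])" for a b
      unfolding u[OF i] by (rule p(2)[OF l]) (use i in simp)
    show "pure H (xs @ ys[i := scal H c (ys ! i)]) = pure H (xs @ ys[j := scal H c (ys ! j)])" if j: "j < m" for c j
      unfolding u[OF i] u[OF j] g[OF i] g[OF j] by (rule p(3)[OF l]) (use i j in simp_all)
  qed
qed

lemma tcat_biadditive: "biadditive (tpow H m) (tpow H n) (tpow H (m + n)) (tcat H m n)"
  unfolding tcat_def[abs_def]
  by (rule tensor_lift2_biadditive[OF tpow_abelian_group]) (simp_all only: multilinear_append)

lemma tcat_pure:
  "length xs = m \<Longrightarrow> length ys = n \<Longrightarrow> tcat H m n (pure H xs) (pure H ys) = pure H (xs @ ys)"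
  unfolding tcat_def
  by (rule tensor_lift2_pure[where \<tau> = "\<lambda>xs ys. pure H (xs @ ys)", OF tpow_abelian_group])
    (simp_all only: multilinear_append)

lemma tcat_21_biadditive: "biadditive (tpow H 2) (tpow H 1) (tpow H 3) (tcat H 2 1)"
  and tcat_12_biadditive: "biadditive (tpow H 1) (tpow H 2) (tpow H 3) (tcat H 1 2)"
  using tcat_biadditive[of 2 1] tcat_biadditive[of 1 2] by (simp_all add: numeral_3_eq_3)

lemma pure_single_additive: "additive_map type_ring (tpow H 1) (\<lambda>a. pure H [a])"
  using multilinearD(2)[OF pure_multilinear[of H 1], of "[a]" 0 for a]
  by (auto intro!: additiveI pure_closed)

lemma tcat_scal:
  assumes t: "t \<in> carrier (tpow H 2)"
  shows "tcat H 2 1 (c \<odot>\<^bsub>tpow H 2\<^esub> t) (pure H [b]) = tcat H 2 1 t (pure H [scal H c b])"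
    and "tcat H 1 2 (pure H [b]) (c \<odot>\<^bsub>tpow H 2\<^esub> t) = tcat H 1 2 (pure H [scal H c b]) t"
proof -
  have p1: "pure H [b] \<in> carrier (tpow H 1)" for b by (simp add: pure_closed)
  note p3 = multilinearD(3)[OF pure_multilinear[of H 3]]
  show "tcat H 2 1 (c \<odot>\<^bsub>tpow H 2\<^esub> t) (pure H [b]) = tcat H 2 1 t (pure H [scal H c b])"
  proof (rule tensor_eq_on_pure[OF tpow_abelian_group _ _ _ t])
    show "additive_map (tpow H 2) (tpow H 3) (\<lambda>t. tcat H 2 1 (c \<odot>\<^bsub>tpow H 2\<^esub> t) (pure H [b]))"
      by (rule additive_comp[OF tsmult_additive biadditiveD(2)[OF tcat_21_biadditive p1]]) simp
    show "additive_map (tpow H 2) (tpow H 3) (\<lambda>t. tcat H 2 1 t (pure H [scal H c b]))"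
      by (rule biadditiveD(2)[OF tcat_21_biadditive p1])
    fix xs :: "'h list" assume xs: "length xs = 2"
    show "tcat H 2 1 (c \<odot>\<^bsub>tpow H 2\<^esub> pure H xs) (pure H [b]) = tcat H 2 1 (pure H xs) (pure H [scal H c b])"
    proof -
      have "tcat H 2 1 (c \<odot>\<^bsub>tpow H 2\<^esub> pure H [x, y]) (pure H [b]) = tcat H 2 1 (pure H [x, y]) (pure H [scal H c b])" for x y
        using p3[of "[x, y, b]" 0 2 c] by (simp add: tsmult_pure tcat_pure)
      then show ?thesis by (subst (1 2) length2[OF xs])
    qed
  qed
  show "tcat H 1 2 (pure H [b]) (c \<odot>\<^bsub>tpow H 2\<^esub> t) = tcat H 1 2 (pure H [scal H c b]) t"
  proof (rule tensor_eq_on_pure[OF tpow_abelian_group _ _ _ t])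
    show "additive_map (tpow H 2) (tpow H 3) (\<lambda>t. tcat H 1 2 (pure H [b]) (c \<odot>\<^bsub>tpow H 2\<^esub> t))"
      by (rule additive_comp[OF tsmult_additive biadditiveD(1)[OF tcat_12_biadditive p1]]) simp
    show "additive_map (tpow H 2) (tpow H 3) (\<lambda>t. tcat H 1 2 (pure H [scal H c b]) t)"
      by (rule biadditiveD(1)[OF tcat_12_biadditive p1])
    fix xs :: "'h list" assume xs: "length xs = 2"
    show "tcat H 1 2 (pure H [b]) (c \<odot>\<^bsub>tpow H 2\<^esub> pure H xs) = tcat H 1 2 (pure H [scal H c b]) (pure H xs)"
    proof -
      have "tcat H 1 2 (pure H [b]) (c \<odot>\<^bsub>tpow H 2\<^esub> pure H [x, y]) = tcat H 1 2 (pure H [scal H c b]) (pure H [x, y])" for x y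
        using p3[of "[b, x, y]" 0 1 c] by (simp add: tsmult_pure tcat_pure)
      then show ?thesis by (subst (1 2) length2[OF xs])
    qed
  qed
qed

lemma
  shows comult_id_additive: "additive_map (tpow H 2) (tpow H 3) (comult_id H)"
    and comult_id_pure: "comult_id H (pure H [a, b]) = tcat H 2 1 (comult H a) (pure H [b])"
    and id_comult_additive: "additive_map (tpow H 2) (tpow H 3) (id_comult H)"
    and id_comult_pure: "id_comult H (pure H [a, b]) = tcat H 1 2 (pure H [a]) (comult H b)"
proof -
  have p1: "pure H [b] \<in> carrier (tpow H 1)" for b by (simp add: pure_closed)
  note B1 = tcat_21_biadditive and B2 = tcat_12_biadditive
  have m1: "multilinear H 2 (tpow H 3) (\<lambda>xs. tcat H 2 1 (comult H (xs ! 0)) (pure H [xs ! 1]))"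
  proof (rule multilinear_2I)
    show "tcat H 2 1 (comult H a) (pure H [b]) \<in> carrier (tpow H 3)" for a b
      by (rule biadditiveD(3)[OF B1 comult_closed p1])
    show "tcat H 2 1 (comult H (u + v)) (pure H [b]) =
      tcat H 2 1 (comult H u) (pure H [b]) \<oplus>\<^bsub>tpow H 3\<^esub> tcat H 2 1 (comult H v) (pure H [b])" for u v b
      unfolding comult_add by (rule additive_add[OF biadditiveD(2)[OF B1 p1] comult_closed comult_closed])
    show "tcat H 2 1 (comult H a) (pure H [u + v]) =
      tcat H 2 1 (comult H a) (pure H [u]) \<oplus>\<^bsub>tpow H 3\<^esub> tcat H 2 1 (comult H a) (pure H [v])" for u v a
      using additive_add[OF additive_comp[OF pure_single_additive biadditiveD(1)[OF B1 comult_closed]], of u v] by simp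
    show "tcat H 2 1 (comult H (scal H c a)) (pure H [b]) = tcat H 2 1 (comult H a) (pure H [scal H c b])" for a b c
      unfolding comult_scal by (rule tcat_scal(1)[OF comult_closed])
  qed
  have m2: "multilinear H 2 (tpow H 3) (\<lambda>xs. tcat H 1 2 (pure H [xs ! 0]) (comult H (xs ! 1)))"
  proof (rule multilinear_2I)
    show "tcat H 1 2 (pure H [a]) (comult H b) \<in> carrier (tpow H 3)" for a b
      by (rule biadditiveD(3)[OF B2 p1 comult_closed])
    show "tcat H 1 2 (pure H [a]) (comult H (u + v)) =
      tcat H 1 2 (pure H [a]) (comult H u) \<oplus>\<^bsub>tpow H 3\<^esub> tcat H 1 2 (pure H [a]) (comult H v)" for u v a
      unfolding comult_add by (rule additive_add[OF biadditiveD(1)[OF B2 p1] comult_closed comult_closed])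
    show "tcat H 1 2 (pure H [u + v]) (comult H a) =
      tcat H 1 2 (pure H [u]) (comult H a) \<oplus>\<^bsub>tpow H 3\<^esub> tcat H 1 2 (pure H [v]) (comult H a)" for u v a
      using additive_add[OF additive_comp[OF pure_single_additive biadditiveD(2)[OF B2 comult_closed]], of u v] by simp
    show "tcat H 1 2 (pure H [scal H c a]) (comult H b) = tcat H 1 2 (pure H [a]) (comult H (scal H c b))" for a b c
      unfolding comult_scal by (rule tcat_scal(2)[OF comult_closed, symmetric])
  qed
  show "additive_map (tpow H 2) (tpow H 3) (comult_id H)" "additive_map (tpow H 2) (tpow H 3) (id_comult H)"
    unfolding comult_id_def[abs_def] id_comult_def[abs_def]
    by (rule tensor_lift_additive[OF tpow_abelian_group m1], rule tensor_lift_additive[OF tpow_abelian_group m2])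
  show "comult_id H (pure H [a, b]) = tcat H 2 1 (comult H a) (pure H [b])"
    using tensor_lift_pure[OF tpow_abelian_group m1, of "[a, b]"] by (simp add: comult_id_def)
  show "id_comult H (pure H [a, b]) = tcat H 1 2 (pure H [a]) (comult H b)"
    using tensor_lift_pure[OF tpow_abelian_group m2, of "[a, b]"] by (simp add: id_comult_def)
qed

text \<open>
  Both sides are \<open>\<Sum>\<tau>(h\<^sub>1)(h\<^sub>2)(h\<^sub>3)\<close>, computed from the two iterated coproducts by the lift of \<open>\<tau>\<close> to the third
  tensor power.
\<close>

lemma sw_coassoc:
  fixes \<tau> :: "'h \<Rightarrow> 'h \<Rightarrow> 'h \<Rightarrow> 'v::ring_1"
  assumes "\<And>b c. lin s (\<lambda>a. \<tau> a b c)" "\<And>a c. lin s (\<lambda>b. \<tau> a b c)" "\<And>a b. lin s (\<lambda>c. \<tau> a b c)"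
  shows "sw (\<lambda>a b. sw (\<lambda>c d. \<tau> c d b) a) h = sw (\<lambda>a b. sw (\<lambda>c d. \<tau> a c d) b) h"
proof -
  have p1: "pure H [b] \<in> carrier (tpow H 1)" for b by (simp add: pure_closed)
  have m: "multilinear H 3 type_ring (\<lambda>xs. \<tau> (xs ! 0) (xs ! 1) (xs ! 2))"
  proof (rule multilinearI)
    fix xs :: "'h list" and i assume xs: "length xs = 3" and i: "i < (3::nat)"
    then have i01: "i = 0 \<or> i = 1 \<or> i = 2" by auto
    show "\<tau> (xs[i := u + v] ! 0) (xs[i := u + v] ! 1) (xs[i := u + v] ! 2) =
      \<tau> (xs[i := u] ! 0) (xs[i := u] ! 1) (xs[i := u] ! 2) \<oplus>\<^bsub>type_ring\<^esub> \<tau> (xs[i := v] ! 0) (xs[i := v] ! 1) (xs[i := v] ! 2)" for u v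
      using i01 xs by (elim disjE) (simp_all add: lin_add[OF assms(1)] lin_add[OF assms(2)] lin_add[OF assms(3)])
    have *: "\<tau> (xs[i := scal H c (xs ! i)] ! 0) (xs[i := scal H c (xs ! i)] ! 1) (xs[i := scal H c (xs ! i)] ! 2) =
      s c (\<tau> (xs ! 0) (xs ! 1) (xs ! 2))" if "i = 0 \<or> i = 1 \<or> i = 2" for i c
      using that xs by (elim disjE) (simp_all add: lin_scal[OF assms(1)] lin_scal[OF assms(2)] lin_scal[OF assms(3)])
    fix j c assume "j < (3::nat)"
    then have "j = 0 \<or> j = 1 \<or> j = 2" by auto
    then show "\<tau> (xs[i := scal H c (xs ! i)] ! 0) (xs[i := scal H c (xs ! i)] ! 1) (xs[i := scal H c (xs ! i)] ! 2) =
      \<tau> (xs[j := scal H c (xs ! j)] ! 0) (xs[j := scal H c (xs ! j)] ! 1) (xs[j := scal H c (xs ! j)] ! 2)"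
      by (simp only: * i01)
  qed simp
  define L where "L = frag_lift type_ring (\<lambda>xs. \<tau> (xs ! 0) (xs ! 1) (xs ! 2))"
  have L: "additive_map (tpow H 3) type_ring L"
    unfolding L_def by (rule tensor_lift_additive[OF abelian_group_type_ring m])
  have Lp: "L (pure H [a, b, c]) = \<tau> a b c" for a b c
    using tensor_lift_pure[OF abelian_group_type_ring m, of "[a, b, c]"] by (simp add: L_def)
  have "sw (\<lambda>a b. sw (\<lambda>c d. \<tau> c d b) a) h = sw (\<lambda>a b. sw (\<lambda>c d. L (tcat H 2 1 (pure H [c, d]) (pure H [b]))) a) h"
    by (simp add: tcat_pure Lp)
  also have "\<dots> = sw (\<lambda>a b. L (tcat H 2 1 (comult H a) (pure H [b]))) h"
    by (intro sw_cong sw_additive[symmetric] additive_comp[OF biadditiveD(2)[OF tcat_21_biadditive] L] p1)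
  also have "\<dots> = sw (\<lambda>a b. L (comult_id H (pure H [a, b]))) h"
    by (simp only: comult_id_pure)
  also have "\<dots> = L (comult_id H (comult H h))"
    by (rule sw_additive[symmetric]) (rule additive_comp[OF comult_id_additive L])
  also have "\<dots> = L (id_comult H (comult H h))" by (simp only: coassoc)
  also have "\<dots> = sw (\<lambda>a b. L (id_comult H (pure H [a, b]))) h"
    by (rule sw_additive) (rule additive_comp[OF id_comult_additive L])
  also have "\<dots> = sw (\<lambda>a b. L (tcat H 1 2 (pure H [a]) (comult H b))) h"
    by (simp only: id_comult_pure)
  also have "\<dots> = sw (\<lambda>a b. sw (\<lambda>c d. L (tcat H 1 2 (pure H [a]) (pure H [c, d]))) b) h"
    by (intro sw_cong sw_additive additive_comp[OF biadditiveD(1)[OF tcat_12_biadditive] L] p1)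
  also have "\<dots> = sw (\<lambda>a b. sw (\<lambda>c d. \<tau> a c d) b) h"
    by (simp add: tcat_pure Lp)
  finally show ?thesis .
qed

lemma sw_counit_left: "lin s F \<Longrightarrow> sw (\<lambda>a b. s (eps a) (F b)) h = (F h :: 'v::ring_1)"
  and sw_counit_right: "lin s F \<Longrightarrow> sw (\<lambda>a b. s (eps b) (F a)) h = F h"
proof -
  have "bilin (scal H) (\<lambda>a b. scal H (eps a) b)" by (intro bilinI lin_intros)
  then have "sw (\<lambda>a b. scal H (eps a) b) h = h" by (rule trans[OF sw_lift[symmetric] counit_left])
  moreover have "bilin (scal H) (\<lambda>a b. scal H (eps b) a)" by (intro bilinI lin_intros)
  then have "sw (\<lambda>a b. scal H (eps b) a) h = h" by (rule trans[OF sw_lift[symmetric] counit_right])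
  moreover assume F: "lin s F"
  ultimately show "sw (\<lambda>a b. s (eps a) (F b)) h = F h" "sw (\<lambda>a b. s (eps b) (F a)) h = F h"
    by (simp_all only: lin_comp_sw[OF F, symmetric] lin_scal[OF F, symmetric])
qed

lemma sw_anti_left: "lin s F \<Longrightarrow> sw (\<lambda>a b. F (anti a * b)) h = (s (eps h) (F 1) :: 'v::ring_1)"
  and sw_anti_right: "lin s F \<Longrightarrow> sw (\<lambda>a b. F (a * anti b)) h = s (eps h) (F 1)"
proof -
  have "bilin (scal H) (\<lambda>a b. anti a * b)" by (intro bilinI lin_intros)
  then have "sw (\<lambda>a b. anti a * b) h = scal H (eps h) 1" by (rule trans[OF sw_lift[symmetric] antipode_left])
  moreover have "bilin (scal H) (\<lambda>a b. a * anti b)" by (intro bilinI lin_intros)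
  then have "sw (\<lambda>a b. a * anti b) h = scal H (eps h) 1" by (rule trans[OF sw_lift[symmetric] antipode_right])
  moreover assume F: "lin s F"
  ultimately show "sw (\<lambda>a b. F (anti a * b)) h = s (eps h) (F 1)" "sw (\<lambda>a b. F (a * anti b)) h = s (eps h) (F 1)"
    by (simp_all add: lin_scal[OF F] flip: lin_comp_sw[OF F])
qed

subsection \<open>The antipode\<close>

lemma anti_one: "anti 1 = 1"
  using sw_anti_left[OF lin_id, of 1] by (subst (asm) sw_one[where s = "scal H"]) (intro bilinI lin_intros, simp add: counit_one)

text \<open>
  Both sides are values of the sum \<open>T = \<Sum>S(g\<^sub>1) S(f\<^sub>1) f\<^sub>2 g\<^sub>2 S(f\<^sub>3 g\<^sub>3)\<close>: either the product of the last three
  factors collapses to the counit, or first \<open>S(f\<^sub>1) f\<^sub>2\<close> and then \<open>S(g\<^sub>1) g\<^sub>2\<close> do.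
\<close>

lemma anti_mult: "anti (f * g) = anti g * anti f"
proof -
  define T where "T = sw (\<lambda>a b. sw (\<lambda>c d. anti c * anti a * sw (\<lambda>x y. x * anti y) (b * d)) g) f"
  have "sw (\<lambda>x y. x * anti y) (b * d) = scal H (eps (b * d)) 1" for b d
    using sw_anti_right[OF lin_id] by simp
  then have "T = sw (\<lambda>a b. sw (\<lambda>c d. scal H (eps d) (scal H (eps b) (anti c * anti a))) g) f"
    by (simp add: T_def counit_mult mult.commute flip: scal_mult_right)
  also have "\<dots> = sw (\<lambda>a b. scal H (eps b) (anti g * anti a)) f"
    by (intro sw_cong sw_counit_right lin_intros)
  also have "\<dots> = anti g * anti f"
    by (rule sw_counit_right) (intro lin_intros)
  finally have 1: "T = anti g * anti f" .
  have "T = sw (\<lambda>a b. sw (\<lambda>c d. sw (\<lambda>b1 b2. sw (\<lambda>d1 d2.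
      anti c * (anti a * b1) * (d1 * anti (b2 * d2))) d) b) g) f"
    unfolding T_def
    by (intro sw_cong, subst sw_mult[where s = "scal H"], intro bilinI lin_intros)
      (simp add: lin_comp_sw[OF lin_mult_left[OF lin_id]] mult.assoc)
  also have "\<dots> = sw (\<lambda>a b. sw (\<lambda>b1 b2. sw (\<lambda>c d. sw (\<lambda>d1 d2.
      anti c * (anti a * b1) * (d1 * anti (b2 * d2))) d) g) b) f"
    by (rule sw_cong, rule sw_swap)
  also have "\<dots> = sw (\<lambda>a b2. sw (\<lambda>a b1. sw (\<lambda>c d. sw (\<lambda>d1 d2.
      anti c * (anti a * b1) * (d1 * anti (b2 * d2))) d) g) a) f"
    by (rule sw_coassoc[symmetric, where s = "scal H"]; intro lin_intros)
  also have "\<dots> = sw (\<lambda>a b2. scal H (eps a) (sw (\<lambda>c d. sw (\<lambda>d1 d2.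
      anti c * 1 * (d1 * anti (b2 * d2))) d) g)) f"
    by (intro sw_cong sw_anti_left[where F = "\<lambda>z. sw (\<lambda>c d. sw (\<lambda>d1 d2. anti c * z * (d1 * anti (b * d2))) d) g" for b] lin_intros)
  also have "\<dots> = sw (\<lambda>c d. sw (\<lambda>d1 d2. anti c * 1 * (d1 * anti (f * d2))) d) g"
    by (rule sw_counit_left) (intro lin_intros)
  also have "\<dots> = sw (\<lambda>c d2. sw (\<lambda>c d1. anti c * 1 * (d1 * anti (f * d2))) c) g"
    by (rule sw_coassoc[symmetric, where s = "scal H"]; intro lin_intros)
  also have "\<dots> = sw (\<lambda>c d2. sw (\<lambda>c d1. (anti c * d1) * anti (f * d2)) c) g"
    by (simp add: mult.assoc)
  also have "\<dots> = sw (\<lambda>c d2. scal H (eps c) (1 * anti (f * d2))) g"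
    by (intro sw_cong sw_anti_left[where F = "\<lambda>z. z * anti (f * d)" for d] lin_intros)
  also have "\<dots> = 1 * anti (f * g)"
    by (rule sw_counit_left) (intro lin_intros)
  finally show ?thesis using 1 by simp
qed

end

locale cocommutative_hopf_algebra = hopf_algebra H for H :: "('k::field, 'h::ring_1) hopf" +
  assumes cocomm: "cocommutative H"
begin

lemma sw_cocomm:
  fixes \<phi> :: "'h \<Rightarrow> 'h \<Rightarrow> 'v::ring_1"
  assumes "bilin s \<phi>" shows "sw (\<lambda>a b. \<phi> b a) h = sw \<phi> h"
proof -
  have m: "multilinear H 2 (tpow H 2) (\<lambda>xs. pure H [xs ! 1, xs ! 0])"
    by (rule multilinear_2I[where \<phi> = "\<lambda>a b. pure H [b, a]"])
      (use additive_add[OF pure_pair_additive(1)] additive_add[OF pure_pair_additive(2)] in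
        \<open>simp_all add: pure_closed pure_pair_scal\<close>)
  have d: "xs ! 1 # xs ! 0 # drop 2 xs = [xs ! 1, xs ! 0]" if "length xs = 2" for xs :: "'h list"
    using that by simp
  have fl: "tflip H 2 t = frag_lift (tpow H 2) (\<lambda>xs. pure H [xs ! 1, xs ! 0]) t" if "t \<in> carrier (tpow H 2)" for t
    unfolding tflip_def
    by (rule frag_lift_cong[OF tpow_presented tpow_abelian_group _ that]) (simp_all add: pure_closed)
  have "sw \<phi> h = tlift \<phi> (frag_lift (tpow H 2) (\<lambda>xs. pure H [xs ! 1, xs ! 0]) (comult H h))"
    using cocomm by (simp only: fl[OF comult_closed, symmetric] cocommutative_def tlift_comult[OF assms])
  also have "\<dots> = sw (\<lambda>a b. tlift \<phi> (frag_lift (tpow H 2) (\<lambda>xs. pure H [xs ! 1, xs ! 0]) (pure H [a, b]))) h"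
    by (rule sw_additive) (rule additive_comp[OF tensor_lift_additive[OF tpow_abelian_group m] tlift_additive[OF assms]])
  also have "\<dots> = sw (\<lambda>a b. \<phi> b a) h"
    using tensor_lift_pure[OF tpow_abelian_group m, of "[a, b]" for a b] by (simp add: tlift_pure[OF assms])
  finally show ?thesis by simp
qed

text \<open>
  The sum \<open>\<Sum>S(S(h\<^sub>1)) S(h\<^sub>2) h\<^sub>3\<close> is \<open>S(S(h))\<close> by the antipode axiom for the last two factors. The first two are
  \<open>S(h\<^sub>2 S(h\<^sub>1))\<close>, and cocommutativity makes the antipode axiom apply to them as well, which leaves \<open>h\<close>.
\<close>

lemma anti_anti: "anti (anti h) = h"
proof -
  have "anti (anti h) = sw (\<lambda>a b. scal H (eps b) (anti (anti a))) h"
    by (rule sw_counit_right[symmetric]) (intro lin_intros)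
  also have "\<dots> = sw (\<lambda>a b. sw (\<lambda>c d. anti (anti a) * (anti c * d)) b) h"
    using sw_anti_left[OF lin_mult_left[OF lin_id], of "anti (anti a)" for a] by simp
  also have "\<dots> = sw (\<lambda>a b. sw (\<lambda>c d. anti (anti c) * (anti d * b)) a) h"
    by (rule sw_coassoc[symmetric, where s = "scal H"]; intro lin_intros)
  also have "\<dots> = sw (\<lambda>a b. sw (\<lambda>c d. anti (d * anti c) * b) a) h"
    by (simp add: anti_mult mult.assoc)
  also have "\<dots> = sw (\<lambda>a b. sw (\<lambda>c d. anti (c * anti d) * b) a) h"
    by (intro sw_cong sw_cocomm[where s = "scal H" and \<phi> = "\<lambda>c d. anti (c * anti d) * b" for b] bilinI lin_intros)
  also have "\<dots> = sw (\<lambda>a b. scal H (eps a) (anti 1 * b)) h"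
    by (intro sw_cong sw_anti_right[where F = "\<lambda>z. anti z * b" for b] lin_intros)
  also have "\<dots> = anti 1 * h"
    by (rule sw_counit_left) (intro lin_intros)
  finally show ?thesis by (simp add: anti_one)
qed

text \<open>
  Both sides are reassociated so that the two middle factors are the legs of one coproduct, which
  cocommutativity exchanges.
\<close>

lemma sw_middle_four:
  fixes \<tau> :: "'h \<Rightarrow> 'h \<Rightarrow> 'h \<Rightarrow> 'h \<Rightarrow> 'v::ring_1"
  assumes s: "distributes s"
    and \<tau>: "\<And>b c d. lin s (\<lambda>a. \<tau> a b c d)" "\<And>a c d. lin s (\<lambda>b. \<tau> a b c d)"
      "\<And>a b d. lin s (\<lambda>c. \<tau> a b c d)" "\<And>a b c. lin s (\<lambda>d. \<tau> a b c d)"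
  shows "sw (\<lambda>p q. sw (\<lambda>a b. sw (\<lambda>c d. \<tau> a b c d) q) p) h =
    sw (\<lambda>p q. sw (\<lambda>a c. sw (\<lambda>b d. \<tau> a b c d) q) p) h"
proof -
  have *: "sw (\<lambda>p q. sw (\<lambda>a b. sw (\<lambda>c d. \<tau> a b c d) q) p) h =
      sw (\<lambda>a q. sw (\<lambda>e d. sw (\<lambda>b c. \<tau> a b c d) e) q) h"
    if \<tau>: "\<And>b c d. lin s (\<lambda>a. \<tau> a b c d)" "\<And>a c d. lin s (\<lambda>b. \<tau> a b c d)"
      "\<And>a b d. lin s (\<lambda>c. \<tau> a b c d)" "\<And>a b c. lin s (\<lambda>d. \<tau> a b c d)"
    for \<tau> :: "'h \<Rightarrow> 'h \<Rightarrow> 'h \<Rightarrow> 'h \<Rightarrow> 'v"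
  proof -
    have "sw (\<lambda>p q. sw (\<lambda>a b. sw (\<lambda>c d. \<tau> a b c d) q) p) h =
        sw (\<lambda>a r. sw (\<lambda>b q. sw (\<lambda>c d. \<tau> a b c d) q) r) h"
      by (rule sw_coassoc[where s = s]; intro \<tau> lin_sw_inside[OF s] lin_sw_outside[OF s] lin_id)
    also have "\<dots> = sw (\<lambda>a r. sw (\<lambda>e d. sw (\<lambda>b c. \<tau> a b c d) e) r) h"
      by (rule sw_cong, rule sw_coassoc[where s = s, symmetric]) (rule \<tau>)+
    finally show ?thesis .
  qed
  have "sw (\<lambda>p q. sw (\<lambda>a b. sw (\<lambda>c d. \<tau> a b c d) q) p) h =
      sw (\<lambda>a q. sw (\<lambda>e d. sw (\<lambda>b c. \<tau> a b c d) e) q) h"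
    by (rule *) (rule \<tau>)+
  also have "\<dots> = sw (\<lambda>a q. sw (\<lambda>e d. sw (\<lambda>c b. \<tau> a b c d) e) q) h"
    by (intro sw_cong sw_cocomm[symmetric, where s = s] bilinI \<tau>)
  also have "\<dots> = sw (\<lambda>p q. sw (\<lambda>a c. sw (\<lambda>b d. \<tau> a b c d) q) p) h"
    by (rule *[symmetric, of "\<lambda>a c b d. \<tau> a b c d"]) (rule \<tau>)+
  finally show ?thesis .
qed

text \<open>
  The product of \<open>\<Delta>(S(h\<^sub>1))\<close>, \<open>\<Delta>(h\<^sub>2)\<close> and \<open>(S \<otimes> S)(\<Delta>(h\<^sub>3))\<close> is \<open>(S \<otimes> S)(\<Delta>(h))\<close> because the first two factors
  cancel, and \<open>\<Delta>(S(h))\<close> because the last two do, once \<open>sw_middle_four\<close> has brought the matching legs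
  together.
\<close>

lemma sw_anti:
  fixes \<phi> :: "'h \<Rightarrow> 'h \<Rightarrow> 'v::ring_1"
  assumes s: "distributes s" and \<phi>: "\<And>b. lin s (\<lambda>a. \<phi> a b)" "\<And>a. lin s (\<lambda>b. \<phi> a b)"
  shows "sw \<phi> (anti h) = sw (\<lambda>a b. \<phi> (anti a) (anti b)) h"
proof -
  note li = lin_comp[OF \<phi>(1)] lin_comp[OF \<phi>(2)] lin_sw_inside[OF s] lin_sw_outside[OF s]
    lin_id lin_mult_left lin_mult_right lin_anti
  have A: "sw (\<lambda>c d. sw (\<lambda>c1 c2. sw (\<lambda>d1 d2. \<phi> (p * (c1 * anti d1)) (q * (c2 * anti d2))) d) c) b =
      s (eps b) (\<phi> p q)" for p q b
  proof -
    have "sw (\<lambda>c d. sw (\<lambda>c1 c2. sw (\<lambda>d1 d2. \<phi> (p * (c1 * anti d1)) (q * (c2 * anti d2))) d) c) b =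
      sw (\<lambda>c d. sw (\<lambda>c1 d1. sw (\<lambda>c2 d2. \<phi> (p * (c1 * anti d1)) (q * (c2 * anti d2))) d) c) b"
      by (rule sw_middle_four[OF s, of "\<lambda>c1 c2 d1 d2. \<phi> (p * (c1 * anti d1)) (q * (c2 * anti d2))"]) (intro li)+
    also have "\<dots> = sw (\<lambda>c d. sw (\<lambda>c1 d1. s (eps d) (\<phi> (p * (c1 * anti d1)) (q * 1))) c) b"
      by (intro sw_cong sw_anti_right[where F = "\<lambda>z. \<phi> (p * c) (q * z)" for c] li)
    also have "\<dots> = sw (\<lambda>c d. s (eps d) (sw (\<lambda>c1 d1. \<phi> (p * (c1 * anti d1)) (q * 1)) c)) b"
      by (simp only: sw_scale_out[OF s])
    also have "\<dots> = sw (\<lambda>c1 d1. \<phi> (p * (c1 * anti d1)) (q * 1)) b"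
      by (rule sw_counit_right) (intro li)
    also have "\<dots> = s (eps b) (\<phi> (p * 1) (q * 1))"
      by (rule sw_anti_right[where F = "\<lambda>z. \<phi> (p * z) (q * 1)"]) (intro li)
    finally show ?thesis by simp
  qed
  have "sw \<phi> (anti h) = sw (\<lambda>a b. s (eps b) (sw \<phi> (anti a))) h"
    by (rule sw_counit_right[symmetric]) (intro li \<phi>)
  also have "\<dots> = sw (\<lambda>a b. sw (\<lambda>p q. sw (\<lambda>c d. sw (\<lambda>c1 c2. sw (\<lambda>d1 d2.
      \<phi> (p * (c1 * anti d1)) (q * (c2 * anti d2))) d) c) b) (anti a)) h"
    unfolding A by (simp only: sw_scale_out[OF s])
  also have "\<dots> = sw (\<lambda>a b. sw (\<lambda>c d. sw (\<lambda>p q. sw (\<lambda>c1 c2. sw (\<lambda>d1 d2.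
      \<phi> (p * (c1 * anti d1)) (q * (c2 * anti d2))) d) c) (anti a)) b) h"
    by (rule sw_cong, rule sw_swap)
  also have "\<dots> = sw (\<lambda>a d. sw (\<lambda>a c. sw (\<lambda>p q. sw (\<lambda>c1 c2. sw (\<lambda>d1 d2.
      \<phi> (p * (c1 * anti d1)) (q * (c2 * anti d2))) d) c) (anti a)) a) h"
    by (rule sw_coassoc[symmetric, where s = s]; intro li)
  also have "\<dots> = sw (\<lambda>a d. sw (\<lambda>a c. sw (\<lambda>p q. sw (\<lambda>d1 d2.
      \<phi> (p * anti d1) (q * anti d2)) d) (anti a * c)) a) h"
  proof (intro sw_cong)
    fix d a c
    have "sw (\<lambda>p q. sw (\<lambda>d1 d2. \<phi> (p * anti d1) (q * anti d2)) d) (anti a * c) =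
       sw (\<lambda>p q. sw (\<lambda>c1 c2. sw (\<lambda>d1 d2. \<phi> (p * c1 * anti d1) (q * c2 * anti d2)) d) c) (anti a)"
      by (rule sw_mult[where s = s]) (intro bilinI li)
    then show "sw (\<lambda>p q. sw (\<lambda>c1 c2. sw (\<lambda>d1 d2. \<phi> (p * (c1 * anti d1)) (q * (c2 * anti d2))) d) c) (anti a) =
       sw (\<lambda>p q. sw (\<lambda>d1 d2. \<phi> (p * anti d1) (q * anti d2)) d) (anti a * c)"
      by (simp add: mult.assoc)
  qed
  also have "\<dots> = sw (\<lambda>a d. s (eps a) (sw (\<lambda>p q. sw (\<lambda>d1 d2. \<phi> (p * anti d1) (q * anti d2)) d) 1)) h"
    by (intro sw_cong sw_anti_left[where F = "\<lambda>z. sw (\<lambda>p q. sw (\<lambda>d1 d2. \<phi> (p * anti d1) (q * anti d2)) d) z" for d] li)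
  also have "\<dots> = sw (\<lambda>p q. sw (\<lambda>d1 d2. \<phi> (p * anti d1) (q * anti d2)) h) 1"
    by (rule sw_counit_left) (intro li)
  also have "\<dots> = sw (\<lambda>d1 d2. \<phi> (1 * anti d1) (1 * anti d2)) h"
    by (rule sw_one[where s = s]) (intro bilinI li)
  finally show ?thesis by simp
qed

end

section \<open>Finite-dimensional linear algebra\<close>

locale linear_space = V: vector_space scale for scale :: "'k::field \<Rightarrow> 'b::ab_group_add \<Rightarrow> 'b"
begin

definition fin_dim :: "'b set \<Rightarrow> bool" where
  "fin_dim W \<longleftrightarrow> V.subspace W \<and> (\<exists>E. finite E \<and> W \<subseteq> V.span E)"

lemma fin_dim_subset: "fin_dim W \<Longrightarrow> V.subspace U \<Longrightarrow> U \<subseteq> W \<Longrightarrow> fin_dim U"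
  unfolding fin_dim_def by blast

lemma fin_dim_basis:
  assumes "fin_dim W" "A \<subseteq> W" "V.independent A"
  obtains B where "A \<subseteq> B" "B \<subseteq> W" "V.independent B" "W \<subseteq> V.span B" "finite B" "card B = V.dim W"
proof -
  obtain B where B: "A \<subseteq> B" "B \<subseteq> W" "V.independent B" "W \<subseteq> V.span B"
    using V.maximal_independent_subset_extend[OF assms(2,3)] .
  obtain E where "finite E" "W \<subseteq> V.span E" using assms(1) by (auto simp: fin_dim_def)
  then have "finite B" using V.independent_span_bound[of E B] B by blast
  then show ?thesis using that[OF B] V.basis_card_eq_dim[OF B(2,4,3)] by blast
qed

lemma dim_psubset_fin_dim:
  assumes "fin_dim W" "V.subspace U" "U \<subset> W"
  shows "V.dim U < V.dim W"
proof -
  have U: "fin_dim U" by (rule fin_dim_subset[OF assms(1,2)]) (use assms(3) in blast)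
  obtain B where B: "{} \<subseteq> B" "B \<subseteq> U" "V.independent B" "U \<subseteq> V.span B" "finite B" "card B = V.dim U"
    using fin_dim_basis[OF U empty_subsetI V.independent_empty] .
  obtain w where w: "w \<in> W" "w \<notin> U" using assms by blast
  have "V.span B \<subseteq> U" using B(2) assms(2) by (rule V.span_minimal)
  then have w': "w \<notin> V.span B" using w(2) by blast
  then have ind: "V.independent (insert w B)" using B(3) by (rule V.independent_insertI)
  have sub: "insert w B \<subseteq> W" using B(2) w assms(3) by blast
  obtain C where C: "insert w B \<subseteq> C" "C \<subseteq> W" "V.independent C" "W \<subseteq> V.span C" "finite C" "card C = V.dim W"
    using fin_dim_basis[OF assms(1) sub ind] .
  have "card (insert w B) = Suc (V.dim U)"
    using B(5,6) w' V.span_base[of w B] by (subst card_insert_disjoint) auto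
  then show ?thesis using card_mono[OF C(5,1)] C(6) by simp
qed

lemma fin_dim_eqI:
  assumes "fin_dim W" "V.subspace U" "U \<subseteq> W" "V.dim W \<le> V.dim U"
  shows "U = W"
  using dim_psubset_fin_dim[OF assms(1,2)] assms(3,4) by fastforce

text \<open>If \<open>g\<close> were nonzero, the images of the other members of a basis through \<open>g\<close> would span, but they are too few.\<close>

lemma onto_imp_no_kernel:
  assumes W: "fin_dim W" and T: "Vector_Spaces.linear scale scale T" "W \<subseteq> T ` W"
    and g: "g \<in> W" "T g = 0"
  shows "g = 0"
proof (rule ccontr)
  assume "g \<noteq> 0"
  interpret T: Vector_Spaces.linear scale scale T by fact
  have ind: "V.independent {g}" using \<open>g \<noteq> 0\<close> by simp
  have gW: "{g} \<subseteq> W" using g(1) by simp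
  obtain B where B: "{g} \<subseteq> B" "B \<subseteq> W" "V.independent B" "W \<subseteq> V.span B" "finite B" "card B = V.dim W"
    using fin_dim_basis[OF W gW ind] .
  have "W \<subseteq> T ` V.span B" using T(2) B(4) by blast
  also have "\<dots> = V.span (T ` B)" by (rule T.span_image[symmetric])
  also have "T ` B = insert 0 (T ` (B - {g}))" using B(1) g(2) by force
  finally have "W \<subseteq> V.span (T ` (B - {g}))" by simp
  then have "V.dim W \<le> card (T ` (B - {g}))" using B(5) by (intro V.dim_le_card) auto
  also have "\<dots> \<le> card (B - {g})" using B(5) by (intro card_image_le) auto
  also have "\<dots> < card B" using B(1,5) by (intro psubset_card_mono) auto
  finally show False using B(6) by simp
qed

text \<open>
  Eigenvectors come from a polynomial of least degree that annihilates a given vector: after the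
  removal of a linear factor it does not annihilate the vector.
\<close>

definition poly_act :: "('b \<Rightarrow> 'b) \<Rightarrow> 'k poly \<Rightarrow> 'b \<Rightarrow> 'b" where
  "poly_act T p w = (\<Sum>i\<le>degree p. scale (coeff p i) ((T ^^ i) w))"

context
  fixes T assumes lin: "Vector_Spaces.linear scale scale T"
begin

lemma poly_act_upto:
  assumes "degree p \<le> n" shows "poly_act T p w = (\<Sum>i\<le>n. scale (coeff p i) ((T ^^ i) w))"
  unfolding poly_act_def
  by (rule sum.mono_neutral_left) (use assms in \<open>auto simp: coeff_eq_0\<close>)

lemma poly_act_add: "poly_act T (p + q) w = poly_act T p w + poly_act T q w"
proof -
  let ?n = "max (degree p) (degree q)"
  have "degree (p + q) \<le> ?n" by (rule degree_add_le_max)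
  then show ?thesis
    by (simp add: poly_act_upto[where n = ?n] V.scale_left_distrib sum.distrib)
qed

lemma poly_act_smult: "poly_act T (Polynomial.smult c p) w = scale c (poly_act T p w)"
  by (cases "c = 0") (simp_all add: poly_act_def V.scale_sum_right)

lemma poly_act_pCons: "poly_act T (pCons c p) w = scale c w + T (poly_act T p w)"
proof -
  interpret T: Vector_Spaces.linear scale scale T by (rule lin)
  have "poly_act T (pCons c p) w = (\<Sum>i\<le>Suc (degree p). scale (coeff (pCons c p) i) ((T ^^ i) w))"
    by (rule poly_act_upto) (simp add: degree_pCons_le)
  also have "\<dots> = scale c w + (\<Sum>i\<le>degree p. scale (coeff p i) (T ((T ^^ i) w)))"
    by (subst sum.atMost_Suc_shift) simp
  finally show ?thesis by (simp add: poly_act_def T.sum T.scale)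
qed

lemma poly_act_root_factor: "poly_act T ([:- c, 1:] * q) w = T (poly_act T q w) - scale c (poly_act T q w)"
proof -
  have "[:- c, 1:] * q = pCons 0 q + Polynomial.smult (- c) q" by simp
  then show ?thesis
    by (simp only: poly_act_add poly_act_smult poly_act_pCons) simp
qed

lemma poly_act_in:
  assumes "V.subspace W" "\<And>v. v \<in> W \<Longrightarrow> T v \<in> W" "w \<in> W" shows "poly_act T p w \<in> W"
proof -
  have "(T ^^ i) w \<in> W" for i by (induction i) (use assms in auto)
  then show ?thesis
    unfolding poly_act_def using assms(1) by (intro V.subspace_sum V.subspace_scale)
qed

lemma annihilating_poly_exists:
  assumes "fin_dim W" "\<And>v. v \<in> W \<Longrightarrow> T v \<in> W" "w \<in> W"
  shows "\<exists>p. p \<noteq> 0 \<and> poly_act T p w = 0"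
proof -
  obtain E where E: "finite E" "W \<subseteq> V.span E" using assms(1) by (auto simp: fin_dim_def)
  define n where "n = card E"
  have inW: "(T ^^ i) w \<in> W" for i by (induction i) (use assms in auto)
  show ?thesis
  proof (cases "inj_on (\<lambda>i. (T ^^ i) w) {..n}")
    case False
    then obtain i j where ij: "i \<noteq> j" "(T ^^ i) w = (T ^^ j) w" by (auto simp: inj_on_def)
    have m: "poly_act T (monom c i) w = scale c ((T ^^ i) w)" for c i
      by (subst poly_act_upto[OF degree_monom_le]) (simp add: if_distrib[of "\<lambda>c. scale c _"] cong: if_cong)
    have "monom 1 i + monom (-1) j \<noteq> (0 :: 'k poly)"
    proof
      assume "monom 1 i + monom (-1) j = (0 :: 'k poly)"
      then have "coeff (monom 1 i + monom (-1) j) i = (0 :: 'k)" by (simp only: coeff_0)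
      then show False using ij(1) by simp
    qed
    moreover have "poly_act T (monom 1 i + monom (-1) j) w = 0"
      by (simp add: poly_act_add m ij(2))
    ultimately show ?thesis by blast
  next
    case True
    define S where "S = (\<lambda>i. (T ^^ i) w) ` {..n}"
    have S: "finite S" "card S = Suc n" using card_image[OF True] by (simp_all add: S_def)
    have "S \<subseteq> V.span E" using inW E by (auto simp: S_def)
    then have "V.dependent S" using V.independent_span_bound[OF E(1), of S] S by (auto simp: n_def)
    then obtain u where u: "\<exists>v\<in>S. u v \<noteq> 0" "(\<Sum>v\<in>S. scale (u v) v) = 0"
      using V.dependent_finite[OF S(1)] by blast
    define p where "p = (\<Sum>i\<le>n. monom (u ((T ^^ i) w)) i)"
    have cp: "coeff p i = (if i \<le> n then u ((T ^^ i) w) else 0)" for i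
      by (simp add: p_def coeff_sum)
    have "p \<noteq> 0" using u(1) cp by (auto simp: S_def) (metis coeff_0)
    moreover have "degree p \<le> n" using cp by (intro degree_le) simp
    then have "poly_act T p w = (\<Sum>v\<in>S. scale (u v) v)"
      by (simp add: poly_act_upto S_def sum.reindex[OF True] cp)
    ultimately show ?thesis using u(2) by auto
  qed
qed

end

end

locale closed_linear_space = linear_space scale
  for scale :: "'k::alg_closed_field \<Rightarrow> 'b::ab_group_add \<Rightarrow> 'b"
begin

lemma eigenvector_exists:
  assumes T: "Vector_Spaces.linear scale scale T" and W: "fin_dim W"
    and inv: "\<And>v. v \<in> W \<Longrightarrow> T v \<in> W" and w: "w \<in> W" "w \<noteq> 0"
  shows "\<exists>c. \<exists>v\<in>W. v \<noteq> 0 \<and> T v = scale c v"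
proof -
  define Q where "Q p \<longleftrightarrow> p \<noteq> 0 \<and> poly_act T p w = 0" for p
  obtain p0 where "Q p0"
    using annihilating_poly_exists[OF T W inv w(1)] by (auto simp: Q_def)
  then obtain p where p: "Q p" "\<And>q. Q q \<Longrightarrow> degree p \<le> degree q"
    using ex_has_least_nat[of Q p0 degree] by blast
  have "degree p > 0"
  proof (rule ccontr)
    assume "\<not> degree p > 0"
    then have "degree p = 0" by simp
    then show False using p(1) w(2) leading_coeff_0_iff[of p] by (auto simp: Q_def poly_act_def)
  qed
  then obtain c where "poly p c = 0" using alg_closed_imp_poly_has_root by blast
  then obtain q where q: "p = [:- c, 1:] * q" by (auto simp: poly_eq_0_iff_dvd elim: dvdE)
  have "q \<noteq> 0" using p(1) q by (auto simp: Q_def)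
  then have "degree p = Suc (degree q)" unfolding q by (subst degree_mult_eq) auto
  then have "\<not> Q q" using p(2)[of q] by auto
  then have "poly_act T q w \<noteq> 0" using \<open>q \<noteq> 0\<close> by (simp add: Q_def)
  moreover have "T (poly_act T q w) = scale c (poly_act T q w)"
    using p(1) poly_act_root_factor[OF T, of c q w] by (simp add: Q_def q)
  moreover have "poly_act T q w \<in> W"
    using W by (intro poly_act_in[OF T _ inv w(1)]) (auto simp: fin_dim_def)
  ultimately show ?thesis by blast
qed

end

section \<open>Generation by primitive and group-like elements\<close>

context cocommutative_hopf_algebra
begin

text \<open>The action \<open>x h = x(h\<^sub>2) h\<^sub>1\<close> of the dual algebra; it is commutative because \<open>H\<close> is cocommutative.\<close>

definition act :: "('h \<Rightarrow> 'k) \<Rightarrow> 'h \<Rightarrow> 'h" where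
  "act x h = sw (\<lambda>a b. scal H (x b) a) h"

lemma act_contract: "lin (*) x \<Longrightarrow> contract x (comult H h) = act x h"
  unfolding act_def by (subst sw_additive[OF contract_additive]) (simp_all add: contract_pure)

lemma act_lin: assumes "lin (*) x" shows "lin (scal H) (act x)"
  unfolding act_def by (intro lin_intros lin_comp[OF assms])

lemma act_linear: "lin (*) x \<Longrightarrow> Vector_Spaces.linear (scal H) (scal H) (act x)"
  using act_lin[of x] by (simp add: lin_def Vector_Spaces.linear_iff scal_vector_space)

lemma act_plus: "act (\<lambda>f. x f + y f) h = act x h + act y h"
  by (simp add: act_def V.scale_left_distrib sw_plus)

lemma act_times: "act (\<lambda>f. c * x f) h = scal H c (act x h)"
  unfolding act_def by (simp add: sw_scale_out[OF distributes_scal, symmetric])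

lemma act_sum: "act (\<lambda>f. \<Sum>i\<in>A. x i f) h = (\<Sum>i\<in>A. act (x i) h)"
  by (simp add: act_def V.scale_sum_left sw_sum)

lemma act_eps: "act eps h = h"
  unfolding act_def by (rule sw_counit_right) (rule lin_id)

lemma eps_act: assumes "lin (*) x" shows "eps (act x h) = x h"
proof -
  have "eps (act x h) = sw (\<lambda>a b. eps (scal H (x b) a)) h"
    unfolding act_def by (rule lin_comp_sw[OF lin_counit])
  also have "\<dots> = sw (\<lambda>a b. eps a * x b) h" by (simp add: lin_scal[OF lin_counit] mult.commute)
  also have "\<dots> = x h" by (rule sw_counit_left[OF assms])
  finally show ?thesis .
qed

lemma act_act:
  assumes "lin (*) x" "lin (*) y"
  shows "act x (act y h) = sw (\<lambda>a b. sw (\<lambda>c d. scal H (x c * y d) a) b) h"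
proof -
  have "act x (act y h) = sw (\<lambda>a b. scal H (y b) (act x a)) h"
    by (subst (2) act_def) (simp add: lin_comp_sw[OF act_lin[OF assms(1)]] lin_scal[OF act_lin[OF assms(1)]])
  also have "\<dots> = sw (\<lambda>a b. sw (\<lambda>c d. scal H (x d * y b) c) a) h"
    by (simp add: act_def sw_scale_out[OF distributes_scal, symmetric] mult.commute)
  also have "\<dots> = sw (\<lambda>a b. sw (\<lambda>c d. scal H (x c * y d) a) b) h"
    by (rule sw_coassoc[where s = "scal H"]; intro lin_intros lin_comp[OF assms(1)] lin_comp[OF assms(2)])
  finally show ?thesis .
qed

lemma act_commute:
  assumes "lin (*) x" "lin (*) y" shows "act x (act y h) = act y (act x h)"
proof -
  have "act x (act y h) = sw (\<lambda>a b. sw (\<lambda>c d. scal H (x c * y d) a) b) h"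
    by (rule act_act[OF assms])
  also have "\<dots> = sw (\<lambda>a b. sw (\<lambda>d c. scal H (x c * y d) a) b) h"
    by (rule sw_cong, rule sw_cocomm[symmetric, where s = "scal H"], rule bilinI;
        intro lin_intros lin_comp[OF assms(1)] lin_comp[OF assms(2)])
  also have "\<dots> = act y (act x h)"
    by (subst act_act[OF assms(2,1)]) (simp add: mult.commute)
  finally show ?thesis .
qed

lemma dual_separates: assumes "\<And>x. lin (*) x \<Longrightarrow> x h = 0" shows "h = 0"
proof -
  have "dual_vec H hbasis b h = 0" for b by (rule assms[OF dual_vec_lin[OF is_basis_hbasis]])
  then show ?thesis using basis_expansion[OF is_basis_hbasis, of "{}" h] by simp
qed

lemma lin_plus: "lin (*) x \<Longrightarrow> lin (*) y \<Longrightarrow> lin (*) (\<lambda>f. x f + y f :: 'k)"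
  by (simp add: lin_def algebra_simps)

lemma lin_minus: "lin (*) x \<Longrightarrow> lin (*) y \<Longrightarrow> lin (*) (\<lambda>f. x f - y f :: 'k)"
  by (simp add: lin_def algebra_simps)

lemma lin_sum_fun: "(\<And>i. i \<in> A \<Longrightarrow> lin (*) (x i)) \<Longrightarrow> lin (*) (\<lambda>f. \<Sum>i\<in>A. x i f :: 'k)"
  by (simp add: lin_def sum.distrib sum_distrib_left)

subsection \<open>Primitive and group-like elements\<close>

lemma one_neq_zero: "(1::'h) \<noteq> 0"
  using counit_one lin_zero[OF lin_counit] by auto

lemma sw_primitive:
  assumes "p \<in> primitives H" "bilin s \<phi>" shows "sw \<phi> p = \<phi> p 1 + (\<phi> 1 p :: 'v::ring_1)"
proof -
  have "sw \<phi> p = tlift \<phi> (pure H [p, 1] \<oplus>\<^bsub>tpow H 2\<^esub> pure H [1, p])"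
    using assms(1) tlift_comult[OF assms(2), of p] by (simp add: primitives_def)
  then show ?thesis
    by (simp add: additive_add[OF tlift_additive[OF assms(2)]] pure_closed tlift_pure[OF assms(2)])
qed

lemma sw_grouplike:
  assumes "g \<in> grouplikes H" "bilin s \<phi>" shows "sw \<phi> g = (\<phi> g g :: 'v::ring_1)"
  using assms(1) tlift_comult[OF assms(2), of g] by (simp add: grouplikes_def tlift_pure[OF assms(2)])

lemma primitivesI:
  assumes "\<And>x. lin (*) x \<Longrightarrow> act x p = scal H (x 1) p + scal H (x p) 1"
  shows "p \<in> primitives H"
proof -
  interpret T: abelian_group "tpow H 2" by (rule tpow_abelian_group)
  have "comult H p = pure H [p, 1] \<oplus>\<^bsub>tpow H 2\<^esub> pure H [1, p]"
  proof (rule tensor_eqI)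
    fix x :: "'h \<Rightarrow> 'k" assume x: "lin (*) x"
    show "contract x (comult H p) = contract x (pure H [p, 1] \<oplus>\<^bsub>tpow H 2\<^esub> pure H [1, p])"
      by (simp add: act_contract[OF x] assms[OF x] additive_add[OF contract_additive[OF x]] pure_closed contract_pure[OF x])
  qed (simp_all add: comult_closed pure_closed)
  then show ?thesis by (simp add: primitives_def)
qed

lemma grouplikesI:
  assumes "g \<noteq> 0" "\<And>x. lin (*) x \<Longrightarrow> act x g = scal H (x g) g"
  shows "g \<in> grouplikes H"
proof -
  have "comult H g = pure H [g, g]"
  proof (rule tensor_eqI)
    fix x :: "'h \<Rightarrow> 'k" assume x: "lin (*) x"
    show "contract x (comult H g) = contract x (pure H [g, g])"
      by (simp add: act_contract[OF x] assms(2)[OF x] contract_pure[OF x])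
  qed (simp_all add: comult_closed pure_closed)
  then show ?thesis using assms(1) by (simp add: grouplikes_def)
qed

lemma bilin_act: "lin (*) x \<Longrightarrow> bilin (scal H) (\<lambda>a b. scal H (x b) a)"
  by (rule bilin_contract)

lemma act_one: "lin (*) x \<Longrightarrow> act x 1 = scal H (x 1) 1"
  unfolding act_def by (rule sw_one[OF bilin_act])

lemma one_grouplike: "1 \<in> grouplikes H"
  by (rule grouplikesI[OF one_neq_zero]) (rule act_one)

lemma eps_primitive: assumes "p \<in> primitives H" shows "eps p = 0"
proof -
  have "p = sw (\<lambda>a b. scal H (eps a) b) p"
    by (rule sw_counit_left[OF lin_id, symmetric])
  also have "\<dots> = scal H (eps p) 1 + scal H (eps 1) p"
    by (rule sw_primitive[OF assms, of "scal H"]) (intro bilinI lin_intros)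
  finally show ?thesis using one_neq_zero by (simp add: counit_one)
qed

lemma eps_grouplike: assumes "g \<in> grouplikes H" shows "eps g = 1"
proof -
  have "g = sw (\<lambda>a b. scal H (eps a) b) g"
    by (rule sw_counit_left[OF lin_id, symmetric])
  also have "\<dots> = scal H (eps g) g"
    by (rule sw_grouplike[OF assms, of "scal H"]) (intro bilinI lin_intros)
  finally have "scal H (eps g) g = scal H 1 g" by simp
  then show ?thesis using assms by (simp only: V.scale_cancel_right) (simp add: grouplikes_def)
qed

lemma anti_grouplike: assumes "g \<in> grouplikes H" shows "anti g * g = 1"
proof -
  have "anti g * g = sw (\<lambda>a b. anti a * b) g"
    by (rule sw_grouplike[OF assms, of "scal H", symmetric]) (intro bilinI lin_intros)
  also have "\<dots> = scal H (eps g) 1" by (rule sw_anti_left[OF lin_id])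
  finally show ?thesis by (simp add: eps_grouplike[OF assms])
qed

lemma act_mult_primitive:
  assumes x: "lin (*) x" and p: "p \<in> primitives H"
  shows "act x (h * p) = act x h * p + act (\<lambda>f. x (f * p)) h"
proof -
  have "act x (h * p) = sw (\<lambda>a b. sw (\<lambda>c d. scal H (x (b * d)) (a * c)) p) h"
    unfolding act_def by (rule sw_mult[OF bilin_act[OF x]])
  also have "\<dots> = sw (\<lambda>a b. scal H (x (b * 1)) (a * p) + scal H (x (b * p)) (a * 1)) h"
    by (rule sw_cong, rule sw_primitive[OF p, of "scal H"]) (intro bilinI lin_intros lin_comp[OF x])
  also have "\<dots> = sw (\<lambda>a b. scal H (x b) a * p) h + act (\<lambda>f. x (f * p)) h"
    by (simp add: sw_plus act_def scal_mult_left)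
  also have "sw (\<lambda>a b. scal H (x b) a * p) h = act x h * p"
    unfolding act_def by (rule lin_comp_sw[OF lin_mult_right[OF lin_id], symmetric])
  finally show ?thesis .
qed

lemma act_mult_anti_grouplike:
  assumes x: "lin (*) x" and g: "g \<in> grouplikes H"
  shows "act x (h * anti g) = act (\<lambda>f. x (f * anti g)) h * anti g"
proof -
  have "act x (h * anti g) = sw (\<lambda>a b. sw (\<lambda>c d. scal H (x (b * d)) (a * c)) (anti g)) h"
    unfolding act_def by (rule sw_mult[OF bilin_act[OF x]])
  also have "\<dots> = sw (\<lambda>a b. sw (\<lambda>c d. scal H (x (b * anti d)) (a * anti c)) g) h"
    by (rule sw_cong, rule sw_anti[OF distributes_scal]; intro lin_intros lin_comp[OF x])
  also have "\<dots> = sw (\<lambda>a b. scal H (x (b * anti g)) (a * anti g)) h"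
    by (rule sw_cong, rule sw_grouplike[OF g, of "scal H"], rule bilinI; intro lin_intros lin_comp[OF x])
  also have "\<dots> = sw (\<lambda>a b. scal H (x (b * anti g)) a * anti g) h"
    by (simp add: scal_mult_left)
  also have "\<dots> = act (\<lambda>f. x (f * anti g)) h * anti g"
    unfolding act_def by (rule lin_comp_sw[OF lin_mult_right[OF lin_id], symmetric])
  finally show ?thesis .
qed

subsection \<open>Locally finite decomposition\<close>

sublocale L: linear_space "scal H" ..

definition submodule :: "'h set \<Rightarrow> bool" where
  "submodule W \<longleftrightarrow> L.fin_dim W \<and> (\<forall>x. lin (*) x \<longrightarrow> (\<forall>w\<in>W. act x w \<in> W))"

lemma submoduleD:
  assumes "submodule W"
  shows "L.fin_dim W" "V.subspace W" "lin (*) x \<Longrightarrow> w \<in> W \<Longrightarrow> act x w \<in> W"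
  using assms by (auto simp: submodule_def L.fin_dim_def)

lemma submodule_subset:
  assumes "submodule W" "V.subspace U" "U \<subseteq> W" "\<And>x w. lin (*) x \<Longrightarrow> w \<in> U \<Longrightarrow> act x w \<in> U"
  shows "submodule U"
  using assms L.fin_dim_subset[OF submoduleD(1)[OF assms(1)] assms(2,3)] by (simp add: submodule_def)

lemma submodule_kernel:
  assumes W: "submodule W" and T: "lin (scal H) T" "\<And>x h. lin (*) x \<Longrightarrow> T (act x h) = act x (T h)"
  shows "submodule {w \<in> W. T w = 0}"
proof (rule submodule_subset[OF W])
  show "V.subspace {w \<in> W. T w = 0}"
    using submoduleD(2)[OF W] lin_zero[OF T(1)] lin_add[OF T(1)] lin_scal[OF T(1)]
    by (auto simp: V.subspace_def)
  show "act x w \<in> {w \<in> W. T w = 0}" if "lin (*) x" "w \<in> {w \<in> W. T w = 0}" for x w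
    using that submoduleD(3)[OF W that(1)] by (simp add: T(2)[OF that(1)] lin_zero[OF act_lin[OF that(1)]])
qed auto

lemma submodule_image:
  assumes W: "submodule W" and T: "lin (scal H) T" "\<And>x h. lin (*) x \<Longrightarrow> T (act x h) = act x (T h)"
    and TW: "T ` W \<subseteq> W"
  shows "submodule (T ` W)"
proof (rule submodule_subset[OF W])
  show "V.subspace (T ` W)"
  proof (rule V.subspaceI)
    show "0 \<in> T ` W"
      using V.subspace_0[OF submoduleD(2)[OF W]] by (rule rev_image_eqI) (simp add: lin_zero[OF T(1)])
  next
    fix x y assume "x \<in> T ` W" "y \<in> T ` W"
    then obtain u v where "u \<in> W" "v \<in> W" "x = T u" "y = T v" by blast
    then show "x + y \<in> T ` W"
      using V.subspace_add[OF submoduleD(2)[OF W]] by (intro rev_image_eqI[of "u + v"]) (simp_all add: lin_add[OF T(1)])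
  next
    fix c x assume "x \<in> T ` W"
    then obtain u where "u \<in> W" "x = T u" by blast
    then show "scal H c x \<in> T ` W"
      using V.subspace_scale[OF submoduleD(2)[OF W]] by (intro rev_image_eqI[of "scal H c u"]) (simp_all add: lin_scal[OF T(1)])
  qed
  show "act x w \<in> T ` W" if x: "lin (*) x" and w: "w \<in> T ` W" for x w
  proof -
    obtain u where u: "u \<in> W" "w = T u" using w by blast
    show ?thesis
      using submoduleD(3)[OF W x u(1)] by (intro rev_image_eqI[of "act x u"]) (simp_all add: u(2) T(2)[OF x])
  qed
qed (rule TW)

lemma lin_pow: "lin (scal H) T \<Longrightarrow> lin (scal H) (T ^^ n)"
  by (induction n) (simp_all add: lin_def)

lemma act_pow_commute:
  assumes "lin (*) x" "lin (*) y" shows "(act x ^^ n) (act y h) = act y ((act x ^^ n) h)"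
  by (induction n) (simp_all add: act_commute[OF assms])

lemma act_pow_in: "submodule W \<Longrightarrow> lin (*) x \<Longrightarrow> (act x ^^ n) ` W \<subseteq> W"
  by (induction n) (auto dest: submoduleD(3))

text \<open>
  The elements \<open>act x h\<close> for varying \<open>x\<close> form a submodule that contains \<open>h\<close>. All of them are
  combinations of the finitely many left legs of the coproduct of \<open>h\<close>.
\<close>

lemma submodule_generated: "\<exists>W. submodule W \<and> h \<in> W"
proof (intro exI conjI)
  let ?W = "{act x h |x. lin (*) x}"
  have "V.subspace ?W"
  proof (rule V.subspaceI)
    show "0 \<in> ?W"
      using lin_minus[OF lin_counit lin_counit] act_times[of 0 eps h] by (auto intro!: exI[of _ "\<lambda>f. 0"] simp: lin_def)
    show "a + b \<in> ?W" if "a \<in> ?W" "b \<in> ?W" for a b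
      using that lin_plus act_plus by (auto simp flip: act_plus)
    show "scal H c a \<in> ?W" if "a \<in> ?W" for c a
      using that lin_times_left by (auto simp flip: act_times)
  qed
  moreover have "act x h \<in> V.span (colegs h ` cosupp h)" for x
    unfolding act_def sw_def by (intro V.span_sum V.span_scale V.span_base) auto
  then have "?W \<subseteq> V.span (colegs h ` cosupp h)" by blast
  moreover have "act y a \<in> ?W" if y: "lin (*) y" and a: "a \<in> ?W" for y a
  proof -
    obtain x where x: "lin (*) x" "a = act x h" using a by blast
    have "act y a = sw (\<lambda>a b. sw (\<lambda>c d. scal H (y c * x d) a) b) h"
      by (simp only: x(2) act_act[OF y x(1)])
    also have "\<dots> = act (sw (\<lambda>c d. y c * x d)) h"
      unfolding act_def
      by (intro sw_cong sw_comp[of "\<lambda>z. scal H z c" for c, symmetric]) (simp_all add: V.scale_left_distrib)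
    finally have "act y a = act (sw (\<lambda>c d. y c * x d)) h" .
    moreover have "lin (*) (sw (\<lambda>c d. y c * x d))"
      using lin_sw_outside[OF distributes_times lin_times_right lin_times_left lin_id, OF y x(1)] by simp
    ultimately show ?thesis by blast
  qed
  ultimately show "submodule ?W"
    using cosupp(1)[of h] unfolding submodule_def L.fin_dim_def by blast
  show "h \<in> ?W" using lin_counit act_eps[of h] by (intro CollectI exI[of _ eps]) simp
qed

text \<open>
  The elements killed by the \<open>n\<close>-th power of the ideal of functionals that vanish at \<open>g\<close>.
\<close>

primrec local_filt :: "'h \<Rightarrow> nat \<Rightarrow> 'h set" where
  "local_filt g 0 = {0}"
| "local_filt g (Suc n) = {h. \<forall>x. lin (*) x \<longrightarrow> x g = 0 \<longrightarrow> act x h \<in> local_filt g n}"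

lemma local_filt_SucI:
  "(\<And>x. lin (*) x \<Longrightarrow> x g = 0 \<Longrightarrow> act x h \<in> local_filt g n) \<Longrightarrow> h \<in> local_filt g (Suc n)"
  by simp

lemma local_filt_SucD: "h \<in> local_filt g (Suc n) \<Longrightarrow> lin (*) x \<Longrightarrow> x g = 0 \<Longrightarrow> act x h \<in> local_filt g n"
  by simp

declare local_filt.simps(2) [simp del]

lemma local_filt_subspace: "V.subspace (local_filt g n)"
proof (induction n)
  case (Suc n)
  show ?case
  proof (rule V.subspaceI)
    show "0 \<in> local_filt g (Suc n)"
      by (rule local_filt_SucI) (simp add: lin_zero[OF act_lin] V.subspace_0[OF Suc])
    show "a + b \<in> local_filt g (Suc n)" if "a \<in> local_filt g (Suc n)" "b \<in> local_filt g (Suc n)" for a b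
      by (rule local_filt_SucI)
        (simp add: lin_add[OF act_lin] V.subspace_add[OF Suc] local_filt_SucD[OF that(1)] local_filt_SucD[OF that(2)])
    show "scal H c a \<in> local_filt g (Suc n)" if "a \<in> local_filt g (Suc n)" for c a
      by (rule local_filt_SucI)
        (simp add: lin_scal[OF act_lin] V.subspace_scale[OF Suc] local_filt_SucD[OF that])
  qed
qed simp

text \<open>
  If some functional \<open>x\<close> that vanishes at \<open>g\<close> acts nontrivially, its image and its kernel are smaller submodules, hence
  killed by powers of the ideal. An element of \<open>W\<close> that such a power carries into the kernel of \<open>x\<close> is
  killed by the power increased by the exponent for the kernel.
\<close>

lemma nilpotent_in_local_filt:
  assumes "submodule W" "\<And>x. lin (*) x \<Longrightarrow> x g = 0 \<Longrightarrow> \<exists>m. \<forall>w\<in>W. (act x ^^ m) w = 0"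
  shows "\<exists>n. W \<subseteq> local_filt g n"
  using assms
proof (induction "V.dim W" arbitrary: W rule: less_induct)
  case less
  note W = less.prems(1)
  show ?case
  proof (cases "\<exists>x. lin (*) x \<and> x g = 0 \<and> \<not> act x ` W \<subseteq> {0}")
    case False
    have "w \<in> local_filt g (Suc 0)" if "w \<in> W" for w
      by (rule local_filt_SucI) (use that False in auto)
    then have "W \<subseteq> local_filt g (Suc 0)" by blast
    then show ?thesis by blast
  next
    case True
    then obtain x where x: "lin (*) x" "x g = 0" "\<not> act x ` W \<subseteq> {0}" by blast
    let ?I = "act x ` W" and ?K = "{w \<in> W. act x w = 0}"
    have com: "act x (act y h) = act y (act x h)" if "lin (*) y" for y h
      by (rule act_commute[OF x(1) that])
    have IW: "?I \<subseteq> W" using submoduleD(3)[OF W x(1)] by blast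
    have I: "submodule ?I" by (rule submodule_image[OF W act_lin[OF x(1)] com IW])
    have K: "submodule ?K" by (rule submodule_kernel[OF W act_lin[OF x(1)] com])
    have "?I \<noteq> W"
    proof
      assume e: "?I = W"
      obtain m where m: "\<forall>w\<in>W. (act x ^^ m) w = 0" using less.prems(2)[OF x(1,2)] by blast
      have im: "(act x ^^ n) ` W = W" for n
      proof (induction n)
        case (Suc n)
        then show ?case by (simp only: funpow.simps image_comp[symmetric] e)
      qed simp
      have "W \<subseteq> {0}"
      proof
        fix w assume "w \<in> W"
        then have "w \<in> (act x ^^ m) ` W" by (simp only: im)
        then show "w \<in> {0}" using m by auto
      qed
      then show False using x(3) e by simp
    qed
    then have dI: "V.dim ?I < V.dim W"
      using IW by (intro L.dim_psubset_fin_dim[OF submoduleD(1)[OF W] submoduleD(2)[OF I]]) blast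
    have dK: "V.dim ?K < V.dim W"
      using x(3) by (intro L.dim_psubset_fin_dim[OF submoduleD(1)[OF W] submoduleD(2)[OF K]]) blast
    obtain n1 where n1: "?I \<subseteq> local_filt g n1"
      using less.hyps[OF dI I] less.prems(2) IW by (meson subsetD)
    obtain n2 where n2: "?K \<subseteq> local_filt g n2"
      using less.hyps[OF dK K] less.prems(2) by (metis (no_types, lifting) mem_Collect_eq)
    have "w \<in> local_filt g (n + n2)" if "w \<in> W" "act x w \<in> local_filt g n" for n w
      using that
    proof (induction n arbitrary: w)
      case 0
      then show ?case using n2 by auto
    next
      case (Suc n)
      show ?case unfolding add_Suc
      proof (rule local_filt_SucI)
        fix y :: "'h \<Rightarrow> 'k" assume y: "lin (*) y" "y g = 0"
        have "act x (act y w) \<in> local_filt g n"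
          unfolding com[OF y(1)] by (rule local_filt_SucD[OF Suc.prems(2) y])
        then show "act y w \<in> local_filt g (n + n2)"
          by (rule Suc.IH[OF submoduleD(3)[OF W y(1) Suc.prems(1)]])
      qed
    qed
    then have "W \<subseteq> local_filt g (n1 + n2)" using n1 by blast
    then show ?thesis by blast
  qed
qed

text \<open>
  Since \<open>S(g)\<close> is group-like, \<open>x (h S(g)) = (y h) S(g)\<close> for the translated functional \<open>y f = x(f S(g))\<close>, which
  vanishes at \<open>g\<close> when \<open>x\<close> vanishes at \<open>1\<close>.
\<close>

lemma local_filt_translate:
  assumes g: "g \<in> grouplikes H" shows "h \<in> local_filt g n \<Longrightarrow> h * anti g \<in> local_filt 1 n"
proof (induction n arbitrary: h)
  case (Suc n)
  have gg: "g * anti g = 1"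
  proof -
    have "g * anti g = sw (\<lambda>a b. a * anti b) g"
      by (rule sw_grouplike[OF g, of "scal H", symmetric]) (intro bilinI lin_intros)
    also have "\<dots> = scal H (eps g) 1" by (rule sw_anti_right[OF lin_id])
    finally show ?thesis by (simp add: eps_grouplike[OF g])
  qed
  show ?case
  proof (rule local_filt_SucI)
    fix x :: "'h \<Rightarrow> 'k" assume x: "lin (*) x" "x 1 = 0"
    have l: "lin (*) (\<lambda>f. x (f * anti g))" by (rule lin_comp[OF x(1) lin_mult_right[OF lin_id]])
    show "act x (h * anti g) \<in> local_filt 1 n"
      unfolding act_mult_anti_grouplike[OF x(1) g]
      by (rule Suc.IH) (rule local_filt_SucD[OF Suc.prems l], simp add: gg x(2))
  qed
qed simp

text \<open>
  An eigenspace of one functional is a submodule because the action is commutative. Passing to proper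
  eigenspaces ends with a submodule on which every functional acts by a scalar.
\<close>

lemma common_eigenvector:
  assumes eig: "\<And>x U. lin (*) x \<Longrightarrow> submodule U \<Longrightarrow> U \<noteq> {0} \<Longrightarrow> \<exists>c. \<exists>v\<in>U. v \<noteq> 0 \<and> act x v = scal H c v"
    and W: "submodule W" "W \<noteq> {0}"
  shows "\<exists>w\<in>W. w \<noteq> 0 \<and> (\<forall>x. lin (*) x \<longrightarrow> (\<exists>c. act x w = scal H c w))"
  using W
proof (induction "V.dim W" arbitrary: W rule: less_induct)
  case less
  note W = less.prems
  show ?case
  proof (cases "\<exists>x c U. lin (*) x \<and> U = {w \<in> W. act x w - scal H c w = 0} \<and> U \<noteq> {0} \<and> U \<noteq> W")
    case True
    then obtain x c U where x: "lin (*) x" and U: "U = {w \<in> W. act x w - scal H c w = 0}" "U \<noteq> {0}" "U \<noteq> W"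
      by blast
    have "submodule U"
      unfolding U(1)
    proof (rule submodule_kernel[OF W(1)])
      show "lin (scal H) (\<lambda>w. act x w - scal H c w)"
        using act_lin[OF x] by (simp add: lin_def V.scale_right_distrib V.scale_right_diff_distrib mult.commute)
      show "act x (act y h) - scal H c (act y h) = act y (act x h - scal H c h)" if "lin (*) y" for y h
        by (simp add: lin_diff[OF act_lin[OF that]] lin_scal[OF act_lin[OF that]] act_commute[OF x that])
    qed
    moreover have "V.dim U < V.dim W"
      using U by (intro L.dim_psubset_fin_dim[OF submoduleD(1)[OF W(1)] submoduleD(2)[OF calculation]]) blast
    ultimately show ?thesis using less.hyps[of U] U by blast
  next
    case False
    obtain w where w: "w \<in> W" "w \<noteq> 0" using W V.subspace_0[OF submoduleD(2)[OF W(1)]] by blast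
    have "\<exists>c. act x w = scal H c w" if x: "lin (*) x" for x
    proof -
      obtain c v where v: "v \<in> W" "v \<noteq> 0" "act x v = scal H c v" using eig[OF x W] by blast
      then have "{w \<in> W. act x w - scal H c w = 0} \<noteq> {0}" by auto
      then have "{w \<in> W. act x w - scal H c w = 0} = W" using False x by blast
      then have "act x w - scal H c w = 0" using w(1) by blast
      then show ?thesis by auto
    qed
    then show ?thesis using w by blast
  qed
qed

text \<open>
  If \<open>x w = c w\<close>, then applying the counit gives \<open>x(w) = c \<epsilon>(w)\<close>. So \<open>\<epsilon>(w)\<close> is nonzero, and the multiple of \<open>w\<close> with
  counit \<open>1\<close> is an eigenvector with eigenvalues \<open>x(w)\<close>.
\<close>

lemma grouplike_of_eigenvector:
  assumes w: "w \<noteq> 0" "\<And>x. lin (*) x \<Longrightarrow> \<exists>c. act x w = scal H c w"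
  shows "\<exists>c. scal H c w \<in> grouplikes H"
proof -
  have ch: "\<exists>c. act x w = scal H c w \<and> x w = c * eps w" if x: "lin (*) x" for x
    using w(2)[OF x] eps_act[OF x, of w] by (auto simp: lin_scal[OF lin_counit])
  have e: "eps w \<noteq> 0"
  proof
    assume "eps w = 0"
    then have "x w = 0" if "lin (*) x" for x using ch[OF that] by auto
    then have "w = 0" by (rule dual_separates)
    then show False using w(1) by simp
  qed
  have "scal H (1 / eps w) w \<in> grouplikes H"
  proof (rule grouplikesI)
    show "scal H (1 / eps w) w \<noteq> 0" using e w(1) by simp
    fix x :: "'h \<Rightarrow> 'k" assume x: "lin (*) x"
    obtain c where c: "act x w = scal H c w" "x w = c * eps w" using ch[OF x] by blast
    show "act x (scal H (1 / eps w) w) = scal H (x (scal H (1 / eps w) w)) (scal H (1 / eps w) w)"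
      using e by (simp add: lin_scal[OF act_lin[OF x]] lin_scal[OF x] c mult.commute)
  qed
  then show ?thesis by blast
qed

end

locale finite_type_hopf_algebra = cocommutative_hopf_algebra H
  for H :: "('k::{alg_closed_field, field_char_0}, 'h::ring_1) hopf" +
  assumes finite_filt: "\<exists>E. finite E \<and> H_filt H n = hspan H E"
begin

sublocale C: closed_linear_space "scal H" ..

lemma eigenvector_in_submodule:
  assumes "lin (*) x" "submodule U" "U \<noteq> {0}" shows "\<exists>c. \<exists>v\<in>U. v \<noteq> 0 \<and> act x v = scal H c v"
proof -
  obtain w where w: "w \<in> U" "w \<noteq> 0" using assms(3) V.subspace_0[OF submoduleD(2)[OF assms(2)]] by blast
  show ?thesis
    by (rule C.eigenvector_exists[OF act_linear[OF assms(1)] submoduleD(1)[OF assms(2)] submoduleD(3)[OF assms(2,1)] w])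
qed

text \<open>
  A nonzero submodule contains a group-like element \<open>g\<close>. If all functionals that vanish at \<open>g\<close> act
  nilpotently, the submodule lies in the local filtration at \<open>g\<close>. Otherwise let \<open>x\<close> be one that does not;
  by Fitting's lemma for \<open>x\<close> the submodule is the sum of the kernel and the image of a power of \<open>x\<close>. The
  kernel is proper by the choice of \<open>x\<close>, the image because it does not contain \<open>g\<close>.
\<close>

lemma submodule_decomposition:
  assumes "submodule W" "V.subspace K" "\<And>g n. g \<in> grouplikes H \<Longrightarrow> local_filt g n \<subseteq> K"
  shows "W \<subseteq> K"
  using assms(1)
proof (induction "V.dim W" arbitrary: W rule: less_induct)
  case less
  note W = less.prems
  show ?case
  proof (cases "W = {0}")
    case True
    then show ?thesis using V.subspace_0[OF assms(2)] by simp
  next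
    case False
    obtain w where w: "w \<in> W" "w \<noteq> 0" "\<forall>x. lin (*) x \<longrightarrow> (\<exists>c. act x w = scal H c w)"
      using common_eigenvector[OF eigenvector_in_submodule W False] by blast
    obtain c where c: "scal H c w \<in> grouplikes H" using grouplike_of_eigenvector[OF w(2)] w(3) by blast
    define g where "g = scal H c w"
    have g: "g \<in> grouplikes H" "g \<in> W" "g \<noteq> 0"
      using c V.subspace_scale[OF submoduleD(2)[OF W] w(1)] by (simp_all add: g_def grouplikes_def)
    show ?thesis
    proof (cases "\<forall>x. lin (*) x \<longrightarrow> x g = 0 \<longrightarrow> (\<exists>m. \<forall>w\<in>W. (act x ^^ m) w = 0)")
      case True
      then obtain n where "W \<subseteq> local_filt g n" using nilpotent_in_local_filt[OF W] by blast
      then show ?thesis using assms(3)[OF g(1)] by blast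
    next
      case False
      then obtain x where x: "lin (*) x" "x g = 0" "\<nexists>m. \<forall>w\<in>W. (act x ^^ m) w = 0" by blast
      define T where "T m = (act x ^^ m)" for m
      have T: "lin (scal H) (T m)" "lin (*) y \<Longrightarrow> T m (act y h) = act y (T m h)" for m y h
        by (simp_all add: T_def lin_pow act_lin[OF x(1)] act_pow_commute[OF x(1)])
      have TW: "T m ` W \<subseteq> W" for m unfolding T_def by (rule act_pow_in[OF W x(1)])
      have Tadd: "T (m + n) h = T m (T n h)" for m n h by (simp add: T_def funpow_add)
      have I: "submodule (T m ` W)" for m by (rule submodule_image[OF W T TW])
      have K: "submodule {w \<in> W. T m w = 0}" for m by (rule submodule_kernel[OF W T])
      \<comment> \<open>The images of the powers of \<open>x\<close> are stationary from the one of least dimension on.\<close>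
      obtain m0 where m0: "\<And>m. V.dim (T m0 ` W) \<le> V.dim (T m ` W)"
        using ex_has_least_nat[of "\<lambda>m. True" 0 "\<lambda>m. V.dim (T m ` W)"] by blast
      \<comment> \<open>A positive exponent, so that the power kills \<open>g\<close>.\<close>
      define m where "m = Suc m0"
      have sub: "T (m0 + j) ` W \<subseteq> T m0 ` W" for j
        using TW[of j] by (auto simp: Tadd)
      have st: "T (m0 + j) ` W = T m0 ` W" for j
        by (rule L.fin_dim_eqI[OF submoduleD(1)[OF I] submoduleD(2)[OF I] sub m0])
      have stm: "T (m + m) ` W = T m ` W"
        using st[of "m + 1"] st[of 1] by (simp add: m_def)
      have "T m g = 0"
      proof -
        have "act x g = 0"
        proof -
          obtain d where d: "act x w = scal H d w" using w(3) x(1) by blast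
          have "act x g = scal H d g" by (simp add: g_def lin_scal[OF act_lin[OF x(1)]] d mult.commute)
          moreover have "d = 0"
            using eps_act[OF x(1), of g] calculation eps_grouplike[OF g(1)] x(2) by (simp add: lin_scal[OF lin_counit])
          ultimately show ?thesis by simp
        qed
        then show ?thesis
          by (simp add: T_def m_def funpow_swap1 lin_zero[OF lin_pow[OF act_lin[OF x(1)]]])
      qed
      then have "T m ` W \<noteq> W"
        using L.onto_imp_no_kernel[OF submoduleD(1)[OF W], of "T m" g] g T(1)[of m]
        by (auto simp: lin_def Vector_Spaces.linear_iff scal_vector_space)
      then have dI: "V.dim (T m ` W) < V.dim W"
        using TW by (intro L.dim_psubset_fin_dim[OF submoduleD(1)[OF W] submoduleD(2)[OF I]]) blast
      have dK: "V.dim {w \<in> W. T m w = 0} < V.dim W"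
        using x(3) by (intro L.dim_psubset_fin_dim[OF submoduleD(1)[OF W] submoduleD(2)[OF K]]) (auto simp: T_def)
      show ?thesis
      proof
        fix v assume v: "v \<in> W"
        then have "T m v \<in> T (m + m) ` W" using stm by blast
        then obtain u where u: "u \<in> W" "T m v = T m (T m u)" by (auto simp: Tadd)
        have "v - T m u \<in> {w \<in> W. T m w = 0}"
          using u v TW[of m] V.subspace_diff[OF submoduleD(2)[OF W]] by (auto simp: lin_diff[OF T(1)])
        then have "v - T m u \<in> K" using less.hyps[OF dK K] by blast
        moreover have "T m u \<in> K" using less.hyps[OF dI I] u(1) by blast
        ultimately show "v \<in> K" using V.subspace_add[OF assms(2), of "v - T m u" "T m u"] by simp
      qed
    qed
  qed
qed

subsection \<open>The connected component\<close>

lemma act_primitive: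
  assumes "lin (*) x" "p \<in> primitives H" shows "act x p = scal H (x 1) p + scal H (x p) 1"
  unfolding act_def by (rule sw_primitive[OF assms(2) bilin_act[OF assms(1)]])

lemma primitives_subspace: "V.subspace (primitives H)"
proof (rule V.subspaceI)
  show "0 \<in> primitives H"
    by (rule primitivesI) (simp add: lin_zero[OF act_lin] lin_zero)
  show "a + b \<in> primitives H" if "a \<in> primitives H" "b \<in> primitives H" for a b
    by (rule primitivesI)
      (simp add: lin_add[OF act_lin] lin_add act_primitive that V.scale_left_distrib V.scale_right_distrib)
  show "scal H c a \<in> primitives H" if "a \<in> primitives H" for c a
    by (rule primitivesI)
      (simp add: lin_scal[OF act_lin] lin_scal act_primitive that V.scale_right_distrib mult.commute)
qed

lemma U_filt_mono: "m \<le> n \<Longrightarrow> U_filt H m \<subseteq> U_filt H n"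
  unfolding U_filt_def by (rule V.span_mono) (auto intro: order_trans)

lemma H_filt_mono: "m \<le> n \<Longrightarrow> H_filt H m \<subseteq> H_filt H n"
  unfolding H_filt_def using U_filt_mono by (intro V.span_mono) blast

definition U_all :: "'h set" where "U_all = (\<Union>n. U_filt H n)"
definition H_all :: "'h set" where "H_all = (\<Union>n. H_filt H n)"

lemma subspace_UN_mono:
  assumes "\<And>n. V.subspace (F n)" "\<And>m n. m \<le> n \<Longrightarrow> F m \<subseteq> F (n::nat)"
  shows "V.subspace (\<Union>n. F n)"
proof (rule V.subspaceI)
  show "0 \<in> (\<Union>n. F n)" using V.subspace_0[OF assms(1)] by blast
  fix a b assume "a \<in> (\<Union>n. F n)" "b \<in> (\<Union>n. F n)"
  then obtain m n where "a \<in> F m" "b \<in> F n" by blast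
  then have "a \<in> F (max m n)" "b \<in> F (max m n)"
    using assms(2)[of m "max m n"] assms(2)[of n "max m n"] by auto
  then show "a + b \<in> (\<Union>n. F n)" using V.subspace_add[OF assms(1)] by blast
next
  fix c a assume "a \<in> (\<Union>n. F n)"
  then show "scal H c a \<in> (\<Union>n. F n)" using V.subspace_scale[OF assms(1)] by blast
qed

lemma U_all_subspace: "V.subspace U_all"
  unfolding U_all_def by (rule subspace_UN_mono[OF _ U_filt_mono]) (simp add: U_filt_def)

lemma H_all_subspace: "V.subspace H_all"
  unfolding H_all_def by (rule subspace_UN_mono[OF _ H_filt_mono]) (simp add: H_filt_def)

lemma one_in_U_filt: "1 \<in> U_filt H n"
  unfolding U_filt_def by (rule V.span_base) (intro CollectI exI[of _ "[]"], simp)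

lemma prim_in_U_filt: assumes "p \<in> primitives H" shows "p \<in> U_filt H 1"
  unfolding U_filt_def by (rule V.span_base) (intro CollectI exI[of _ "[p]"], simp add: assms)

lemma U_all_mult_prim: assumes "u \<in> U_all" "p \<in> primitives H" shows "u * p \<in> U_all"
proof -
  obtain n where "u \<in> U_filt H n" using assms(1) by (auto simp: U_all_def)
  then have "u * p \<in> U_filt H (Suc n)"
    unfolding U_filt_def
  proof (induction u rule: V.span_induct_alt)
    case base
    show ?case by (simp add: V.span_zero)
  next
    case (step c x y)
    obtain ps where ps: "x = prod_list ps" "set ps \<subseteq> primitives H" "length ps \<le> n" using step(1) by blast
    have "x * p = prod_list (ps @ [p])" by (simp add: ps(1))
    then have "x * p \<in> V.span {prod_list ps |ps. set ps \<subseteq> primitives H \<and> length ps \<le> Suc n}"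
      by (intro V.span_base CollectI exI[of _ "ps @ [p]"]) (use ps assms(2) in auto)
    then show ?case using step(2)
      by (simp add: distrib_right V.span_add V.span_scale flip: scal_mult_left)
  qed
  then show ?thesis by (auto simp: U_all_def)
qed

lemma U_all_mult_grouplike: assumes "u \<in> U_all" "g \<in> grouplikes H" shows "u * g \<in> H_all"
proof -
  obtain n where "u \<in> U_filt H n" using assms(1) by (auto simp: U_all_def)
  then have "u * g \<in> H_filt H n"
    unfolding H_filt_def using V.span_base[OF assms(2)] by (intro V.span_base) blast
  then show ?thesis by (auto simp: H_all_def)
qed

lemma primitives_fin_dim: "L.fin_dim (primitives H)"
proof -
  obtain E where E: "finite E" "H_filt H 1 = V.span E" using finite_filt by blast
  have "primitives H \<subseteq> H_filt H 1"
  proof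
    fix p assume "p \<in> primitives H"
    then have "p * 1 \<in> {u * g |u g. u \<in> U_filt H 1 \<and> g \<in> V.span (grouplikes H)}"
      using prim_in_U_filt V.span_base[OF one_grouplike] by blast
    then show "p \<in> H_filt H 1" unfolding H_filt_def by (simp add: V.span_base)
  qed
  then show ?thesis
    unfolding L.fin_dim_def using primitives_subspace E by blast
qed

text \<open>
  The coordinates for the Euler operator. A multiple of the counit makes them vanish at \<open>1\<close> without
  changing them on primitive elements, where the counit is zero.
\<close>

lemma primitive_dual_basis:
  "\<exists>B \<xi>. finite B \<and> B \<subseteq> primitives H \<and> primitives H \<subseteq> V.span B \<and>
    (\<forall>p. lin (*) (\<xi> p) \<and> \<xi> p 1 = 0) \<and> (\<forall>p\<in>B. \<forall>q\<in>B. \<xi> p q = (if p = q then 1 else 0))"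
proof -
  obtain B where B: "{} \<subseteq> B" "B \<subseteq> primitives H" "V.independent B" "primitives H \<subseteq> V.span B" "finite B"
    "card B = V.dim (primitives H)"
    using L.fin_dim_basis[OF primitives_fin_dim empty_subsetI V.independent_empty] .
  define C where "C = V.extend_basis B"
  have C: "is_basis H C" "B \<subseteq> C"
    unfolding is_basis_def C_def
    using V.independent_extend_basis[OF B(3)] V.span_extend_basis[OF B(3)] V.extend_basis_superset[OF B(3)] by auto
  \<comment> \<open>The basis extends to one of \<open>H\<close>, whose coordinate functionals are then corrected at \<open>1\<close>.\<close>
  define \<xi> where "\<xi> p f = dual_vec H C p f - dual_vec H C p 1 * eps f" for p f
  show ?thesis
  proof (intro exI[of _ B] exI[of _ \<xi>] conjI allI ballI B)
    show "lin (*) (\<xi> p)" for p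
      unfolding \<xi>_def by (intro lin_minus dual_vec_lin[OF C(1)] lin_times_left lin_counit)
    show "\<xi> p 1 = 0" for p by (simp add: \<xi>_def counit_one)
    show "\<xi> p q = (if p = q then 1 else 0)" if "p \<in> B" "q \<in> B" for p q
    proof -
      have "eps q = 0" using that B(2) eps_primitive by blast
      moreover have "dual_vec H C p q = (if p = q then 1 else 0)"
        using V.representation_basis[OF basis_facts(1)[OF C(1)], of q] C(2) that(2) by (auto simp: dual_vec_def)
      ultimately show ?thesis by (simp add: \<xi>_def)
    qed
  qed
qed

lemma local_filt_one: assumes "h \<in> local_filt 1 (Suc 0)" shows "h = scal H (eps h) 1"
proof -
  have "x h = x (scal H (eps h) 1)" if x: "lin (*) x" for x
  proof -
    define y where "y f = x f - x 1 * eps f" for f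
    have y: "lin (*) y" "y 1 = 0"
      unfolding y_def by (intro lin_minus x lin_times_left lin_counit) (simp add: counit_one)
    have "act y h = 0" using local_filt_SucD[OF assms y] by simp
    then have "y h = 0" using eps_act[OF y(1), of h] lin_zero[OF lin_counit] by simp
    then show ?thesis by (simp add: y_def lin_scal[OF x] mult.commute)
  qed
  then have "h - scal H (eps h) 1 = 0"
    by (intro dual_separates) (simp add: lin_diff)
  then show ?thesis by simp
qed

text \<open>
  For \<open>y = x - x(1) \<epsilon>\<close> the element \<open>y h\<close> is a scalar, namely \<open>y(h)\<close>. This determines \<open>x h\<close> for every \<open>x\<close>, hence the
  coproduct of \<open>h\<close>.
\<close>

lemma local_filt_two: assumes "h \<in> local_filt 1 (Suc (Suc 0))" shows "h - scal H (eps h) 1 \<in> primitives H"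
proof (rule primitivesI)
  fix x :: "'h \<Rightarrow> 'k" assume x: "lin (*) x"
  define y where "y f = x f - x 1 * eps f" for f
  have y: "lin (*) y" "y 1 = 0"
    unfolding y_def by (intro lin_minus x lin_times_left lin_counit) (simp add: counit_one)
  have "act y h = scal H (eps (act y h)) 1" by (rule local_filt_one[OF local_filt_SucD[OF assms y]])
  then have "act y h = scal H (y h) 1" by (simp add: eps_act[OF y(1)])
  moreover have "x = (\<lambda>f. y f + x 1 * eps f)" by (auto simp: y_def)
  then have "act x h = act y h + scal H (x 1) h" by (metis act_plus act_times act_eps)
  ultimately have "act x h = scal H (y h) 1 + scal H (x 1) h" by simp
  then show "act x (h - scal H (eps h) 1) =
      scal H (x 1) (h - scal H (eps h) 1) + scal H (x (h - scal H (eps h) 1)) 1"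
    by (simp add: lin_diff[OF act_lin[OF x]] lin_scal[OF act_lin[OF x]] act_one[OF x] lin_diff[OF x] lin_scal[OF x]
        y_def V.scale_right_diff_distrib V.scale_left_diff_distrib mult.commute)
qed

text \<open>
  Functionals that vanish at \<open>1\<close> and on the primitive elements behave like elements of the square of the
  ideal of \<open>1\<close>, since by \<open>local_filt_two\<close> they kill the second step of the filtration.
\<close>

lemma local_filt_drop_two:
  assumes x: "lin (*) x" "x 1 = 0" "\<And>p. p \<in> primitives H \<Longrightarrow> x p = 0"
  shows "h \<in> local_filt 1 (Suc (Suc n)) \<Longrightarrow> act x h \<in> local_filt 1 n"
proof (induction n arbitrary: h)
  case 0
  let ?p = "h - scal H (eps h) 1"
  have p: "?p \<in> primitives H" by (rule local_filt_two[OF 0])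
  have "act x h = act x ?p + act x (scal H (eps h) 1)" by (simp flip: lin_add[OF act_lin[OF x(1)]])
  also have "\<dots> = 0"
    by (simp add: act_primitive[OF x(1) p] lin_scal[OF act_lin[OF x(1)]] act_one[OF x(1)] x(2) x(3)[OF p])
  finally show ?case by simp
next
  case (Suc n)
  show ?case
  proof (rule local_filt_SucI)
    fix y :: "'h \<Rightarrow> 'k" assume y: "lin (*) y" "y 1 = 0"
    show "act y (act x h) \<in> local_filt 1 n"
      unfolding act_commute[OF y(1) x(1)] by (rule Suc.IH[OF local_filt_SucD[OF Suc.prems y]])
  qed
qed

text \<open>
  The operator \<open>E\<close> below is the Euler vector field in the coordinates \<open>\<xi>\<close>; up to lower terms it
  multiplies elements of degree \<open>n\<close> by \<open>n\<close>. Since its values are combinations of products with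
  primitive elements, dividing by \<open>n\<close> shows by induction that everything is generated by them.
\<close>

lemma euler_operator:
  fixes \<xi> :: "'h \<Rightarrow> 'h \<Rightarrow> 'k"
  assumes B: "finite B" "B \<subseteq> primitives H" "primitives H \<subseteq> V.span B"
    and \<xi>: "\<And>p. lin (*) (\<xi> p)" "\<And>p. \<xi> p 1 = 0" "\<And>p q. p \<in> B \<Longrightarrow> q \<in> B \<Longrightarrow> \<xi> p q = (if p = q then 1 else 0)"
  defines "E \<equiv> \<lambda>h. \<Sum>p\<in>B. act (\<xi> p) h * p"
  shows "h \<in> local_filt 1 (Suc n) \<Longrightarrow> E h - scal H (of_nat n) h \<in> local_filt 1 n"
proof (induction n arbitrary: h)
  case 0
  have "act (\<xi> p) h = 0" for p using local_filt_SucD[OF 0 \<xi>(1,2)] by simp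
  then show ?case by (simp add: E_def)
next
  case (Suc n)
  note sub = local_filt_subspace[of 1 n]
  show ?case
  proof (rule local_filt_SucI)
    fix x :: "'h \<Rightarrow> 'k" assume x: "lin (*) x" "x 1 = 0"
    \<comment> \<open>The corrections make \<open>y\<close> vanish at \<open>1\<close> and \<open>x'\<close> on the primitive elements.\<close>
    define y where "y p f = x (f * p) - x p * eps f" for p f
    define x' where "x' f = x f - (\<Sum>p\<in>B. x p * \<xi> p f)" for f
    have l: "lin (*) (\<lambda>f. x (f * p))" for p by (rule lin_comp[OF x(1) lin_mult_right[OF lin_id]])
    have y: "lin (*) (y p)" "y p 1 = 0" for p
      unfolding y_def by (intro lin_minus l lin_times_left lin_counit) (simp add: counit_one)
    have x': "lin (*) x'" unfolding x'_def
      by (intro lin_minus x(1) lin_sum_fun lin_times_left \<xi>(1))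
    have x'1: "x' 1 = 0" by (simp add: x'_def x(2) \<xi>(2))
    have x'B: "x' q = 0" if "q \<in> B" for q
    proof -
      have "(\<Sum>p\<in>B. x p * \<xi> p q) = (\<Sum>p\<in>B. if p = q then x p else 0)"
        by (rule sum.cong) (simp_all add: \<xi>(3) that)
      then show ?thesis by (simp add: x'_def that B(1))
    qed
    have x'P: "x' q = 0" if "q \<in> primitives H" for q
    proof -
      have "q \<in> V.span B" using that B(3) by blast
      then show ?thesis
        by (induction q rule: V.span_induct_alt) (simp_all add: lin_zero[OF x'] lin_add[OF x'] lin_scal[OF x'] x'B)
    qed
    have a1: "act x (act (\<xi> p) h * p) = act (\<xi> p) (act x h) * p + scal H (x p) (act (\<xi> p) h) + act (y p) (act (\<xi> p) h)"
      if "p \<in> B" for p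
    proof -
      have "act (\<lambda>f. x (f * p)) k = act (y p) k + scal H (x p) k" for k
      proof -
        have "(\<lambda>f. x (f * p)) = (\<lambda>f. y p f + x p * eps f)" by (auto simp: y_def)
        then show ?thesis by (simp only: act_plus act_times act_eps)
      qed
      moreover have "p \<in> primitives H" using that B(2) by blast
      ultimately show ?thesis
        by (simp add: act_mult_primitive[OF x(1)] act_commute[OF x(1) \<xi>(1)] add.assoc add.commute)
    qed
    have a2: "(\<Sum>p\<in>B. scal H (x p) (act (\<xi> p) h)) = act x h - act x' h"
    proof -
      have "x = (\<lambda>f. x' f + (\<Sum>p\<in>B. x p * \<xi> p f))" by (auto simp: x'_def)
      then have "act x h = act (\<lambda>f. x' f + (\<Sum>p\<in>B. x p * \<xi> p f)) h" by simp
      also have "\<dots> = act x' h + (\<Sum>p\<in>B. scal H (x p) (act (\<xi> p) h))"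
        by (simp only: act_plus act_sum act_times)
      finally show ?thesis by simp
    qed
    have "act x (E h) = (\<Sum>p\<in>B. act x (act (\<xi> p) h * p))"
      unfolding E_def by (rule lin_sum[OF act_lin[OF x(1)]])
    also have "\<dots> = (\<Sum>p\<in>B. act (\<xi> p) (act x h) * p + scal H (x p) (act (\<xi> p) h) + act (y p) (act (\<xi> p) h))"
      by (rule sum.cong[OF refl a1])
    also have "\<dots> = E (act x h) + (act x h - act x' h) + (\<Sum>p\<in>B. act (y p) (act (\<xi> p) h))"
      by (simp add: sum.distrib a2 E_def)
    finally have aE: "act x (E h) = \<dots>" .
    have "act x (scal H (of_nat (Suc n)) h) = act x h + scal H (of_nat n) (act x h)"
      by (simp add: lin_add[OF act_lin[OF x(1)]] lin_scal[OF act_lin[OF x(1)]] V.scale_left_distrib)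
    then have "act x (E h - scal H (of_nat (Suc n)) h) =
        (E (act x h) - scal H (of_nat n) (act x h)) - act x' h + (\<Sum>p\<in>B. act (y p) (act (\<xi> p) h))"
      by (simp only: lin_diff[OF act_lin[OF x(1)]] aE) (simp only: algebra_simps)
    moreover have "E (act x h) - scal H (of_nat n) (act x h) \<in> local_filt 1 n"
      by (rule Suc.IH[OF local_filt_SucD[OF Suc.prems x]])
    moreover have "act x' h \<in> local_filt 1 n"
      by (rule local_filt_drop_two[OF x' x'1 x'P Suc.prems])
    moreover have "(\<Sum>p\<in>B. act (y p) (act (\<xi> p) h)) \<in> local_filt 1 n"
      by (rule V.subspace_sum[OF sub])
        (rule local_filt_SucD[OF local_filt_SucD[OF Suc.prems \<xi>(1,2)] y])
    ultimately show "act x (E h - scal H (of_nat (Suc n)) h) \<in> local_filt 1 n"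
      by (simp only:) (rule V.subspace_add[OF sub V.subspace_diff[OF sub]])
  qed
qed

lemma local_filt_one_generated: "h \<in> local_filt 1 n \<Longrightarrow> h \<in> U_all"
proof (induction n arbitrary: h)
  case 0
  then show ?case using V.subspace_0[OF U_all_subspace] by simp
next
  case (Suc n)
  note sub = U_all_subspace
  obtain B \<xi> where B: "finite B" "B \<subseteq> primitives H" "primitives H \<subseteq> V.span B"
    and \<xi>: "\<And>p. lin (*) (\<xi> p)" "\<And>p. \<xi> p 1 = 0" "\<And>p q. p \<in> B \<Longrightarrow> q \<in> B \<Longrightarrow> \<xi> p q = (if p = q then 1 else 0)"
  proof -
    obtain B \<xi> where "finite B" "B \<subseteq> primitives H" "primitives H \<subseteq> V.span B"
      "\<forall>p. lin (*) (\<xi> p) \<and> \<xi> p 1 = 0" "\<forall>p\<in>B. \<forall>q\<in>B. \<xi> p q = (if p = q then 1 else 0)"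
      using primitive_dual_basis by (elim exE conjE)
    then show ?thesis by (intro that[of B \<xi>]) blast+
  qed
  define E where "E h = (\<Sum>p\<in>B. act (\<xi> p) h * p)" for h
  show ?case
  proof (cases "n = 0")
    case True
    have "h = scal H (eps h) 1" using local_filt_one Suc.prems True by simp
    moreover have "1 \<in> U_all" using one_in_U_filt by (auto simp: U_all_def)
    ultimately show ?thesis using V.subspace_scale[OF sub] by metis
  next
    case False
    have "E h - scal H (of_nat n) h \<in> local_filt 1 n"
      unfolding E_def by (rule euler_operator[OF B \<xi> Suc.prems])
    then have 1: "E h - scal H (of_nat n) h \<in> U_all" by (rule Suc.IH)
    have 2: "E h \<in> U_all"
      unfolding E_def
    proof (rule V.subspace_sum[OF sub])
      fix p assume "p \<in> B"
      then have "p \<in> primitives H" using B(2) by blast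
      then show "act (\<xi> p) h * p \<in> U_all"
        by (rule U_all_mult_prim[OF Suc.IH[OF local_filt_SucD[OF Suc.prems \<xi>(1,2)]]])
    qed
    have "h = scal H (1 / of_nat n) (E h - (E h - scal H (of_nat n) h))"
      using False by simp
    moreover have "scal H (1 / of_nat n) (E h - (E h - scal H (of_nat n) h)) \<in> U_all"
      by (rule V.subspace_scale[OF sub V.subspace_diff[OF sub 2 1]])
    ultimately show ?thesis by metis
  qed
qed

text \<open>This combines the decomposition at group-like elements, translation to \<open>1\<close>, and generation by primitive elements there.\<close>

theorem H_filt_exhausts: "\<exists>n. h \<in> H_filt H n"
proof -
  have "local_filt g n \<subseteq> H_all" if g: "g \<in> grouplikes H" for g n
  proof
    fix h assume "h \<in> local_filt g n"
    then have "h * anti g \<in> U_all"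
      by (intro local_filt_one_generated local_filt_translate[OF g])
    then have "h * anti g * g \<in> H_all" by (rule U_all_mult_grouplike[OF _ g])
    then show "h \<in> H_all" by (simp add: mult.assoc anti_grouplike[OF g])
  qed
  moreover obtain W where "submodule W" "h \<in> W" using submodule_generated by blast
  ultimately have "h \<in> H_all" using submodule_decomposition[OF _ H_all_subspace] by blast
  then show ?thesis by (auto simp: H_all_def)
qed

end

section \<open>Balanced tensor products\<close>

lemma left_moduleD:
  assumes "left_module M"
  shows "abelian_group M" "a \<in> carrier M \<Longrightarrow> r \<odot>\<^bsub>M\<^esub> a \<in> carrier M"
    "a \<in> carrier M \<Longrightarrow> b \<in> carrier M \<Longrightarrow> r \<odot>\<^bsub>M\<^esub> (a \<oplus>\<^bsub>M\<^esub> b) = r \<odot>\<^bsub>M\<^esub> a \<oplus>\<^bsub>M\<^esub> r \<odot>\<^bsub>M\<^esub> b"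
    "a \<in> carrier M \<Longrightarrow> (r + s) \<odot>\<^bsub>M\<^esub> a = r \<odot>\<^bsub>M\<^esub> a \<oplus>\<^bsub>M\<^esub> s \<odot>\<^bsub>M\<^esub> a"
    "a \<in> carrier M \<Longrightarrow> (r * s) \<odot>\<^bsub>M\<^esub> a = r \<odot>\<^bsub>M\<^esub> (s \<odot>\<^bsub>M\<^esub> a)"
    "a \<in> carrier M \<Longrightarrow> 1 \<odot>\<^bsub>M\<^esub> a = a"
  using assms unfolding left_module_def by simp_all

locale tprod_data =
  fixes A :: "('a, 'x) ring_scheme" and ra :: "'a \<Rightarrow> 'r::ring_1 \<Rightarrow> 'a" and M :: "('r, 'm, 'y) module_scheme"
  assumes A: "abelian_group A" and M: "left_module M"
    and ra: "a \<in> carrier A \<Longrightarrow> ra a r \<in> carrier A"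
begin

interpretation A: abelian_group A by (rule A)
interpretation M: abelian_group M by (rule left_moduleD(1)[OF M])

definition balanced :: "('g, 'z) ring_scheme \<Rightarrow> ('a \<Rightarrow> 'm \<Rightarrow> 'g) \<Rightarrow> bool" where
  "balanced G \<phi> \<longleftrightarrow> biadditive A M G \<phi> \<and>
     (\<forall>a\<in>carrier A. \<forall>m\<in>carrier M. \<forall>r. \<phi> (ra a r) m = \<phi> a (r \<odot>\<^bsub>M\<^esub> m))"

lemma balancedI:
  assumes "biadditive A M G \<phi>"
    "\<And>a m r. a \<in> carrier A \<Longrightarrow> m \<in> carrier M \<Longrightarrow> \<phi> (ra a r) m = \<phi> a (r \<odot>\<^bsub>M\<^esub> m)"
  shows "balanced G \<phi>"
  using assms by (simp add: balanced_def)

lemma balancedD: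
  assumes "balanced G \<phi>"
  shows "biadditive A M G \<phi>"
    "a \<in> carrier A \<Longrightarrow> m \<in> carrier M \<Longrightarrow> \<phi> (ra a r) m = \<phi> a (r \<odot>\<^bsub>M\<^esub> m)"
  using assms by (simp_all add: balanced_def)

lemma presented_tprod: "presented (tprod A ra la M) (carrier A \<times> carrier M) (tprod_rels A ra M)"
proof (rule presented_group_presented)
  fix r assume "r \<in> tprod_rels A ra M"
  then show "Poly_Mapping.keys r \<subseteq> carrier A \<times> carrier M"
    unfolding tprod_rels_def
    by (elim UnE CollectE exE conjE) (simp_all add: keys_diff2 ra left_moduleD(2)[OF M])
qed (simp_all add: tprod_def tprod_group_def)

lemmas tprod_abelian_group = presented_abelian_group[OF presented_tprod]

lemma lift_relator:
  assumes G: "abelian_group G" and \<phi>: "balanced G \<phi>" and r: "r \<in> tprod_rels A ra M"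
  shows "formal_sum G (\<lambda>(a, m). \<phi> a m) r = \<zero>\<^bsub>G\<^esub>"
proof -
  interpret G: abelian_group G by (rule G)
  note b = balancedD[OF \<phi>] and sm = left_moduleD(2)[OF M]
  note cl = biadditiveD(3)[OF b(1)]
  let ?\<phi> = "\<lambda>(a, m). \<phi> a m"
  from r show ?thesis
    unfolding tprod_rels_def
  proof (elim UnE CollectE exE conjE)
    fix a a' m assume a: "a \<in> carrier A" "a' \<in> carrier A" "m \<in> carrier M"
      and r: "r = frag_of (a \<oplus>\<^bsub>A\<^esub> a', m) - frag_of (a, m) - frag_of (a', m)"
    show ?thesis unfolding r
      by (rule G.formal_sum_diff_of2[of ?\<phi>])
        (simp_all only: split_conv cl[OF A.a_closed[OF a(1,2)] a(3)] cl[OF a(1,3)] cl[OF a(2,3)]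
          G.a_closed[OF cl[OF a(1,3)] cl[OF a(2,3)]] additive_add[OF biadditiveD(2)[OF b(1) a(3)] a(1,2)])
  next
    fix a m m' assume a: "a \<in> carrier A" "m \<in> carrier M" "m' \<in> carrier M"
      and r: "r = frag_of (a, m \<oplus>\<^bsub>M\<^esub> m') - frag_of (a, m) - frag_of (a, m')"
    show ?thesis unfolding r
      by (rule G.formal_sum_diff_of2[of ?\<phi>])
        (simp_all only: split_conv cl[OF a(1) M.a_closed[OF a(2,3)]] cl[OF a(1,2)] cl[OF a(1,3)]
          G.a_closed[OF cl[OF a(1,2)] cl[OF a(1,3)]] additive_add[OF biadditiveD(1)[OF b(1) a(1)] a(2,3)])
  next
    fix a h m assume a: "a \<in> carrier A" "m \<in> carrier M"
      and r: "r = frag_of (ra a h, m) - frag_of (a, h \<odot>\<^bsub>M\<^esub> m)"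
    show ?thesis unfolding r
      by (rule G.formal_sum_diff_of[of ?\<phi>])
        (simp_all only: split_conv b(2)[OF a] cl[OF a(1) sm[OF a(2)]])
  qed
qed

lemma
  assumes G: "abelian_group G" and \<phi>: "balanced G \<phi>"
  shows lift_additive: "additive_map (tprod A ra la M) G (frag_lift G (\<lambda>(a, m). \<phi> a m))"
    and lift_pure: "a \<in> carrier A \<Longrightarrow> m \<in> carrier M \<Longrightarrow>
      frag_lift G (\<lambda>(a, m). \<phi> a m) (tprod_pure A ra M a m) = \<phi> a m"
proof -
  let ?\<phi> = "\<lambda>(a, m). \<phi> a m"
  have 1: "?\<phi> b \<in> carrier G" if "b \<in> carrier A \<times> carrier M" for b
    using that biadditiveD(3)[OF balancedD(1)[OF \<phi>]] by (cases b) simp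
  have 2: "formal_sum G ?\<phi> r = \<zero>\<^bsub>G\<^esub>" if "r \<in> tprod_rels A ra M" for r
    by (rule lift_relator[OF G \<phi> that])
  show "additive_map (tprod A ra la M) G (frag_lift G ?\<phi>)"
    by (rule frag_lift_additive[where \<phi> = ?\<phi>, OF presented_tprod G]) (erule 1, erule 2)
  assume am: "a \<in> carrier A" "m \<in> carrier M"
  then have m: "(a, m) \<in> carrier A \<times> carrier M" by simp
  have "frag_lift G ?\<phi> (frag_class (tprod_rels A ra M) (frag_of (a, m))) = ?\<phi> (a, m)"
  proof (rule frag_lift_gen[of "tprod A ra la M" "carrier A \<times> carrier M" "tprod_rels A ra M" G ?\<phi> "(a, m)"])
    show "presented (tprod A ra la M) (carrier A \<times> carrier M) (tprod_rels A ra M)" by (rule presented_tprod)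
    show "?\<phi> b \<in> carrier G" if "b \<in> carrier A \<times> carrier M" for b by (rule 1[OF that])
    show "formal_sum G ?\<phi> r = \<zero>\<^bsub>G\<^esub>" if "r \<in> tprod_rels A ra M" for r by (rule 2[OF that])
  qed (rule G m)+
  then show "frag_lift G ?\<phi> (tprod_pure A ra M a m) = \<phi> a m"
    by (simp add: tprod_pure_def)
qed

lemma pure_closed:
  assumes "a \<in> carrier A" "m \<in> carrier M" shows "tprod_pure A ra M a m \<in> carrier (tprod A ra la M)"
  unfolding tprod_pure_def by (rule presented_class[OF presented_tprod]) (simp add: assms)

lemma pure_balanced: "balanced (tprod A ra la M) (tprod_pure A ra M)"
proof -
  let ?T = "tprod A ra la M" and ?c = "frag_class (tprod_rels A ra M)"
  have add: "?c u = ?c v \<oplus>\<^bsub>?T\<^esub> ?c w" if "u - v - w \<in> tprod_rels A ra M" for u v w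
  proof -
    have "u - (v + w) \<in> frag.span (tprod_rels A ra M)"
      using that by (simp only: diff_diff_add frag.span_base)
    then have "?c u = ?c (v + w)" by (simp only: frag_class_eq_iff)
    also have "\<dots> = ?c v \<oplus>\<^bsub>?T\<^esub> ?c w" by (rule presented_add[OF presented_tprod, symmetric])
    finally show ?thesis .
  qed
  show ?thesis
  proof (rule balancedI, rule biadditiveI)
    fix a assume a: "a \<in> carrier A"
    show "additive_map M ?T (tprod_pure A ra M a)"
    proof (rule additiveI)
      fix m m' assume m: "m \<in> carrier M"
      show "tprod_pure A ra M a m \<in> carrier ?T" by (rule pure_closed[OF a m])
      assume "m' \<in> carrier M"
      then show "tprod_pure A ra M a (m \<oplus>\<^bsub>M\<^esub> m') = tprod_pure A ra M a m \<oplus>\<^bsub>?T\<^esub> tprod_pure A ra M a m'"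
        unfolding tprod_pure_def using a m by (intro add) (unfold tprod_rels_def, blast)
    qed
  next
    fix m assume m: "m \<in> carrier M"
    show "additive_map A ?T (\<lambda>a. tprod_pure A ra M a m)"
    proof (rule additiveI)
      fix a a' assume a: "a \<in> carrier A"
      show "tprod_pure A ra M a m \<in> carrier ?T" by (rule pure_closed[OF a m])
      assume "a' \<in> carrier A"
      then show "tprod_pure A ra M (a \<oplus>\<^bsub>A\<^esub> a') m = tprod_pure A ra M a m \<oplus>\<^bsub>?T\<^esub> tprod_pure A ra M a' m"
        unfolding tprod_pure_def using a m by (intro add) (unfold tprod_rels_def, blast)
    qed
  next
    fix a m r assume "a \<in> carrier A" "m \<in> carrier M"
    then have "frag_of (ra a r, m) - frag_of (a, r \<odot>\<^bsub>M\<^esub> m) \<in> tprod_rels A ra M"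
      unfolding tprod_rels_def by blast
    then show "tprod_pure A ra M (ra a r) m = tprod_pure A ra M a (r \<odot>\<^bsub>M\<^esub> m)"
      unfolding tprod_pure_def by (simp only: frag_class_eq_iff frag.span_base)
  qed
qed

lemmas pure_biadditive = balancedD(1)[OF pure_balanced]
lemmas pure_ract = balancedD(2)[OF pure_balanced]

lemma eq_on_pure:
  assumes "abelian_group G" "additive_map (tprod A ra la M) G f" "additive_map (tprod A ra la M) G g"
    and "\<And>a m. a \<in> carrier A \<Longrightarrow> m \<in> carrier M \<Longrightarrow> f (tprod_pure A ra M a m) = g (tprod_pure A ra M a m)"
    and "U \<in> carrier (tprod A ra la M)"
  shows "f U = g U"
proof (rule additive_eq_on_generators[OF presented_tprod assms(1-3) _ assms(5)])
  fix b assume "b \<in> carrier A \<times> carrier M"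
  then obtain a m where b: "b = (a, m)" "a \<in> carrier A" "m \<in> carrier M" by blast
  show "f (frag_class (tprod_rels A ra M) (frag_of b)) = g (frag_class (tprod_rels A ra M) (frag_of b))"
    using assms(4)[OF b(2,3)] by (simp only: tprod_pure_def b(1))
qed

lemma
  assumes la: "additive_map A A (la s)" "\<And>a r. a \<in> carrier A \<Longrightarrow> la s (ra a r) = ra (la s a) r"
  shows smult_additive: "additive_map (tprod A ra la M) (tprod A ra la M) (smult (tprod A ra la M) s)"
    and smult_pure: "a \<in> carrier A \<Longrightarrow> m \<in> carrier M \<Longrightarrow>
      s \<odot>\<^bsub>tprod A ra la M\<^esub> tprod_pure A ra M a m = tprod_pure A ra M (la s a) m"
proof -
  let ?T = "tprod A ra la M"
  have "smult ?T s = frag_lift (tprod_group A ra M) (\<lambda>(a, m). tprod_pure A ra M (la s a) m)"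
    by (simp add: tprod_def)
  also have "frag_lift (tprod_group A ra M) = frag_lift ?T"
    by (rule add_monoid_cong(2)) (simp_all add: tprod_def)
  finally have eq: "smult ?T s = frag_lift ?T (\<lambda>(a, m). tprod_pure A ra M (la s a) m)" .
  have b: "balanced ?T (\<lambda>a m. tprod_pure A ra M (la s a) m)"
  proof (rule balancedI, rule biadditiveI)
    show "additive_map M ?T (tprod_pure A ra M (la s a))" if "a \<in> carrier A" for a
      by (rule biadditiveD(1)[OF pure_biadditive additive_closed[OF la(1) that]])
    show "additive_map A ?T (\<lambda>a. tprod_pure A ra M (la s a) m)" if "m \<in> carrier M" for m
      by (rule additive_comp[OF la(1) biadditiveD(2)[OF pure_biadditive that]])
    show "tprod_pure A ra M (la s (ra a r)) m = tprod_pure A ra M (la s a) (r \<odot>\<^bsub>M\<^esub> m)"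
      if "a \<in> carrier A" "m \<in> carrier M" for a m r
      unfolding la(2)[OF that(1)] by (rule pure_ract[OF additive_closed[OF la(1) that(1)] that(2)])
  qed
  show "additive_map ?T ?T (smult ?T s)"
    unfolding eq by (rule lift_additive[OF tprod_abelian_group b])
  show "s \<odot>\<^bsub>?T\<^esub> tprod_pure A ra M a m = tprod_pure A ra M (la s a) m" if "a \<in> carrier A" "m \<in> carrier M"
    unfolding eq by (rule lift_pure[where \<phi> = "\<lambda>a m. tprod_pure A ra M (la s a) m", OF tprod_abelian_group b that])
qed

end

section \<open>The modules of pseudobracket values\<close>

context cocommutative_hopf_algebra
begin

lemma frag_lift_pure_id: assumes "t \<in> carrier (tpow H n)" shows "frag_lift (tpow H n) (pure H) t = t"
proof (rule tensor_eq_on_pure[OF tpow_abelian_group tensor_lift_additive[OF tpow_abelian_group pure_multilinear] _ _ assms])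
  show "additive_map (tpow H n) (tpow H n) (\<lambda>t. t)" by (simp add: additive_map_def)
  show "frag_lift (tpow H n) (pure H) (pure H xs) = pure H xs" if "length xs = n" for xs
    by (rule tensor_lift_pure[where \<tau> = "pure H", OF tpow_abelian_group pure_multilinear that])
qed

declare comult_iter.simps(2) [simp del]

lemma comult_iter_1: "comult_iter H 1 h = comult H h"
proof -
  define \<tau> where "\<tau> xs = frag_lift (tpow H 2) (\<lambda>ys. pure H (ys @ tl xs)) (comult H (hd xs))" for xs
  have \<tau>: "\<tau> [a] = comult H a" for a
    by (simp add: \<tau>_def frag_lift_pure_id comult_closed)
  have s: "xs = [xs ! 0]" if "length xs = 1" for xs :: "'h list"
    using that by (cases xs) auto
  have "multilinear H 1 (tpow H 2) \<tau>"
  proof (rule multilinearI)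
    fix xs :: "'h list" and i assume xs: "length xs = 1" and i: "i < (1::nat)"
    have u: "xs[i := w] = [w]" for w using s[OF xs] i by (metis list_update_code(2) less_one)
    show "\<tau> (xs[i := u + v]) = \<tau> (xs[i := u]) \<oplus>\<^bsub>tpow H 2\<^esub> \<tau> (xs[i := v])" for u v
      by (simp only: u \<tau> comult_add)
    show "\<tau> (xs[i := scal H c (xs ! i)]) = \<tau> (xs[j := scal H c (xs ! j)])" if "j < 1" for j c
      using i that by simp
  next
    fix xs :: "'h list" assume "length xs = 1"
    then show "\<tau> xs \<in> carrier (tpow H 2)" using s[of xs] \<tau>[of "xs ! 0"] comult_closed by metis
  qed
  then have "frag_lift (tpow H 2) \<tau> (pure H [h]) = \<tau> [h]"
    by (rule tensor_lift_pure[OF tpow_abelian_group]) simp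
  then have "frag_lift (tpow H (0 + 2)) \<tau> (comult_iter H 0 h) = comult H h"
    by (simp only: \<tau> comult_iter.simps(1) add_0)
  then show ?thesis by (simp only: One_nat_def comult_iter.simps(2) \<tau>_def[abs_def] add_0)
qed

lemma tcat_21_single:
  assumes "s \<in> carrier (tpow H 2)"
  shows "tcat H 2 1 s (pure H [b]) = frag_lift (tpow H 3) (\<lambda>xs. pure H (xs @ [b])) s"
proof -
  have in3: "frag_lift (tpow H (2 + 1)) (\<lambda>ys. pure H (xs @ ys)) (pure H [b]) = pure H (xs @ [b])"
    if "length xs = 2" for xs :: "'h list"
    by (rule tensor_lift_pure[where \<tau> = "\<lambda>ys. pure H (xs @ ys)", OF tpow_abelian_group multilinear_append(2)[OF that]]) simp
  have e: "(2::nat) + 1 = 3" by simp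
  show ?thesis
    unfolding tcat_def e
    by (rule frag_lift_cong[OF tpow_presented tpow_abelian_group _ assms])
      (simp_all add: in3[unfolded e] pure_closed)
qed

lemma comult_iter_2: "comult_iter H 2 h = comult_id H (comult H h)"
proof -
  have e: "(2::nat) = Suc 1" "1 + 2 = (3::nat)" by simp_all
  have "comult_iter H 2 h = frag_lift (tpow H 3)
      (\<lambda>xs. frag_lift (tpow H 3) (\<lambda>ys. pure H (ys @ tl xs)) (comult H (hd xs))) (comult H h)"
    by (subst e(1)) (simp only: comult_iter.simps(2) comult_iter_1 e(2))
  also have "\<dots> = comult_id H (comult H h)"
    unfolding comult_id_def
  proof (rule frag_lift_cong[OF tpow_presented tpow_abelian_group _ comult_closed])
    fix xs :: "'h list" assume "xs \<in> {xs. length xs = 2}"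
    then have l: "length xs = 2" by simp
    have "hd xs = xs ! 0 \<and> tl xs = [xs ! 1]" by (subst (1 3) length2[OF l]) simp
    then show *: "frag_lift (tpow H 3) (\<lambda>ys. pure H (ys @ tl xs)) (comult H (hd xs)) =
        tcat H 2 1 (comult H (xs ! 0)) (pure H [xs ! 1])"
      by (simp only: tcat_21_single[OF comult_closed] simp_thms)
    show "frag_lift (tpow H 3) (\<lambda>ys. pure H (ys @ tl xs)) (comult H (hd xs)) \<in> carrier (tpow H 3)"
      unfolding * by (rule biadditiveD(3)[OF tcat_21_biadditive comult_closed]) (simp add: pure_closed)
  qed
  finally show ?thesis .
qed

lemma comult_iter_pred: "comult_iter H (2 - 1) h = comult H h" "comult_iter H (3 - 1) h = comult_id H (comult H h)"
proof -
  have "(2::nat) - 1 = 1" "(3::nat) - 1 = 2" by simp_all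
  then show "comult_iter H (2 - 1) h = comult H h" "comult_iter H (3 - 1) h = comult_id H (comult H h)"
    by (simp_all only: comult_iter_1 comult_iter_2)
qed

lemma ract_2: "tpow_ract H 2 t h = t \<otimes>\<^bsub>tpow H 2\<^esub> comult H h"
  by (simp only: tpow_ract_def comult_iter_pred)

lemma ract_3: "tpow_ract H 3 t h = t \<otimes>\<^bsub>tpow H 3\<^esub> comult_id H (comult H h)"
  by (simp only: tpow_ract_def comult_iter_pred)

lemma comult_iter_closed: assumes "n \<in> {2, 3}" shows "comult_iter H (n - 1) h \<in> carrier (tpow H n)"
proof -
  have "n = 2 \<or> n = 3" using assms by simp
  then show ?thesis
    by (elim disjE) (simp_all only: comult_iter_pred comult_closed additive_closed[OF comult_id_additive comult_closed])
qed

text \<open>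
  Multiplicativity of these maps makes the iterated brackets compatible with the right action of \<open>H\<close> on
  the third tensor power.
\<close>

lemma tcat_mult:
  assumes s: "s \<in> carrier (tpow H m)" "s' \<in> carrier (tpow H m)" and t: "t \<in> carrier (tpow H n)" "t' \<in> carrier (tpow H n)"
  shows "tcat H m n (s \<otimes>\<^bsub>tpow H m\<^esub> s') (t \<otimes>\<^bsub>tpow H n\<^esub> t') =
    tcat H m n s t \<otimes>\<^bsub>tpow H (m + n)\<^esub> tcat H m n s' t'"
proof -
  let ?m = "\<lambda>n. mult (tpow H n)" and ?c = "tcat H m n" and ?N = "m + n"
  note ag = tpow_abelian_group[of H ?N]
  note mulL = biadditiveD(1)[OF tmult_biadditive] and mulR = biadditiveD(2)[OF tmult_biadditive]
  note catL = biadditiveD(1)[OF tcat_biadditive] and catR = biadditiveD(2)[OF tcat_biadditive]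
  note cl = pure_closed tmult_closed biadditiveD(3)[OF tcat_biadditive]
  have 1: "?c (?m m (pure H xs) (pure H xs')) (?m n (pure H ys) (pure H ys')) =
      ?m ?N (?c (pure H xs) (pure H ys)) (?c (pure H xs') (pure H ys'))"
    if "length xs = m" "length xs' = m" "length ys = n" "length ys' = n" for xs xs' ys ys'
    using that by (simp add: tmult_pure tcat_pure)
  have 2: "?c (?m m (pure H xs) (pure H xs')) (?m n (pure H ys) t') =
      ?m ?N (?c (pure H xs) (pure H ys)) (?c (pure H xs') t')"
    if "length xs = m" "length xs' = m" "length ys = n" for xs xs' ys
    by (rule tensor_eq_on_pure[OF ag additive_comp[OF mulL catL] additive_comp[OF catL mulL] _ t(2)])
      (use that in \<open>simp_all add: 1 cl\<close>)
  have 3: "?c (?m m (pure H xs) (pure H xs')) (?m n t t') = ?m ?N (?c (pure H xs) t) (?c (pure H xs') t')"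
    if "length xs = m" "length xs' = m" for xs xs'
    by (rule tensor_eq_on_pure[OF ag additive_comp[OF mulR catL] additive_comp[OF catL mulR] _ t(1)])
      (use that t in \<open>simp_all add: 2 cl\<close>)
  have 4: "?c (?m m (pure H xs) s') (?m n t t') = ?m ?N (?c (pure H xs) t) (?c s' t')"
    if "length xs = m" for xs
    by (rule tensor_eq_on_pure[OF ag additive_comp[OF mulL catR] additive_comp[OF catR mulL] _ s(2)])
      (use that t in \<open>simp_all add: 3 cl\<close>)
  show ?thesis
    by (rule tensor_eq_on_pure[OF ag additive_comp[OF mulR catR] additive_comp[OF catR mulR] _ s(1)])
      (use s t in \<open>simp_all add: 4 cl\<close>)
qed

lemma pure1_closed: "pure H [b] \<in> carrier (tpow H 1)" by (simp add: pure_closed)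

lemma pure1_mult: "pure H [a] \<otimes>\<^bsub>tpow H 1\<^esub> pure H [b] = pure H [a * b]"
  by (simp add: tmult_pure)

lemma tcat_21_mult:
  "s \<in> carrier (tpow H 2) \<Longrightarrow> s' \<in> carrier (tpow H 2) \<Longrightarrow>
   tcat H 2 1 s (pure H [a]) \<otimes>\<^bsub>tpow H 3\<^esub> tcat H 2 1 s' (pure H [b]) =
   tcat H 2 1 (s \<otimes>\<^bsub>tpow H 2\<^esub> s') (pure H [a * b])"
  using tcat_mult[of s 2 s' "pure H [a]" 1 "pure H [b]"] pure1_closed by (simp add: pure1_mult[unfolded One_nat_def] numeral_3_eq_3)

lemma tcat_12_mult:
  "s \<in> carrier (tpow H 2) \<Longrightarrow> s' \<in> carrier (tpow H 2) \<Longrightarrow>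
   tcat H 1 2 (pure H [a]) s \<otimes>\<^bsub>tpow H 3\<^esub> tcat H 1 2 (pure H [b]) s' =
   tcat H 1 2 (pure H [a * b]) (s \<otimes>\<^bsub>tpow H 2\<^esub> s')"
  using tcat_mult[of "pure H [a]" 1 "pure H [b]" s 2 s'] pure1_closed by (simp add: pure1_mult[unfolded One_nat_def] numeral_3_eq_3)

lemma mult_preserving:
  assumes F: "additive_map (tpow H n) (tpow H m) F"
    and p: "\<And>xs ys. length xs = n \<Longrightarrow> length ys = n \<Longrightarrow>
      F (pure H xs \<otimes>\<^bsub>tpow H n\<^esub> pure H ys) = F (pure H xs) \<otimes>\<^bsub>tpow H m\<^esub> F (pure H ys)"
    and s: "s \<in> carrier (tpow H n)" and t: "t \<in> carrier (tpow H n)"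
  shows "F (s \<otimes>\<^bsub>tpow H n\<^esub> t) = F s \<otimes>\<^bsub>tpow H m\<^esub> F t"
proof -
  note ag = tpow_abelian_group[of H m]
  note L = biadditiveD(1)[OF tmult_biadditive] and R = biadditiveD(2)[OF tmult_biadditive]
  note cl = pure_closed additive_closed[OF F]
  have 1: "F (pure H xs \<otimes>\<^bsub>tpow H n\<^esub> t) = F (pure H xs) \<otimes>\<^bsub>tpow H m\<^esub> F t" if "length xs = n" for xs
    by (rule tensor_eq_on_pure[OF ag additive_comp[OF L F] additive_comp[OF F L] _ t])
      (use that in \<open>simp_all add: p cl\<close>)
  show ?thesis
    by (rule tensor_eq_on_pure[OF ag additive_comp[OF R F] additive_comp[OF F R] _ s])
      (use t in \<open>simp_all add: 1 cl\<close>)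
qed

lemma comult_id_mult:
  assumes "s \<in> carrier (tpow H 2)" "t \<in> carrier (tpow H 2)"
  shows "comult_id H (s \<otimes>\<^bsub>tpow H 2\<^esub> t) = comult_id H s \<otimes>\<^bsub>tpow H 3\<^esub> comult_id H t"
proof (rule mult_preserving[OF comult_id_additive _ assms])
  fix xs ys :: "'h list" assume "length xs = 2" "length ys = 2"
  then obtain a b c d where "xs = [a, b]" "ys = [c, d]" using length2 by metis
  then show "comult_id H (pure H xs \<otimes>\<^bsub>tpow H 2\<^esub> pure H ys) =
      comult_id H (pure H xs) \<otimes>\<^bsub>tpow H 3\<^esub> comult_id H (pure H ys)"
    by (simp add: tmult_pure comult_id_pure comult_mult tcat_21_mult[unfolded One_nat_def] comult_closed)
qed

lemma id_comult_mult:
  assumes "s \<in> carrier (tpow H 2)" "t \<in> carrier (tpow H 2)"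
  shows "id_comult H (s \<otimes>\<^bsub>tpow H 2\<^esub> t) = id_comult H s \<otimes>\<^bsub>tpow H 3\<^esub> id_comult H t"
proof (rule mult_preserving[OF id_comult_additive _ assms])
  fix xs ys :: "'h list" assume "length xs = 2" "length ys = 2"
  then obtain a b c d where "xs = [a, b]" "ys = [c, d]" using length2 by metis
  then show "id_comult H (pure H xs \<otimes>\<^bsub>tpow H 2\<^esub> pure H ys) =
      id_comult H (pure H xs) \<otimes>\<^bsub>tpow H 3\<^esub> id_comult H (pure H ys)"
    by (simp add: tmult_pure id_comult_pure comult_mult tcat_12_mult[unfolded One_nat_def] comult_closed)
qed

lemma multilinear_flip:
  assumes "n \<ge> 2" shows "multilinear H n (tpow H n) (\<lambda>xs. pure H (xs ! 1 # xs ! 0 # drop 2 xs))"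
proof -
  define \<sigma> where "\<sigma> i = (if i = 0 then 1 else if i = 1 then 0 else i :: nat)" for i
  define F where "F xs = xs ! 1 # xs ! 0 # drop 2 xs" for xs :: "'h list"
  have Fl: "length (F xs) = n" if "length xs = n" for xs using that assms by (simp add: F_def)
  have Fn: "F xs ! \<sigma> i = xs ! i" if "length xs = n" "i < n" for xs i
  proof -
    consider "i = 0" | "i = 1" | k where "i = Suc (Suc k)" by (metis One_nat_def not0_implies_Suc)
    then show ?thesis using that by cases (simp_all add: F_def \<sigma>_def)
  qed
  have \<sigma>: "\<sigma> i < n" if "i < n" for i using that assms by (auto simp: \<sigma>_def)
  have Fu: "F (xs[i := u]) = (F xs)[\<sigma> i := u]" if "length xs = n" "i < n" for xs i u
  proof (rule nth_equalityI)
    show "length (F (xs[i := u])) = length ((F xs)[\<sigma> i := u])" using that Fl by simp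
    fix j assume "j < length (F (xs[i := u]))"
    then have j: "j < n" using Fl[of "xs[i := u]"] that by simp
    have ss: "\<sigma> (\<sigma> j) = j" "\<sigma> j = i \<longleftrightarrow> j = \<sigma> i" for j i by (auto simp: \<sigma>_def)
    have "F (xs[i := u]) ! j = xs[i := u] ! \<sigma> j"
      using Fn[of "xs[i := u]" "\<sigma> j"] that \<sigma>[OF j] by (simp add: ss)
    also have "\<dots> = (F xs)[\<sigma> i := u] ! j"
      using that \<sigma>[OF j] \<sigma>[OF that(2)] Fn[OF that(1) \<sigma>[OF j]] Fl[OF that(1)] j
      by (auto simp: nth_list_update ss)
    finally show "F (xs[i := u]) ! j = (F xs)[\<sigma> i := u] ! j" .
  qed
  note p = multilinearD[OF pure_multilinear[of H n]]
  have "multilinear H n (tpow H n) (\<lambda>xs. pure H (F xs))"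
  proof (rule multilinearI)
    fix xs :: "'h list" assume xs: "length xs = n"
    show "pure H (F xs) \<in> carrier (tpow H n)" by (rule p(1)[OF Fl[OF xs]])
    fix i assume i: "i < n"
    show "pure H (F (xs[i := u + v])) = pure H (F (xs[i := u])) \<oplus>\<^bsub>tpow H n\<^esub> pure H (F (xs[i := v]))" for u v
      unfolding Fu[OF xs i] by (rule p(2)[OF Fl[OF xs] \<sigma>[OF i]])
    show "pure H (F (xs[i := scal H c (xs ! i)])) = pure H (F (xs[j := scal H c (xs ! j)]))" if j: "j < n" for j c
      unfolding Fu[OF xs i] Fu[OF xs j] Fn[OF xs i, symmetric] Fn[OF xs j, symmetric]
      by (rule p(3)[OF Fl[OF xs] \<sigma>[OF i] \<sigma>[OF j]])
  qed
  then show ?thesis by (simp only: F_def)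
qed

lemma tflip_additive: "n \<ge> 2 \<Longrightarrow> additive_map (tpow H n) (tpow H n) (tflip H n)"
  unfolding tflip_def[abs_def] by (rule tensor_lift_additive[OF tpow_abelian_group multilinear_flip])

lemma tflip_pure: "n \<ge> 2 \<Longrightarrow> length xs = n \<Longrightarrow> tflip H n (pure H xs) = pure H (xs ! 1 # xs ! 0 # drop 2 xs)"
  unfolding tflip_def
  by (rule tensor_lift_pure[where \<tau> = "\<lambda>xs. pure H (xs ! 1 # xs ! 0 # drop 2 xs)", OF tpow_abelian_group multilinear_flip])

lemma tflip_mult:
  assumes n: "n \<ge> 2" and "s \<in> carrier (tpow H n)" "t \<in> carrier (tpow H n)"
  shows "tflip H n (s \<otimes>\<^bsub>tpow H n\<^esub> t) = tflip H n s \<otimes>\<^bsub>tpow H n\<^esub> tflip H n t"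
proof (rule mult_preserving[OF tflip_additive[OF n] _ assms(2,3)])
  fix xs ys :: "'h list" assume l: "length xs = n" "length ys = n"
  have "map2 (*) xs ys ! 1 # map2 (*) xs ys ! 0 # drop 2 (map2 (*) xs ys) =
      map2 (*) (xs ! 1 # xs ! 0 # drop 2 xs) (ys ! 1 # ys ! 0 # drop 2 ys)"
    using l n by (simp add: drop_map drop_zip)
  then show "tflip H n (pure H xs \<otimes>\<^bsub>tpow H n\<^esub> pure H ys) =
      tflip H n (pure H xs) \<otimes>\<^bsub>tpow H n\<^esub> tflip H n (pure H ys)"
    using l n by (simp add: tmult_pure tflip_pure del: list.map zip.simps)
qed

text \<open>By cocommutativity; this makes the exchange of factors descend to the tensor product over \<open>H\<close>.\<close>

lemma tflip_comult_iter: assumes "n \<in> {2, 3}" shows "tflip H n (comult_iter H (n - 1) h) = comult_iter H (n - 1) h"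
proof -
  have 2: "tflip H 2 (comult H a) = comult H a" for a using cocomm by (simp add: cocommutative_def)
  have t: "tflip H 3 (tcat H 2 1 s (pure H [b])) = tcat H 2 1 (tflip H 2 s) (pure H [b])"
    if s: "s \<in> carrier (tpow H 2)" for s b
  proof (rule tensor_eq_on_pure[OF tpow_abelian_group _ _ _ s])
    show "additive_map (tpow H 2) (tpow H 3) (\<lambda>s. tflip H 3 (tcat H 2 1 s (pure H [b])))"
      by (rule additive_comp[OF biadditiveD(2)[OF tcat_21_biadditive pure1_closed] tflip_additive]) simp
    show "additive_map (tpow H 2) (tpow H 3) (\<lambda>s. tcat H 2 1 (tflip H 2 s) (pure H [b]))"
      by (rule additive_comp[OF tflip_additive biadditiveD(2)[OF tcat_21_biadditive pure1_closed]]) simp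
    fix xs :: "'h list" assume "length xs = 2"
    then obtain a c where "xs = [a, c]" using length2 by metis
    then show "tflip H 3 (tcat H 2 1 (pure H xs) (pure H [b])) = tcat H 2 1 (tflip H 2 (pure H xs)) (pure H [b])"
      by (simp add: tcat_pure tflip_pure)
  qed
  have 3: "tflip H 3 (comult_id H s) = comult_id H s" if s: "s \<in> carrier (tpow H 2)" for s
  proof (rule tensor_eq_on_pure[OF tpow_abelian_group _ comult_id_additive _ s])
    show "additive_map (tpow H 2) (tpow H 3) (\<lambda>s. tflip H 3 (comult_id H s))"
      by (rule additive_comp[OF comult_id_additive tflip_additive]) simp
    fix xs :: "'h list" assume "length xs = 2"
    then obtain a c where "xs = [a, c]" using length2 by metis
    then show "tflip H 3 (comult_id H (pure H xs)) = comult_id H (pure H xs)"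
      by (simp only: comult_id_pure t[OF comult_closed] 2)
  qed
  have "n = 2 \<or> n = 3" using assms by simp
  then show ?thesis
    by (elim disjE) (simp_all only: comult_iter_pred 2 3[OF comult_closed])
qed

lemma two_in: "(2::nat) \<in> {2, 3}" and three_in: "(3::nat) \<in> {2, 3}" by simp_all

lemma tpow_ract_closed:
  "n \<in> {2, 3} \<Longrightarrow> t \<in> carrier (tpow H n) \<Longrightarrow> tpow_ract H n t h \<in> carrier (tpow H n)"
  unfolding tpow_ract_def by (rule tmult_closed[OF _ comult_iter_closed])

lemma htens_data: "n \<in> {2, 3} \<Longrightarrow> left_module M \<Longrightarrow> tprod_data (tpow H n) (tpow_ract H n) M"
  by (rule tprod_data.intro[OF tpow_abelian_group]) (simp_all only: tpow_ract_closed)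

definition hbal :: "nat \<Rightarrow> ('h, 'm, 'x) module_scheme \<Rightarrow> ('g, 'z) ring_scheme \<Rightarrow> ('h tensor \<Rightarrow> 'm \<Rightarrow> 'g) \<Rightarrow> bool" where
  "hbal n M G \<phi> \<longleftrightarrow> tprod_data.balanced (tpow H n) (tpow_ract H n) M G \<phi>"

lemma hbalI:
  assumes "n \<in> {2, 3}" "left_module M" "biadditive (tpow H n) M G \<phi>"
    and "\<And>t m r. t \<in> carrier (tpow H n) \<Longrightarrow> m \<in> carrier M \<Longrightarrow> \<phi> (tpow_ract H n t r) m = \<phi> t (r \<odot>\<^bsub>M\<^esub> m)"
  shows "hbal n M G \<phi>"
  unfolding hbal_def using assms(3,4) by (rule tprod_data.balancedI[OF htens_data[OF assms(1,2)]])

context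
  fixes n :: nat and M :: "('h, 'm, 'x) module_scheme"
  assumes n: "n \<in> {2, 3}" and M: "left_module M"
begin

interpretation tprod_data "tpow H n" "tpow_ract H n" M by (rule htens_data[OF n M])

lemma htens_abelian_group: "abelian_group (htens H n M)"
  unfolding htens_def by (rule tprod_abelian_group)

lemma hpure_closed: "t \<in> carrier (tpow H n) \<Longrightarrow> m \<in> carrier M \<Longrightarrow> hpure H n M t m \<in> carrier (htens H n M)"
  unfolding htens_def hpure_def by (rule pure_closed)

lemma hpure_hbal: "hbal n M (htens H n M) (hpure H n M)"
  unfolding htens_def hpure_def hbal_def by (rule pure_balanced)

lemma hpure_biadditive: "biadditive (tpow H n) M (htens H n M) (hpure H n M)"
  using balancedD(1)[OF hpure_hbal[unfolded hbal_def]] .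

lemma hpure_ract:
  "t \<in> carrier (tpow H n) \<Longrightarrow> m \<in> carrier M \<Longrightarrow> hpure H n M (tpow_ract H n t r) m = hpure H n M t (r \<odot>\<^bsub>M\<^esub> m)"
  by (rule balancedD(2)[OF hpure_hbal[unfolded hbal_def]])

lemma hlift_additive:
  "abelian_group G \<Longrightarrow> hbal n M G \<phi> \<Longrightarrow> additive_map (htens H n M) G (frag_lift G (\<lambda>(t, m). \<phi> t m))"
  unfolding htens_def hbal_def by (rule lift_additive)

lemma hlift_pure:
  "abelian_group G \<Longrightarrow> hbal n M G \<phi> \<Longrightarrow> t \<in> carrier (tpow H n) \<Longrightarrow> m \<in> carrier M \<Longrightarrow>
   frag_lift G (\<lambda>(t, m). \<phi> t m) (hpure H n M t m) = \<phi> t m"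
  unfolding hpure_def hbal_def by (rule lift_pure[where \<phi> = \<phi>])

lemma htens_eq_on_pure:
  assumes "abelian_group G" "additive_map (htens H n M) G f" "additive_map (htens H n M) G g"
    and "\<And>t m. t \<in> carrier (tpow H n) \<Longrightarrow> m \<in> carrier M \<Longrightarrow> f (hpure H n M t m) = g (hpure H n M t m)"
    and "U \<in> carrier (htens H n M)"
  shows "f U = g U"
  by (rule eq_on_pure[where la = "mult (tpow H n)", OF assms(1) assms(2,3)[unfolded htens_def]
        assms(4)[unfolded hpure_def] assms(5)[unfolded htens_def]])

lemma
  assumes s: "s \<in> carrier (tpow H n)"
  shows hsmult_additive: "additive_map (htens H n M) (htens H n M) (smult (htens H n M) s)"
    and hsmult_pure: "t \<in> carrier (tpow H n) \<Longrightarrow> m \<in> carrier M \<Longrightarrow>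
      s \<odot>\<^bsub>htens H n M\<^esub> hpure H n M t m = hpure H n M (s \<otimes>\<^bsub>tpow H n\<^esub> t) m"
proof -
  have c: "s \<otimes>\<^bsub>tpow H n\<^esub> tpow_ract H n a r = tpow_ract H n (s \<otimes>\<^bsub>tpow H n\<^esub> a) r"
    if "a \<in> carrier (tpow H n)" for a r
    unfolding tpow_ract_def by (rule tmult_assoc[OF s that comult_iter_closed[OF n], symmetric])
  note la = biadditiveD(1)[OF tmult_biadditive s]
  show "additive_map (htens H n M) (htens H n M) (smult (htens H n M) s)"
    unfolding htens_def by (rule smult_additive[where la = "mult (tpow H n)", OF la c])
  show "t \<in> carrier (tpow H n) \<Longrightarrow> m \<in> carrier M \<Longrightarrow>
      s \<odot>\<^bsub>htens H n M\<^esub> hpure H n M t m = hpure H n M (s \<otimes>\<^bsub>tpow H n\<^esub> t) m"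
    unfolding htens_def hpure_def by (rule smult_pure[where la = "mult (tpow H n)", OF la c])
qed

lemma
  shows hflip_additive: "additive_map (htens H n M) (htens H n M) (hflip H n M)"
    and hflip_pure: "t \<in> carrier (tpow H n) \<Longrightarrow> m \<in> carrier M \<Longrightarrow>
      hflip H n M (hpure H n M t m) = hpure H n M (tflip H n t) m"
proof -
  have n2: "n \<ge> 2" using n by auto
  note fl = tflip_additive[OF n2]
  have "hbal n M (htens H n M) (\<lambda>t m. hpure H n M (tflip H n t) m)"
  proof (rule hbalI[OF n M], rule biadditiveI)
    show "additive_map M (htens H n M) (hpure H n M (tflip H n a))" if "a \<in> carrier (tpow H n)" for a
      by (rule biadditiveD(1)[OF hpure_biadditive additive_closed[OF fl that]])
    show "additive_map (tpow H n) (htens H n M) (\<lambda>a. hpure H n M (tflip H n a) b)" if "b \<in> carrier M" for b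
      by (rule additive_comp[OF fl biadditiveD(2)[OF hpure_biadditive that]])
    fix t m r assume t: "t \<in> carrier (tpow H n)" and m: "m \<in> carrier M"
    have "tflip H n (tpow_ract H n t r) = tpow_ract H n (tflip H n t) r"
      unfolding tpow_ract_def tflip_mult[OF n2 t comult_iter_closed[OF n]] tflip_comult_iter[OF n] ..
    then show "hpure H n M (tflip H n (tpow_ract H n t r)) m = hpure H n M (tflip H n t) (r \<odot>\<^bsub>M\<^esub> m)"
      by (simp only: hpure_ract[OF additive_closed[OF fl t] m])
  qed
  note * = htens_abelian_group this
  show "additive_map (htens H n M) (htens H n M) (hflip H n M)"
    unfolding hflip_def[abs_def] by (rule hlift_additive[OF *])
  show "t \<in> carrier (tpow H n) \<Longrightarrow> m \<in> carrier M \<Longrightarrow>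
      hflip H n M (hpure H n M t m) = hpure H n M (tflip H n t) m"
    unfolding hflip_def by (rule hlift_pure[where \<phi> = "\<lambda>t m. hpure H n M (tflip H n t) m", OF *])
qed

end

section \<open>Transport of Lie pseudoalgebra structures\<close>

text \<open>The bilinear part of the axioms, under which the iterated brackets are well-defined.\<close>

definition pseudobracket :: "('h, 'm, 'x) pseudoalgebra_scheme \<Rightarrow> bool" where
  "pseudobracket L \<longleftrightarrow> left_module L \<and> biadditive L L (htens H 2 L) (pbracket L) \<and>
    (\<forall>f g. \<forall>a\<in>carrier L. \<forall>b\<in>carrier L.
       pbracket L (f \<odot>\<^bsub>L\<^esub> a) (g \<odot>\<^bsub>L\<^esub> b) = pure H [f, g] \<odot>\<^bsub>htens H 2 L\<^esub> pbracket L a b)"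

lemma pseudobracketD:
  assumes "pseudobracket L"
  shows "left_module L" "biadditive L L (htens H 2 L) (pbracket L)"
    "a \<in> carrier L \<Longrightarrow> b \<in> carrier L \<Longrightarrow>
      pbracket L (f \<odot>\<^bsub>L\<^esub> a) (g \<odot>\<^bsub>L\<^esub> b) = pure H [f, g] \<odot>\<^bsub>htens H 2 L\<^esub> pbracket L a b"
proof -
  note p = assms[unfolded pseudobracket_def]
  show "left_module L" "biadditive L L (htens H 2 L) (pbracket L)"
    by (rule conjunct1[OF p], rule conjunct1[OF conjunct2[OF p]])
  show "a \<in> carrier L \<Longrightarrow> b \<in> carrier L \<Longrightarrow>
      pbracket L (f \<odot>\<^bsub>L\<^esub> a) (g \<odot>\<^bsub>L\<^esub> b) = pure H [f, g] \<odot>\<^bsub>htens H 2 L\<^esub> pbracket L a b"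
    by (rule conjunct2[OF conjunct2[OF p], rule_format])
qed

lemma lie_pseudoalgebraD:
  assumes "lie_pseudoalgebra H L"
  shows "pseudobracket L"
    and "a \<in> carrier L \<Longrightarrow> b \<in> carrier L \<Longrightarrow>
      pbracket L b a = \<ominus>\<^bsub>htens H 2 L\<^esub> hflip H 2 L (pbracket L a b)"
    and "a \<in> carrier L \<Longrightarrow> b \<in> carrier L \<Longrightarrow> c \<in> carrier L \<Longrightarrow>
       pbracket_right H L a b c \<ominus>\<^bsub>htens H 3 L\<^esub> hflip H 3 L (pbracket_right H L b a c) = pbracket_left H L a b c"
proof -
  note l = assms[unfolded lie_pseudoalgebra_def]
  note t2 = conjunct2[OF l]
  note t3 = conjunct2[OF t2]
  note t4 = conjunct2[OF t3]
  note t5 = conjunct2[OF t4]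
  note t6 = conjunct2[OF t5]
  show "pseudobracket L"
    unfolding pseudobracket_def
  proof (intro conjI biadditiveI additiveI)
    show "left_module L" by (rule conjunct1[OF l])
    show "\<forall>f g. \<forall>a\<in>carrier L. \<forall>b\<in>carrier L.
       pbracket L (f \<odot>\<^bsub>L\<^esub> a) (g \<odot>\<^bsub>L\<^esub> b) = pure H [f, g] \<odot>\<^bsub>htens H 2 L\<^esub> pbracket L a b"
      by (rule conjunct1[OF t5])
  qed (erule (1) conjunct1[OF t2, rule_format], erule (2) conjunct1[OF t4, rule_format],
      erule (1) conjunct1[OF t2, rule_format, rotated], erule (2) conjunct1[OF t3, rule_format, rotated 2])
  show "a \<in> carrier L \<Longrightarrow> b \<in> carrier L \<Longrightarrow>
      pbracket L b a = \<ominus>\<^bsub>htens H 2 L\<^esub> hflip H 2 L (pbracket L a b)"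
    by (rule conjunct1[OF t6, rule_format])
  show "a \<in> carrier L \<Longrightarrow> b \<in> carrier L \<Longrightarrow> c \<in> carrier L \<Longrightarrow>
       pbracket_right H L a b c \<ominus>\<^bsub>htens H 3 L\<^esub> hflip H 3 L (pbracket_right H L b a c) = pbracket_left H L a b c"
    by (rule conjunct2[OF t6, rule_format])
qed

text \<open>
  The contribution of one term \<open>g \<otimes>\<^sub>H e\<close> of the inner bracket to an iterated bracket, as a function of the
  outer bracket.
\<close>

definition nest_left :: "('h, 'm, 'x) module_scheme \<Rightarrow> 'h tensor \<Rightarrow> ('h, 'm) htensor \<Rightarrow> ('h, 'm) htensor" where
  "nest_left M g = frag_lift (htens H 3 M)
     (\<lambda>(t, e). hpure H 3 M (tcat H 2 1 g (pure H [1]) \<otimes>\<^bsub>tpow H 3\<^esub> comult_id H t) e)"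

definition nest_right :: "('h, 'm, 'x) module_scheme \<Rightarrow> 'h tensor \<Rightarrow> ('h, 'm) htensor \<Rightarrow> ('h, 'm) htensor" where
  "nest_right M g = frag_lift (htens H 3 M)
     (\<lambda>(t, e). hpure H 3 M (tcat H 1 2 (pure H [1]) g \<otimes>\<^bsub>tpow H 3\<^esub> id_comult H t) e)"

lemma nest_hbal:
  assumes M: "left_module M" and F: "additive_map (tpow H 2) (tpow H 3) F"
    and c: "\<And>t r. t \<in> carrier (tpow H 2) \<Longrightarrow>
      F (t \<otimes>\<^bsub>tpow H 2\<^esub> comult H r) = F t \<otimes>\<^bsub>tpow H 3\<^esub> comult_id H (comult H r)"
    and s: "s \<in> carrier (tpow H 3)"
  shows "hbal 2 M (htens H 3 M) (\<lambda>t e. hpure H 3 M (s \<otimes>\<^bsub>tpow H 3\<^esub> F t) e)"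
proof -
  note n3 = three_in and n2 = two_in
  note h = hpure_biadditive[OF n3 M]
  note mul = biadditiveD(1)[OF tmult_biadditive s]
  have cl: "s \<otimes>\<^bsub>tpow H 3\<^esub> F t \<in> carrier (tpow H 3)" if "t \<in> carrier (tpow H 2)" for t
    by (rule tmult_closed[OF s additive_closed[OF F that]])
  show ?thesis
  proof (rule hbalI[OF n2 M], rule biadditiveI)
    show "additive_map M (htens H 3 M) (hpure H 3 M (s \<otimes>\<^bsub>tpow H 3\<^esub> F a))" if "a \<in> carrier (tpow H 2)" for a
      by (rule biadditiveD(1)[OF h cl[OF that]])
    show "additive_map (tpow H 2) (htens H 3 M) (\<lambda>a. hpure H 3 M (s \<otimes>\<^bsub>tpow H 3\<^esub> F a) b)" if "b \<in> carrier M" for b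
      by (rule additive_comp[OF additive_comp[OF F mul] biadditiveD(2)[OF h that]])
    fix t m r assume t: "t \<in> carrier (tpow H 2)" and m: "m \<in> carrier M"
    have "s \<otimes>\<^bsub>tpow H 3\<^esub> F (tpow_ract H 2 t r) = tpow_ract H 3 (s \<otimes>\<^bsub>tpow H 3\<^esub> F t) r"
      unfolding ract_2 ract_3 c[OF t]
      by (rule tmult_assoc[OF s additive_closed[OF F t] additive_closed[OF comult_id_additive comult_closed], symmetric])
    then show "hpure H 3 M (s \<otimes>\<^bsub>tpow H 3\<^esub> F (tpow_ract H 2 t r)) m = hpure H 3 M (s \<otimes>\<^bsub>tpow H 3\<^esub> F t) (r \<odot>\<^bsub>M\<^esub> m)"
      by (simp only: hpure_ract[OF n3 M cl[OF t] m])
  qed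
qed

lemma tcat_one_closed:
  "g \<in> carrier (tpow H 2) \<Longrightarrow> tcat H 2 1 g (pure H [1]) \<in> carrier (tpow H 3)"
  "g \<in> carrier (tpow H 2) \<Longrightarrow> tcat H 1 2 (pure H [1]) g \<in> carrier (tpow H 3)"
  by (rule biadditiveD(3)[OF tcat_21_biadditive _ pure1_closed], assumption)
    (rule biadditiveD(3)[OF tcat_12_biadditive pure1_closed])

text \<open>
  The properties of the two nested maps that matter: they are biadditive, and multiplying the inner
  bracket by the coefficient that sesquilinearity produces multiplies the outer coefficient on the
  right by a coproduct.
\<close>

lemma nest_properties:
  assumes M: "left_module M" and F: "additive_map (tpow H 2) (tpow H 3) F" and C: "additive_map (tpow H 2) (tpow H 3) C"
    and c: "\<And>t r. t \<in> carrier (tpow H 2) \<Longrightarrow>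
      F (t \<otimes>\<^bsub>tpow H 2\<^esub> comult H r) = F t \<otimes>\<^bsub>tpow H 3\<^esub> comult_id H (comult H r)"
    and Fm: "\<And>s t. s \<in> carrier (tpow H 2) \<Longrightarrow> t \<in> carrier (tpow H 2) \<Longrightarrow>
      F (s \<otimes>\<^bsub>tpow H 2\<^esub> t) = F s \<otimes>\<^bsub>tpow H 3\<^esub> F t"
    and N: "\<And>g. N g = frag_lift (htens H 3 M) (\<lambda>(t, e). hpure H 3 M (C g \<otimes>\<^bsub>tpow H 3\<^esub> F t) e)"
  shows "biadditive (tpow H 2) (htens H 2 M) (htens H 3 M) N"
    and "g \<in> carrier (tpow H 2) \<Longrightarrow> t \<in> carrier (tpow H 2) \<Longrightarrow> m \<in> carrier M \<Longrightarrow>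
      N g (hpure H 2 M t m) = hpure H 3 M (C g \<otimes>\<^bsub>tpow H 3\<^esub> F t) m"
    and "g \<in> carrier (tpow H 2) \<Longrightarrow> p \<in> carrier (tpow H 2) \<Longrightarrow> q \<in> carrier (tpow H 2) \<Longrightarrow>
      C (g \<otimes>\<^bsub>tpow H 2\<^esub> q) = C g \<otimes>\<^bsub>tpow H 3\<^esub> F p \<Longrightarrow> U \<in> carrier (htens H 2 M) \<Longrightarrow>
      N (g \<otimes>\<^bsub>tpow H 2\<^esub> q) U = N g (p \<odot>\<^bsub>htens H 2 M\<^esub> U)"
proof -
  note n3 = three_in and n2 = two_in
  note ag = htens_abelian_group[OF n3 M]
  note cC = additive_closed[OF C] and cF = additive_closed[OF F]
  note b = nest_hbal[OF M F c cC]
  have add: "additive_map (htens H 2 M) (htens H 3 M) (N g)" if "g \<in> carrier (tpow H 2)" for g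
    unfolding N by (rule hlift_additive[OF n2 M ag b[OF _ that]])
  show val: "N g (hpure H 2 M t m) = hpure H 3 M (C g \<otimes>\<^bsub>tpow H 3\<^esub> F t) m"
    if "g \<in> carrier (tpow H 2)" "t \<in> carrier (tpow H 2)" "m \<in> carrier M" for g t m
    unfolding N
    by (rule hlift_pure[where \<phi> = "\<lambda>t e. hpure H 3 M (C g \<otimes>\<^bsub>tpow H 3\<^esub> F t) e", OF n2 M ag b[OF _ that(1)] that(2,3)])
  interpret T2: abelian_group "tpow H 2" by (rule tpow_abelian_group)
  interpret T3: abelian_group "tpow H 3" by (rule tpow_abelian_group)
  interpret H3: abelian_group "htens H 3 M" by (rule ag)
  show "biadditive (tpow H 2) (htens H 2 M) (htens H 3 M) N"
  proof (rule biadditiveI[OF add])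
    fix U assume U: "U \<in> carrier (htens H 2 M)"
    show "additive_map (tpow H 2) (htens H 3 M) (\<lambda>g. N g U)"
    proof (rule additiveI)
      fix g g' assume g: "g \<in> carrier (tpow H 2)"
      show "N g U \<in> carrier (htens H 3 M)" by (rule additive_closed[OF add[OF g] U])
      assume g': "g' \<in> carrier (tpow H 2)"
      show "N (g \<oplus>\<^bsub>tpow H 2\<^esub> g') U = N g U \<oplus>\<^bsub>htens H 3 M\<^esub> N g' U"
      proof (rule htens_eq_on_pure[OF n2 M ag add[OF T2.a_closed[OF g g']] additive_sum2[OF ag add[OF g] add[OF g']] _ U])
        fix t m assume t: "t \<in> carrier (tpow H 2)" and m: "m \<in> carrier M"
        have "additive_map (tpow H 2) (htens H 3 M) (\<lambda>g. hpure H 3 M (C g \<otimes>\<^bsub>tpow H 3\<^esub> F t) m)"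
          by (rule additive_comp[OF additive_comp[OF C biadditiveD(2)[OF tmult_biadditive cF[OF t]]]
                biadditiveD(2)[OF hpure_biadditive[OF n3 M] m]])
        from additive_add[OF this g g']
        show "N (g \<oplus>\<^bsub>tpow H 2\<^esub> g') (hpure H 2 M t m) = N g (hpure H 2 M t m) \<oplus>\<^bsub>htens H 3 M\<^esub> N g' (hpure H 2 M t m)"
          by (simp only: val[OF g t m] val[OF g' t m] val[OF T2.a_closed[OF g g'] t m])
      qed
    qed
  qed
  assume g: "g \<in> carrier (tpow H 2)" and p: "p \<in> carrier (tpow H 2)" and q: "q \<in> carrier (tpow H 2)"
    and e: "C (g \<otimes>\<^bsub>tpow H 2\<^esub> q) = C g \<otimes>\<^bsub>tpow H 3\<^esub> F p" and U: "U \<in> carrier (htens H 2 M)"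
  show "N (g \<otimes>\<^bsub>tpow H 2\<^esub> q) U = N g (p \<odot>\<^bsub>htens H 2 M\<^esub> U)"
  proof (rule htens_eq_on_pure[OF n2 M ag add[OF tmult_closed[OF g q]]
        additive_comp[OF hsmult_additive[OF n2 M p] add[OF g]] _ U])
    fix t m assume t: "t \<in> carrier (tpow H 2)" and m: "m \<in> carrier M"
    show "N (g \<otimes>\<^bsub>tpow H 2\<^esub> q) (hpure H 2 M t m) = N g (p \<odot>\<^bsub>htens H 2 M\<^esub> hpure H 2 M t m)"
      unfolding hsmult_pure[OF n2 M p t m] val[OF tmult_closed[OF g q] t m] val[OF g tmult_closed[OF p t] m] e Fm[OF p t]
        tmult_assoc[OF cC[OF g] cF[OF p] cF[OF t]] ..
  qed
qed

lemma tcat_one_additive: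
  "additive_map (tpow H 2) (tpow H 3) (\<lambda>g. tcat H 2 1 g (pure H [1]))"
  "additive_map (tpow H 2) (tpow H 3) (tcat H 1 2 (pure H [1]))"
  by (rule biadditiveD(2)[OF tcat_21_biadditive pure1_closed], rule biadditiveD(1)[OF tcat_12_biadditive pure1_closed])

lemma id_comult_ract:
  "t \<in> carrier (tpow H 2) \<Longrightarrow>
    id_comult H (t \<otimes>\<^bsub>tpow H 2\<^esub> comult H r) = id_comult H t \<otimes>\<^bsub>tpow H 3\<^esub> comult_id H (comult H r)"
  unfolding coassoc by (rule id_comult_mult[OF _ comult_closed])

lemma nest_left_properties:
  assumes M: "left_module M"
  shows "biadditive (tpow H 2) (htens H 2 M) (htens H 3 M) (nest_left M)"
    and "g \<in> carrier (tpow H 2) \<Longrightarrow> t \<in> carrier (tpow H 2) \<Longrightarrow> m \<in> carrier M \<Longrightarrow>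
      nest_left M g (hpure H 2 M t m) = hpure H 3 M (tcat H 2 1 g (pure H [1]) \<otimes>\<^bsub>tpow H 3\<^esub> comult_id H t) m"
    and "g \<in> carrier (tpow H 2) \<Longrightarrow> p \<in> carrier (tpow H 2) \<Longrightarrow> q \<in> carrier (tpow H 2) \<Longrightarrow>
      tcat H 2 1 (g \<otimes>\<^bsub>tpow H 2\<^esub> q) (pure H [1]) = tcat H 2 1 g (pure H [1]) \<otimes>\<^bsub>tpow H 3\<^esub> comult_id H p \<Longrightarrow>
      U \<in> carrier (htens H 2 M) \<Longrightarrow>
      nest_left M (g \<otimes>\<^bsub>tpow H 2\<^esub> q) U = nest_left M g (p \<odot>\<^bsub>htens H 2 M\<^esub> U)"
proof -
  note P = nest_properties[where C = "\<lambda>g. tcat H 2 1 g (pure H [1])" and F = "comult_id H" and N = "nest_left M" and M = M,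
    OF M comult_id_additive tcat_one_additive(1)]
  note c = comult_id_mult[OF _ comult_closed]
  show "biadditive (tpow H 2) (htens H 2 M) (htens H 3 M) (nest_left M)"
    by (rule P(1)) (rule nest_left_def | erule c | erule (1) comult_id_mult)+
  show "g \<in> carrier (tpow H 2) \<Longrightarrow> t \<in> carrier (tpow H 2) \<Longrightarrow> m \<in> carrier M \<Longrightarrow>
      nest_left M g (hpure H 2 M t m) = hpure H 3 M (tcat H 2 1 g (pure H [1]) \<otimes>\<^bsub>tpow H 3\<^esub> comult_id H t) m"
    by (rule P(2)) (assumption | rule nest_left_def | erule c | erule (1) comult_id_mult)+
  show "g \<in> carrier (tpow H 2) \<Longrightarrow> p \<in> carrier (tpow H 2) \<Longrightarrow> q \<in> carrier (tpow H 2) \<Longrightarrow>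
      tcat H 2 1 (g \<otimes>\<^bsub>tpow H 2\<^esub> q) (pure H [1]) = tcat H 2 1 g (pure H [1]) \<otimes>\<^bsub>tpow H 3\<^esub> comult_id H p \<Longrightarrow>
      U \<in> carrier (htens H 2 M) \<Longrightarrow>
      nest_left M (g \<otimes>\<^bsub>tpow H 2\<^esub> q) U = nest_left M g (p \<odot>\<^bsub>htens H 2 M\<^esub> U)"
    by (rule P(3)) (assumption | rule nest_left_def | erule c | erule (1) comult_id_mult)+
qed

lemma nest_right_properties:
  assumes M: "left_module M"
  shows "biadditive (tpow H 2) (htens H 2 M) (htens H 3 M) (nest_right M)"
    and "g \<in> carrier (tpow H 2) \<Longrightarrow> t \<in> carrier (tpow H 2) \<Longrightarrow> m \<in> carrier M \<Longrightarrow>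
      nest_right M g (hpure H 2 M t m) = hpure H 3 M (tcat H 1 2 (pure H [1]) g \<otimes>\<^bsub>tpow H 3\<^esub> id_comult H t) m"
    and "g \<in> carrier (tpow H 2) \<Longrightarrow> p \<in> carrier (tpow H 2) \<Longrightarrow> q \<in> carrier (tpow H 2) \<Longrightarrow>
      tcat H 1 2 (pure H [1]) (g \<otimes>\<^bsub>tpow H 2\<^esub> q) = tcat H 1 2 (pure H [1]) g \<otimes>\<^bsub>tpow H 3\<^esub> id_comult H p \<Longrightarrow>
      U \<in> carrier (htens H 2 M) \<Longrightarrow>
      nest_right M (g \<otimes>\<^bsub>tpow H 2\<^esub> q) U = nest_right M g (p \<odot>\<^bsub>htens H 2 M\<^esub> U)"
proof -
  note P = nest_properties[where C = "tcat H 1 2 (pure H [1])" and F = "id_comult H" and N = "nest_right M" and M = M,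
    OF M id_comult_additive tcat_one_additive(2)]
  note c = id_comult_ract
  show "biadditive (tpow H 2) (htens H 2 M) (htens H 3 M) (nest_right M)"
    by (rule P(1)) (rule nest_right_def | erule c | erule (1) id_comult_mult)+
  show "g \<in> carrier (tpow H 2) \<Longrightarrow> t \<in> carrier (tpow H 2) \<Longrightarrow> m \<in> carrier M \<Longrightarrow>
      nest_right M g (hpure H 2 M t m) = hpure H 3 M (tcat H 1 2 (pure H [1]) g \<otimes>\<^bsub>tpow H 3\<^esub> id_comult H t) m"
    by (rule P(2)) (assumption | rule nest_right_def | erule c | erule (1) id_comult_mult)+
  show "g \<in> carrier (tpow H 2) \<Longrightarrow> p \<in> carrier (tpow H 2) \<Longrightarrow> q \<in> carrier (tpow H 2) \<Longrightarrow>
      tcat H 1 2 (pure H [1]) (g \<otimes>\<^bsub>tpow H 2\<^esub> q) = tcat H 1 2 (pure H [1]) g \<otimes>\<^bsub>tpow H 3\<^esub> id_comult H p \<Longrightarrow>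
      U \<in> carrier (htens H 2 M) \<Longrightarrow>
      nest_right M (g \<otimes>\<^bsub>tpow H 2\<^esub> q) U = nest_right M g (p \<odot>\<^bsub>htens H 2 M\<^esub> U)"
    by (rule P(3)) (assumption | rule nest_right_def | erule c | erule (1) id_comult_mult)+
qed

text \<open>
  The definitions of the iterated brackets choose expressions of the inner brackets; this is the
  independence of that choice, which follows from sesquilinearity.
\<close>

lemma iterated_bracket_hbal:
  assumes L: "pseudobracket L"
  shows "c \<in> carrier L \<Longrightarrow> hbal 2 L (htens H 3 L) (\<lambda>g e. nest_left L g (pbracket L e c))"
    and "a \<in> carrier L \<Longrightarrow> hbal 2 L (htens H 3 L) (\<lambda>h d. nest_right L h (pbracket L a d))"
proof -
  note n2 = two_in
  note M = pseudobracketD(1)[OF L] and bi = pseudobracketD(2)[OF L] and sq = pseudobracketD(3)[OF L]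
  note cl = biadditiveD(3)[OF bi] and one = left_moduleD(6)[OF M]
  note p2 = pair_closed
  show "hbal 2 L (htens H 3 L) (\<lambda>g e. nest_left L g (pbracket L e c))" if c: "c \<in> carrier L"
  proof (rule hbalI[OF n2 M], rule biadditiveI)
    show "additive_map L (htens H 3 L) (\<lambda>e. nest_left L g (pbracket L e c))" if "g \<in> carrier (tpow H 2)" for g
      by (rule additive_comp[OF biadditiveD(2)[OF bi c] biadditiveD(1)[OF nest_left_properties(1)[OF M] that]])
    show "additive_map (tpow H 2) (htens H 3 L) (\<lambda>g. nest_left L g (pbracket L e c))" if "e \<in> carrier L" for e
      by (rule biadditiveD(2)[OF nest_left_properties(1)[OF M] cl[OF that c]])
    fix g e r assume g: "g \<in> carrier (tpow H 2)" and e: "e \<in> carrier L"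
    have "pbracket L (r \<odot>\<^bsub>L\<^esub> e) c = pure H [r, 1] \<odot>\<^bsub>htens H 2 L\<^esub> pbracket L e c"
      using sq[OF e c, of r 1] by (simp only: one[OF c])
    moreover have "nest_left L (g \<otimes>\<^bsub>tpow H 2\<^esub> comult H r) (pbracket L e c) =
        nest_left L g (pure H [r, 1] \<odot>\<^bsub>htens H 2 L\<^esub> pbracket L e c)"
      by (rule nest_left_properties(3)[OF M g p2 comult_closed _ cl[OF e c]])
        (simp only: comult_id_pure tcat_21_mult[OF g comult_closed] mult_1)
    ultimately show "nest_left L (tpow_ract H 2 g r) (pbracket L e c) = nest_left L g (pbracket L (r \<odot>\<^bsub>L\<^esub> e) c)"
      by (simp only: ract_2)
  qed
  show "hbal 2 L (htens H 3 L) (\<lambda>h d. nest_right L h (pbracket L a d))" if a: "a \<in> carrier L"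
  proof (rule hbalI[OF n2 M], rule biadditiveI)
    show "additive_map L (htens H 3 L) (\<lambda>d. nest_right L g (pbracket L a d))" if "g \<in> carrier (tpow H 2)" for g
      by (rule additive_comp[OF biadditiveD(1)[OF bi a] biadditiveD(1)[OF nest_right_properties(1)[OF M] that]])
    show "additive_map (tpow H 2) (htens H 3 L) (\<lambda>g. nest_right L g (pbracket L a d))" if "d \<in> carrier L" for d
      by (rule biadditiveD(2)[OF nest_right_properties(1)[OF M] cl[OF a that]])
    fix g d r assume g: "g \<in> carrier (tpow H 2)" and d: "d \<in> carrier L"
    have "pbracket L a (r \<odot>\<^bsub>L\<^esub> d) = pure H [1, r] \<odot>\<^bsub>htens H 2 L\<^esub> pbracket L a d"
      using sq[OF a d, of 1 r] by (simp only: one[OF a])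
    moreover have "nest_right L (g \<otimes>\<^bsub>tpow H 2\<^esub> comult H r) (pbracket L a d) =
        nest_right L g (pure H [1, r] \<odot>\<^bsub>htens H 2 L\<^esub> pbracket L a d)"
      by (rule nest_right_properties(3)[OF M g p2 comult_closed _ cl[OF a d]])
        (simp only: id_comult_pure tcat_12_mult[OF g comult_closed] mult_1)
    ultimately show "nest_right L (tpow_ract H 2 g r) (pbracket L a d) = nest_right L g (pbracket L a (r \<odot>\<^bsub>L\<^esub> d))"
      by (simp only: ract_2)
  qed
qed

lemma pbracket_left_eq: "pbracket_left H L a b c = frag_lift (htens H 3 L) (\<lambda>(g, e). nest_left L g (pbracket L e c)) (pbracket L a b)"
  by (simp only: pbracket_left_def nest_left_def)

lemma pbracket_right_eq: "pbracket_right H L a b c = frag_lift (htens H 3 L) (\<lambda>(h, d). nest_right L h (pbracket L a d)) (pbracket L b c)"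
  by (simp only: pbracket_right_def nest_right_def)

text \<open>The map \<open>id \<otimes>\<^sub>H \<Phi>\<close> on values of brackets and of iterated brackets.\<close>

definition hfun :: "nat \<Rightarrow> ('h, 'n, 'y) module_scheme \<Rightarrow> ('m \<Rightarrow> 'n) \<Rightarrow> ('h, 'm) htensor \<Rightarrow> ('h, 'n) htensor" where
  "hfun n M' \<Phi> = frag_lift (htens H n M') (\<lambda>(t, m). hpure H n M' t (\<Phi> m))"

lemma hfun_2: "hfun 2 M' \<Phi> = hmap H M' \<Phi>"
  by (simp add: hfun_def hmap_def)

lemma hfun_properties:
  assumes n: "n \<in> {2, 3}" and M: "left_module M" and M': "left_module M'" and \<Phi>: "additive_map M M' \<Phi>"
    and lin: "\<And>h a. a \<in> carrier M \<Longrightarrow> \<Phi> (h \<odot>\<^bsub>M\<^esub> a) = h \<odot>\<^bsub>M'\<^esub> \<Phi> a"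
  shows "additive_map (htens H n M) (htens H n M') (hfun n M' \<Phi>)"
    and "t \<in> carrier (tpow H n) \<Longrightarrow> m \<in> carrier M \<Longrightarrow> hfun n M' \<Phi> (hpure H n M t m) = hpure H n M' t (\<Phi> m)"
proof -
  note cl = additive_closed[OF \<Phi>]
  have hb: "hbal n M (htens H n M') (\<lambda>t m. hpure H n M' t (\<Phi> m))"
  proof (rule hbalI[OF n M], rule biadditiveI)
    show "additive_map M (htens H n M') (\<lambda>m. hpure H n M' t (\<Phi> m))" if "t \<in> carrier (tpow H n)" for t
      by (rule additive_comp[OF \<Phi> biadditiveD(1)[OF hpure_biadditive[OF n M'] that]])
    show "additive_map (tpow H n) (htens H n M') (\<lambda>t. hpure H n M' t (\<Phi> m))" if "m \<in> carrier M" for m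
      by (rule biadditiveD(2)[OF hpure_biadditive[OF n M'] cl[OF that]])
    show "hpure H n M' (tpow_ract H n t r) (\<Phi> m) = hpure H n M' t (\<Phi> (r \<odot>\<^bsub>M\<^esub> m))"
      if "t \<in> carrier (tpow H n)" "m \<in> carrier M" for t m r
      unfolding lin[OF that(2)] by (rule hpure_ract[OF n M' that(1) cl[OF that(2)]])
  qed
  show "additive_map (htens H n M) (htens H n M') (hfun n M' \<Phi>)"
    unfolding hfun_def by (rule hlift_additive[OF n M htens_abelian_group[OF n M'] hb])
  show "hfun n M' \<Phi> (hpure H n M t m) = hpure H n M' t (\<Phi> m)" if "t \<in> carrier (tpow H n)" "m \<in> carrier M"
    unfolding hfun_def
    by (rule hlift_pure[where \<phi> = "\<lambda>t m. hpure H n M' t (\<Phi> m)", OF n M htens_abelian_group[OF n M'] hb that])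
qed

lemma transport_left_module:
  assumes M: "left_module M" and \<Phi>: "additive_map M M' \<Phi>" and onto: "\<Phi> ` carrier M = carrier M'"
    and lin: "\<And>h a. a \<in> carrier M \<Longrightarrow> \<Phi> (h \<odot>\<^bsub>M\<^esub> a) = h \<odot>\<^bsub>M'\<^esub> \<Phi> a" and zero: "\<Phi> \<zero>\<^bsub>M\<^esub> = \<zero>\<^bsub>M'\<^esub>"
  shows "left_module M'"
proof -
  interpret M: abelian_group M by (rule left_moduleD(1)[OF M])
  note add = additive_add[OF \<Phi>, symmetric]
  have cl: "\<Phi> a \<in> carrier M'" if "a \<in> carrier M" for a using onto that by blast
  have pre: "\<exists>a\<in>carrier M. a' = \<Phi> a" if "a' \<in> carrier M'" for a' using onto that by blast
  have "abelian_group M'"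
  proof (rule abelian_groupI)
    fix a' b' c' assume "a' \<in> carrier M'" "b' \<in> carrier M'"
    then obtain a b where ab: "a \<in> carrier M" "b \<in> carrier M" "a' = \<Phi> a" "b' = \<Phi> b" using pre by meson
    show "a' \<oplus>\<^bsub>M'\<^esub> b' \<in> carrier M'" using ab by (simp add: add cl)
    show "a' \<oplus>\<^bsub>M'\<^esub> b' = b' \<oplus>\<^bsub>M'\<^esub> a'" using ab by (simp add: add M.a_comm)
    assume "c' \<in> carrier M'"
    then obtain c where "c \<in> carrier M" "c' = \<Phi> c" using pre by meson
    then show "a' \<oplus>\<^bsub>M'\<^esub> b' \<oplus>\<^bsub>M'\<^esub> c' = a' \<oplus>\<^bsub>M'\<^esub> (b' \<oplus>\<^bsub>M'\<^esub> c')" using ab by (simp add: add M.a_assoc)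
  next
    show "\<zero>\<^bsub>M'\<^esub> \<in> carrier M'" unfolding zero[symmetric] by (rule cl) simp
    fix a' assume "a' \<in> carrier M'"
    then obtain a where a: "a \<in> carrier M" "a' = \<Phi> a" using pre by meson
    show "\<zero>\<^bsub>M'\<^esub> \<oplus>\<^bsub>M'\<^esub> a' = a'" using a by (simp add: add flip: zero)
    show "\<exists>b'\<in>carrier M'. b' \<oplus>\<^bsub>M'\<^esub> a' = \<zero>\<^bsub>M'\<^esub>"
      using a by (intro bexI[of _ "\<Phi> (\<ominus>\<^bsub>M\<^esub> a)"]) (simp_all add: add cl M.l_neg zero)
  qed
  moreover note m = left_moduleD(2-)[OF M]
  have "r \<odot>\<^bsub>M'\<^esub> a' \<in> carrier M'" if "a' \<in> carrier M'" for r a'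
    using pre[OF that] m(1) cl by (auto simp flip: lin)
  moreover have "r \<odot>\<^bsub>M'\<^esub> (a' \<oplus>\<^bsub>M'\<^esub> b') = r \<odot>\<^bsub>M'\<^esub> a' \<oplus>\<^bsub>M'\<^esub> r \<odot>\<^bsub>M'\<^esub> b'" if "a' \<in> carrier M'" "b' \<in> carrier M'" for r a' b'
    using pre[OF that(1)] pre[OF that(2)] m(1,2) by (auto simp: add simp flip: lin)
  moreover have "(r + s) \<odot>\<^bsub>M'\<^esub> a' = r \<odot>\<^bsub>M'\<^esub> a' \<oplus>\<^bsub>M'\<^esub> s \<odot>\<^bsub>M'\<^esub> a'" if "a' \<in> carrier M'" for r s a'
    using pre[OF that] m(1,3) by (auto simp: add simp flip: lin)
  moreover have "(r * s) \<odot>\<^bsub>M'\<^esub> a' = r \<odot>\<^bsub>M'\<^esub> (s \<odot>\<^bsub>M'\<^esub> a')" if "a' \<in> carrier M'" for r s a'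
    using pre[OF that] m(1,4) by (auto simp flip: lin)
  moreover have "1 \<odot>\<^bsub>M'\<^esub> a' = a'" if "a' \<in> carrier M'" for a'
    using pre[OF that] m(5) by (auto simp flip: lin)
  ultimately show ?thesis by (simp add: left_module_def)
qed

text \<open>
  The maps \<open>id \<otimes>\<^sub>H \<Phi>\<close> commute with everything from which the axioms are formed: the actions of the tensor
  powers, the exchange of factors and, by \<open>iterated_bracket_hbal\<close>, both iterated brackets. Since \<open>\<Phi>\<close> is onto, an
  identity between values of \<open>\<Phi>\<close> is all that has to be checked.
\<close>

lemma transport_lie_pseudoalgebra:
  fixes L :: "('h, 'm, 'x) pseudoalgebra_scheme" and L' :: "('h, 'n, 'y) pseudoalgebra_scheme"
  assumes L: "lie_pseudoalgebra H L" and \<Phi>: "additive_map L L' \<Phi>" and onto: "\<Phi> ` carrier L = carrier L'"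
    and lin: "\<And>h a. a \<in> carrier L \<Longrightarrow> \<Phi> (h \<odot>\<^bsub>L\<^esub> a) = h \<odot>\<^bsub>L'\<^esub> \<Phi> a" and zero: "\<Phi> \<zero>\<^bsub>L\<^esub> = \<zero>\<^bsub>L'\<^esub>"
    and br: "\<And>a b. a \<in> carrier L \<Longrightarrow> b \<in> carrier L \<Longrightarrow> hmap H L' \<Phi> (pbracket L a b) = pbracket L' (\<Phi> a) (\<Phi> b)"
  shows "lie_pseudoalgebra H L'"
proof -
  note n3 = three_in and n2 = two_in
  note pb = lie_pseudoalgebraD(1)[OF L]
  note M = pseudobracketD(1)[OF pb] and bi = pseudobracketD(2)[OF pb] and sq = pseudobracketD(3)[OF pb]
  have M': "left_module L'" by (rule transport_left_module[OF M \<Phi> onto lin zero])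
  interpret L: abelian_group L by (rule left_moduleD(1)[OF M])
  note cl = additive_closed[OF \<Phi>] and bcl = biadditiveD(3)[OF bi]
  have pre: "\<exists>a\<in>carrier L. a' = \<Phi> a" if "a' \<in> carrier L'" for a' using onto that by blast
  note ag = htens_abelian_group[OF _ M] and ag' = htens_abelian_group[OF _ M']
  have F: "additive_map (htens H n L) (htens H n L') (hfun n L' \<Phi>)" if n: "n \<in> {2, 3}" for n
    by (rule hfun_properties(1)[OF n M M' \<Phi>]) (rule lin)
  have Fp: "hfun n L' \<Phi> (hpure H n L t m) = hpure H n L' t (\<Phi> m)"
    if n: "n \<in> {2, 3}" and t: "t \<in> carrier (tpow H n)" and m: "m \<in> carrier L" for n t m
    by (rule hfun_properties(2)[OF n M M' \<Phi> _ t m]) (rule lin)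
  have Fs: "hfun n L' \<Phi> (s \<odot>\<^bsub>htens H n L\<^esub> U) = s \<odot>\<^bsub>htens H n L'\<^esub> hfun n L' \<Phi> U"
    if n: "n \<in> {2, 3}" and s: "s \<in> carrier (tpow H n)" and U: "U \<in> carrier (htens H n L)" for n s U
  proof (rule htens_eq_on_pure[OF n M ag'[OF n] additive_comp[OF hsmult_additive[OF n M s] F[OF n]]
        additive_comp[OF F[OF n] hsmult_additive[OF n M' s]] _ U])
    fix t m assume t: "t \<in> carrier (tpow H n)" and m: "m \<in> carrier L"
    show "hfun n L' \<Phi> (s \<odot>\<^bsub>htens H n L\<^esub> hpure H n L t m) = s \<odot>\<^bsub>htens H n L'\<^esub> hfun n L' \<Phi> (hpure H n L t m)"
      unfolding hsmult_pure[OF n M s t m] Fp[OF n t m] hsmult_pure[OF n M' s t cl[OF m]]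
      by (rule Fp[OF n tmult_closed[OF s t] m])
  qed
  have Ff: "hfun n L' \<Phi> (hflip H n L U) = hflip H n L' (hfun n L' \<Phi> U)"
    if n: "n \<in> {2, 3}" and U: "U \<in> carrier (htens H n L)" for n U
  proof (rule htens_eq_on_pure[OF n M ag'[OF n] additive_comp[OF hflip_additive[OF n M] F[OF n]]
        additive_comp[OF F[OF n] hflip_additive[OF n M']] _ U])
    fix t m assume t: "t \<in> carrier (tpow H n)" and m: "m \<in> carrier L"
    have "n \<ge> 2" using n by auto
    then have "tflip H n t \<in> carrier (tpow H n)" by (rule additive_closed[OF tflip_additive t])
    then show "hfun n L' \<Phi> (hflip H n L (hpure H n L t m)) = hflip H n L' (hfun n L' \<Phi> (hpure H n L t m))"
      unfolding hflip_pure[OF n M t m] Fp[OF n t m] hflip_pure[OF n M' t cl[OF m]] by (rule Fp[OF n _ m])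
  qed
  have br: "pbracket L' (\<Phi> a) (\<Phi> b) = hfun 2 L' \<Phi> (pbracket L a b)" if "a \<in> carrier L" "b \<in> carrier L" for a b
    unfolding hfun_2 by (rule br[OF that, symmetric])
  have pb': "pseudobracket L'"
    unfolding pseudobracket_def
  proof (intro conjI allI ballI M' biadditiveI additiveI)
    fix a' b' assume "a' \<in> carrier L'" "b' \<in> carrier L'"
    then obtain a b where ab: "a \<in> carrier L" "b \<in> carrier L" "a' = \<Phi> a" "b' = \<Phi> b" using pre by meson
    show c: "pbracket L' a' b' \<in> carrier (htens H 2 L')"
      unfolding ab br[OF ab(1,2)] by (rule additive_closed[OF F[OF n2] bcl[OF ab(1,2)]])
    show "pbracket L' a' b' \<in> carrier (htens H 2 L')" by (rule c)
    show "pbracket L' (f \<odot>\<^bsub>L'\<^esub> a') (g \<odot>\<^bsub>L'\<^esub> b') = pure H [f, g] \<odot>\<^bsub>htens H 2 L'\<^esub> pbracket L' a' b'" for f g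
      unfolding ab lin[OF ab(1), symmetric] lin[OF ab(2), symmetric] br[OF ab(1,2)]
        br[OF left_moduleD(2)[OF M ab(1)] left_moduleD(2)[OF M ab(2)]] sq[OF ab(1,2)]
      by (rule Fs[OF n2 _ bcl[OF ab(1,2)]]) (simp add: pure_closed)
  next
    fix a' b' c' assume "a' \<in> carrier L'" "b' \<in> carrier L'" "c' \<in> carrier L'"
    then obtain a b c where ab: "a \<in> carrier L" "b \<in> carrier L" "c \<in> carrier L" "a' = \<Phi> a" "b' = \<Phi> b" "c' = \<Phi> c"
      using pre by meson
    show "pbracket L' a' (b' \<oplus>\<^bsub>L'\<^esub> c') = pbracket L' a' b' \<oplus>\<^bsub>htens H 2 L'\<^esub> pbracket L' a' c'"
      unfolding ab additive_add[OF \<Phi> ab(2,3), symmetric] br[OF ab(1,2)] br[OF ab(1,3)] br[OF ab(1) L.a_closed[OF ab(2,3)]]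
        additive_add[OF biadditiveD(1)[OF bi ab(1)] ab(2,3)]
      by (rule additive_add[OF F[OF n2] bcl[OF ab(1,2)] bcl[OF ab(1,3)]])
  next
    fix a' b' c' assume "a' \<in> carrier L'" "b' \<in> carrier L'" "c' \<in> carrier L'"
    then obtain a b c where ab: "a \<in> carrier L" "b \<in> carrier L" "c \<in> carrier L" "a' = \<Phi> a" "b' = \<Phi> b" "c' = \<Phi> c"
      using pre by meson
    show "pbracket L' (b' \<oplus>\<^bsub>L'\<^esub> c') a' = pbracket L' b' a' \<oplus>\<^bsub>htens H 2 L'\<^esub> pbracket L' c' a'"
      unfolding ab additive_add[OF \<Phi> ab(2,3), symmetric] br[OF ab(2,1)] br[OF ab(3,1)] br[OF L.a_closed[OF ab(2,3)] ab(1)]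
        additive_add[OF biadditiveD(2)[OF bi ab(1)] ab(2,3)]
      by (rule additive_add[OF F[OF n2] bcl[OF ab(2,1)] bcl[OF ab(3,1)]])
  qed
  note bi' = pseudobracketD(2)[OF pb'] and sq' = pseudobracketD(3)[OF pb']
  note bcl' = biadditiveD(3)[OF bi']
  have N: "hfun 3 L' \<Phi> (N g U) = N' g (hfun 2 L' \<Phi> U)"
    if N: "biadditive (tpow H 2) (htens H 2 L) (htens H 3 L) N"
        "\<And>g t m. g \<in> carrier (tpow H 2) \<Longrightarrow> t \<in> carrier (tpow H 2) \<Longrightarrow> m \<in> carrier L \<Longrightarrow>
          N g (hpure H 2 L t m) = hpure H 3 L (C g t) m"
      and N': "biadditive (tpow H 2) (htens H 2 L') (htens H 3 L') N'"
        "\<And>g t m. g \<in> carrier (tpow H 2) \<Longrightarrow> t \<in> carrier (tpow H 2) \<Longrightarrow> m \<in> carrier L' \<Longrightarrow>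
          N' g (hpure H 2 L' t m) = hpure H 3 L' (C g t) m"
      and C: "\<And>g t. g \<in> carrier (tpow H 2) \<Longrightarrow> t \<in> carrier (tpow H 2) \<Longrightarrow> C g t \<in> carrier (tpow H 3)"
      and g: "g \<in> carrier (tpow H 2)" and U: "U \<in> carrier (htens H 2 L)" for N N' C g U
  proof (rule htens_eq_on_pure[OF n2 M ag'[OF n3] additive_comp[OF biadditiveD(1)[OF N(1) g] F[OF n3]]
        additive_comp[OF F[OF n2] biadditiveD(1)[OF N'(1) g]] _ U])
    fix t m assume t: "t \<in> carrier (tpow H 2)" and m: "m \<in> carrier L"
    show "hfun 3 L' \<Phi> (N g (hpure H 2 L t m)) = N' g (hfun 2 L' \<Phi> (hpure H 2 L t m))"
      unfolding N(2)[OF g t m] Fp[OF n2 t m] N'(2)[OF g t cl[OF m]] by (rule Fp[OF n3 C[OF g t] m])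
  qed
  have Cl: "tcat H 2 1 g (pure H [1]) \<otimes>\<^bsub>tpow H 3\<^esub> comult_id H t \<in> carrier (tpow H 3)"
      "tcat H 1 2 (pure H [1]) g \<otimes>\<^bsub>tpow H 3\<^esub> id_comult H t \<in> carrier (tpow H 3)"
    if "g \<in> carrier (tpow H 2)" "t \<in> carrier (tpow H 2)" for g t
    by (rule tmult_closed[OF tcat_one_closed(1)[OF that(1)] additive_closed[OF comult_id_additive that(2)]],
        rule tmult_closed[OF tcat_one_closed(2)[OF that(1)] additive_closed[OF id_comult_additive that(2)]])
  note Nl = N[OF nest_left_properties(1,2)[OF M] nest_left_properties(1,2)[OF M'] Cl(1)]
  note Nr = N[OF nest_right_properties(1,2)[OF M] nest_right_properties(1,2)[OF M'] Cl(2)]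
  have I: "hfun 3 L' \<Phi> (frag_lift (htens H 3 L) (\<lambda>(g, e). \<psi> g e) U) = frag_lift (htens H 3 L') (\<lambda>(g, e). \<psi>' g e) (hfun 2 L' \<Phi> U)"
    if \<psi>: "hbal 2 L (htens H 3 L) \<psi>" and \<psi>': "hbal 2 L' (htens H 3 L') \<psi>'"
      and e: "\<And>g e. g \<in> carrier (tpow H 2) \<Longrightarrow> e \<in> carrier L \<Longrightarrow> hfun 3 L' \<Phi> (\<psi> g e) = \<psi>' g (\<Phi> e)"
      and U: "U \<in> carrier (htens H 2 L)" for \<psi> \<psi>' U
  proof (rule htens_eq_on_pure[OF n2 M ag'[OF n3] additive_comp[OF hlift_additive[OF n2 M ag[OF n3] \<psi>] F[OF n3]]
        additive_comp[OF F[OF n2] hlift_additive[OF n2 M' ag'[OF n3] \<psi>']] _ U])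
    fix t m assume t: "t \<in> carrier (tpow H 2)" and m: "m \<in> carrier L"
    show "hfun 3 L' \<Phi> (frag_lift (htens H 3 L) (\<lambda>(g, e). \<psi> g e) (hpure H 2 L t m)) =
        frag_lift (htens H 3 L') (\<lambda>(g, e). \<psi>' g e) (hfun 2 L' \<Phi> (hpure H 2 L t m))"
      unfolding hlift_pure[where \<phi> = \<psi>, OF n2 M ag[OF n3] \<psi> t m] Fp[OF n2 t m]
        hlift_pure[where \<phi> = \<psi>', OF n2 M' ag'[OF n3] \<psi>' t cl[OF m]] by (rule e[OF t m])
  qed
  have left: "hfun 3 L' \<Phi> (pbracket_left H L a b c) = pbracket_left H L' (\<Phi> a) (\<Phi> b) (\<Phi> c)"
    if a: "a \<in> carrier L" and b: "b \<in> carrier L" and c: "c \<in> carrier L" for a b c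
    unfolding pbracket_left_eq br[OF a b]
    by (rule I[OF iterated_bracket_hbal(1)[OF pb c] iterated_bracket_hbal(1)[OF pb' cl[OF c]] _ bcl[OF a b]])
      (simp only: Nl bcl[OF _ c] br[OF _ c])
  have right: "hfun 3 L' \<Phi> (pbracket_right H L a b c) = pbracket_right H L' (\<Phi> a) (\<Phi> b) (\<Phi> c)"
    if a: "a \<in> carrier L" and b: "b \<in> carrier L" and c: "c \<in> carrier L" for a b c
    unfolding pbracket_right_eq br[OF b c]
    by (rule I[OF iterated_bracket_hbal(2)[OF pb a] iterated_bracket_hbal(2)[OF pb' cl[OF a]] _ bcl[OF b c]])
      (simp only: Nr bcl[OF a] br[OF a])
  have rcl: "pbracket_right H L a b c \<in> carrier (htens H 3 L)"
    if a: "a \<in> carrier L" and b: "b \<in> carrier L" and c: "c \<in> carrier L" for a b c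
    unfolding pbracket_right_eq
    by (rule additive_closed[OF hlift_additive[OF n2 M ag[OF n3] iterated_bracket_hbal(2)[OF pb a]] bcl[OF b c]])
  have skew: "pbracket L' b' a' = \<ominus>\<^bsub>htens H 2 L'\<^esub> hflip H 2 L' (pbracket L' a' b')"
    if a': "a' \<in> carrier L'" and b': "b' \<in> carrier L'" for a' b'
  proof -
    obtain a where a: "a \<in> carrier L" "a' = \<Phi> a" using pre[OF a'] by blast
    obtain b where b: "b \<in> carrier L" "b' = \<Phi> b" using pre[OF b'] by blast
    have "pbracket L' b' a' = hfun 2 L' \<Phi> (\<ominus>\<^bsub>htens H 2 L\<^esub> hflip H 2 L (pbracket L a b))"
      unfolding a(2) b(2) br[OF b(1) a(1)] lie_pseudoalgebraD(2)[OF L a(1) b(1)] ..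
    also have "\<dots> = \<ominus>\<^bsub>htens H 2 L'\<^esub> hfun 2 L' \<Phi> (hflip H 2 L (pbracket L a b))"
      by (rule additive_uminus[OF ag[OF n2] ag'[OF n2] F[OF n2] additive_closed[OF hflip_additive[OF n2 M] bcl[OF a(1) b(1)]]])
    also have "\<dots> = \<ominus>\<^bsub>htens H 2 L'\<^esub> hflip H 2 L' (pbracket L' a' b')"
      unfolding Ff[OF n2 bcl[OF a(1) b(1)]] a(2) b(2) br[OF a(1) b(1)] ..
    finally show ?thesis .
  qed
  have jac: "pbracket_right H L' a' b' c' \<ominus>\<^bsub>htens H 3 L'\<^esub> hflip H 3 L' (pbracket_right H L' b' a' c') = pbracket_left H L' a' b' c'"
    if a': "a' \<in> carrier L'" and b': "b' \<in> carrier L'" and c': "c' \<in> carrier L'" for a' b' c'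
  proof -
    obtain a where a: "a \<in> carrier L" "a' = \<Phi> a" using pre[OF a'] by blast
    obtain b where b: "b \<in> carrier L" "b' = \<Phi> b" using pre[OF b'] by blast
    obtain c where c: "c \<in> carrier L" "c' = \<Phi> c" using pre[OF c'] by blast
    have "pbracket_left H L' a' b' c' = hfun 3 L' \<Phi> (pbracket_left H L a b c)"
      unfolding a(2) b(2) c(2) by (rule left[OF a(1) b(1) c(1), symmetric])
    also have "\<dots> = hfun 3 L' \<Phi> (pbracket_right H L a b c \<ominus>\<^bsub>htens H 3 L\<^esub> hflip H 3 L (pbracket_right H L b a c))"
      unfolding lie_pseudoalgebraD(3)[OF L a(1) b(1) c(1)] ..
    also have "\<dots> = hfun 3 L' \<Phi> (pbracket_right H L a b c) \<ominus>\<^bsub>htens H 3 L'\<^esub> hfun 3 L' \<Phi> (hflip H 3 L (pbracket_right H L b a c))"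
      by (rule additive_minus[OF ag[OF n3] ag'[OF n3] F[OF n3] rcl[OF a(1) b(1) c(1)]
            additive_closed[OF hflip_additive[OF n3 M] rcl[OF b(1) a(1) c(1)]]])
    also have "\<dots> = pbracket_right H L' a' b' c' \<ominus>\<^bsub>htens H 3 L'\<^esub> hflip H 3 L' (pbracket_right H L' b' a' c')"
      unfolding Ff[OF n3 rcl[OF b(1) a(1) c(1)]] right[OF a(1) b(1) c(1)] right[OF b(1) a(1) c(1)] a(2) b(2) c(2) ..
    finally show ?thesis by (rule sym)
  qed
  show ?thesis
    unfolding lie_pseudoalgebra_def
  proof (intro conjI allI ballI)
    show "pbracket L' (f \<odot>\<^bsub>L'\<^esub> a) (g \<odot>\<^bsub>L'\<^esub> b) = pure H [f, g] \<odot>\<^bsub>htens H 2 L'\<^esub> pbracket L' a b"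
      if "a \<in> carrier L'" "b \<in> carrier L'" for f g a b by (rule sq'[OF that])
    show "pbracket L' (a \<oplus>\<^bsub>L'\<^esub> a') b = pbracket L' a b \<oplus>\<^bsub>htens H 2 L'\<^esub> pbracket L' a' b"
      if "a \<in> carrier L'" "a' \<in> carrier L'" "b \<in> carrier L'" for a a' b
      by (rule additive_add[OF biadditiveD(2)[OF bi' that(3)] that(1,2)])
    show "pbracket L' a (b \<oplus>\<^bsub>L'\<^esub> b') = pbracket L' a b \<oplus>\<^bsub>htens H 2 L'\<^esub> pbracket L' a b'"
      if "a \<in> carrier L'" "b \<in> carrier L'" "b' \<in> carrier L'" for a b b'
      by (rule additive_add[OF biadditiveD(1)[OF bi' that(1)] that(2,3)])
  qed (rule M', erule (1) bcl', erule (1) skew, erule (2) jac)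
qed

end

section \<open>Group topologies given by a filtration\<close>

locale filtered_group = abelian_group G for G :: "('g, 'x) ring_scheme" (structure) +
  fixes N :: "nat \<Rightarrow> 'g set"
  assumes N_subset: "N n \<subseteq> carrier G" and N_zero: "\<zero> \<in> N n"
    and N_add: "u \<in> N n \<Longrightarrow> v \<in> N n \<Longrightarrow> u \<oplus> v \<in> N n"
    and N_uminus: "u \<in> N n \<Longrightarrow> \<ominus> u \<in> N n"
    and N_mono: "m \<le> n \<Longrightarrow> N n \<subseteq> N m"
begin

lemma N_closed: "u \<in> N n \<Longrightarrow> u \<in> carrier G"
  using N_subset by blast

lemma N_finsum: "(\<And>i. i \<in> A \<Longrightarrow> s i \<in> N n) \<Longrightarrow> (\<Oplus>i\<in>A. s i) \<in> N n"
proof (induction A rule: infinite_finite_induct)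
  case (insert x F)
  have "(\<Oplus>i\<in>insert x F. s i) = s x \<oplus> (\<Oplus>i\<in>F. s i)"
    by (rule finsum_insert) (use insert N_closed in auto)
  then show ?case using insert by (simp add: N_add)
qed (simp_all add: N_zero)

lemma coset_swap:
  assumes "a \<in> carrier G" "b \<in> carrier G" "v \<in> N n" "b = a \<oplus> v"
  shows "(\<lambda>v. b \<oplus> v) ` N n = (\<lambda>v. a \<oplus> v) ` N n"
proof -
  have v: "v \<in> carrier G" by (rule N_closed[OF assms(3)])
  have "b \<oplus> w \<in> (\<lambda>v. a \<oplus> v) ` N n" if w: "w \<in> N n" for w
    by (rule image_eqI[OF _ N_add[OF assms(3) w]])
      (simp add: assms(4) a_assoc assms(1) v N_closed[OF w])
  moreover have "a \<oplus> w \<in> (\<lambda>v. b \<oplus> v) ` N n" if w: "w \<in> N n" for w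
  proof (rule image_eqI[OF _ N_add[OF N_uminus[OF assms(3)] w]])
    show "a \<oplus> w = b \<oplus> (\<ominus> v \<oplus> w)"
      using assms(1) v N_closed[OF w] by (simp add: assms(4) a_assoc r_neg2)
  qed
  ultimately show ?thesis by blast
qed

text \<open>The cosets already form a base, because a coset of \<open>N n\<close> is the coset at each of its members and the \<open>N n\<close> form a chain.\<close>

lemma openin_filt:
  "openin (filt_topology G N) U \<longleftrightarrow> U \<subseteq> carrier G \<and> (\<forall>u\<in>U. \<exists>n. (\<lambda>v. u \<oplus> v) ` N n \<subseteq> U)"
proof
  define S where "S = {(\<lambda>v. u \<oplus> v) ` N n |u n. u \<in> carrier G}"
  have t: "filt_topology G N = topology_generated_by S" by (simp add: filt_topology_def S_def)
  assume "openin (filt_topology G N) U"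
  then have "generate_topology_on S U" by (simp add: t openin_topology_generated_by_iff)
  then show "U \<subseteq> carrier G \<and> (\<forall>u\<in>U. \<exists>n. (\<lambda>v. u \<oplus> v) ` N n \<subseteq> U)"
  proof (induction rule: generate_topology_on.induct)
    case (Int a b)
    have "\<exists>n. (\<lambda>v. u \<oplus> v) ` N n \<subseteq> a \<inter> b" if u: "u \<in> a \<inter> b" for u
    proof -
      obtain m where m: "(\<lambda>v. u \<oplus> v) ` N m \<subseteq> a" using Int.IH(1) u by blast
      obtain n where n: "(\<lambda>v. u \<oplus> v) ` N n \<subseteq> b" using Int.IH(2) u by blast
      have "N (max m n) \<subseteq> N m" "N (max m n) \<subseteq> N n" by (simp_all add: N_mono)
      then show ?thesis using m n by (intro exI[of _ "max m n"]) blast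
    qed
    then show ?case using Int.IH by blast
  next
    case (UN K)
    show ?case
    proof (intro conjI ballI Union_least)
      show "k \<subseteq> carrier G" if "k \<in> K" for k using UN.IH[OF that] by (rule conjunct1)
      fix u assume "u \<in> \<Union> K"
      then obtain k where k: "k \<in> K" "u \<in> k" by (elim UnionE)
      obtain n where "(\<lambda>v. u \<oplus> v) ` N n \<subseteq> k" using UN.IH[OF k(1)] k(2) by blast
      then show "\<exists>n. (\<lambda>v. u \<oplus> v) ` N n \<subseteq> \<Union> K" using k(1) by blast
    qed
  next
    case (Basis s)
    then obtain a n where a: "a \<in> carrier G" "s = (\<lambda>v. a \<oplus> v) ` N n" by (auto simp: S_def)
    have sub: "s \<subseteq> carrier G" using a N_closed by auto
    have "(\<lambda>v. u \<oplus> v) ` N n \<subseteq> s" if u: "u \<in> s" for u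
    proof -
      obtain v where v: "v \<in> N n" "u = a \<oplus> v" using u a(2) by blast
      have "u \<in> carrier G" using u sub by blast
      from coset_swap[OF a(1) this v] show ?thesis by (simp add: a(2))
    qed
    then show ?case using sub by blast
  qed simp
next
  assume U: "U \<subseteq> carrier G \<and> (\<forall>u\<in>U. \<exists>n. (\<lambda>v. u \<oplus> v) ` N n \<subseteq> U)"
  define S where "S = {(\<lambda>v. u \<oplus> v) ` N n |u n. u \<in> carrier G}"
  have t: "filt_topology G N = topology_generated_by S" by (simp add: filt_topology_def S_def)
  have "\<exists>V. openin (filt_topology G N) V \<and> u \<in> V \<and> V \<subseteq> U" if u: "u \<in> U" for u
  proof -
    obtain n where n: "(\<lambda>v. u \<oplus> v) ` N n \<subseteq> U" using U u by blast
    have uc: "u \<in> carrier G" using U u by blast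
    have "openin (filt_topology G N) ((\<lambda>v. u \<oplus> v) ` N n)"
      unfolding t by (rule topology_generated_by_Basis) (use uc in \<open>auto simp: S_def\<close>)
    moreover have "u \<in> (\<lambda>v. u \<oplus> v) ` N n"
      using N_zero uc by (intro image_eqI[of _ _ \<zero>]) simp_all
    ultimately show ?thesis using n by blast
  qed
  then show "openin (filt_topology G N) U" by (subst openin_subopen) blast
qed

lemma topspace_filt: "topspace (filt_topology G N) = carrier G"
proof
  show "topspace (filt_topology G N) \<subseteq> carrier G"
    using openin_filt[of "topspace (filt_topology G N)"] by simp
  have "openin (filt_topology G N) (carrier G)"
    unfolding openin_filt using N_closed by (auto intro!: exI[of _ 0])
  then show "carrier G \<subseteq> topspace (filt_topology G N)" by (rule openin_subset)
qed

lemma openin_N: "openin (filt_topology G N) (N n)"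
  unfolding openin_filt using N_subset N_add by blast

lemma limitin_filtI:
  assumes "l \<in> carrier G" "\<And>n. eventually (\<lambda>i. \<exists>v\<in>N n. f i = l \<oplus> v) F"
  shows "limitin (filt_topology G N) f l F"
  unfolding limitin_def topspace_filt
proof (intro conjI allI impI assms(1))
  fix U assume U: "openin (filt_topology G N) U \<and> l \<in> U"
  then obtain n where n: "(\<lambda>v. l \<oplus> v) ` N n \<subseteq> U" by (auto simp: openin_filt)
  show "eventually (\<lambda>i. f i \<in> U) F"
    using assms(2)[of n] by (rule eventually_mono) (use n in blast)
qed

lemma limitin_filtD:
  assumes "limitin (filt_topology G N) f l F"
  shows "l \<in> carrier G" "eventually (\<lambda>i. \<exists>v\<in>N n. f i = l \<oplus> v) F"
proof -
  show l: "l \<in> carrier G" using assms by (simp add: limitin_def topspace_filt)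
  let ?V = "(\<lambda>v. l \<oplus> v) ` N n"
  have "openin (filt_topology G N) ?V"
    unfolding openin_filt
  proof (intro conjI ballI)
    show "?V \<subseteq> carrier G" using l N_closed by auto
    fix u assume "u \<in> ?V"
    then obtain v where v: "v \<in> N n" "u = l \<oplus> v" by blast
    have "u \<in> carrier G" using v l N_closed by auto
    from coset_swap[OF l this v] show "\<exists>m. (\<lambda>v. u \<oplus> v) ` N m \<subseteq> ?V" by blast
  qed
  moreover have "l \<in> ?V" using N_zero l by (intro image_eqI[of _ _ \<zero>]) simp_all
  ultimately have "eventually (\<lambda>i. f i \<in> ?V) F" using assms by (simp add: limitin_def)
  then show "eventually (\<lambda>i. \<exists>v\<in>N n. f i = l \<oplus> v) F" by (rule eventually_mono) blast
qed

text \<open>The difference of two limits lies in every \<open>N n\<close>.\<close>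

lemma limitin_filt_unique:
  assumes sep: "\<And>u. (\<And>n. u \<in> N n) \<Longrightarrow> u = \<zero>" and F: "F \<noteq> bot"
    and l: "limitin (filt_topology G N) f l F" and l': "limitin (filt_topology G N) f l' F"
  shows "l = l'"
proof -
  note c = limitin_filtD(1)[OF l] limitin_filtD(1)[OF l']
  have "l \<oplus> \<ominus> l' \<in> N n" for n
  proof -
    have "eventually (\<lambda>i. (\<exists>v\<in>N n. f i = l \<oplus> v) \<and> (\<exists>v\<in>N n. f i = l' \<oplus> v)) F"
      by (rule eventually_conj[OF limitin_filtD(2)[OF l] limitin_filtD(2)[OF l']])
    then obtain i where "(\<exists>v\<in>N n. f i = l \<oplus> v) \<and> (\<exists>v\<in>N n. f i = l' \<oplus> v)"
      using eventually_happens'[OF F] by blast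
    then obtain v w where vw: "v \<in> N n" "w \<in> N n" "l \<oplus> v = l' \<oplus> w" by metis
    note vc = N_closed[OF vw(1)] N_closed[OF vw(2)]
    have "l = l' \<oplus> w \<oplus> \<ominus> v" using c vc by (simp add: a_assoc r_neg flip: vw(3))
    also have "\<dots> = (w \<oplus> \<ominus> v) \<oplus> l'" using c vc by (simp add: a_ac)
    finally have "l \<oplus> \<ominus> l' = (w \<oplus> \<ominus> v) \<oplus> (l' \<oplus> \<ominus> l')" using c vc by (simp add: a_assoc)
    then have "l \<oplus> \<ominus> l' = w \<oplus> \<ominus> v" using c vc by (simp add: r_neg)
    then show ?thesis using vw by (simp add: N_add N_uminus)
  qed
  then have "l \<oplus> \<ominus> l' = \<zero>" by (rule sep)
  then have "\<ominus> (\<ominus> l') = l" by (rule minus_equality) (use c in simp_all)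
  then show ?thesis using c by simp
qed

end

lemma additive_continuous_iff:
  assumes G: "filtered_group G N" and K: "filtered_group K M" and f: "additive_map G K f"
  shows "continuous_map (filt_topology G N) (filt_topology K M) f \<longleftrightarrow> (\<forall>n. \<exists>m. f ` N m \<subseteq> M n)"
proof -
  interpret G: filtered_group G N by (rule G)
  interpret K: filtered_group K M by (rule K)
  have ag: "abelian_group G" "abelian_group K" by unfold_locales
  note add = additive_add[OF f] and cl = additive_closed[OF f] and zero = additive_zero[OF ag f]
  show ?thesis
  proof
    assume c: "continuous_map (filt_topology G N) (filt_topology K M) f"
    show "\<forall>n. \<exists>m. f ` N m \<subseteq> M n"
    proof
      fix n
      have "openin (filt_topology G N) {x \<in> topspace (filt_topology G N). f x \<in> M n}"
        using c K.openin_N by (simp add: continuous_map_def)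
      then have o: "openin (filt_topology G N) {x \<in> carrier G. f x \<in> M n}" by (simp add: G.topspace_filt)
      moreover have "\<zero>\<^bsub>G\<^esub> \<in> {x \<in> carrier G. f x \<in> M n}" by (simp add: zero K.N_zero)
      ultimately obtain m where "(\<lambda>v. \<zero>\<^bsub>G\<^esub> \<oplus>\<^bsub>G\<^esub> v) ` N m \<subseteq> {x \<in> carrier G. f x \<in> M n}"
        unfolding G.openin_filt by blast
      moreover have "(\<lambda>v. \<zero>\<^bsub>G\<^esub> \<oplus>\<^bsub>G\<^esub> v) ` N m = N m"
        using G.N_closed by (simp add: image_def)
      ultimately have "f ` N m \<subseteq> M n" by blast
      then show "\<exists>m. f ` N m \<subseteq> M n" by blast
    qed
  next
    assume c: "\<forall>n. \<exists>m. f ` N m \<subseteq> M n"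
    show "continuous_map (filt_topology G N) (filt_topology K M) f"
      unfolding continuous_map_def G.topspace_filt K.topspace_filt
    proof (intro conjI allI impI)
      show "f \<in> carrier G \<rightarrow> carrier K" using cl by blast
      fix U assume U: "openin (filt_topology K M) U"
      show "openin (filt_topology G N) {x \<in> carrier G. f x \<in> U}"
        unfolding G.openin_filt
      proof (intro conjI ballI)
        fix u assume u: "u \<in> {x \<in> carrier G. f x \<in> U}"
        then obtain n where n: "(\<lambda>v. f u \<oplus>\<^bsub>K\<^esub> v) ` M n \<subseteq> U" using U by (auto simp: K.openin_filt)
        obtain m where m: "f ` N m \<subseteq> M n" using c by blast
        have "u \<oplus>\<^bsub>G\<^esub> v \<in> {x \<in> carrier G. f x \<in> U}" if v: "v \<in> N m" for v
        proof -
          have "f v \<in> M n" using m v by blast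
          then have "f u \<oplus>\<^bsub>K\<^esub> f v \<in> U" using n by blast
          then show ?thesis using u G.N_closed[OF v] by (simp add: add)
        qed
        then show "\<exists>m. (\<lambda>v. u \<oplus>\<^bsub>G\<^esub> v) ` N m \<subseteq> {x \<in> carrier G. f x \<in> U}" by blast
      qed blast
    qed
  qed
qed

section \<open>The dual algebra and the annihilation algebra\<close>

context cocommutative_hopf_algebra
begin

abbreviation X :: "('h \<Rightarrow> 'k) ring" where "X \<equiv> dual H"

lemma X_carrier: "x \<in> carrier X \<longleftrightarrow> lin (*) x"
  by (rule lin_dual)

lemma X_simps: "\<zero>\<^bsub>X\<^esub> = (\<lambda>h. 0)" "x \<oplus>\<^bsub>X\<^esub> y = (\<lambda>h. x h + y h)"
  by (simp_all add: dual_def)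

lemma X_add_apply: "(x \<oplus>\<^bsub>X\<^esub> y) h = x h + y h"
  by (simp add: X_simps)

lemma X_abelian_group: "abelian_group X"
proof (rule abelian_groupI)
  show "x \<oplus>\<^bsub>X\<^esub> y \<in> carrier X" if "x \<in> carrier X" "y \<in> carrier X" for x y
    using that by (simp add: X_simps X_carrier lin_plus)
  show "\<zero>\<^bsub>X\<^esub> \<in> carrier X" by (simp add: X_simps X_carrier lin_def)
  show "\<exists>y\<in>carrier X. y \<oplus>\<^bsub>X\<^esub> x = \<zero>\<^bsub>X\<^esub>" if "x \<in> carrier X" for x
    using that by (intro bexI[of _ "\<lambda>h. - x h"]) (simp_all add: X_simps X_carrier lin_def)
qed (simp_all add: X_simps ac_simps)

lemma X_uminus: "x \<in> carrier X \<Longrightarrow> \<ominus>\<^bsub>X\<^esub> x = (\<lambda>h. - x h)"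
proof -
  interpret X: abelian_group X by (rule X_abelian_group)
  assume x: "x \<in> carrier X"
  show ?thesis
    by (rule X.minus_equality) (use x in \<open>simp_all add: X_simps X_carrier lin_def\<close>)
qed

lemma eval_additive: "additive_map X type_ring (\<lambda>x. x f)"
  by (rule additiveI) (simp_all add: X_simps)

lemma ract_in_X: "x \<in> carrier X \<Longrightarrow> dual_ract H x h \<in> carrier X"
  unfolding X_carrier dual_ract_def by (rule lin_comp[OF _ lin_mult_right[OF lin_id]])

lemma lact_in_X: "x \<in> carrier X \<Longrightarrow> dual_lact H h x \<in> carrier X"
  unfolding X_carrier dual_lact_def by (rule lin_comp[OF _ lin_mult_left[OF lin_id]])

lemma dual_antipode_in_X: "x \<in> carrier X \<Longrightarrow> dual_antipode H x \<in> carrier X"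
  unfolding X_carrier dual_antipode_def by (rule lin_comp[OF _ lin_antipode])

lemma ract_additive: "additive_map X X (\<lambda>x. dual_ract H x h)"
  by (rule additiveI) (simp_all add: ract_in_X, simp add: X_simps dual_ract_def)

lemma lact_additive: "additive_map X X (dual_lact H h)"
  by (rule additiveI) (simp_all add: lact_in_X, simp add: X_simps dual_lact_def)

lemma ract_add_right: "x \<in> carrier X \<Longrightarrow> dual_ract H x (g + h) = dual_ract H x g \<oplus>\<^bsub>X\<^esub> dual_ract H x h"
  by (rule ext) (simp add: dual_ract_def X_simps lin_add[OF lin_antipode] distrib_left lin_add[of "(*)" x] X_carrier)

lemma ract_mult: "dual_ract H x (g * h) = dual_ract H (dual_ract H x g) h"
  by (rule ext) (simp add: dual_ract_def anti_mult mult.assoc)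

lemma ract_one: "dual_ract H x 1 = x"
  by (rule ext) (simp add: dual_ract_def anti_one)

lemma lact_ract: "dual_lact H s (dual_ract H x h) = dual_ract H (dual_lact H s x) h"
  by (rule ext) (simp add: dual_ract_def dual_lact_def mult.assoc)

lemma bilin_dual: "lin (*) x \<Longrightarrow> lin (*) y \<Longrightarrow> bilin (*) (\<lambda>a b. x a * y b)"
  by (intro bilinI lin_times_left lin_times_right)

lemma X_mult: "x \<in> carrier X \<Longrightarrow> y \<in> carrier X \<Longrightarrow> (x \<otimes>\<^bsub>X\<^esub> y) h = sw (\<lambda>a b. x a * y b) h"
  unfolding X_carrier using sw_lift[OF bilin_dual[of x y], of h] by (simp add: dual_def)

lemma X_mult_closed: assumes "x \<in> carrier X" "y \<in> carrier X" shows "x \<otimes>\<^bsub>X\<^esub> y \<in> carrier X"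
proof -
  have "x \<otimes>\<^bsub>X\<^esub> y = sw (\<lambda>a b. x a * y b)" using X_mult[OF assms] by blast
  moreover have "lin (*) (\<lambda>h. sw (\<lambda>a b. x a * y b) h)"
    using assms unfolding X_carrier
    by (intro lin_sw_outside[OF distributes_times] lin_times_left lin_times_right lin_id)
  ultimately show ?thesis by (simp add: X_carrier)
qed

lemma X_mult_biadditive: "biadditive X X X (\<lambda>x y. x \<otimes>\<^bsub>X\<^esub> y)"
proof (rule biadditiveI)
  interpret X: abelian_group X by (rule X_abelian_group)
  show "additive_map X X (\<lambda>y. x \<otimes>\<^bsub>X\<^esub> y)" if x: "x \<in> carrier X" for x
  proof (rule additiveI)
    show "x \<otimes>\<^bsub>X\<^esub> y \<in> carrier X" if "y \<in> carrier X" for y by (rule X_mult_closed[OF x that])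
    show "x \<otimes>\<^bsub>X\<^esub> (y \<oplus>\<^bsub>X\<^esub> z) = (x \<otimes>\<^bsub>X\<^esub> y) \<oplus>\<^bsub>X\<^esub> (x \<otimes>\<^bsub>X\<^esub> z)" if y: "y \<in> carrier X" and z: "z \<in> carrier X" for y z
      by (rule ext) (simp add: X_add_apply X_mult[OF x y] X_mult[OF x z] X_mult[OF x X.a_closed[OF y z]] distrib_left sw_plus)
  qed
  show "additive_map X X (\<lambda>x. x \<otimes>\<^bsub>X\<^esub> y)" if y: "y \<in> carrier X" for y
  proof (rule additiveI)
    show "x \<otimes>\<^bsub>X\<^esub> y \<in> carrier X" if "x \<in> carrier X" for x by (rule X_mult_closed[OF that y])
    show "(x \<oplus>\<^bsub>X\<^esub> z) \<otimes>\<^bsub>X\<^esub> y = (x \<otimes>\<^bsub>X\<^esub> y) \<oplus>\<^bsub>X\<^esub> (z \<otimes>\<^bsub>X\<^esub> y)" if x: "x \<in> carrier X" and z: "z \<in> carrier X" for x z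
      by (rule ext) (simp add: X_add_apply X_mult[OF x y] X_mult[OF z y] X_mult[OF X.a_closed[OF x z] y] distrib_right sw_plus)
  qed
qed

text \<open>The right action is through the antipode, which preserves the coproduct because \<open>H\<close> is cocommutative.\<close>

lemma ract_prod:
  assumes x: "x \<in> carrier X" and y: "y \<in> carrier X"
  shows "dual_ract H (x \<otimes>\<^bsub>X\<^esub> y) h u = sw (\<lambda>a b. (dual_ract H x a \<otimes>\<^bsub>X\<^esub> dual_ract H y b) u) h"
proof -
  have lx: "lin (*) x" and ly: "lin (*) y" using x y by (simp_all add: X_carrier)
  have "dual_ract H (x \<otimes>\<^bsub>X\<^esub> y) h u = sw (\<lambda>p q. x p * y q) (u * anti h)"
    by (simp add: dual_ract_def X_mult[OF x y])
  also have "\<dots> = sw (\<lambda>p q. sw (\<lambda>a b. x (p * a) * y (q * b)) (anti h)) u"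
    by (rule sw_mult[OF bilin_dual[OF lx ly]])
  also have "\<dots> = sw (\<lambda>p q. sw (\<lambda>a b. x (p * anti a) * y (q * anti b)) h) u"
    by (rule sw_cong, rule sw_anti[OF distributes_times];
        intro lin_times_left lin_times_right lin_comp[OF lx] lin_comp[OF ly] lin_mult_left lin_id)
  also have "\<dots> = sw (\<lambda>a b. sw (\<lambda>p q. x (p * anti a) * y (q * anti b)) u) h"
    by (rule sw_swap)
  also have "\<dots> = sw (\<lambda>a b. (dual_ract H x a \<otimes>\<^bsub>X\<^esub> dual_ract H y b) u) h"
    by (simp add: X_mult[OF ract_in_X[OF x] ract_in_X[OF y]]) (simp add: dual_ract_def)
  finally show ?thesis .
qed

lemma annih_data: "left_module L \<Longrightarrow> tprod_data X (dual_ract H) L"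
  by (rule tprod_data.intro[OF X_abelian_group]) (simp_all only: ract_in_X)

lemma X_finsum_apply: "finite A \<Longrightarrow> (\<And>i. i \<in> A \<Longrightarrow> s i \<in> carrier X) \<Longrightarrow> (\<Oplus>\<^bsub>X\<^esub>i\<in>A. s i) u = (\<Sum>i\<in>A. s i u)"
  using additive_finsum[OF X_abelian_group abelian_group_type_ring eval_additive[of u], of A s]
  by (simp add: finsum_type_ring)

lemma ract_scal: "x \<in> carrier X \<Longrightarrow> dual_ract H x (scal H c h) f = c * dual_ract H x h f"
  by (simp add: dual_ract_def X_carrier lin_scal[OF lin_antipode] lin_scal[of "(*)" x] flip: scal_mult_right)

section \<open>Bracket values in normal form\<close>

text \<open>
  In Sweedler notation the right-hand side is \<open>(f S(g\<^sub>1) \<otimes> 1) \<Delta>(g\<^sub>2)\<close>, where \<open>S(g\<^sub>1)\<close> cancels the first leg of \<open>\<Delta>(g\<^sub>2)\<close>.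
  Over \<open>H\<close> the factor \<open>\<Delta>(g\<^sub>2)\<close> moves into the module, which leaves \<open>1\<close> in the second leg.
\<close>

lemma pair_eq_left_leg:
  "pure H [f, g] = (\<Oplus>\<^bsub>tpow H 2\<^esub>b\<in>cosupp g. pure H [f * anti (colegs g b), 1] \<otimes>\<^bsub>tpow H 2\<^esub> comult H b)"
proof (rule tensor_eqI)
  interpret T: abelian_group "tpow H 2" by (rule tpow_abelian_group)
  have cl: "pure H [f * anti (colegs g b), 1] \<otimes>\<^bsub>tpow H 2\<^esub> comult H b \<in> carrier (tpow H 2)" for b
    by (rule tmult_closed[OF pair_closed comult_closed])
  show "pure H [f, g] \<in> carrier (tpow H 2)" by (rule pair_closed)
  show "(\<Oplus>\<^bsub>tpow H 2\<^esub>b\<in>cosupp g. pure H [f * anti (colegs g b), 1] \<otimes>\<^bsub>tpow H 2\<^esub> comult H b) \<in> carrier (tpow H 2)"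
    by (rule T.finsum_closed) (use cl in blast)
  fix x :: "'h \<Rightarrow> 'k" assume x: "lin (*) x"
  have inner: "contract x (pure H [k, 1] \<otimes>\<^bsub>tpow H 2\<^esub> comult H b) = sw (\<lambda>p q. scal H (x q) (k * p)) b" for k b
  proof -
    have "contract x (pure H [k, 1] \<otimes>\<^bsub>tpow H 2\<^esub> comult H b) =
        sw (\<lambda>p q. contract x (pure H [k, 1] \<otimes>\<^bsub>tpow H 2\<^esub> pure H [p, q])) b"
      by (rule sw_additive[OF additive_comp[OF biadditiveD(1)[OF tmult_biadditive pair_closed] contract_additive[OF x]]])
    then show ?thesis by (simp add: tmult_pure contract_pure[OF x])
  qed
  have "contract x (\<Oplus>\<^bsub>tpow H 2\<^esub>b\<in>cosupp g. pure H [f * anti (colegs g b), 1] \<otimes>\<^bsub>tpow H 2\<^esub> comult H b) =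
      (\<Oplus>\<^bsub>type_ring\<^esub>b\<in>cosupp g. contract x (pure H [f * anti (colegs g b), 1] \<otimes>\<^bsub>tpow H 2\<^esub> comult H b))"
    by (rule additive_finsum[OF tpow_abelian_group abelian_group_type_ring contract_additive[OF x] cl])
  also have "\<dots> = sw (\<lambda>a b. sw (\<lambda>p q. scal H (x q) (f * anti a * p)) b) g"
    by (simp only: finsum_type_ring[OF cosupp(1)] inner sw_def[of _ g])
  also have "\<dots> = sw (\<lambda>a b. sw (\<lambda>p q. scal H (x b) (f * anti p * q)) a) g"
    by (rule sw_coassoc[symmetric, where s = "scal H"]; intro lin_intros x)
  also have "\<dots> = sw (\<lambda>a b. scal H (eps a) (scal H (x b) f)) g"
  proof (rule sw_cong)
    fix a b
    have "sw (\<lambda>p q. scal H (x b) (f * (anti p * q))) a = scal H (eps a) (scal H (x b) (f * 1))"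
      by (rule sw_anti_left) (intro lin_intros)
    then show "sw (\<lambda>p q. scal H (x b) (f * anti p * q)) a = scal H (eps a) (scal H (x b) f)"
      by (simp add: mult.assoc)
  qed
  also have "\<dots> = scal H (x g) f"
    by (rule sw_counit_left) (intro lin_scal_left x)
  also have "\<dots> = contract x (pure H [f, g])" by (simp add: contract_pure[OF x])
  finally show "contract x (pure H [f, g]) =
      contract x (\<Oplus>\<^bsub>tpow H 2\<^esub>b\<in>cosupp g. pure H [f * anti (colegs g b), 1] \<otimes>\<^bsub>tpow H 2\<^esub> comult H b)"
    by (rule sym)
qed

definition left_leg :: "('h, 'm, 'x) module_scheme \<Rightarrow> 'h \<Rightarrow> 'm \<Rightarrow> ('h, 'm) htensor" where
  "left_leg M f m = hpure H 2 M (pure H [f, 1]) m"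

text \<open>
  The coefficients \<open>l\<close> are indexed by the elements \<open>f\<close> themselves, so that sums of normal forms are formed by
  adding coefficients.
\<close>

definition normal_forms :: "('h, 'm, 'x) module_scheme \<Rightarrow> ('h, 'm) htensor set" where
  "normal_forms M = {\<Oplus>\<^bsub>htens H 2 M\<^esub>f\<in>F. left_leg M f (l f) |F l. finite F \<and> l \<in> UNIV \<rightarrow> carrier M}"

context
  fixes M :: "('h, 'm, 'x) module_scheme"
  assumes M: "left_module M"
begin

interpretation M: abelian_group M by (rule left_moduleD(1)[OF M])
interpretation T: abelian_group "htens H 2 M" by (rule htens_abelian_group[OF two_in M])

lemma left_leg_biadditive: "biadditive type_ring M (htens H 2 M) (left_leg M)"
proof (rule biadditiveI)
  show "additive_map M (htens H 2 M) (left_leg M f)" for f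
    unfolding left_leg_def[abs_def] by (rule biadditiveD(1)[OF hpure_biadditive[OF two_in M] pair_closed])
  show "additive_map type_ring (htens H 2 M) (\<lambda>f. left_leg M f m)" if "m \<in> carrier M" for m
    unfolding left_leg_def
    by (rule additive_comp[OF pure_pair_additive(1) biadditiveD(2)[OF hpure_biadditive[OF two_in M] that]])
qed

lemma left_leg_closed: "m \<in> carrier M \<Longrightarrow> left_leg M f m \<in> carrier (htens H 2 M)"
  unfolding left_leg_def by (rule hpure_closed[OF two_in M pair_closed])

lemma left_leg_zero: "left_leg M f \<zero>\<^bsub>M\<^esub> = \<zero>\<^bsub>htens H 2 M\<^esub>"
  by (rule additive_zero[OF left_moduleD(1)[OF M] htens_abelian_group[OF two_in M] biadditiveD(1)[OF left_leg_biadditive]]) simp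

text \<open>Scalars pass through the tensor product over \<open>H\<close> because the coproduct of a scalar \<open>c\<close> is \<open>c (1 \<otimes> 1)\<close>.\<close>

lemma left_leg_scal:
  assumes m: "m \<in> carrier M" shows "left_leg M f (scal H c 1 \<odot>\<^bsub>M\<^esub> m) = left_leg M (scal H c f) m"
proof -
  have "comult H (scal H c 1) = pure H [scal H c 1, 1]"
    by (simp add: comult_scal comult_one_pure tsmult_pure)
  then have "tpow_ract H 2 (pure H [f, 1]) (scal H c 1) = pure H [scal H c f, 1]"
    by (simp add: ract_2 tmult_pure flip: scal_mult_right)
  then show ?thesis
    using hpure_ract[OF two_in M pair_closed m, of f 1 "scal H c 1"] by (simp add: left_leg_def)
qed

lemma normal_forms_subset: "normal_forms M \<subseteq> carrier (htens H 2 M)"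
proof
  fix U assume "U \<in> normal_forms M"
  then obtain F l where "U = (\<Oplus>\<^bsub>htens H 2 M\<^esub>f\<in>F. left_leg M f (l f))" "l \<in> UNIV \<rightarrow> carrier M"
    unfolding normal_forms_def by (elim CollectE exE conjE)
  then show "U \<in> carrier (htens H 2 M)"
    using left_leg_closed by (auto simp: Pi_iff intro!: T.finsum_closed)
qed

lemma normal_form_extend:
  assumes "finite G" "F \<subseteq> G" "l \<in> UNIV \<rightarrow> carrier M"
  shows "(\<Oplus>\<^bsub>htens H 2 M\<^esub>f\<in>F. left_leg M f (l f)) =
    (\<Oplus>\<^bsub>htens H 2 M\<^esub>f\<in>G. left_leg M f (if f \<in> F then l f else \<zero>\<^bsub>M\<^esub>))"
  by (rule T.add.finprod_mono_neutral_cong_left[OF assms(1,2)])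
    (use assms(3) left_leg_closed in \<open>auto simp: left_leg_zero Pi_iff\<close>)

lemma normal_forms_group: "filtered_group (htens H 2 M) (\<lambda>n. normal_forms M)"
proof (intro filtered_group.intro filtered_group_axioms.intro htens_abelian_group[OF two_in M] normal_forms_subset)
  show "\<zero>\<^bsub>htens H 2 M\<^esub> \<in> normal_forms M"
    unfolding normal_forms_def by (rule CollectI, rule exI[of _ "{}"], rule exI[of _ "\<lambda>f. \<zero>\<^bsub>M\<^esub>"]) simp
  show "U \<oplus>\<^bsub>htens H 2 M\<^esub> V \<in> normal_forms M" if U: "U \<in> normal_forms M" and V: "V \<in> normal_forms M" for U V
  proof -
    obtain F l where F: "U = (\<Oplus>\<^bsub>htens H 2 M\<^esub>f\<in>F. left_leg M f (l f))" "finite F" "l \<in> UNIV \<rightarrow> carrier M"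
      using U unfolding normal_forms_def by (elim CollectE exE conjE)
    obtain G k where G: "V = (\<Oplus>\<^bsub>htens H 2 M\<^esub>f\<in>G. left_leg M f (k f))" "finite G" "k \<in> UNIV \<rightarrow> carrier M"
      using V unfolding normal_forms_def by (elim CollectE exE conjE)
    define l' where "l' f = (if f \<in> F then l f else \<zero>\<^bsub>M\<^esub>)" for f
    define k' where "k' f = (if f \<in> G then k f else \<zero>\<^bsub>M\<^esub>)" for f
    have l': "l' f \<in> carrier M" and k': "k' f \<in> carrier M" for f
      using F(3) G(3) by (auto simp: l'_def k'_def)
    have FG: "finite (F \<union> G)" using F(2) G(2) by simp
    have U: "U = (\<Oplus>\<^bsub>htens H 2 M\<^esub>f\<in>F \<union> G. left_leg M f (l' f))"
      unfolding F(1) l'_def by (rule normal_form_extend[OF FG _ F(3)]) simp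
    have V: "V = (\<Oplus>\<^bsub>htens H 2 M\<^esub>f\<in>F \<union> G. left_leg M f (k' f))"
      unfolding G(1) k'_def by (rule normal_form_extend[OF FG _ G(3)]) simp
    have "U \<oplus>\<^bsub>htens H 2 M\<^esub> V = (\<Oplus>\<^bsub>htens H 2 M\<^esub>f\<in>F \<union> G. left_leg M f (l' f) \<oplus>\<^bsub>htens H 2 M\<^esub> left_leg M f (k' f))"
      unfolding U V by (rule T.finsum_addf[symmetric]) (simp_all add: left_leg_closed l' k')
    also have "\<dots> = (\<Oplus>\<^bsub>htens H 2 M\<^esub>f\<in>F \<union> G. left_leg M f (l' f \<oplus>\<^bsub>M\<^esub> k' f))"
      by (rule T.finsum_cong'[OF refl])
        (simp_all add: left_leg_closed l' k' additive_add[OF biadditiveD(1)[OF left_leg_biadditive]])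
    finally show ?thesis
      unfolding normal_forms_def using FG l' k'
      by (intro CollectI exI[of _ "F \<union> G"] exI[of _ "\<lambda>f. l' f \<oplus>\<^bsub>M\<^esub> k' f"] conjI) simp_all
  qed
  show "\<ominus>\<^bsub>htens H 2 M\<^esub> U \<in> normal_forms M" if U: "U \<in> normal_forms M" for U
  proof -
    obtain F l where F: "U = (\<Oplus>\<^bsub>htens H 2 M\<^esub>f\<in>F. left_leg M f (l f))" "finite F" "l \<in> UNIV \<rightarrow> carrier M"
      using U unfolding normal_forms_def by (elim CollectE exE conjE)
    have l: "l f \<in> carrier M" for f using F(3) by blast
    have um: "additive_map (htens H 2 M) (htens H 2 M) (a_inv (htens H 2 M))"
      by (rule additiveI) (simp_all add: T.minus_add)
    have "\<ominus>\<^bsub>htens H 2 M\<^esub> U = (\<Oplus>\<^bsub>htens H 2 M\<^esub>f\<in>F. \<ominus>\<^bsub>htens H 2 M\<^esub> left_leg M f (l f))"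
      unfolding F(1) by (rule additive_finsum[OF T.abelian_group_axioms T.abelian_group_axioms um left_leg_closed[OF l]])
    also have "\<dots> = (\<Oplus>\<^bsub>htens H 2 M\<^esub>f\<in>F. left_leg M f (\<ominus>\<^bsub>M\<^esub> l f))"
      by (rule T.finsum_cong'[OF refl])
        (simp_all add: left_leg_closed l additive_uminus[OF M.abelian_group_axioms T.abelian_group_axioms biadditiveD(1)[OF left_leg_biadditive]])
    finally show ?thesis
      unfolding normal_forms_def using F(2) l
      by (intro CollectI exI[of _ F] exI[of _ "\<lambda>f. \<ominus>\<^bsub>M\<^esub> l f"] conjI) simp_all
  qed
qed simp

interpretation N: filtered_group "htens H 2 M" "\<lambda>n. normal_forms M" by (rule normal_forms_group)

lemma left_leg_normal: assumes "m \<in> carrier M" shows "left_leg M f m \<in> normal_forms M"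
proof -
  have "(\<Oplus>\<^bsub>htens H 2 M\<^esub>f\<in>{f}. left_leg M f m) = left_leg M f m"
    using T.finsum_insert[of "{}" f "\<lambda>f. left_leg M f m"] left_leg_closed[OF assms] by simp
  then show ?thesis
    unfolding normal_forms_def using assms
    by (intro CollectI exI[of _ "{f}"] exI[of _ "\<lambda>f. m"] conjI) simp_all
qed

lemma normal_form: assumes U: "U \<in> carrier (htens H 2 M)" shows "U \<in> normal_forms M"
proof -
  have two_legs: "hpure H 2 M (pure H [f, g]) m \<in> normal_forms M" if m: "m \<in> carrier M" for f g m
  proof -
    have "hpure H 2 M (pure H [f, g]) m =
        (\<Oplus>\<^bsub>htens H 2 M\<^esub>b\<in>cosupp g. hpure H 2 M (pure H [f * anti (colegs g b), 1] \<otimes>\<^bsub>tpow H 2\<^esub> comult H b) m)"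
      unfolding pair_eq_left_leg[of f g]
      by (rule additive_finsum[OF tpow_abelian_group T.abelian_group_axioms biadditiveD(2)[OF hpure_biadditive[OF two_in M] m]])
        (rule tmult_closed[OF pair_closed comult_closed])
    also have "\<dots> = (\<Oplus>\<^bsub>htens H 2 M\<^esub>b\<in>cosupp g. left_leg M (f * anti (colegs g b)) (b \<odot>\<^bsub>M\<^esub> m))"
      unfolding left_leg_def ract_2[symmetric] by (simp only: hpure_ract[OF two_in M pair_closed m])
    also have "\<dots> \<in> normal_forms M"
      by (rule N.N_finsum) (rule left_leg_normal[OF left_moduleD(2)[OF M m]])
    finally show ?thesis .
  qed
  have pure: "hpure H 2 M t m \<in> normal_forms M" if t: "t \<in> carrier (tpow H 2)" and m: "m \<in> carrier M" for t m
  proof -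
    note add = biadditiveD(2)[OF hpure_biadditive[OF two_in M] m]
    show ?thesis
      using t
    proof (induction t rule: tensor_induct)
      case zero
      show ?case by (simp only: additive_zero[OF tpow_abelian_group T.abelian_group_axioms add] N.N_zero)
    next
      case (pure xs)
      obtain f g where "xs = [f, g]" using length2[OF pure] by metis
      then show ?case using two_legs[OF m] by simp
    next
      case (diff s t)
      show ?case
        unfolding additive_minus[OF tpow_abelian_group T.abelian_group_axioms add diff(1,2)]
        by (simp only: a_minus_def) (rule N.N_add[OF diff(3) N.N_uminus[OF diff(4)]])
    qed
  qed
  have "presented (htens H 2 M) (carrier (tpow H 2) \<times> carrier M) (tprod_rels (tpow H 2) (tpow_ract H 2) M)"
    unfolding htens_def by (rule tprod_data.presented_tprod[OF htens_data[OF two_in M]])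
  then show ?thesis
    using U
  proof (rule presented_induct)
    show "\<zero>\<^bsub>htens H 2 M\<^esub> \<in> normal_forms M" by (rule N.N_zero)
    show "frag_class (tprod_rels (tpow H 2) (tpow_ract H 2) M) (frag_of p) \<in> normal_forms M"
      if "p \<in> carrier (tpow H 2) \<times> carrier M" for p
      using that pure[unfolded hpure_def tprod_pure_def] by (elim SigmaE) simp
    show "U \<ominus>\<^bsub>htens H 2 M\<^esub> V \<in> normal_forms M" if "U \<in> normal_forms M" "V \<in> normal_forms M" for U V
      unfolding a_minus_def by (rule N.N_add[OF that(1) N.N_uminus[OF that(2)]])
  qed
qed

end
end

section \<open>The bracket of the annihilation algebra\<close>

locale free_lie_pseudoalgebra = finite_type_hopf_algebra H
  for H :: "('k::{alg_closed_field, field_char_0}, 'h::ring_1) hopf" +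
  fixes L :: "('h, 'm) pseudoalgebra" and L0 :: "'m set" and B :: "'h set"
  assumes lie: "lie_pseudoalgebra H L" and finite_L: "finitely_generated L" and free_L: "free_module L"
    and L0: "generating_subspace H L L0" and basis: "is_basis H B"
begin

lemma pb: "pseudobracket L" by (rule lie_pseudoalgebraD(1)[OF lie])
lemma Lm: "left_module L" by (rule pseudobracketD(1)[OF pb])

sublocale Lg: abelian_group L by (rule left_moduleD(1)[OF Lm])
sublocale Xg: abelian_group "dual H" by (rule X_abelian_group)
sublocale T: tprod_data "dual H" "dual_ract H" L by (rule annih_data[OF Lm])

lemmas L_smult_closed = left_moduleD(2)[OF Lm]

definition A :: "('h, ('k, 'h, 'm) annih_elem) module" where "A = annih_module H L"
definition apure :: "('h \<Rightarrow> 'k) \<Rightarrow> 'm \<Rightarrow> ('k, 'h, 'm) annih_elem" where "apure = annih_pure H L"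

lemma A_tprod: "A = tprod X (dual_ract H) (dual_lact H) L"
  by (simp add: A_def annih_module_def)

lemma apure_tprod: "apure = tprod_pure X (dual_ract H) L"
  by (simp add: apure_def annih_pure_def)

lemma A_abelian_group: "abelian_group A"
  unfolding A_tprod by (rule T.tprod_abelian_group)

sublocale Ag: abelian_group A by (rule A_abelian_group)

lemma apure_closed: "x \<in> carrier X \<Longrightarrow> m \<in> carrier L \<Longrightarrow> apure x m \<in> carrier A"
  unfolding A_tprod apure_tprod by (rule T.pure_closed)

lemma apure_biadditive: "biadditive X L A apure"
  unfolding A_tprod apure_tprod by (rule T.pure_biadditive)

lemma apure_ract: "x \<in> carrier X \<Longrightarrow> m \<in> carrier L \<Longrightarrow> apure (dual_ract H x r) m = apure x (r \<odot>\<^bsub>L\<^esub> m)"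
  unfolding apure_tprod by (rule T.pure_ract)

definition abal :: "('g, 'z) ring_scheme \<Rightarrow> (('h \<Rightarrow> 'k) \<Rightarrow> 'm \<Rightarrow> 'g) \<Rightarrow> bool" where
  "abal G \<phi> \<longleftrightarrow> T.balanced G \<phi>"

lemma abalI:
  assumes "biadditive X L G \<phi>"
    "\<And>a m r. a \<in> carrier X \<Longrightarrow> m \<in> carrier L \<Longrightarrow> \<phi> (dual_ract H a r) m = \<phi> a (r \<odot>\<^bsub>L\<^esub> m)"
  shows "abal G \<phi>"
  unfolding abal_def using assms by (rule T.balancedI)

lemma alift_additive: "abelian_group G \<Longrightarrow> abal G \<phi> \<Longrightarrow> additive_map A G (frag_lift G (\<lambda>(x, m). \<phi> x m))"
  unfolding A_tprod abal_def by (rule T.lift_additive)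

lemma alift_pure:
  "abelian_group G \<Longrightarrow> abal G \<phi> \<Longrightarrow> x \<in> carrier X \<Longrightarrow> m \<in> carrier L \<Longrightarrow>
   frag_lift G (\<lambda>(x, m). \<phi> x m) (apure x m) = \<phi> x m"
  unfolding apure_tprod abal_def by (rule T.lift_pure[where \<phi> = \<phi>])

lemma A_eq_on_pure:
  assumes "abelian_group G" "additive_map A G f" "additive_map A G g"
    and "\<And>x m. x \<in> carrier X \<Longrightarrow> m \<in> carrier L \<Longrightarrow> f (apure x m) = g (apure x m)"
    and "U \<in> carrier A"
  shows "f U = g U"
  by (rule T.eq_on_pure[where la = "dual_lact H", OF assms(1) assms(2,3)[unfolded A_tprod]
        assms(4)[unfolded apure_tprod] assms(5)[unfolded A_tprod]])

lemma
  shows asmult_additive: "additive_map A A (smult A h)"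
    and asmult_pure: "x \<in> carrier X \<Longrightarrow> m \<in> carrier L \<Longrightarrow> h \<odot>\<^bsub>A\<^esub> apure x m = apure (dual_lact H h x) m"
proof -
  show "additive_map A A (smult A h)"
    unfolding A_tprod by (rule T.smult_additive[where la = "dual_lact H", OF lact_additive lact_ract])
  show "x \<in> carrier X \<Longrightarrow> m \<in> carrier L \<Longrightarrow> h \<odot>\<^bsub>A\<^esub> apure x m = apure (dual_lact H h x) m"
    unfolding A_tprod apure_tprod by (rule T.smult_pure[where la = "dual_lact H", OF lact_additive lact_ract])
qed

subsection \<open>The bracket on pure tensors\<close>

text \<open>
  For fixed functionals \<open>x\<close>, \<open>y\<close> the bracket is computed from the pseudobracket by the map
  \<open>value_map x y\<close>, which sends the class of \<open>f \<otimes> g\<close> and \<open>e\<close> to that of \<open>(x f)(y g)\<close> and \<open>e\<close>.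
\<close>

definition coeff_map :: "('h \<Rightarrow> 'k) \<Rightarrow> ('h \<Rightarrow> 'k) \<Rightarrow> 'h tensor \<Rightarrow> 'm \<Rightarrow> ('k, 'h, 'm) annih_elem" where
  "coeff_map x y t e =
     frag_lift A (\<lambda>fs. apure (dual_ract H x (fs ! 0) \<otimes>\<^bsub>X\<^esub> dual_ract H y (fs ! 1)) e) t"

definition value_map :: "('h \<Rightarrow> 'k) \<Rightarrow> ('h \<Rightarrow> 'k) \<Rightarrow> ('h, 'm) htensor \<Rightarrow> ('k, 'h, 'm) annih_elem" where
  "value_map x y = frag_lift A (\<lambda>(t, e). coeff_map x y t e)"

lemma bracket_eq:
  "annih_bracket H L U V = frag_lift A (\<lambda>(x, a). frag_lift A (\<lambda>(y, b). value_map x y (pbracket L a b)) V) U"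
  by (simp only: annih_bracket_def value_map_def coeff_map_def[abs_def] A_def apure_def)

lemma ract_prod_additive:
  assumes "x \<in> carrier X" "y \<in> carrier X"
  shows "dual_ract H x (f + f') \<otimes>\<^bsub>X\<^esub> dual_ract H y g =
      (dual_ract H x f \<otimes>\<^bsub>X\<^esub> dual_ract H y g) \<oplus>\<^bsub>X\<^esub> (dual_ract H x f' \<otimes>\<^bsub>X\<^esub> dual_ract H y g)"
    and "dual_ract H x f \<otimes>\<^bsub>X\<^esub> dual_ract H y (g + g') =
      (dual_ract H x f \<otimes>\<^bsub>X\<^esub> dual_ract H y g) \<oplus>\<^bsub>X\<^esub> (dual_ract H x f \<otimes>\<^bsub>X\<^esub> dual_ract H y g')"
  unfolding ract_add_right[OF assms(1)] ract_add_right[OF assms(2)]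
  by (rule additive_add[OF biadditiveD(2)[OF X_mult_biadditive ract_in_X[OF assms(2)]] ract_in_X[OF assms(1)] ract_in_X[OF assms(1)]],
      rule additive_add[OF biadditiveD(1)[OF X_mult_biadditive ract_in_X[OF assms(1)]] ract_in_X[OF assms(2)] ract_in_X[OF assms(2)]])

lemma ract_prod_scal:
  assumes "x \<in> carrier X" "y \<in> carrier X"
  shows "dual_ract H x (scal H c f) \<otimes>\<^bsub>X\<^esub> dual_ract H y g = dual_ract H x f \<otimes>\<^bsub>X\<^esub> dual_ract H y (scal H c g)"
  by (rule ext) (simp add: X_mult ract_in_X assms ract_scal mult.assoc mult.left_commute)

lemma ract_prod_closed:
  "x \<in> carrier X \<Longrightarrow> y \<in> carrier X \<Longrightarrow> dual_ract H x f \<otimes>\<^bsub>X\<^esub> dual_ract H y g \<in> carrier X"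
  by (rule X_mult_closed[OF ract_in_X ract_in_X])

lemma coeff_multilinear:
  assumes x: "x \<in> carrier X" and y: "y \<in> carrier X" and e: "e \<in> carrier L"
  shows "multilinear H 2 A (\<lambda>fs. apure (dual_ract H x (fs ! 0) \<otimes>\<^bsub>X\<^esub> dual_ract H y (fs ! 1)) e)"
proof (rule multilinear_2I)
  note add = additive_add[OF biadditiveD(2)[OF apure_biadditive e] ract_prod_closed[OF x y] ract_prod_closed[OF x y]]
  show "apure (dual_ract H x f \<otimes>\<^bsub>X\<^esub> dual_ract H y g) e \<in> carrier A" for f g
    by (rule apure_closed[OF ract_prod_closed[OF x y] e])
  show "apure (dual_ract H x (u + v) \<otimes>\<^bsub>X\<^esub> dual_ract H y g) e =
      apure (dual_ract H x u \<otimes>\<^bsub>X\<^esub> dual_ract H y g) e \<oplus>\<^bsub>A\<^esub> apure (dual_ract H x v \<otimes>\<^bsub>X\<^esub> dual_ract H y g) e" for u v g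
    unfolding ract_prod_additive(1)[OF x y] by (rule add)
  show "apure (dual_ract H x g \<otimes>\<^bsub>X\<^esub> dual_ract H y (u + v)) e =
      apure (dual_ract H x g \<otimes>\<^bsub>X\<^esub> dual_ract H y u) e \<oplus>\<^bsub>A\<^esub> apure (dual_ract H x g \<otimes>\<^bsub>X\<^esub> dual_ract H y v) e" for u v g
    unfolding ract_prod_additive(2)[OF x y] by (rule add)
  show "apure (dual_ract H x (scal H c f) \<otimes>\<^bsub>X\<^esub> dual_ract H y g) e =
      apure (dual_ract H x f \<otimes>\<^bsub>X\<^esub> dual_ract H y (scal H c g)) e" for c f g
    unfolding ract_prod_scal[OF x y] ..
qed

lemma coeff_pure:
  assumes "x \<in> carrier X" "y \<in> carrier X" "e \<in> carrier L"
  shows "coeff_map x y (pure H [f, g]) e = apure (dual_ract H x f \<otimes>\<^bsub>X\<^esub> dual_ract H y g) e"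
  using tensor_lift_pure[where \<tau> = "\<lambda>fs. apure (dual_ract H x (fs ! 0) \<otimes>\<^bsub>X\<^esub> dual_ract H y (fs ! 1)) e",
      OF A_abelian_group coeff_multilinear[OF assms], of "[f, g]"]
  by (simp add: coeff_map_def)

lemma coeff_additive_t:
  assumes "x \<in> carrier X" "y \<in> carrier X" "e \<in> carrier L"
  shows "additive_map (tpow H 2) A (\<lambda>t. coeff_map x y t e)"
  unfolding coeff_map_def by (rule tensor_lift_additive[OF A_abelian_group coeff_multilinear[OF assms]])

lemma tensor_eq_on_pairs:
  assumes "abelian_group G" "additive_map (tpow H 2) G f" "additive_map (tpow H 2) G g"
    and "\<And>a b. f (pure H [a, b]) = g (pure H [a, b])" "t \<in> carrier (tpow H 2)"
  shows "f t = g t"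
proof (rule tensor_eq_on_pure[OF assms(1-3) _ assms(5)])
  fix xs :: "'h list" assume "length xs = 2"
  then obtain a b where "xs = [a, b]" using length2 by metis
  then show "f (pure H xs) = g (pure H xs)" using assms(4) by (simp only:)
qed

lemma coeff_add_xye:
  assumes x: "x \<in> carrier X" "x' \<in> carrier X" and y: "y \<in> carrier X" "y' \<in> carrier X"
    and e: "e \<in> carrier L" "e' \<in> carrier L" and t: "t \<in> carrier (tpow H 2)"
  shows "coeff_map (x \<oplus>\<^bsub>X\<^esub> x') y t e = coeff_map x y t e \<oplus>\<^bsub>A\<^esub> coeff_map x' y t e"
    and "coeff_map x (y \<oplus>\<^bsub>X\<^esub> y') t e = coeff_map x y t e \<oplus>\<^bsub>A\<^esub> coeff_map x y' t e"
    and "coeff_map x y t (e \<oplus>\<^bsub>L\<^esub> e') = coeff_map x y t e \<oplus>\<^bsub>A\<^esub> coeff_map x y t e'"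
proof -
  note ag = A_abelian_group and c = coeff_additive_t and p = coeff_pure
  note ap = additive_add[OF biadditiveD(2)[OF apure_biadditive e(1)] ract_prod_closed ract_prod_closed]
  note Xm1 = additive_add[OF biadditiveD(2)[OF X_mult_biadditive]] and Xm2 = additive_add[OF biadditiveD(1)[OF X_mult_biadditive]]
  show "coeff_map (x \<oplus>\<^bsub>X\<^esub> x') y t e = coeff_map x y t e \<oplus>\<^bsub>A\<^esub> coeff_map x' y t e"
  proof (rule tensor_eq_on_pairs[OF ag c[OF Xg.a_closed[OF x] y(1) e(1)]
        additive_sum2[OF ag c[OF x(1) y(1) e(1)] c[OF x(2) y(1) e(1)]] _ t])
    fix a b
    have "dual_ract H (x \<oplus>\<^bsub>X\<^esub> x') a \<otimes>\<^bsub>X\<^esub> dual_ract H y b =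
        (dual_ract H x a \<otimes>\<^bsub>X\<^esub> dual_ract H y b) \<oplus>\<^bsub>X\<^esub> (dual_ract H x' a \<otimes>\<^bsub>X\<^esub> dual_ract H y b)"
      unfolding additive_add[OF ract_additive x] by (rule Xm1[OF ract_in_X[OF y(1)] ract_in_X[OF x(1)] ract_in_X[OF x(2)]])
    then show "coeff_map (x \<oplus>\<^bsub>X\<^esub> x') y (pure H [a, b]) e =
        coeff_map x y (pure H [a, b]) e \<oplus>\<^bsub>A\<^esub> coeff_map x' y (pure H [a, b]) e"
      unfolding p[OF Xg.a_closed[OF x] y(1) e(1)] p[OF x(1) y(1) e(1)] p[OF x(2) y(1) e(1)]
      by (simp only: ap[OF x(1) y(1) x(2) y(1)])
  qed
  show "coeff_map x (y \<oplus>\<^bsub>X\<^esub> y') t e = coeff_map x y t e \<oplus>\<^bsub>A\<^esub> coeff_map x y' t e"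
  proof (rule tensor_eq_on_pairs[OF ag c[OF x(1) Xg.a_closed[OF y] e(1)]
        additive_sum2[OF ag c[OF x(1) y(1) e(1)] c[OF x(1) y(2) e(1)]] _ t])
    fix a b
    have "dual_ract H x a \<otimes>\<^bsub>X\<^esub> dual_ract H (y \<oplus>\<^bsub>X\<^esub> y') b =
        (dual_ract H x a \<otimes>\<^bsub>X\<^esub> dual_ract H y b) \<oplus>\<^bsub>X\<^esub> (dual_ract H x a \<otimes>\<^bsub>X\<^esub> dual_ract H y' b)"
      unfolding additive_add[OF ract_additive y] by (rule Xm2[OF ract_in_X[OF x(1)] ract_in_X[OF y(1)] ract_in_X[OF y(2)]])
    then show "coeff_map x (y \<oplus>\<^bsub>X\<^esub> y') (pure H [a, b]) e =
        coeff_map x y (pure H [a, b]) e \<oplus>\<^bsub>A\<^esub> coeff_map x y' (pure H [a, b]) e"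
      unfolding p[OF x(1) Xg.a_closed[OF y] e(1)] p[OF x(1) y(1) e(1)] p[OF x(1) y(2) e(1)]
      by (simp only: ap[OF x(1) y(1) x(1) y(2)])
  qed
  show "coeff_map x y t (e \<oplus>\<^bsub>L\<^esub> e') = coeff_map x y t e \<oplus>\<^bsub>A\<^esub> coeff_map x y t e'"
  proof (rule tensor_eq_on_pairs[OF ag c[OF x(1) y(1) Lg.a_closed[OF e]]
        additive_sum2[OF ag c[OF x(1) y(1) e(1)] c[OF x(1) y(1) e(2)]] _ t])
    fix a b
    show "coeff_map x y (pure H [a, b]) (e \<oplus>\<^bsub>L\<^esub> e') = coeff_map x y (pure H [a, b]) e \<oplus>\<^bsub>A\<^esub> coeff_map x y (pure H [a, b]) e'"
      unfolding p[OF x(1) y(1) Lg.a_closed[OF e]] p[OF x(1) y(1) e(1)] p[OF x(1) y(1) e(2)]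
      by (rule additive_add[OF biadditiveD(1)[OF apure_biadditive ract_prod_closed[OF x(1) y(1)]] e])
  qed
qed

lemma coeff_closed:
  "x \<in> carrier X \<Longrightarrow> y \<in> carrier X \<Longrightarrow> e \<in> carrier L \<Longrightarrow> t \<in> carrier (tpow H 2) \<Longrightarrow> coeff_map x y t e \<in> carrier A"
  by (rule additive_closed[OF coeff_additive_t])

text \<open>Balancedness is the compatibility of the product of \<open>X\<close> with the right action, \<open>ract_prod\<close>.\<close>

lemma coeff_ract:
  assumes x: "x \<in> carrier X" and y: "y \<in> carrier X" and e: "e \<in> carrier L" and t: "t \<in> carrier (tpow H 2)"
  shows "coeff_map x y (tpow_ract H 2 t r) e = coeff_map x y t (r \<odot>\<^bsub>L\<^esub> e)"
proof (rule tensor_eq_on_pairs[OF A_abelian_group _ coeff_additive_t[OF x y L_smult_closed[OF e]] _ t])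
  note c = coeff_additive_t[OF x y e]
  show "additive_map (tpow H 2) A (\<lambda>t. coeff_map x y (tpow_ract H 2 t r) e)"
    unfolding ract_2 by (rule additive_comp[OF biadditiveD(2)[OF tmult_biadditive comult_closed] c])
  fix f g
  let ?x = "dual_ract H x f" and ?y = "dual_ract H y g"
  note xy = ract_in_X[OF x, of f] ract_in_X[OF y, of g]
  have "coeff_map x y (tpow_ract H 2 (pure H [f, g]) r) e =
      (\<Oplus>\<^bsub>A\<^esub>b\<in>cosupp r. coeff_map x y (pure H [f, g] \<otimes>\<^bsub>tpow H 2\<^esub> pure H [colegs r b, b]) e)"
    unfolding ract_2
    by (rule additive_comult_expand[OF A_abelian_group additive_comp[OF biadditiveD(1)[OF tmult_biadditive pair_closed] c]])
  also have "\<dots> = (\<Oplus>\<^bsub>A\<^esub>b\<in>cosupp r. apure (dual_ract H ?x (colegs r b) \<otimes>\<^bsub>X\<^esub> dual_ract H ?y b) e)"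
    by (simp add: tmult_pure coeff_pure[OF x y e] ract_mult)
  also have "\<dots> = apure (\<Oplus>\<^bsub>X\<^esub>b\<in>cosupp r. dual_ract H ?x (colegs r b) \<otimes>\<^bsub>X\<^esub> dual_ract H ?y b) e"
    by (rule additive_finsum[OF X_abelian_group A_abelian_group biadditiveD(2)[OF apure_biadditive e], symmetric])
      (rule ract_prod_closed[OF xy])
  also have "(\<Oplus>\<^bsub>X\<^esub>b\<in>cosupp r. dual_ract H ?x (colegs r b) \<otimes>\<^bsub>X\<^esub> dual_ract H ?y b) = dual_ract H (?x \<otimes>\<^bsub>X\<^esub> ?y) r"
    by (rule ext) (simp only: X_finsum_apply[OF cosupp(1) ract_prod_closed[OF xy]] ract_prod[OF xy] sw_def)
  also have "apure \<dots> e = apure (?x \<otimes>\<^bsub>X\<^esub> ?y) (r \<odot>\<^bsub>L\<^esub> e)"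
    by (rule apure_ract[OF ract_prod_closed[OF x y] e])
  finally show "coeff_map x y (tpow_ract H 2 (pure H [f, g]) r) e = coeff_map x y (pure H [f, g]) (r \<odot>\<^bsub>L\<^esub> e)"
    by (simp only: coeff_pure[OF x y L_smult_closed[OF e]])
qed

lemma coeff_hbal:
  assumes x: "x \<in> carrier X" and y: "y \<in> carrier X" shows "hbal 2 L A (coeff_map x y)"
proof (rule hbalI[OF two_in Lm], rule biadditiveI)
  show "additive_map L A (coeff_map x y t)" if t: "t \<in> carrier (tpow H 2)" for t
    by (rule additiveI[OF coeff_closed[OF x y _ t] coeff_add_xye(3)[OF x x y y _ _ t]])
  show "additive_map (tpow H 2) A (\<lambda>t. coeff_map x y t e)" if "e \<in> carrier L" for e
    by (rule coeff_additive_t[OF x y that])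
  show "coeff_map x y (tpow_ract H 2 t r) m = coeff_map x y t (r \<odot>\<^bsub>L\<^esub> m)"
    if "t \<in> carrier (tpow H 2)" "m \<in> carrier L" for t m r by (rule coeff_ract[OF x y that(2,1)])
qed

lemmas value_additive = hlift_additive[OF two_in Lm A_abelian_group coeff_hbal, folded value_map_def]

lemma value_pure:
  assumes "x \<in> carrier X" "y \<in> carrier X" "t \<in> carrier (tpow H 2)" "e \<in> carrier L"
  shows "value_map x y (hpure H 2 L t e) = coeff_map x y t e"
  unfolding value_map_def
  by (rule hlift_pure[where \<phi> = "coeff_map x y", OF two_in Lm A_abelian_group coeff_hbal[OF assms(1,2)] assms(3,4)])

lemma value_add:
  assumes x: "x \<in> carrier X" "x' \<in> carrier X" and y: "y \<in> carrier X" "y' \<in> carrier X" and U: "U \<in> carrier (htens H 2 L)"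
  shows "value_map (x \<oplus>\<^bsub>X\<^esub> x') y U = value_map x y U \<oplus>\<^bsub>A\<^esub> value_map x' y U"
    and "value_map x (y \<oplus>\<^bsub>X\<^esub> y') U = value_map x y U \<oplus>\<^bsub>A\<^esub> value_map x y' U"
proof -
  note ag = A_abelian_group and v = value_additive
  show "value_map (x \<oplus>\<^bsub>X\<^esub> x') y U = value_map x y U \<oplus>\<^bsub>A\<^esub> value_map x' y U"
  proof (rule htens_eq_on_pure[OF two_in Lm ag v[OF Xg.a_closed[OF x] y(1)] additive_sum2[OF ag v[OF x(1) y(1)] v[OF x(2) y(1)]] _ U])
    fix t m assume t: "t \<in> carrier (tpow H 2)" and m: "m \<in> carrier L"
    show "value_map (x \<oplus>\<^bsub>X\<^esub> x') y (hpure H 2 L t m) = value_map x y (hpure H 2 L t m) \<oplus>\<^bsub>A\<^esub> value_map x' y (hpure H 2 L t m)"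
      unfolding value_pure[OF Xg.a_closed[OF x] y(1) t m] value_pure[OF x(1) y(1) t m] value_pure[OF x(2) y(1) t m]
      by (rule coeff_add_xye(1)[OF x y m m t])
  qed
  show "value_map x (y \<oplus>\<^bsub>X\<^esub> y') U = value_map x y U \<oplus>\<^bsub>A\<^esub> value_map x y' U"
  proof (rule htens_eq_on_pure[OF two_in Lm ag v[OF x(1) Xg.a_closed[OF y]] additive_sum2[OF ag v[OF x(1) y(1)] v[OF x(1) y(2)]] _ U])
    fix t m assume t: "t \<in> carrier (tpow H 2)" and m: "m \<in> carrier L"
    show "value_map x (y \<oplus>\<^bsub>X\<^esub> y') (hpure H 2 L t m) = value_map x y (hpure H 2 L t m) \<oplus>\<^bsub>A\<^esub> value_map x y' (hpure H 2 L t m)"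
      unfolding value_pure[OF x(1) Xg.a_closed[OF y] t m] value_pure[OF x(1) y(1) t m] value_pure[OF x(1) y(2) t m]
      by (rule coeff_add_xye(2)[OF x y m m t])
  qed
qed

lemma value_ract:
  assumes x: "x \<in> carrier X" and y: "y \<in> carrier X" and U: "U \<in> carrier (htens H 2 L)"
  shows "value_map (dual_ract H x f) (dual_ract H y g) U = value_map x y (pure H [f, g] \<odot>\<^bsub>htens H 2 L\<^esub> U)"
proof (rule htens_eq_on_pure[OF two_in Lm A_abelian_group value_additive[OF ract_in_X[OF x] ract_in_X[OF y]]
      additive_comp[OF hsmult_additive[OF two_in Lm pair_closed] value_additive[OF x y]] _ U])
  fix t m assume t: "t \<in> carrier (tpow H 2)" and m: "m \<in> carrier L"
  have "coeff_map (dual_ract H x f) (dual_ract H y g) t m = coeff_map x y (pure H [f, g] \<otimes>\<^bsub>tpow H 2\<^esub> t) m"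
  proof (rule tensor_eq_on_pairs[OF A_abelian_group coeff_additive_t[OF ract_in_X[OF x] ract_in_X[OF y] m]
        additive_comp[OF biadditiveD(1)[OF tmult_biadditive pair_closed] coeff_additive_t[OF x y m]] _ t])
    fix a b
    show "coeff_map (dual_ract H x f) (dual_ract H y g) (pure H [a, b]) m =
        coeff_map x y (pure H [f, g] \<otimes>\<^bsub>tpow H 2\<^esub> pure H [a, b]) m"
      by (simp add: tmult_pure coeff_pure x y m ract_in_X ract_mult)
  qed
  then show "value_map (dual_ract H x f) (dual_ract H y g) (hpure H 2 L t m) =
      value_map x y (pure H [f, g] \<odot>\<^bsub>htens H 2 L\<^esub> hpure H 2 L t m)"
    unfolding hsmult_pure[OF two_in Lm pair_closed t m] value_pure[OF ract_in_X[OF x] ract_in_X[OF y] t m]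
      value_pure[OF x y tmult_closed[OF pair_closed t] m] .
qed

text \<open>
  The bracket of the annihilation algebra is well-defined, since \<open>value_map\<close> is additive in both functionals and the
  sesquilinearity of the pseudobracket matches \<open>value_ract\<close>.
\<close>

lemma bracket_pure:
  assumes x: "x \<in> carrier X" and a: "a \<in> carrier L" and y: "y \<in> carrier X" and b: "b \<in> carrier L"
  shows "annih_bracket H L (apure x a) (apure y b) = value_map x y (pbracket L a b)"
proof -
  note ag = A_abelian_group
  note bi = pseudobracketD(2)[OF pb] and sq = pseudobracketD(3)[OF pb] and one = left_moduleD(6)[OF Lm]
  note bcl = biadditiveD(3)[OF bi]
  have vcl: "value_map x y (pbracket L a b) \<in> carrier A"
    if "x \<in> carrier X" "y \<in> carrier X" "a \<in> carrier L" "b \<in> carrier L" for x y a b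
    by (rule additive_closed[OF value_additive[OF that(1,2)] bcl[OF that(3,4)]])
  have in2: "abal A (\<lambda>y b. value_map x y (pbracket L a b))" if x: "x \<in> carrier X" and a: "a \<in> carrier L" for x a
  proof (rule abalI, rule biadditiveI)
    show "additive_map L A (\<lambda>b. value_map x y (pbracket L a b))" if y: "y \<in> carrier X" for y
      by (rule additive_comp[OF biadditiveD(1)[OF bi a] value_additive[OF x y]])
    show "additive_map X A (\<lambda>y. value_map x y (pbracket L a b))" if b: "b \<in> carrier L" for b
    proof (rule additiveI)
      fix y y' assume y: "y \<in> carrier X"
      show "value_map x y (pbracket L a b) \<in> carrier A" by (rule vcl[OF x y a b])
      assume y': "y' \<in> carrier X"
      show "value_map x (y \<oplus>\<^bsub>X\<^esub> y') (pbracket L a b) = value_map x y (pbracket L a b) \<oplus>\<^bsub>A\<^esub> value_map x y' (pbracket L a b)"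
        by (rule value_add(2)[OF x x y y' bcl[OF a b]])
    qed
    fix y b r assume y: "y \<in> carrier X" and b: "b \<in> carrier L"
    have "pbracket L a (r \<odot>\<^bsub>L\<^esub> b) = pure H [1, r] \<odot>\<^bsub>htens H 2 L\<^esub> pbracket L a b"
      using sq[OF a b, of 1 r] by (simp only: one[OF a])
    then show "value_map x (dual_ract H y r) (pbracket L a b) = value_map x y (pbracket L a (r \<odot>\<^bsub>L\<^esub> b))"
      using value_ract[OF x y bcl[OF a b], of 1 r] by (simp only: ract_one)
  qed
  define G where "G x a V = frag_lift A (\<lambda>(y, b). value_map x y (pbracket L a b)) V" for x a V
  have Gadd: "additive_map A A (G x a)" if "x \<in> carrier X" "a \<in> carrier L" for x a
    unfolding G_def[abs_def] by (rule alift_additive[OF ag in2[OF that]])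
  have Gp: "G x a (apure y b) = value_map x y (pbracket L a b)"
    if "x \<in> carrier X" "a \<in> carrier L" "y \<in> carrier X" "b \<in> carrier L" for x a y b
    unfolding G_def by (rule alift_pure[where \<phi> = "\<lambda>y b. value_map x y (pbracket L a b)", OF ag in2[OF that(1,2)] that(3,4)])
  have "abal A (\<lambda>x a. G x a (apure y b))"
  proof (rule abalI, rule biadditiveI)
    show "additive_map L A (\<lambda>a. G x a (apure y b))" if x: "x \<in> carrier X" for x
    proof (rule additiveI)
      fix a a' assume a: "a \<in> carrier L"
      show "G x a (apure y b) \<in> carrier A" unfolding Gp[OF x a y b] by (rule vcl[OF x y a b])
      assume a': "a' \<in> carrier L"
      show "G x (a \<oplus>\<^bsub>L\<^esub> a') (apure y b) = G x a (apure y b) \<oplus>\<^bsub>A\<^esub> G x a' (apure y b)"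
        unfolding Gp[OF x a y b] Gp[OF x a' y b] Gp[OF x Lg.a_closed[OF a a'] y b]
          additive_add[OF biadditiveD(2)[OF bi b] a a']
        by (rule additive_add[OF value_additive[OF x y] bcl[OF a b] bcl[OF a' b]])
    qed
    show "additive_map X A (\<lambda>x. G x a (apure y b))" if a: "a \<in> carrier L" for a
    proof (rule additiveI)
      fix x x' assume x: "x \<in> carrier X"
      show "G x a (apure y b) \<in> carrier A" unfolding Gp[OF x a y b] by (rule vcl[OF x y a b])
      assume x': "x' \<in> carrier X"
      show "G (x \<oplus>\<^bsub>X\<^esub> x') a (apure y b) = G x a (apure y b) \<oplus>\<^bsub>A\<^esub> G x' a (apure y b)"
        unfolding Gp[OF x a y b] Gp[OF x' a y b] Gp[OF Xg.a_closed[OF x x'] a y b]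
        by (rule value_add(1)[OF x x' y y bcl[OF a b]])
    qed
    fix x a r assume x: "x \<in> carrier X" and a: "a \<in> carrier L"
    have "pbracket L (r \<odot>\<^bsub>L\<^esub> a) b = pure H [r, 1] \<odot>\<^bsub>htens H 2 L\<^esub> pbracket L a b"
      using sq[OF a b, of r 1] by (simp only: one[OF b])
    then show "G (dual_ract H x r) a (apure y b) = G x (r \<odot>\<^bsub>L\<^esub> a) (apure y b)"
      unfolding Gp[OF x L_smult_closed[OF a] y b] Gp[OF ract_in_X[OF x] a y b]
      using value_ract[OF x y bcl[OF a b], of r 1] by (simp only: ract_one)
  qed
  from alift_pure[where \<phi> = "\<lambda>x a. G x a (apure y b)", OF ag this x a]
  have "annih_bracket H L (apure x a) (apure y b) = G x a (apure y b)"
    by (simp only: bracket_eq G_def)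
  then show ?thesis by (simp only: Gp[OF x a y b])
qed

section \<open>Coordinates of a finite free module\<close>

lemma L_smult_additive: "additive_map L L (smult L r)"
  by (rule additiveI) (simp_all add: left_moduleD[OF Lm])

lemma L_smult_additive_left: "a \<in> carrier L \<Longrightarrow> additive_map type_ring L (\<lambda>r. r \<odot>\<^bsub>L\<^esub> a)"
  by (rule additiveI) (simp_all add: left_moduleD[OF Lm])

lemma L_smult_zero: "a \<in> carrier L \<Longrightarrow> 0 \<odot>\<^bsub>L\<^esub> a = \<zero>\<^bsub>L\<^esub>"
  using additive_zero[OF abelian_group_type_ring Lg.abelian_group_axioms L_smult_additive_left, of a] by simp

text \<open>Linear combinations over a fixed set, so that coefficients can be added and compared.\<close>

definition lcomb :: "'m set \<Rightarrow> ('m \<Rightarrow> 'h) \<Rightarrow> 'm" where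
  "lcomb E r = (\<Oplus>\<^bsub>L\<^esub>e\<in>E. r e \<odot>\<^bsub>L\<^esub> e)"

lemma lcomb_term: "E \<subseteq> carrier L \<Longrightarrow> (\<lambda>e. r e \<odot>\<^bsub>L\<^esub> e) \<in> E \<rightarrow> carrier L"
  using L_smult_closed by blast

lemma lcomb_closed: "E \<subseteq> carrier L \<Longrightarrow> lcomb E r \<in> carrier L"
  unfolding lcomb_def by (rule Lg.finsum_closed[OF lcomb_term])

lemma lcomb_cong: "E \<subseteq> carrier L \<Longrightarrow> (\<And>e. e \<in> E \<Longrightarrow> r e = s e) \<Longrightarrow> lcomb E r = lcomb E s"
  unfolding lcomb_def by (rule Lg.finsum_cong'[OF refl lcomb_term]) simp_all

lemma lcomb_add: assumes E: "E \<subseteq> carrier L" shows "lcomb E r \<oplus>\<^bsub>L\<^esub> lcomb E s = lcomb E (\<lambda>e. r e + s e)"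
proof -
  have "lcomb E (\<lambda>e. r e + s e) = (\<Oplus>\<^bsub>L\<^esub>e\<in>E. r e \<odot>\<^bsub>L\<^esub> e \<oplus>\<^bsub>L\<^esub> s e \<odot>\<^bsub>L\<^esub> e)"
    unfolding lcomb_def
    by (rule Lg.finsum_cong'[OF refl]) (use E L_smult_closed in \<open>auto simp: left_moduleD(4)[OF Lm]\<close>)
  also have "\<dots> = lcomb E r \<oplus>\<^bsub>L\<^esub> lcomb E s"
    unfolding lcomb_def by (rule Lg.finsum_addf[OF lcomb_term[OF E] lcomb_term[OF E]])
  finally show ?thesis by (rule sym)
qed

lemma lcomb_smult: assumes E: "E \<subseteq> carrier L" shows "h \<odot>\<^bsub>L\<^esub> lcomb E r = lcomb E (\<lambda>e. h * r e)"
proof -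
  have "h \<odot>\<^bsub>L\<^esub> lcomb E r = (\<Oplus>\<^bsub>L\<^esub>e\<in>E. h \<odot>\<^bsub>L\<^esub> (r e \<odot>\<^bsub>L\<^esub> e))"
    unfolding lcomb_def
    by (rule additive_finsum[OF Lg.abelian_group_axioms Lg.abelian_group_axioms L_smult_additive])
      (use E L_smult_closed in blast)
  also have "\<dots> = lcomb E (\<lambda>e. h * r e)"
    unfolding lcomb_def
    by (rule Lg.finsum_cong'[OF refl]) (use E L_smult_closed in \<open>auto simp: left_moduleD(5)[OF Lm]\<close>)
  finally show ?thesis .
qed

lemma lcomb_extend:
  assumes "finite E" "E \<subseteq> carrier L" "F \<subseteq> E" shows "lcomb F r = lcomb E (\<lambda>e. if e \<in> F then r e else 0)"
  unfolding lcomb_def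
  by (rule Lg.add.finprod_mono_neutral_cong_left[OF assms(1,3)])
    (use assms L_smult_closed in \<open>auto simp: L_smult_zero\<close>)

lemma lcomb_finsum:
  assumes "E \<subseteq> carrier L" "finite I"
  shows "(\<Oplus>\<^bsub>L\<^esub>i\<in>I. lcomb E (r i)) = lcomb E (\<lambda>e. \<Sum>i\<in>I. r i e)"
  using assms(2)
proof (induction I rule: finite_induct)
  case empty
  show ?case
    unfolding lcomb_def using assms(1) by (simp add: L_smult_zero subset_eq cong: Lg.finsum_cong)
next
  case (insert i I)
  have "(\<Oplus>\<^bsub>L\<^esub>i\<in>insert i I. lcomb E (r i)) = lcomb E (r i) \<oplus>\<^bsub>L\<^esub> (\<Oplus>\<^bsub>L\<^esub>i\<in>I. lcomb E (r i))"
    by (rule Lg.finsum_insert) (use insert lcomb_closed[OF assms(1)] in auto)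
  then show ?case using insert by (simp add: lcomb_add[OF assms(1)])
qed

text \<open>
  A free basis may be infinite a priori; the members of it that occur
  in the expressions of finitely many generators already generate.
\<close>

lemma finite_free_basis:
  "\<exists>E. finite E \<and> E \<subseteq> carrier L \<and> (\<forall>a\<in>carrier L. \<exists>r. a = lcomb E r) \<and>
     (\<forall>r s. lcomb E r = lcomb E s \<longrightarrow> (\<forall>e\<in>E. r e = s e))"
proof -
  obtain E1 where E1: "E1 \<subseteq> carrier L" "span_over L UNIV E1 = carrier L"
    "\<forall>F r. finite F \<longrightarrow> F \<subseteq> E1 \<longrightarrow> (\<Oplus>\<^bsub>L\<^esub>e\<in>F. r e \<odot>\<^bsub>L\<^esub> e) = \<zero>\<^bsub>L\<^esub> \<longrightarrow> (\<forall>e\<in>F. r e = 0)"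
    using free_L unfolding free_module_def by (elim exE conjE)
  obtain E0 where E0: "finite E0" "E0 \<subseteq> carrier L" "span_over L UNIV E0 = carrier L"
    using finite_L unfolding finitely_generated_def by (elim exE conjE)
  have "\<exists>F r. finite F \<and> F \<subseteq> E1 \<and> g = lcomb F r" if "g \<in> carrier L" for g
    using that unfolding E1(2)[symmetric] span_over_def lcomb_def by blast
  then have "\<forall>g\<in>E0. \<exists>F. finite F \<and> F \<subseteq> E1 \<and> (\<exists>r. g = lcomb F r)" using E0(2) by blast
  then obtain F where F: "\<forall>g\<in>E0. finite (F g) \<and> F g \<subseteq> E1 \<and> (\<exists>r. g = lcomb (F g) r)"
    unfolding bchoice_iff by (elim exE)
  define E where "E = (\<Union>g\<in>E0. F g)"
  have fE: "finite E" unfolding E_def using F E0(1) by blast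
  have EE1: "E \<subseteq> E1" unfolding E_def using F by blast
  then have EL: "E \<subseteq> carrier L" using E1(1) by (rule subset_trans)
  have "\<exists>r. g = lcomb E r" if g: "g \<in> E0" for g
  proof -
    obtain r where r: "g = lcomb (F g) r" using F g by blast
    have "F g \<subseteq> E" unfolding E_def using g by blast
    show ?thesis by (rule exI) (rule trans[OF r lcomb_extend[OF fE EL \<open>F g \<subseteq> E\<close>]])
  qed
  then obtain c where c: "\<And>g. g \<in> E0 \<Longrightarrow> g = lcomb E (c g)" by metis
  have "\<exists>r. a = lcomb E r" if a: "a \<in> carrier L" for a
  proof -
    obtain F r where Fr: "finite F" "F \<subseteq> E0" "a = (\<Oplus>\<^bsub>L\<^esub>e\<in>F. r e \<odot>\<^bsub>L\<^esub> e)"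
      using a unfolding E0(3)[symmetric] span_over_def by blast
    have "a = (\<Oplus>\<^bsub>L\<^esub>g\<in>F. lcomb E (\<lambda>e. r g * c g e))"
      unfolding Fr(3)
    proof (rule Lg.finsum_cong'[OF refl])
      show "(\<lambda>g. lcomb E (\<lambda>e. r g * c g e)) \<in> F \<rightarrow> carrier L" using lcomb_closed[OF EL] by blast
      fix g assume "g \<in> F"
      then have "g \<in> E0" using Fr(2) by blast
      then show "r g \<odot>\<^bsub>L\<^esub> g = lcomb E (\<lambda>e. r g * c g e)"
        unfolding lcomb_smult[OF EL, symmetric] by (simp only: c[symmetric])
    qed
    also have "\<dots> = lcomb E (\<lambda>e. \<Sum>g\<in>F. r g * c g e)" by (rule lcomb_finsum[OF EL Fr(1)])
    finally show ?thesis by blast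
  qed
  moreover have "r e = s e" if eq: "lcomb E r = lcomb E s" and e: "e \<in> E" for r s e
  proof -
    have "lcomb E (\<lambda>e. r e - s e) \<oplus>\<^bsub>L\<^esub> lcomb E s = lcomb E s"
      unfolding lcomb_add[OF EL] by (simp add: eq)
    then have "lcomb E (\<lambda>e. r e - s e) = \<zero>\<^bsub>L\<^esub>"
      using lcomb_closed[OF EL] by simp
    then have "(\<Oplus>\<^bsub>L\<^esub>e\<in>E. (r e - s e) \<odot>\<^bsub>L\<^esub> e) = \<zero>\<^bsub>L\<^esub>" by (simp only: lcomb_def)
    from E1(3)[THEN spec[of _ E], THEN spec[of _ "\<lambda>e. r e - s e"], THEN mp[OF _ fE], THEN mp[OF _ EE1], THEN mp[OF _ this]]
    have "r e - s e = 0" using e by (rule bspec)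
    then show ?thesis by simp
  qed
  ultimately show ?thesis using fE EL by (intro exI[of _ E] conjI ballI allI impI) simp_all
qed

definition gens :: "'m set" where
  "gens = (SOME E. finite E \<and> E \<subseteq> carrier L \<and> (\<forall>a\<in>carrier L. \<exists>r. a = lcomb E r) \<and>
     (\<forall>r s. lcomb E r = lcomb E s \<longrightarrow> (\<forall>e\<in>E. r e = s e)))"

definition co :: "'m \<Rightarrow> 'm \<Rightarrow> 'h" where
  "co e a = (SOME r. a = lcomb gens r) e"

lemma gens: "finite gens" "gens \<subseteq> carrier L" "a \<in> carrier L \<Longrightarrow> \<exists>r. a = lcomb gens r"
    "lcomb gens r = lcomb gens s \<Longrightarrow> e \<in> gens \<Longrightarrow> r e = s e"
proof -
  note * = someI_ex[OF finite_free_basis, folded gens_def]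
  show "finite gens" using * by (elim conjE)
  show "gens \<subseteq> carrier L" using * by (elim conjE)
  show "\<exists>r. a = lcomb gens r" if "a \<in> carrier L"
    using * that by (elim conjE) simp
  show "r e = s e" if "lcomb gens r = lcomb gens s" "e \<in> gens"
    using * that by (elim conjE) simp
qed

lemma gens_closed: "e \<in> gens \<Longrightarrow> e \<in> carrier L"
  using gens(2) by blast

lemma co: "a \<in> carrier L \<Longrightarrow> a = lcomb gens (\<lambda>e. co e a)"
  using someI_ex[OF gens(3)] by (simp add: co_def)

lemma co_lcomb: "e \<in> gens \<Longrightarrow> co e (lcomb gens r) = r e"
  by (rule gens(4)[OF co[symmetric]]) (rule lcomb_closed[OF gens(2)])

lemma co_additive: assumes e: "e \<in> gens" shows "additive_map L type_ring (co e)"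
proof (rule additiveI)
  fix a b assume ab: "a \<in> carrier L" "b \<in> carrier L"
  have "a \<oplus>\<^bsub>L\<^esub> b = lcomb gens (\<lambda>e. co e a + co e b)"
    unfolding lcomb_add[OF gens(2), symmetric] by (simp only: co[OF ab(1), symmetric] co[OF ab(2), symmetric])
  then have "co e (a \<oplus>\<^bsub>L\<^esub> b) = co e a + co e b" by (simp only: co_lcomb[OF e])
  then show "co e (a \<oplus>\<^bsub>L\<^esub> b) = co e a \<oplus>\<^bsub>type_ring\<^esub> co e b" by simp
qed simp

lemma co_smult: assumes e: "e \<in> gens" and a: "a \<in> carrier L" shows "co e (h \<odot>\<^bsub>L\<^esub> a) = h * co e a"
proof -
  have "h \<odot>\<^bsub>L\<^esub> a = lcomb gens (\<lambda>e. h * co e a)"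
    unfolding lcomb_smult[OF gens(2), symmetric] by (simp only: co[OF a, symmetric])
  then show ?thesis by (simp only: co_lcomb[OF e])
qed

text \<open>
  In coordinates the annihilation module is a finite power of \<open>X\<close>: \<open>coord e\<close> is the projection to
  the factor of the basis element \<open>e\<close>.
\<close>

definition coord :: "'m \<Rightarrow> ('k, 'h, 'm) annih_elem \<Rightarrow> 'h \<Rightarrow> 'k" where
  "coord e = frag_lift X (\<lambda>(x, m). dual_ract H x (co e m))"

lemma coord_bal: assumes e: "e \<in> gens" shows "abal X (\<lambda>x m. dual_ract H x (co e m))"
proof (rule abalI, rule biadditiveI)
  show "additive_map X X (\<lambda>x. dual_ract H x (co e m))" for m by (rule ract_additive)
  show "additive_map L X (\<lambda>m. dual_ract H x (co e m))" if "x \<in> carrier X" for x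
    by (rule additiveI) (simp_all add: ract_in_X that additive_add[OF co_additive[OF e]] ract_add_right)
  show "dual_ract H (dual_ract H x r) (co e m) = dual_ract H x (co e (r \<odot>\<^bsub>L\<^esub> m))"
    if "m \<in> carrier L" for x m r
    by (simp add: co_smult[OF e that] ract_mult)
qed

lemma coord_additive: "e \<in> gens \<Longrightarrow> additive_map A X (coord e)"
  unfolding coord_def by (rule alift_additive[OF X_abelian_group coord_bal])

lemma coord_pure:
  "e \<in> gens \<Longrightarrow> x \<in> carrier X \<Longrightarrow> m \<in> carrier L \<Longrightarrow> coord e (apure x m) = dual_ract H x (co e m)"
  unfolding coord_def
  by (rule alift_pure[where \<phi> = "\<lambda>x m. dual_ract H x (co e m)", OF X_abelian_group coord_bal])

lemma coord_closed: "e \<in> gens \<Longrightarrow> U \<in> carrier A \<Longrightarrow> coord e U \<in> carrier X"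
  by (rule additive_closed[OF coord_additive])

lemma coord_smult:
  assumes e: "e \<in> gens" and U: "U \<in> carrier A" shows "coord e (h \<odot>\<^bsub>A\<^esub> U) = dual_lact H h (coord e U)"
proof (rule A_eq_on_pure[OF X_abelian_group additive_comp[OF asmult_additive coord_additive[OF e]]
      additive_comp[OF coord_additive[OF e] lact_additive] _ U])
  fix x m assume x: "x \<in> carrier X" and m: "m \<in> carrier L"
  show "coord e (h \<odot>\<^bsub>A\<^esub> apure x m) = dual_lact H h (coord e (apure x m))"
    by (simp only: asmult_pure[OF x m] coord_pure[OF e lact_in_X[OF x] m] coord_pure[OF e x m] lact_ract)
qed

lemma coord_expansion:
  assumes U: "U \<in> carrier A" shows "U = (\<Oplus>\<^bsub>A\<^esub>e\<in>gens. apure (coord e U) e)"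
proof -
  have id: "additive_map A A (\<lambda>U. U)" by (simp add: additive_map_def)
  have add: "additive_map A A (\<lambda>U. \<Oplus>\<^bsub>A\<^esub>e\<in>gens. apure (coord e U) e)"
    by (rule additive_map_finsum[OF A_abelian_group])
      (rule additive_comp[OF coord_additive biadditiveD(2)[OF apure_biadditive gens_closed]])
  show ?thesis
  proof (rule A_eq_on_pure[OF A_abelian_group id add _ U])
    fix x m assume x: "x \<in> carrier X" and m: "m \<in> carrier L"
    have "apure x m = apure x (\<Oplus>\<^bsub>L\<^esub>e\<in>gens. co e m \<odot>\<^bsub>L\<^esub> e)"
      using co[OF m] by (simp only: lcomb_def)
    also have "\<dots> = (\<Oplus>\<^bsub>A\<^esub>e\<in>gens. apure x (co e m \<odot>\<^bsub>L\<^esub> e))"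
      by (rule additive_finsum[OF Lg.abelian_group_axioms A_abelian_group biadditiveD(1)[OF apure_biadditive x]])
        (rule L_smult_closed[OF gens_closed])
    also have "\<dots> = (\<Oplus>\<^bsub>A\<^esub>e\<in>gens. apure (coord e (apure x m)) e)"
    proof (rule Ag.finsum_cong'[OF refl])
      show "(\<lambda>e. apure (coord e (apure x m)) e) \<in> gens \<rightarrow> carrier A"
        using apure_closed[OF coord_closed gens_closed] apure_closed[OF x m] by blast
      show "apure x (co e m \<odot>\<^bsub>L\<^esub> e) = apure (coord e (apure x m)) e" if e: "e \<in> gens" for e
        by (simp only: coord_pure[OF e x m] apure_ract[OF x gens_closed[OF e]])
    qed
    finally show "apure x m = (\<Oplus>\<^bsub>A\<^esub>e\<in>gens. apure (coord e (apure x m)) e)" .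
  qed
qed

lemma coord_eqI:
  assumes U: "U \<in> carrier A" and V: "V \<in> carrier A" and eq: "\<And>e. e \<in> gens \<Longrightarrow> coord e U = coord e V"
  shows "U = V"
proof -
  have "(\<Oplus>\<^bsub>A\<^esub>e\<in>gens. apure (coord e U) e) = (\<Oplus>\<^bsub>A\<^esub>e\<in>gens. apure (coord e V) e)"
    by (rule Ag.finsum_cong'[OF refl]) (use apure_closed[OF coord_closed gens_closed] V in \<open>auto simp: eq\<close>)
  then show ?thesis using coord_expansion[OF U] coord_expansion[OF V] by simp
qed

section \<open>The topologies of \<open>X\<close> and of the annihilation algebra\<close>

lemma H_filt_subspace: "V.subspace (H_filt H n)"
  by (simp add: H_filt_def V.subspace_span)

lemma finite_in_H_filt: assumes "finite S" shows "\<exists>n. S \<subseteq> H_filt H n"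
  using assms
proof (induction S rule: finite_induct)
  case (insert h S)
  obtain m n where "h \<in> H_filt H m" "S \<subseteq> H_filt H n" using insert.IH H_filt_exhausts by blast
  then have "insert h S \<subseteq> H_filt H (max m n)"
    using H_filt_mono[of m "max m n"] H_filt_mono[of n "max m n"] by auto
  then show ?case ..
qed simp

text \<open>The translates of a finite spanning set lie in some term of the filtration.\<close>

lemma H_filt_translate: "\<exists>m. \<forall>f\<in>H_filt H n. f * h \<in> H_filt H m"
proof -
  obtain E where E: "finite E" "H_filt H n = V.span E" using finite_filt by blast
  obtain m where m: "(\<lambda>f. f * h) ` E \<subseteq> H_filt H m" using finite_in_H_filt[OF finite_imageI[OF E(1)]] by blast
  have "V.span E \<subseteq> {f. f * h \<in> H_filt H m}"
  proof (rule V.span_minimal)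
    show "V.subspace {f. f * h \<in> H_filt H m}"
      by (rule V.subspaceI)
        (simp_all add: V.subspace_0[OF H_filt_subspace] distrib_right V.subspace_add[OF H_filt_subspace]
          V.subspace_scale[OF H_filt_subspace] flip: scal_mult_left)
  qed (use m in auto)
  then show ?thesis using E by blast
qed

lemma dual_filtD: "x \<in> dual_filt H n \<Longrightarrow> x \<in> carrier X" "x \<in> dual_filt H n \<Longrightarrow> f \<in> H_filt H n \<Longrightarrow> x f = 0"
  by (simp_all add: dual_filt_def)

lemma X_filtered: "filtered_group X (dual_filt H)"
proof (intro filtered_group.intro filtered_group_axioms.intro X_abelian_group)
  show "dual_filt H n \<subseteq> carrier X" for n by (auto simp: dual_filt_def)
  show "\<zero>\<^bsub>X\<^esub> \<in> dual_filt H n" for n unfolding dual_filt_def using Xg.zero_closed by (simp add: X_simps(1))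
  show "u \<oplus>\<^bsub>X\<^esub> v \<in> dual_filt H n" if "u \<in> dual_filt H n" "v \<in> dual_filt H n" for u v n
    using that unfolding dual_filt_def by (simp add: X_add_apply)
  show "\<ominus>\<^bsub>X\<^esub> u \<in> dual_filt H n" if "u \<in> dual_filt H n" for u n
    using that unfolding dual_filt_def by (simp add: X_uminus[symmetric]) (simp add: X_uminus)
  show "dual_filt H n \<subseteq> dual_filt H m" if "m \<le> n" for m n
    using H_filt_mono[OF that] unfolding dual_filt_def by blast
qed

sublocale XF: filtered_group "dual H" "dual_filt H" by (rule X_filtered)

lemma dual_filt_ract: "\<exists>m. \<forall>x\<in>dual_filt H m. dual_ract H x h \<in> dual_filt H n"
proof -
  obtain m where m: "\<forall>f\<in>H_filt H n. f * anti h \<in> H_filt H m" using H_filt_translate by blast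
  have "dual_ract H x h \<in> dual_filt H n" if "x \<in> dual_filt H m" for x
    unfolding dual_filt_def using m ract_in_X dual_filtD[OF that] by (simp add: dual_ract_def)
  then show ?thesis by blast
qed

abbreviation A_filt :: "nat \<Rightarrow> ('k, 'h, 'm) annih_elem set" where
  "A_filt \<equiv> annih_filt H L L0"

lemma L0_span: "\<exists>E. finite E \<and> E \<subseteq> carrier L \<and> L0 = span_over L (scalars H) E" "span_over L UNIV L0 = carrier L"
  using L0 by (simp_all add: generating_subspace_def)

lemma L0_subset: "L0 \<subseteq> carrier L"
proof -
  obtain E where "E \<subseteq> carrier L" "L0 = span_over L (scalars H) E" using L0_span(1) by blast
  then show ?thesis using L_smult_closed by (auto simp: span_over_def intro!: Lg.finsum_closed)
qed

lemma A_presented: "presented A (carrier X \<times> carrier L) (tprod_rels X (dual_ract H) L)"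
  unfolding A_tprod by (rule T.presented_tprod)

lemma apure_class: "apure x m = frag_class (tprod_rels X (dual_ract H) L) (frag_of (x, m))"
  by (simp add: apure_tprod tprod_pure_def)

lemma A_filt_gens: "dual_filt H n \<times> L0 \<subseteq> carrier X \<times> carrier L"
  using L0_subset dual_filtD(1) by blast

lemma A_filtI: "Poly_Mapping.keys u \<subseteq> dual_filt H n \<times> L0 \<Longrightarrow> frag_class (tprod_rels X (dual_ract H) L) u \<in> A_filt n"
  unfolding annih_filt_def by blast

lemma A_filtE:
  assumes "U \<in> A_filt n"
  obtains u where "Poly_Mapping.keys u \<subseteq> dual_filt H n \<times> L0" "U = frag_class (tprod_rels X (dual_ract H) L) u"
  using assms unfolding annih_filt_def by blast

lemma A_filt_subset: "A_filt n \<subseteq> carrier A"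
proof
  fix U assume "U \<in> A_filt n"
  then obtain u where u: "Poly_Mapping.keys u \<subseteq> dual_filt H n \<times> L0" "U = frag_class (tprod_rels X (dual_ract H) L) u"
    by (rule A_filtE)
  show "U \<in> carrier A"
    unfolding u(2) by (rule presented_class[OF A_presented subset_trans[OF u(1) A_filt_gens]])
qed

lemma A_filtered: "filtered_group A A_filt"
proof (intro filtered_group.intro filtered_group_axioms.intro A_abelian_group A_filt_subset)
  show "\<zero>\<^bsub>A\<^esub> \<in> A_filt n" for n
    unfolding presented_zero[OF A_presented] by (rule A_filtI) simp
  show "U \<oplus>\<^bsub>A\<^esub> V \<in> A_filt n" if U: "U \<in> A_filt n" and V: "V \<in> A_filt n" for U V n
  proof -
    obtain u where u: "Poly_Mapping.keys u \<subseteq> dual_filt H n \<times> L0" "U = frag_class (tprod_rels X (dual_ract H) L) u"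
      using U by (rule A_filtE)
    obtain v where v: "Poly_Mapping.keys v \<subseteq> dual_filt H n \<times> L0" "V = frag_class (tprod_rels X (dual_ract H) L) v"
      using V by (rule A_filtE)
    show ?thesis
      unfolding u(2) v(2) presented_add[OF A_presented]
      by (rule A_filtI) (use u(1) v(1) keys_add[of u v] in blast)
  qed
  show "\<ominus>\<^bsub>A\<^esub> U \<in> A_filt n" if U: "U \<in> A_filt n" for U n
  proof -
    obtain u where u: "Poly_Mapping.keys u \<subseteq> dual_filt H n \<times> L0" "U = frag_class (tprod_rels X (dual_ract H) L) u"
      using U by (rule A_filtE)
    show ?thesis
      unfolding u(2) presented_uminus[OF A_presented subset_trans[OF u(1) A_filt_gens]]
      by (rule A_filtI) (use u(1) in \<open>simp add: keys_minus\<close>)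
  qed
  show "A_filt n \<subseteq> A_filt m" if "m \<le> n" for m n
    unfolding annih_filt_def using XF.N_mono[OF that] by blast
qed

sublocale AF: filtered_group A A_filt by (rule A_filtered)

lemma apure_in_A_filt: "x \<in> dual_filt H n \<Longrightarrow> l \<in> L0 \<Longrightarrow> apure x l \<in> A_filt n"
  unfolding apure_class by (rule A_filtI) simp

lemma A_filt_minimal:
  assumes U: "U \<in> A_filt n" and zero: "P \<zero>\<^bsub>A\<^esub>" and gen: "\<And>x l. x \<in> dual_filt H n \<Longrightarrow> l \<in> L0 \<Longrightarrow> P (apure x l)"
    and diff: "\<And>U V. U \<in> carrier A \<Longrightarrow> V \<in> carrier A \<Longrightarrow> P U \<Longrightarrow> P V \<Longrightarrow> P (U \<ominus>\<^bsub>A\<^esub> V)"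
  shows "P U"
proof -
  let ?c = "frag_class (tprod_rels X (dual_ract H) L)"
  obtain u where u: "Poly_Mapping.keys u \<subseteq> dual_filt H n \<times> L0" "U = ?c u"
    using U by (rule A_filtE)
  have "Poly_Mapping.keys u \<subseteq> dual_filt H n \<times> L0 \<and> P (?c u)"
    using u(1)
  proof (induction u rule: frag_induction)
    case zero
    show ?case using assms(2) by (simp add: presented_zero[OF A_presented])
  next
    case (one p)
    then obtain x l where p: "p = (x, l)" "x \<in> dual_filt H n" "l \<in> L0" by blast
    show ?case using gen[OF p(2,3)] p by (simp add: apure_class)
  next
    case (diff a b)
    then have k: "Poly_Mapping.keys a \<subseteq> carrier X \<times> carrier L" "Poly_Mapping.keys b \<subseteq> carrier X \<times> carrier L"
      using A_filt_gens by blast+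
    have "P (?c a \<ominus>\<^bsub>A\<^esub> ?c b)"
      by (rule assms(4)[OF presented_class[OF A_presented k(1)] presented_class[OF A_presented k(2)]])
        (use diff in blast)+
    then show ?case
      using diff keys_diff[of a b] unfolding presented_minus[OF A_presented k(1,2)] by blast
  qed
  then show ?thesis by (simp add: u(2))
qed

text \<open>Write \<open>a = \<Sum>r\<^sub>l l\<close> with \<open>l\<close> in \<open>L0\<close>; then \<open>x \<otimes>\<^sub>H a = \<Sum>x r\<^sub>l \<otimes>\<^sub>H l\<close>, and the right action on \<open>X\<close> is continuous.\<close>

lemma apure_continuous: assumes a: "a \<in> carrier L" shows "\<exists>m. \<forall>x\<in>dual_filt H m. apure x a \<in> A_filt n"
proof -
  obtain F r where F: "finite F" "F \<subseteq> L0" "a = (\<Oplus>\<^bsub>L\<^esub>l\<in>F. r l \<odot>\<^bsub>L\<^esub> l)"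
    using a unfolding L0_span(2)[symmetric] span_over_def by blast
  have "\<forall>l\<in>F. \<exists>m. \<forall>x\<in>dual_filt H m. dual_ract H x (r l) \<in> dual_filt H n"
    using dual_filt_ract by blast
  then obtain M where M: "\<forall>l\<in>F. \<forall>x\<in>dual_filt H (M l). dual_ract H x (r l) \<in> dual_filt H n"
    unfolding bchoice_iff by (elim exE)
  define m where "m = Max (M ` F)"
  have "apure x a \<in> A_filt n" if x: "x \<in> dual_filt H m" for x
  proof -
    have xX: "x \<in> carrier X" by (rule dual_filtD(1)[OF x])
    have lL: "l \<in> carrier L" if "l \<in> F" for l using that F(2) L0_subset by blast
    have "apure x a = (\<Oplus>\<^bsub>A\<^esub>l\<in>F. apure x (r l \<odot>\<^bsub>L\<^esub> l))"
      unfolding F(3)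
      by (rule additive_finsum[OF Lg.abelian_group_axioms A_abelian_group biadditiveD(1)[OF apure_biadditive xX]])
        (rule L_smult_closed[OF lL])
    moreover have "apure x (r l \<odot>\<^bsub>L\<^esub> l) \<in> A_filt n" if l: "l \<in> F" for l
    proof -
      have "M l \<le> m" unfolding m_def using F(1) l by simp
      then have "x \<in> dual_filt H (M l)" using XF.N_mono x by blast
      then have "dual_ract H x (r l) \<in> dual_filt H n" using M l by blast
      then show ?thesis
        unfolding apure_ract[OF xX lL[OF l], symmetric] using l F(2) by (intro apure_in_A_filt) blast+
    qed
    ultimately show ?thesis by (simp only:) (rule AF.N_finsum)
  qed
  then show ?thesis by blast
qed

text \<open>
  On \<open>x \<otimes>\<^sub>H l\<close> the coordinate at \<open>f\<close> is the value of \<open>x\<close> at \<open>f S(h)\<close>, with \<open>h\<close> the coordinate of \<open>l\<close>. As \<open>L0\<close> has finite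
  dimension, these elements lie in one term of the filtration of \<open>H\<close>.
\<close>

lemma coord_vanishes: assumes e: "e \<in> gens" shows "\<exists>n. \<forall>U\<in>A_filt n. coord e U f = 0"
proof -
  obtain E where E: "finite E" "E \<subseteq> carrier L" "L0 = span_over L (scalars H) E" using L0_span(1) by blast
  obtain n where n: "(\<lambda>a. f * anti (co e a)) ` E \<subseteq> H_filt H n"
    using finite_in_H_filt[OF finite_imageI[OF E(1)]] by blast
  let ?S = "{h. f * anti h \<in> H_filt H n}"
  have S: "V.subspace ?S"
    by (rule V.subspaceI)
      (simp_all add: V.subspace_0[OF H_filt_subspace] distrib_left V.subspace_add[OF H_filt_subspace]
        V.subspace_scale[OF H_filt_subspace] lin_zero[OF lin_antipode] lin_add[OF lin_antipode]
        lin_scal[OF lin_antipode] flip: scal_mult_right)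
  have L0S: "co e l \<in> ?S" if l: "l \<in> L0" for l
  proof -
    obtain F r where F: "finite F" "F \<subseteq> E" "r ` F \<subseteq> scalars H" "l = (\<Oplus>\<^bsub>L\<^esub>a\<in>F. r a \<odot>\<^bsub>L\<^esub> a)"
      using l unfolding E(3) span_over_def by blast
    have aL: "a \<in> carrier L" if "a \<in> F" for a using that F(2) E(2) by blast
    have "co e l = (\<Oplus>\<^bsub>type_ring\<^esub>a\<in>F. co e (r a \<odot>\<^bsub>L\<^esub> a))"
      unfolding F(4)
      by (rule additive_finsum[OF Lg.abelian_group_axioms abelian_group_type_ring co_additive[OF e]])
        (rule L_smult_closed[OF aL])
    also have "\<dots> = (\<Sum>a\<in>F. r a * co e a)"
      unfolding finsum_type_ring[OF F(1)] by (rule sum.cong[OF refl]) (rule co_smult[OF e aL])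
    also have "\<dots> \<in> ?S"
    proof (rule V.subspace_sum[OF S])
      fix a assume a: "a \<in> F"
      then obtain c where c: "r a = scal H c 1" using F(3) by (auto simp: scalars_def)
      have "co e a \<in> ?S" using n F(2) a by blast
      then have "scal H c (co e a) \<in> ?S" by (rule V.subspace_scale[OF S])
      then show "r a * co e a \<in> ?S" by (simp add: c flip: scal_mult_left)
    qed
    finally show ?thesis .
  qed
  have "coord e U f = 0" if U: "U \<in> A_filt n" for U
    using U
  proof (rule A_filt_minimal)
    show "coord e \<zero>\<^bsub>A\<^esub> f = 0"
      by (simp add: additive_zero[OF A_abelian_group X_abelian_group coord_additive[OF e]] X_simps)
    show "coord e (apure x l) f = 0" if x: "x \<in> dual_filt H n" and l: "l \<in> L0" for x l
    proof -
      have "l \<in> carrier L" using l L0_subset by blast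
      then have "coord e (apure x l) f = x (f * anti (co e l))"
        by (simp add: coord_pure[OF e dual_filtD(1)[OF x]] dual_ract_def)
      also have "\<dots> = 0" using L0S[OF l] by (intro dual_filtD(2)[OF x]) simp
      finally show ?thesis .
    qed
    show "coord e (U \<ominus>\<^bsub>A\<^esub> V) f = 0" if "U \<in> carrier A" "V \<in> carrier A" "coord e U f = 0" "coord e V f = 0" for U V
      unfolding additive_minus[OF A_abelian_group X_abelian_group coord_additive[OF e] that(1,2)]
      using that(3,4) coord_closed[OF e that(2)] by (simp add: a_minus_def X_uminus X_simps)
  qed
  then show ?thesis by blast
qed

text \<open>An element of all terms of the filtration has zero coordinates.\<close>

lemma A_separated: assumes U: "\<And>n. U \<in> A_filt n" shows "U = \<zero>\<^bsub>A\<^esub>"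
proof (rule coord_eqI)
  show UA: "U \<in> carrier A" by (rule AF.N_closed[OF U])
  show "coord e U = coord e \<zero>\<^bsub>A\<^esub>" if e: "e \<in> gens" for e
  proof
    fix f
    obtain n where "\<forall>U\<in>A_filt n. coord e U f = 0" using coord_vanishes[OF e] by blast
    then show "coord e U f = coord e \<zero>\<^bsub>A\<^esub> f" using U AF.N_zero by simp
  qed
qed simp

section \<open>The canonical map is bijective\<close>

text \<open>
  Choose a basis of \<open>H\<close> that extends a basis \<open>C\<close> of \<open>F\<^sup>m H\<close>. Up to an element of \<open>F\<^sub>m X\<close>, every \<open>x\<close> is the combination
  of the coordinate functionals at \<open>C\<close> with coefficients \<open>x(b)\<close>.
\<close>

lemma continuous_functional:
  fixes \<phi> :: "('h \<Rightarrow> 'k) \<Rightarrow> 'k"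
  assumes add: "\<And>x y. x \<in> carrier X \<Longrightarrow> y \<in> carrier X \<Longrightarrow> \<phi> (x \<oplus>\<^bsub>X\<^esub> y) = \<phi> x + \<phi> y"
    and scal: "\<And>c x. x \<in> carrier X \<Longrightarrow> \<phi> (\<lambda>f. c * x f) = c * \<phi> x"
    and vanish: "\<And>x. x \<in> dual_filt H m \<Longrightarrow> \<phi> x = 0"
  shows "\<exists>h. \<forall>x\<in>carrier X. \<phi> x = x h"
proof -
  have "L.fin_dim (H_filt H m)"
    unfolding L.fin_dim_def using finite_filt[of m] H_filt_subspace by blast
  then obtain C where C: "C \<subseteq> H_filt H m" "V.independent C" "H_filt H m \<subseteq> V.span C" "finite C" "card C = V.dim (H_filt H m)"
    by (rule L.fin_dim_basis[of _ "{}"]) (simp_all add: V.independent_empty)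
  define B' where "B' = V.extend_basis C"
  have B': "is_basis H B'" "C \<subseteq> B'"
    using V.independent_extend_basis[OF C(2)] V.span_extend_basis[OF C(2)] V.extend_basis_superset[OF C(2)]
    by (simp_all add: is_basis_def B'_def)
  let ?v = "dual_vec H B'"
  have v: "?v b \<in> carrier X" for b unfolding X_carrier by (rule dual_vec_lin[OF B'(1)])
  have cv: "(\<lambda>f. c * ?v b f) \<in> carrier X" for c b
    using v[of b] unfolding X_carrier by (rule lin_times_left)
  have vb: "?v b b' = (if b = b' then 1 else 0)" if "b' \<in> C" for b b'
  proof -
    have "b' \<in> B'" using that B'(2) by blast
    then show ?thesis
      using basis_facts(1)[OF B'(1)] by (simp add: dual_vec_def V.representation_basis)
  qed
  have sum_closed: "(\<lambda>f. \<Sum>b\<in>S. c b * ?v b f) \<in> carrier X" if "finite S" for S and c :: "'h \<Rightarrow> 'k"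
    using that
  proof (induction S rule: finite_induct)
    case (insert b S)
    then show ?case using Xg.a_closed[OF cv[of "c b" b] insert.IH] by (simp add: X_simps)
  qed (use Xg.zero_closed in \<open>simp add: X_simps\<close>)
  have phi_zero: "\<phi> (\<lambda>f. 0) = 0"
    using scal[OF v, of 0] by simp
  have phi_sum: "\<phi> (\<lambda>f. \<Sum>b\<in>S. c b * ?v b f) = (\<Sum>b\<in>S. c b * \<phi> (?v b))" if "finite S" for S and c :: "'h \<Rightarrow> 'k"
    using that
  proof (induction S rule: finite_induct)
    case (insert b S)
    then show ?case
      using add[OF cv[of "c b" b] sum_closed[OF insert.hyps(1), of c]] scal[OF v, of "c b" b] by (simp add: X_simps)
  qed (simp add: phi_zero)
  define h where "h = (\<Sum>b\<in>C. scal H (\<phi> (?v b)) b)"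
  have "\<phi> x = x h" if x: "x \<in> carrier X" for x
  proof -
    let ?y = "\<lambda>f. \<Sum>b\<in>C. x b * ?v b f" and ?z = "\<lambda>f. x f - (\<Sum>b\<in>C. x b * ?v b f)"
    have lx: "lin (*) x" using x by (simp add: X_carrier)
    have y: "?y \<in> carrier X" by (rule sum_closed[OF C(4)])
    have zX: "?z \<in> carrier X" using lx y unfolding X_carrier by (rule lin_minus)
    then have lz: "lin (*) ?z" by (simp add: X_carrier)
    have zC: "?z b = 0" if "b \<in> C" for b
    proof -
      have "(\<Sum>b'\<in>C. x b' * ?v b' b) = (\<Sum>b'\<in>C. if b' = b then x b' else 0)"
        by (rule sum.cong) (simp_all add: vb[OF that])
      then show ?thesis using that C(4) by simp
    qed
    have "V.span C \<subseteq> {f. ?z f = 0}"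
    proof (rule V.span_minimal)
      show "C \<subseteq> {f. ?z f = 0}" using zC by blast
      show "V.subspace {f. ?z f = 0}"
      proof (rule V.subspaceI)
        show "0 \<in> {f. ?z f = 0}" using lin_zero[OF lz] by simp
        show "f + g \<in> {f. ?z f = 0}" if "f \<in> {f. ?z f = 0}" "g \<in> {f. ?z f = 0}" for f g
          unfolding mem_Collect_eq lin_add[OF lz] using that[unfolded mem_Collect_eq] by (simp only: add_0)
        show "scal H c f \<in> {f. ?z f = 0}" if "f \<in> {f. ?z f = 0}" for c f
          unfolding mem_Collect_eq lin_scal[OF lz] using that[unfolded mem_Collect_eq] by (simp only: mult_zero_right)
      qed
    qed
    then have "?z \<in> dual_filt H m" using C(3) zX unfolding dual_filt_def by blast
    then have z0: "\<phi> ?z = 0" by (rule vanish)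
    have "?z \<oplus>\<^bsub>X\<^esub> ?y = x" by (simp add: X_simps)
    then have "\<phi> x = \<phi> ?y" using add[OF zX y] z0 by simp
    also have "\<dots> = x h"
      unfolding phi_sum[OF C(4)] h_def lin_sum[OF lx] lin_scal[OF lx] by (simp add: mult.commute)
    finally show ?thesis .
  qed
  then show ?thesis by blast
qed

definition LL :: "('h, ('k, 'h, 'm) annih_elem) top_lie_algebra" where "LL = annih H L L0"

definition Lhat :: "('h, ('h \<Rightarrow> 'k) \<Rightarrow> ('k, 'h, 'm) annih_elem) module" where "Lhat = cont_hom H LL"

lemma LL_simps:
  "carrier LL = carrier A" "\<zero>\<^bsub>LL\<^esub> = \<zero>\<^bsub>A\<^esub>" "add LL = add A" "smult LL = smult A"
  "lie_bracket LL = annih_bracket H L" "lie_topology LL = filt_topology A A_filt"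
  by (simp_all add: LL_def annih_def module.extend_def top_lie_algebra.fields_def A_def)

lemma LL_finsum: "finsum LL = finsum A"
  by (rule add_monoid_cong(3)) (simp_all add: LL_simps)

lemma Lhat_carrier:
  "\<alpha> \<in> carrier Lhat \<longleftrightarrow> \<alpha> \<in> extensional (carrier X) \<and> additive_map X A \<alpha> \<and>
    (\<forall>h. \<forall>x\<in>carrier X. \<alpha> (dual_lact H h x) = h \<odot>\<^bsub>A\<^esub> \<alpha> x) \<and> (\<forall>n. \<exists>m. \<alpha> ` dual_filt H m \<subseteq> A_filt n)"
proof -
  have "\<alpha> \<in> carrier Lhat \<longleftrightarrow> \<alpha> \<in> extensional (carrier X) \<and> additive_map X A \<alpha> \<and>
    (\<forall>h. \<forall>x\<in>carrier X. \<alpha> (dual_lact H h x) = h \<odot>\<^bsub>A\<^esub> \<alpha> x) \<and>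
    continuous_map (dual_topology H) (filt_topology A A_filt) \<alpha>"
    by (auto simp: Lhat_def cont_hom_def LL_simps PiE_def additive_map_def)
  then show ?thesis
    by (metis additive_continuous_iff[OF X_filtered A_filtered])
qed

lemma Lhat_simps:
  "\<zero>\<^bsub>Lhat\<^esub> = (\<lambda>x\<in>carrier X. \<zero>\<^bsub>A\<^esub>)" "\<alpha> \<oplus>\<^bsub>Lhat\<^esub> \<beta> = (\<lambda>x\<in>carrier X. \<alpha> x \<oplus>\<^bsub>A\<^esub> \<beta> x)"
  "h \<odot>\<^bsub>Lhat\<^esub> \<alpha> = (\<lambda>x\<in>carrier X. \<alpha> (dual_ract H x h))"
  by (simp_all add: Lhat_def cont_hom_def LL_simps)

definition can :: "'m \<Rightarrow> ('h \<Rightarrow> 'k) \<Rightarrow> ('k, 'h, 'm) annih_elem" where "can = canonical_map H L"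

lemma can: "can a = (\<lambda>x\<in>carrier X. apure x a)"
  by (simp add: can_def canonical_map_def apure_def)

lemma can_apply: "x \<in> carrier X \<Longrightarrow> can a x = apure x a"
  by (simp add: can)

lemma can_closed: assumes a: "a \<in> carrier L" shows "can a \<in> carrier Lhat"
  unfolding Lhat_carrier
proof (intro conjI allI ballI)
  show "can a \<in> extensional (carrier X)" by (simp add: can)
  show "additive_map X A (can a)"
  proof (rule additiveI)
    show "can a x \<in> carrier A" if "x \<in> carrier X" for x
      unfolding can_apply[OF that] by (rule apure_closed[OF that a])
    show "can a (x \<oplus>\<^bsub>X\<^esub> y) = can a x \<oplus>\<^bsub>A\<^esub> can a y" if x: "x \<in> carrier X" and y: "y \<in> carrier X" for x y
      unfolding can_apply[OF x] can_apply[OF y] can_apply[OF Xg.a_closed[OF x y]]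
      by (rule additive_add[OF biadditiveD(2)[OF apure_biadditive a] x y])
  qed
  show "can a (dual_lact H h x) = h \<odot>\<^bsub>A\<^esub> can a x" if x: "x \<in> carrier X" for h x
    unfolding can_apply[OF x] can_apply[OF lact_in_X[OF x]] by (rule asmult_pure[OF x a, symmetric])
  show "\<exists>m. can a ` dual_filt H m \<subseteq> A_filt n" for n
  proof -
    obtain m where m: "\<forall>x\<in>dual_filt H m. apure x a \<in> A_filt n" using apure_continuous[OF a] by blast
    have "can a ` dual_filt H m \<subseteq> A_filt n"
    proof
      fix U assume "U \<in> can a ` dual_filt H m"
      then obtain x where x: "x \<in> dual_filt H m" "U = can a x" by blast
      show "U \<in> A_filt n" unfolding x(2) can_apply[OF dual_filtD(1)[OF x(1)]] using m x(1) by blast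
    qed
    then show ?thesis by blast
  qed
qed

lemma can_additive: "additive_map L Lhat can"
proof (rule additiveI)
  show "can a \<in> carrier Lhat" if "a \<in> carrier L" for a by (rule can_closed[OF that])
  fix a b assume ab: "a \<in> carrier L" "b \<in> carrier L"
  show "can (a \<oplus>\<^bsub>L\<^esub> b) = can a \<oplus>\<^bsub>Lhat\<^esub> can b"
    unfolding Lhat_simps can
  proof (rule restrict_ext)
    fix x assume x: "x \<in> carrier X"
    show "apure x (a \<oplus>\<^bsub>L\<^esub> b) = (\<lambda>x\<in>carrier X. apure x a) x \<oplus>\<^bsub>A\<^esub> (\<lambda>x\<in>carrier X. apure x b) x"
      using additive_add[OF biadditiveD(1)[OF apure_biadditive x] ab] x by simp
  qed
qed

lemma can_smult: assumes a: "a \<in> carrier L" shows "can (h \<odot>\<^bsub>L\<^esub> a) = h \<odot>\<^bsub>Lhat\<^esub> can a"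
  unfolding Lhat_simps can
proof (rule restrict_ext)
  fix x assume x: "x \<in> carrier X"
  show "apure x (h \<odot>\<^bsub>L\<^esub> a) = (\<lambda>x\<in>carrier X. apure x a) (dual_ract H x h)"
    using apure_ract[OF x a] ract_in_X[OF x] by simp
qed

lemma can_zero: "can \<zero>\<^bsub>L\<^esub> = \<zero>\<^bsub>Lhat\<^esub>"
  unfolding Lhat_simps can
  by (rule restrict_ext)
    (rule additive_zero[OF Lg.abelian_group_axioms A_abelian_group biadditiveD(1)[OF apure_biadditive]])

text \<open>
  The coordinates of \<open>x \<otimes>\<^sub>H a\<close>, evaluated at \<open>1\<close>, are the values of \<open>x\<close> at the antipodes of the coordinates
  of \<open>a\<close>; the functionals \<open>x\<close> separate these and the antipode is injective.
\<close>

lemma can_inj: "inj_on can (carrier L)"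
proof (rule inj_onI)
  fix a b assume a: "a \<in> carrier L" and b: "b \<in> carrier L" and eq: "can a = can b"
  have "co e a = co e b" if e: "e \<in> gens" for e
  proof -
    have "x (anti (co e a)) = x (anti (co e b))" if "lin (*) x" for x
    proof -
      have x: "x \<in> carrier X" using that by (simp add: X_carrier)
      have "apure x a = apure x b" using fun_cong[OF eq, of x] by (simp only: can_apply[OF x])
      then have "dual_ract H x (co e a) = dual_ract H x (co e b)"
        by (simp only: coord_pure[OF e x a, symmetric] coord_pure[OF e x b, symmetric])
      then have "dual_ract H x (co e a) 1 = dual_ract H x (co e b) 1" by (simp only:)
      then show ?thesis by (simp add: dual_ract_def)
    qed
    then have "anti (co e a) - anti (co e b) = 0" by (intro dual_separates) (simp add: lin_diff)
    then have "anti (co e a) = anti (co e b)" by simp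
    then have "anti (anti (co e a)) = anti (anti (co e b))" by (simp only:)
    then show ?thesis by (simp only: anti_anti)
  qed
  then have "lcomb gens (\<lambda>e. co e a) = lcomb gens (\<lambda>e. co e b)"
    by (rule lcomb_cong[OF gens(2)])
  then show "a = b" by (simp only: co[OF a, symmetric] co[OF b, symmetric])
qed

text \<open>
  A continuous \<open>H\<close>-linear map is determined by the functionals that take the value at \<open>1\<close> of its
  coordinates. These are continuous on \<open>X\<close>, hence evaluations at elements of \<open>H\<close>.
\<close>

lemma can_surj: assumes \<alpha>: "\<alpha> \<in> carrier Lhat" shows "\<exists>a\<in>carrier L. can a = \<alpha>"
proof -
  have \<alpha>': "\<alpha> \<in> extensional (carrier X)" "additive_map X A \<alpha>"
      "\<forall>h. \<forall>x\<in>carrier X. \<alpha> (dual_lact H h x) = h \<odot>\<^bsub>A\<^esub> \<alpha> x" "\<forall>n. \<exists>m. \<alpha> ` dual_filt H m \<subseteq> A_filt n"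
    using \<alpha> unfolding Lhat_carrier by blast+
  note cl = additive_closed[OF \<alpha>'(2)]
  have lin: "coord e (\<alpha> (dual_lact H h x)) = dual_lact H h (coord e (\<alpha> x))" if "e \<in> gens" "x \<in> carrier X" for e h x
    using \<alpha>'(3) that(2) coord_smult[OF that(1) cl[OF that(2)]] by simp
  have "\<exists>h. \<forall>x\<in>carrier X. coord e (\<alpha> x) 1 = x h" if e: "e \<in> gens" for e
  proof -
    obtain n where n: "\<forall>U\<in>A_filt n. coord e U 1 = 0" using coord_vanishes[OF e] by blast
    obtain m where m: "\<alpha> ` dual_filt H m \<subseteq> A_filt n" using \<alpha>'(4) by blast
    show ?thesis
    proof (rule continuous_functional)
      show "coord e (\<alpha> (x \<oplus>\<^bsub>X\<^esub> y)) 1 = coord e (\<alpha> x) 1 + coord e (\<alpha> y) 1"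
        if "x \<in> carrier X" "y \<in> carrier X" for x y
        using additive_add[OF additive_comp[OF \<alpha>'(2) coord_additive[OF e]] that] by (simp add: X_simps)
      show "coord e (\<alpha> x) 1 = 0" if "x \<in> dual_filt H m" for x using that m n by blast
      show "coord e (\<alpha> (\<lambda>f. c * x f)) 1 = c * coord e (\<alpha> x) 1" if x: "x \<in> carrier X" for c x
      proof -
        \<comment> \<open>Linearity over the field is \<open>H\<close>-linearity for multiples of \<open>1\<close>.\<close>
        have l: "dual_lact H (scal H c 1) y = (\<lambda>f. c * y f)" if "y \<in> carrier X" for y
          using that by (intro ext)
            (simp add: dual_lact_def X_carrier lin_scal[OF lin_antipode] anti_one lin_scal[of "(*)" y] flip: scal_mult_left)
        show ?thesis
          using lin[OF e x, of "scal H c 1"] by (simp only: l[OF x] l[OF coord_closed[OF e cl[OF x]]])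
      qed
    qed
  qed
  then have "\<forall>e\<in>gens. \<exists>h. \<forall>x\<in>carrier X. coord e (\<alpha> x) 1 = x h" by blast
  then obtain h where h: "\<forall>e\<in>gens. \<forall>x\<in>carrier X. coord e (\<alpha> x) 1 = x (h e)"
    unfolding bchoice_iff by (elim exE)
  define a where "a = lcomb gens (\<lambda>e. anti (h e))"
  have a: "a \<in> carrier L" unfolding a_def by (rule lcomb_closed[OF gens(2)])
  have "can a x = \<alpha> x" if x: "x \<in> carrier X" for x
    unfolding can_apply[OF x]
  proof (rule coord_eqI[OF apure_closed[OF x a] cl[OF x]])
    fix e assume e: "e \<in> gens"
    show "coord e (apure x a) = coord e (\<alpha> x)"
    proof
      fix f
      have "coord e (\<alpha> x) f = dual_lact H (anti f) (coord e (\<alpha> x)) 1"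
        by (simp add: dual_lact_def anti_anti)
      also have "\<dots> = coord e (\<alpha> (dual_lact H (anti f) x)) 1" by (simp only: lin[OF e x])
      also have "\<dots> = dual_lact H (anti f) x (h e)" using h e lact_in_X[OF x] by blast
      also have "\<dots> = coord e (apure x a) f"
        by (simp only: coord_pure[OF e x a]) (simp add: a_def co_lcomb[OF e] dual_lact_def dual_ract_def anti_anti)
      finally show "coord e (apure x a) f = coord e (\<alpha> x) f" by (rule sym)
    qed
  qed
  then have "can a = \<alpha>" using \<alpha>'(1) by (intro extensionalityI[of _ "carrier X"]) (simp_all add: can)
  then show ?thesis using a by blast
qed

lemma can_image: "can ` carrier L = carrier Lhat"
  using can_closed can_surj by blast

lemma Lhat_left_module: "left_module Lhat"
  by (rule transport_left_module[where \<Phi> = can, OF Lm can_additive can_image can_smult can_zero])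

section \<open>The brackets of the reconstructed pseudoalgebra\<close>

abbreviation dvec :: "'h \<Rightarrow> 'h \<Rightarrow> 'k" where "dvec \<equiv> dual_vec H B"

lemma dvec_X: "dvec h \<in> carrier X"
  unfolding X_carrier by (rule dual_vec_lin[OF basis])

text \<open>The factor in \<open>y\<close> of a term of the series for the \<open>x\<close>-bracket.\<close>

definition shifted :: "('h \<Rightarrow> 'k) \<Rightarrow> ('h \<Rightarrow> 'k) \<Rightarrow> 'h \<Rightarrow> 'h \<Rightarrow> 'k" where
  "shifted x y h = y \<otimes>\<^bsub>X\<^esub> dual_lact H h (dual_antipode H x)"

definition partial :: "'h \<Rightarrow> ('h \<Rightarrow> 'k) \<Rightarrow> ('h \<Rightarrow> 'k) \<Rightarrow> 'h set \<Rightarrow> 'h \<Rightarrow> 'k" where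
  "partial f x y S = (\<Oplus>\<^bsub>X\<^esub>h\<in>S. dual_ract H (dvec h) f \<otimes>\<^bsub>X\<^esub> shifted x y h)"

lemma shifted_X: "x \<in> carrier X \<Longrightarrow> y \<in> carrier X \<Longrightarrow> shifted x y h \<in> carrier X"
  unfolding shifted_def by (rule X_mult_closed[OF _ lact_in_X[OF dual_antipode_in_X]])

lemma partial_term_X: "x \<in> carrier X \<Longrightarrow> y \<in> carrier X \<Longrightarrow> dual_ract H (dvec h) f \<otimes>\<^bsub>X\<^esub> shifted x y h \<in> carrier X"
  by (rule X_mult_closed[OF ract_in_X[OF dvec_X] shifted_X])

lemma partial_X: "x \<in> carrier X \<Longrightarrow> y \<in> carrier X \<Longrightarrow> partial f x y S \<in> carrier X"
  unfolding partial_def by (rule Xg.finsum_closed) (use partial_term_X in blast)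

lemma scaled_X: "y \<in> carrier X \<Longrightarrow> (\<lambda>u. c * y u) \<in> carrier X"
  unfolding X_carrier by (rule lin_times_left)

text \<open>
  At each \<open>u\<close> the series is a finite sum: once the partial sum contains the basis vectors in the
  expansion of the elements \<open>u\<^sub>1 S(f)\<close>, it equals \<open>y(u\<^sub>2) x(S(u\<^sub>3) u\<^sub>1 S(f))\<close>, and by cocommutativity
  \<open>S(u\<^sub>3)\<close> cancels \<open>u\<^sub>1\<close>.
\<close>

lemma partial_apply:
  assumes x: "x \<in> carrier X" and y: "y \<in> carrier X" and S: "finite S"
    and big: "\<And>b. b \<in> cosupp u \<Longrightarrow> {h. dvec h (colegs u b * anti f) \<noteq> 0} \<subseteq> S"
  shows "partial f x y S u = x (anti f) * y u"
proof -
  have lx: "lin (*) x" and ly: "lin (*) y" using x y by (simp_all add: X_carrier)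
  have sh: "shifted x y h q = sw (\<lambda>r s. y r * x (anti s * h)) q" for h q
    unfolding shifted_def X_mult[OF y lact_in_X[OF dual_antipode_in_X[OF x]]]
    by (simp add: dual_lact_def dual_antipode_def anti_mult anti_anti)
  have "partial f x y S u = (\<Sum>h\<in>S. sw (\<lambda>p q. dvec h (p * anti f) * sw (\<lambda>r s. y r * x (anti s * h)) q) u)"
    unfolding partial_def X_finsum_apply[OF S partial_term_X[OF x y]] X_mult[OF ract_in_X[OF dvec_X] shifted_X[OF x y]] sh
    by (simp only: dual_ract_def)
  also have "\<dots> = sw (\<lambda>p q. \<Sum>h\<in>S. dvec h (p * anti f) * sw (\<lambda>r s. y r * x (anti s * h)) q) u"
    by (rule sw_sum[symmetric])
  also have "\<dots> = sw (\<lambda>p q. sw (\<lambda>r s. y r * x (anti s * (p * anti f))) q) u"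
    unfolding sw_def[of _ u]
  proof (rule sum.cong[OF refl])
    fix q assume q: "q \<in> cosupp u"
    let ?w = "colegs u q * anti f"
    have "(\<Sum>h\<in>S. dvec h ?w * sw (\<lambda>r s. y r * x (anti s * h)) q) =
        sw (\<lambda>r s. \<Sum>h\<in>S. dvec h ?w * (y r * x (anti s * h))) q"
      unfolding sw_sum
      by (rule sum.cong[OF refl]) (simp add: sw_def sum_distrib_left)
    also have "\<dots> = sw (\<lambda>r s. y r * x (anti s * ?w)) q"
    proof (rule sw_cong)
      fix r s
      have "(\<Sum>h\<in>S. dvec h ?w * (y r * x (anti s * h))) = y r * (\<Sum>h\<in>S. x (scal H (dvec h ?w) (anti s * h)))"
        by (simp add: sum_distrib_left lin_scal[OF lx] mult.left_commute)
      also have "\<dots> = y r * x (anti s * (\<Sum>h\<in>S. scal H (dvec h ?w) h))"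
        by (simp only: lin_sum[OF lx] sum_distrib_left scal_mult_right)
      also have "(\<Sum>h\<in>S. scal H (dvec h ?w) h) = ?w"
        by (rule basis_expansion[OF basis S big[OF q]])
      finally show "(\<Sum>h\<in>S. dvec h ?w * (y r * x (anti s * h))) = y r * x (anti s * ?w)" .
    qed
    finally show "(\<Sum>h\<in>S. dvec h ?w * sw (\<lambda>r s. y r * x (anti s * h)) q) = sw (\<lambda>r s. y r * x (anti s * ?w)) q" .
  qed
  also have "\<dots> = sw (\<lambda>p q. sw (\<lambda>r s. y s * x (anti r * (p * anti f))) q) u"
    by (rule sw_cong, rule sw_cocomm[symmetric, where s = "(*)" and \<phi> = "\<lambda>r s. y r * x (anti s * (p * anti f))" for p])
      (intro bilinI lin_times_left lin_times_right ly lin_comp[OF lx] lin_intros)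
  also have "\<dots> = sw (\<lambda>a b. sw (\<lambda>c d. y b * x (anti d * (c * anti f))) a) u"
    by (rule sw_coassoc[symmetric, where s = "(*)"]; intro lin_times_left lin_times_right ly lin_comp[OF lx] lin_intros)
  also have "\<dots> = sw (\<lambda>a b. sw (\<lambda>c d. y b * x (anti c * (d * anti f))) a) u"
    by (rule sw_cong, rule sw_cocomm[where s = "(*)" and \<phi> = "\<lambda>c d. y b * x (anti c * (d * anti f))" for b])
      (intro bilinI lin_times_left lin_times_right ly lin_comp[OF lx] lin_intros)
  also have "\<dots> = sw (\<lambda>a b. eps a * (y b * x (anti f))) u"
  proof (rule sw_cong)
    fix a b
    have "sw (\<lambda>c d. y b * x ((anti c * d) * anti f)) a = eps a * (y b * x (1 * anti f))"
      by (rule sw_anti_left[where s = "(*)" and F = "\<lambda>z. y b * x (z * anti f)"])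
        (intro lin_times_left lin_comp[OF lx] lin_intros)
    then show "sw (\<lambda>c d. y b * x (anti c * (d * anti f))) a = eps a * (y b * x (anti f))"
      by (simp add: mult.assoc)
  qed
  also have "\<dots> = y u * x (anti f)"
    by (rule sw_counit_left) (intro lin_times_right ly)
  finally show ?thesis by (simp only: mult.commute)
qed

text \<open>By \<open>partial_apply\<close> the difference vanishes on a finite spanning set of \<open>F\<^sup>m H\<close> once the partial sum is large enough.\<close>

lemma partial_converges:
  assumes x: "x \<in> carrier X" and y: "y \<in> carrier X"
  shows "eventually (\<lambda>S. \<exists>z\<in>dual_filt H m. partial f x y S = (\<lambda>u. x (anti f) * y u) \<oplus>\<^bsub>X\<^esub> z) (finite_subsets_at_top B)"
proof -
  obtain E where E: "finite E" "H_filt H m = V.span E" using finite_filt by blast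
  define S0 where "S0 = (\<Union>u\<in>E. \<Union>b\<in>cosupp u. {h. dvec h (colegs u b * anti f) \<noteq> 0})"
  have S0: "finite S0" "S0 \<subseteq> B"
    unfolding S0_def using E(1) cosupp(1) finite_dual_vec dual_vec_nonzero by auto
  have "\<exists>z\<in>dual_filt H m. partial f x y S = (\<lambda>u. x (anti f) * y u) \<oplus>\<^bsub>X\<^esub> z"
    if S: "finite S" "S0 \<subseteq> S" for S
  proof -
    define z where "z = (\<lambda>u. partial f x y S u - x (anti f) * y u)"
    have zX: "z \<in> carrier X"
      using partial_X[OF x y] scaled_X[OF y] unfolding X_carrier z_def by (rule lin_minus)
    then have lz: "lin (*) z" by (simp add: X_carrier)
    have "V.span E \<subseteq> {u. z u = 0}"
    proof (rule V.span_minimal)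
      show "E \<subseteq> {u. z u = 0}"
      proof
        fix u assume u: "u \<in> E"
        have "partial f x y S u = x (anti f) * y u"
          by (rule partial_apply[OF x y S(1)]) (use u S(2) in \<open>auto simp: S0_def\<close>)
        then show "u \<in> {u. z u = 0}" by (simp add: z_def)
      qed
      show "V.subspace {u. z u = 0}"
        by (rule V.subspaceI) (simp_all add: lin_zero[OF lz] lin_add[OF lz] lin_scal[OF lz])
    qed
    then have "z \<in> dual_filt H m" unfolding dual_filt_def E(2) using zX by blast
    moreover have "partial f x y S = (\<lambda>u. x (anti f) * y u) \<oplus>\<^bsub>X\<^esub> z" by (simp add: z_def X_simps)
    ultimately show ?thesis by blast
  qed
  then show ?thesis
    unfolding eventually_finite_subsets_at_top using S0 by (intro exI[of _ S0]) simp
qed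

text \<open>The element of \<open>L\<close> whose image under the canonical map is the \<open>x\<close>-bracket.\<close>

abbreviation combine :: "('h \<Rightarrow> 'k) \<Rightarrow> 'h set \<Rightarrow> ('h \<Rightarrow> 'm) \<Rightarrow> 'm" where
  "combine x F l \<equiv> (\<Oplus>\<^bsub>L\<^esub>f\<in>F. scal H (x (anti f)) 1 \<odot>\<^bsub>L\<^esub> l f)"

context
  fixes a b :: 'm and F :: "'h set" and l :: "'h \<Rightarrow> 'm"
  assumes a: "a \<in> carrier L" and b: "b \<in> carrier L" and F: "finite F" and l: "\<And>f. l f \<in> carrier L"
    and pval: "pbracket L a b = (\<Oplus>\<^bsub>htens H 2 L\<^esub>f\<in>F. left_leg L f (l f))"
begin

lemma combine_closed: "combine x F l \<in> carrier L"
  by (rule Lg.finsum_closed) (use L_smult_closed[OF l] in blast)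

lemma bracket_term:
  assumes x: "x \<in> carrier X" and y: "y \<in> carrier X"
  shows "annih_bracket H L (apure x a) (apure y b) = (\<Oplus>\<^bsub>A\<^esub>f\<in>F. apure (dual_ract H x f \<otimes>\<^bsub>X\<^esub> y) (l f))"
proof -
  have "annih_bracket H L (apure x a) (apure y b) = (\<Oplus>\<^bsub>A\<^esub>f\<in>F. value_map x y (left_leg L f (l f)))"
    unfolding bracket_pure[OF x a y b] pval
    by (rule additive_finsum[OF htens_abelian_group[OF two_in Lm] A_abelian_group value_additive[OF x y] left_leg_closed[OF Lm l]])
  then show ?thesis
    by (simp only: left_leg_def value_pure[OF x y pair_closed l] coeff_pure[OF x y l] ract_one)
qed

lemma partial_sums:
  assumes x: "x \<in> carrier X" and y: "y \<in> carrier X" and S: "finite S"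
  shows "(\<Oplus>\<^bsub>A\<^esub>h\<in>S. annih_bracket H L (apure (dvec h) a) (apure (shifted x y h) b)) =
    (\<Oplus>\<^bsub>A\<^esub>f\<in>F. apure (partial f x y S) (l f))"
proof -
  note cl = apure_closed[OF partial_term_X[OF x y] l]
  have "(\<Oplus>\<^bsub>A\<^esub>h\<in>S. annih_bracket H L (apure (dvec h) a) (apure (shifted x y h) b)) =
      (\<Oplus>\<^bsub>A\<^esub>h\<in>S. \<Oplus>\<^bsub>A\<^esub>f\<in>F. apure (dual_ract H (dvec h) f \<otimes>\<^bsub>X\<^esub> shifted x y h) (l f))"
    by (simp only: bracket_term[OF dvec_X shifted_X[OF x y]])
  also have "\<dots> = (\<Oplus>\<^bsub>A\<^esub>f\<in>F. \<Oplus>\<^bsub>A\<^esub>h\<in>S. apure (dual_ract H (dvec h) f \<otimes>\<^bsub>X\<^esub> shifted x y h) (l f))"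
    by (rule Ag.finsum_swap[OF S cl])
  also have "\<dots> = (\<Oplus>\<^bsub>A\<^esub>f\<in>F. apure (partial f x y S) (l f))"
    unfolding partial_def
    by (simp only: additive_finsum[OF X_abelian_group A_abelian_group biadditiveD(2)[OF apure_biadditive l] partial_term_X[OF x y]])
  finally show ?thesis .
qed

lemma limit_value:
  assumes y: "y \<in> carrier X"
  shows "apure y (combine x F l) = (\<Oplus>\<^bsub>A\<^esub>f\<in>F. apure (\<lambda>u. x (anti f) * y u) (l f))"
proof -
  have r: "dual_ract H y (scal H c 1) = (\<lambda>u. c * y u)" for c
    by (rule ext) (simp add: ract_scal[OF y] ract_one)
  have "apure y (combine x F l) = (\<Oplus>\<^bsub>A\<^esub>f\<in>F. apure y (scal H (x (anti f)) 1 \<odot>\<^bsub>L\<^esub> l f))"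
    by (rule additive_finsum[OF Lg.abelian_group_axioms A_abelian_group biadditiveD(1)[OF apure_biadditive y] L_smult_closed[OF l]])
  then show ?thesis by (simp only: apure_ract[OF y l, symmetric] r)
qed

lemma xbracket_limit:
  assumes x: "x \<in> carrier X" and y: "y \<in> carrier X"
  shows "xbracket_sums H B LL (can a) x (can b) y (apure y (combine x F l))"
proof -
  have term_eq: "lie_bracket LL (can a (dvec h)) (can b (y \<otimes>\<^bsub>X\<^esub> dual_lact H h (dual_antipode H x))) =
      annih_bracket H L (apure (dvec h) a) (apure (shifted x y h) b)" for h
    using can_apply[OF shifted_X[OF x y], of b h, unfolded shifted_def]
    by (simp only: LL_simps can_apply[OF dvec_X] shifted_def)
  have "eventually (\<lambda>S. \<exists>v\<in>A_filt n. (\<Oplus>\<^bsub>A\<^esub>h\<in>S. annih_bracket H L (apure (dvec h) a) (apure (shifted x y h) b)) =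
      apure y (combine x F l) \<oplus>\<^bsub>A\<^esub> v) (finite_subsets_at_top B)" for n
  proof -
    have ev: "eventually (\<lambda>S. \<exists>z\<in>carrier X. apure z (l f) \<in> A_filt n \<and> partial f x y S = (\<lambda>u. x (anti f) * y u) \<oplus>\<^bsub>X\<^esub> z)
        (finite_subsets_at_top B)" for f
    proof -
      obtain m where m: "\<forall>z\<in>dual_filt H m. apure z (l f) \<in> A_filt n" using apure_continuous[OF l] by blast
      show ?thesis
        by (rule eventually_mono[OF partial_converges[OF x y, of m f]]) (use m dual_filtD(1) in blast)
    qed
    have "eventually (\<lambda>S. \<forall>f\<in>F. \<exists>z\<in>carrier X. apure z (l f) \<in> A_filt n \<and> partial f x y S = (\<lambda>u. x (anti f) * y u) \<oplus>\<^bsub>X\<^esub> z)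
        (finite_subsets_at_top B)"
      by (rule eventually_ball_finite[OF F]) (use ev in blast)
    moreover have "eventually finite (finite_subsets_at_top B)"
      by (rule eventually_finite_subsets_at_top_weakI)
    ultimately have "eventually (\<lambda>S. (\<forall>f\<in>F. \<exists>z\<in>carrier X. apure z (l f) \<in> A_filt n \<and>
        partial f x y S = (\<lambda>u. x (anti f) * y u) \<oplus>\<^bsub>X\<^esub> z) \<and> finite S) (finite_subsets_at_top B)"
      by (rule eventually_conj)
    then show ?thesis
    proof (rule eventually_mono)
      fix S assume S: "(\<forall>f\<in>F. \<exists>z\<in>carrier X. apure z (l f) \<in> A_filt n \<and>
        partial f x y S = (\<lambda>u. x (anti f) * y u) \<oplus>\<^bsub>X\<^esub> z) \<and> finite S"
      obtain z where z: "\<forall>f\<in>F. z f \<in> carrier X \<and> apure (z f) (l f) \<in> A_filt n \<and>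
          partial f x y S = (\<lambda>u. x (anti f) * y u) \<oplus>\<^bsub>X\<^esub> z f"
        using conjunct1[OF S] unfolding Bex_def bchoice_iff by (elim exE)
      have zX: "z f \<in> carrier X" if "f \<in> F" for f using z that by blast
      have "(\<Oplus>\<^bsub>A\<^esub>f\<in>F. apure (partial f x y S) (l f)) =
          (\<Oplus>\<^bsub>A\<^esub>f\<in>F. apure (\<lambda>u. x (anti f) * y u) (l f) \<oplus>\<^bsub>A\<^esub> apure (z f) (l f))"
      proof (rule Ag.finsum_cong'[OF refl])
        show "(\<lambda>f. apure (\<lambda>u. x (anti f) * y u) (l f) \<oplus>\<^bsub>A\<^esub> apure (z f) (l f)) \<in> F \<rightarrow> carrier A"
          using apure_closed[OF scaled_X[OF y] l] apure_closed[OF zX l] by blast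
        fix f assume f: "f \<in> F"
        have "partial f x y S = (\<lambda>u. x (anti f) * y u) \<oplus>\<^bsub>X\<^esub> z f" using z f by blast
        then show "apure (partial f x y S) (l f) = apure (\<lambda>u. x (anti f) * y u) (l f) \<oplus>\<^bsub>A\<^esub> apure (z f) (l f)"
          by (simp only: additive_add[OF biadditiveD(2)[OF apure_biadditive l] scaled_X[OF y] zX[OF f]])
      qed
      also have "\<dots> = apure y (combine x F l) \<oplus>\<^bsub>A\<^esub> (\<Oplus>\<^bsub>A\<^esub>f\<in>F. apure (z f) (l f))"
        unfolding limit_value[OF y]
        by (rule Ag.finsum_addf) (use apure_closed[OF scaled_X[OF y] l] apure_closed[OF zX l] in blast)+
      finally have eq: "(\<Oplus>\<^bsub>A\<^esub>h\<in>S. annih_bracket H L (apure (dvec h) a) (apure (shifted x y h) b)) =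
          apure y (combine x F l) \<oplus>\<^bsub>A\<^esub> (\<Oplus>\<^bsub>A\<^esub>f\<in>F. apure (z f) (l f))"
        unfolding partial_sums[OF x y conjunct2[OF S]] .
      have "(\<Oplus>\<^bsub>A\<^esub>f\<in>F. apure (z f) (l f)) \<in> A_filt n"
        by (rule AF.N_finsum) (use z in blast)
      with eq show "\<exists>v\<in>A_filt n. (\<Oplus>\<^bsub>A\<^esub>h\<in>S. annih_bracket H L (apure (dvec h) a) (apure (shifted x y h) b)) =
          apure y (combine x F l) \<oplus>\<^bsub>A\<^esub> v"
        by (rule bexI)
    qed
  qed
  then have "limitin (filt_topology A A_filt)
      (\<lambda>S. \<Oplus>\<^bsub>A\<^esub>h\<in>S. annih_bracket H L (apure (dvec h) a) (apure (shifted x y h) b))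
      (apure y (combine x F l)) (finite_subsets_at_top B)"
    by (rule AF.limitin_filtI[OF apure_closed[OF y combine_closed]])
  then show ?thesis
    unfolding xbracket_sums_def term_eq LL_finsum unfolding LL_simps .
qed

lemma xbracket_unique:
  assumes x: "x \<in> carrier X" and y: "y \<in> carrier X" and s: "xbracket_sums H B LL (can a) x (can b) y s"
  shows "s = apure y (combine x F l)"
  using A_separated finite_subsets_at_top_neq_bot
    s[unfolded xbracket_sums_def LL_simps(6)] xbracket_limit[OF x y, unfolded xbracket_sums_def LL_simps(6)]
  by (rule AF.limitin_filt_unique)

lemma xbracket_can:
  assumes x: "x \<in> carrier X" shows "xbracket H B LL (can a) x (can b) = can (combine x F l)"
  unfolding xbracket_def can
proof (rule restrict_ext)
  fix y assume y: "y \<in> carrier X"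
  show "(THE s. xbracket_sums H B LL (\<lambda>x\<in>carrier X. apure x a) x (\<lambda>x\<in>carrier X. apure x b) y s) = apure y (combine x F l)"
    unfolding can[symmetric]
  proof (rule the_equality)
    show "xbracket_sums H B LL (can a) x (can b) y (apure y (combine x F l))" by (rule xbracket_limit[OF x y])
    show "s = apure y (combine x F l)" if "xbracket_sums H B LL (can a) x (can b) y s" for s
      by (rule xbracket_unique[OF x y that])
  qed
qed

text \<open>The basis elements at which the \<open>x\<close>-bracket may be nonzero.\<close>

definition "relevant = (\<Union>f\<in>F. {h. dvec h (anti f) \<noteq> 0})"

lemma relevant: "finite relevant" "relevant \<subseteq> B"
  unfolding relevant_def using F finite_dual_vec dual_vec_nonzero by auto

lemma support_subset: "xbracket_support H B LL (can a) (can b) \<subseteq> relevant"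
proof
  fix h assume "h \<in> xbracket_support H B LL (can a) (can b)"
  then have ne: "can (combine (dvec h) F l) \<noteq> \<zero>\<^bsub>Lhat\<^esub>"
    by (simp add: xbracket_support_def xbracket_can[OF dvec_X] Lhat_def)
  show "h \<in> relevant"
  proof (rule ccontr)
    assume "h \<notin> relevant"
    then have z: "dvec h (anti f) = 0" if "f \<in> F" for f using that by (auto simp: relevant_def)
    have "combine (dvec h) F l = (\<Oplus>\<^bsub>L\<^esub>f\<in>F. \<zero>\<^bsub>L\<^esub>)"
      by (rule Lg.finsum_cong'[OF refl]) (simp_all add: z L_smult_zero l)
    then show False using ne by (simp add: can_zero)
  qed
qed

text \<open>
  The coefficients of \<open>\<Phi>(l\<^sub>f)\<close> on the left are \<open>\<Sum>x\<^sub>h(S f) S(h) = S(S(f)) = f\<close>, where the scalars \<open>x\<^sub>h(S f)\<close> have been moved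
  across the tensor product.
\<close>

lemma pbracket_can:
  "(\<Oplus>\<^bsub>htens H 2 Lhat\<^esub>h\<in>xbracket_support H B LL (can a) (can b).
      hpure H 2 Lhat (pure H [anti h, 1]) (xbracket H B LL (can a) (dvec h) (can b))) =
    hfun 2 Lhat can (pbracket L a b)"
proof -
  note M = Lhat_left_module
  interpret T: abelian_group "htens H 2 Lhat" by (rule htens_abelian_group[OF two_in M])
  interpret Z: abelian_group "type_ring :: 'h ring" by (rule abelian_group_type_ring)
  note ll = left_leg_biadditive[OF M] and llc = left_leg_closed[OF M can_closed]
  have lc: "can (l f) \<in> carrier Lhat" for f by (rule can_closed[OF l])
  have "(\<Oplus>\<^bsub>htens H 2 Lhat\<^esub>h\<in>xbracket_support H B LL (can a) (can b).
      hpure H 2 Lhat (pure H [anti h, 1]) (xbracket H B LL (can a) (dvec h) (can b))) =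
    (\<Oplus>\<^bsub>htens H 2 Lhat\<^esub>h\<in>xbracket_support H B LL (can a) (can b). left_leg Lhat (anti h) (can (combine (dvec h) F l)))"
    by (simp only: xbracket_can[OF dvec_X] left_leg_def)
  also have "\<dots> = (\<Oplus>\<^bsub>htens H 2 Lhat\<^esub>h\<in>relevant. left_leg Lhat (anti h) (can (combine (dvec h) F l)))"
  proof (rule T.add.finprod_mono_neutral_cong_left[OF relevant(1) support_subset])
    show "left_leg Lhat (anti h) (can (combine (dvec h) F l)) = \<zero>\<^bsub>htens H 2 Lhat\<^esub>"
      if "h \<in> relevant - xbracket_support H B LL (can a) (can b)" for h
    proof -
      have "can (combine (dvec h) F l) = \<zero>\<^bsub>Lhat\<^esub>"
        using that relevant(2) by (auto simp: xbracket_support_def xbracket_can[OF dvec_X] Lhat_def)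
      then show ?thesis by (simp only: left_leg_zero[OF M])
    qed
  qed (use llc[OF combine_closed] in blast)+
  also have "\<dots> = (\<Oplus>\<^bsub>htens H 2 Lhat\<^esub>h\<in>relevant. \<Oplus>\<^bsub>htens H 2 Lhat\<^esub>f\<in>F.
      left_leg Lhat (scal H (dvec h (anti f)) (anti h)) (can (l f)))"
  proof (rule T.finsum_cong'[OF refl])
    show "(\<lambda>h. \<Oplus>\<^bsub>htens H 2 Lhat\<^esub>f\<in>F. left_leg Lhat (scal H (dvec h (anti f)) (anti h)) (can (l f))) \<in> relevant \<rightarrow> carrier (htens H 2 Lhat)"
      using llc[OF l] by (intro Pi_I T.finsum_closed) blast
    fix h
    have "left_leg Lhat (anti h) (can (combine (dvec h) F l)) =
        (\<Oplus>\<^bsub>htens H 2 Lhat\<^esub>f\<in>F. left_leg Lhat (anti h) (can (scal H (dvec h (anti f)) 1 \<odot>\<^bsub>L\<^esub> l f)))"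
      by (rule additive_finsum[OF Lg.abelian_group_axioms T.abelian_group_axioms
            additive_comp[OF can_additive biadditiveD(1)[OF ll]] L_smult_closed[OF l]]) simp
    then show "left_leg Lhat (anti h) (can (combine (dvec h) F l)) =
        (\<Oplus>\<^bsub>htens H 2 Lhat\<^esub>f\<in>F. left_leg Lhat (scal H (dvec h (anti f)) (anti h)) (can (l f)))"
      by (simp only: can_smult[OF l] left_leg_scal[OF M lc])
  qed
  also have "\<dots> = (\<Oplus>\<^bsub>htens H 2 Lhat\<^esub>f\<in>F. \<Oplus>\<^bsub>htens H 2 Lhat\<^esub>h\<in>relevant.
      left_leg Lhat (scal H (dvec h (anti f)) (anti h)) (can (l f)))"
    by (rule T.finsum_swap[OF relevant(1) llc[OF l]])
  also have "\<dots> = (\<Oplus>\<^bsub>htens H 2 Lhat\<^esub>f\<in>F. left_leg Lhat f (can (l f)))"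
  proof (rule T.finsum_cong'[OF refl])
    show "(\<lambda>f. left_leg Lhat f (can (l f))) \<in> F \<rightarrow> carrier (htens H 2 Lhat)" using llc[OF l] by blast
    fix f assume f: "f \<in> F"
    have "(\<Sum>h\<in>relevant. scal H (dvec h (anti f)) (anti h)) = anti (\<Sum>h\<in>relevant. scal H (dvec h (anti f)) h)"
      by (simp only: lin_sum[OF lin_antipode] lin_scal[OF lin_antipode])
    also have "(\<Sum>h\<in>relevant. scal H (dvec h (anti f)) h) = anti f"
      by (rule basis_expansion[OF basis relevant(1)]) (use f in \<open>auto simp: relevant_def\<close>)
    finally have sum: "(\<Sum>h\<in>relevant. scal H (dvec h (anti f)) (anti h)) = f" by (simp only: anti_anti)
    have "left_leg Lhat (\<Oplus>\<^bsub>type_ring\<^esub>h\<in>relevant. scal H (dvec h (anti f)) (anti h)) (can (l f)) =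
        (\<Oplus>\<^bsub>htens H 2 Lhat\<^esub>h\<in>relevant. left_leg Lhat (scal H (dvec h (anti f)) (anti h)) (can (l f)))"
      by (rule additive_finsum[OF abelian_group_type_ring T.abelian_group_axioms biadditiveD(2)[OF ll lc]]) simp
    then show "(\<Oplus>\<^bsub>htens H 2 Lhat\<^esub>h\<in>relevant. left_leg Lhat (scal H (dvec h (anti f)) (anti h)) (can (l f))) =
        left_leg Lhat f (can (l f))"
      by (simp only: finsum_type_ring[OF relevant(1)] sum)
  qed
  also have "\<dots> = (\<Oplus>\<^bsub>htens H 2 Lhat\<^esub>f\<in>F. hfun 2 Lhat can (left_leg L f (l f)))"
    by (simp only: left_leg_def hfun_properties(2)[where \<Phi> = can, OF two_in Lm M can_additive can_smult pair_closed l])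
  also have "\<dots> = hfun 2 Lhat can (pbracket L a b)"
    unfolding pval
    by (rule additive_finsum[OF htens_abelian_group[OF two_in Lm] T.abelian_group_axioms
          hfun_properties(1)[where \<Phi> = can, OF two_in Lm M can_additive can_smult] left_leg_closed[OF Lm l], symmetric])
  finally show ?thesis .
qed

end

lemma bracket_normal_form:
  assumes a: "a \<in> carrier L" and b: "b \<in> carrier L"
  shows "\<exists>F l. finite F \<and> (\<forall>f. l f \<in> carrier L) \<and> pbracket L a b = (\<Oplus>\<^bsub>htens H 2 L\<^esub>f\<in>F. left_leg L f (l f))"
proof -
  have "pbracket L a b \<in> normal_forms L"
    by (rule normal_form[OF Lm biadditiveD(3)[OF pseudobracketD(2)[OF pb] a b]])
  then obtain F l where "pbracket L a b = (\<Oplus>\<^bsub>htens H 2 L\<^esub>f\<in>F. left_leg L f (l f))" "finite F" "l \<in> UNIV \<rightarrow> carrier L"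
    unfolding normal_forms_def by (elim CollectE exE conjE)
  then show ?thesis by (intro exI[of _ F] exI[of _ l] conjI) (simp_all add: Pi_iff)
qed

theorem xbrackets: "xbrackets_ok H B LL"
  unfolding xbrackets_ok_def Lhat_def[symmetric]
proof (intro ballI)
  fix \<alpha> \<beta> assume "\<alpha> \<in> carrier Lhat" "\<beta> \<in> carrier Lhat"
  then obtain a b where a: "a \<in> carrier L" "can a = \<alpha>" and b: "b \<in> carrier L" "can b = \<beta>"
    using can_surj by metis
  obtain F l where Fl: "finite F" "\<forall>f. l f \<in> carrier L" "pbracket L a b = (\<Oplus>\<^bsub>htens H 2 L\<^esub>f\<in>F. left_leg L f (l f))"
    using bracket_normal_form[OF a(1) b(1)] by (elim exE conjE)
  note hyps = a(1) b(1) Fl(1) spec[OF Fl(2)] Fl(3)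
  show "(\<forall>x\<in>carrier X. (\<forall>y\<in>carrier X. \<exists>!s. xbracket_sums H B LL \<alpha> x \<beta> y s) \<and> xbracket H B LL \<alpha> x \<beta> \<in> carrier Lhat) \<and>
      finite (xbracket_support H B LL \<alpha> \<beta>)"
    unfolding a(2)[symmetric] b(2)[symmetric]
  proof (intro conjI ballI)
    fix x assume x: "x \<in> carrier X"
    show "\<exists>!s. xbracket_sums H B LL (can a) x (can b) y s" if y: "y \<in> carrier X" for y
    proof (rule ex1I)
      show "xbracket_sums H B LL (can a) x (can b) y (apure y (combine x F l))" by (rule xbracket_limit[OF hyps x y])
      show "s = apure y (combine x F l)" if "xbracket_sums H B LL (can a) x (can b) y s" for s
        by (rule xbracket_unique[OF hyps x y that])
    qed
    show "xbracket H B LL (can a) x (can b) \<in> carrier Lhat"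
      unfolding xbracket_can[OF hyps x] by (rule can_closed[OF combine_closed[OF hyps]])
  next
    show "finite (xbracket_support H B LL (can a) (can b))"
      by (rule finite_subset[OF support_subset[OF hyps] relevant(1)[OF hyps]])
  qed
qed

definition R :: "('h, ('h \<Rightarrow> 'k) \<Rightarrow> ('k, 'h, 'm) annih_elem) pseudoalgebra" where
  "R = reconstruction H B LL"

lemma R_simps:
  "carrier R = carrier Lhat" "\<zero>\<^bsub>R\<^esub> = \<zero>\<^bsub>Lhat\<^esub>" "add R = add Lhat" "smult R = smult Lhat"
  "pbracket R \<alpha> \<beta> = (\<Oplus>\<^bsub>htens H 2 Lhat\<^esub>h\<in>xbracket_support H B LL \<alpha> \<beta>.
       hpure H 2 Lhat (pure H [anti h, 1]) (xbracket H B LL \<alpha> (dvec h) \<beta>))"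
  by (simp_all add: R_def reconstruction_def module.extend_def pseudoalgebra.fields_def Lhat_def)

text \<open>The tensor products depend on the carrier, the addition and the action of a module only.\<close>

lemma R_htens: "htens H n R = htens H n Lhat" "hpure H n R = hpure H n Lhat"
proof -
  have rels: "tprod_rels (tpow H n) (tpow_ract H n) R = tprod_rels (tpow H n) (tpow_ract H n) Lhat"
    unfolding tprod_rels_def R_simps ..
  show pure: "hpure H n R = hpure H n Lhat"
    by (intro ext) (simp only: hpure_def tprod_pure_def rels)
  show "htens H n R = htens H n Lhat"
    unfolding htens_def tprod_def tprod_group_def rels R_simps(1)
    using pure[unfolded hpure_def] by (simp only:)
qed

theorem canonical_map_iso: "lie_pseudoalgebra_iso H L R can"
proof -
  have add: "additive_map L R can"
    using can_additive by (simp add: additive_map_def R_simps)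
  have onto: "can ` carrier L = carrier R" by (simp only: can_image R_simps)
  have smult: "can (h \<odot>\<^bsub>L\<^esub> a) = h \<odot>\<^bsub>R\<^esub> can a" if "a \<in> carrier L" for h a
    by (simp only: can_smult[OF that] R_simps)
  have zero: "can \<zero>\<^bsub>L\<^esub> = \<zero>\<^bsub>R\<^esub>" by (simp only: can_zero R_simps)
  have hm: "hmap H R can = hfun 2 Lhat can"
    by (simp only: hmap_def hfun_def R_htens)
  have br: "hmap H R can (pbracket L a b) = pbracket R (can a) (can b)" if a: "a \<in> carrier L" and b: "b \<in> carrier L" for a b
  proof -
    obtain F l where Fl: "finite F" "\<forall>f. l f \<in> carrier L" "pbracket L a b = (\<Oplus>\<^bsub>htens H 2 L\<^esub>f\<in>F. left_leg L f (l f))"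
      using bracket_normal_form[OF a b] by (elim exE conjE)
    show ?thesis unfolding hm R_simps by (rule pbracket_can[OF a b Fl(1) spec[OF Fl(2)] Fl(3), symmetric])
  qed
  have "lie_pseudoalgebra H R"
    by (rule transport_lie_pseudoalgebra[where \<Phi> = can, OF lie add onto smult zero br])
  then show ?thesis
    unfolding lie_pseudoalgebra_iso_def bij_betw_def
    using lie can_inj onto additive_add[OF add] smult br by (intro conjI allI ballI)
qed

end

theorem proposition11p3:
  fixes H :: "('k::{alg_closed_field, field_char_0}, 'h::ring_1) hopf"
    and L :: "('h, 'm) pseudoalgebra"
    and L0 :: "'m set"
    and B :: "'h set"
  assumes "hopf_algebra H" and "cocommutative H"
    and "\<And>n. \<exists>E. finite E \<and> H_filt H n = hspan H E"
    and "lie_pseudoalgebra H L" and "finitely_generated L" and "free_module L"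
    and "generating_subspace H L L0"
    and "is_basis H B"
  shows "xbrackets_ok H B (annih H L L0) \<and>
    lie_pseudoalgebra_iso H L (reconstruction H B (annih H L L0)) (canonical_map H L)"
proof -
  interpret hopf_algebra H by (rule assms(1))
  interpret free_lie_pseudoalgebra H L L0 B
    by unfold_locales (rule assms)+
  show ?thesis
    using xbrackets canonical_map_iso unfolding R_def LL_def can_def by (rule conjI)
qed

end
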